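(* Let $\lambda\leq\mu$ be regular cardinals, let $\mathcal V$ be a symmetric monoidal closed category which is locally $\lambda$-generated as a closed category (with respect to some class $\mathcal M_{\mathcal V}$), and let $\mathcal K$ be a $\mathcal V$-category which is $\mathcal M$-locally $\lambda$-generated and locally $\mu$-presentable as a $\mathcal V$-category. Let $T$ be a $\mu$-ary $\mathcal V$-monad on $\mathcal K$ preserving $\mathcal M$-morphisms and $\lambda$-directed colimits of $\mathcal M$-morphisms. Then there is a $\lambda$-ary $\mathcal V$-equational theory $E$ over $\mathcal K$ such that $\mathcal K^T$ and $\mathbf{Alg}(E)$ are equivalent as $\mathcal V$-concrete categories over $\mathcal K$ (i.e. $\mathcal V$-equivalent compatibly with the forgetful $\mathcal V$-functors to $\mathcal K$).
   Context: A $\mathcal V$-monad is $\mu$-ary if it preserves $\mu$-filtered (conical) colimits; it preserves $\lambda$-directed colimits of $\mathcal M$-morphisms if it sends colimits of $\lambda$-directed diagrams whose connecting morphisms are in $\mathcal M$ to $\lambda$-directed colimits. A $\mathcal V$-category $\mathcal K$ is locally $\mu$-presentable (in the enriched sense) if it has weighted colimits and a set of objects $A$ with $\mathcal K(A,-):\mathcal K\to\mathcal V$ preserving $\mu$-filtered colimits such that every object of $\mathcal K$ is a $\mu$-filtered colimit of them. Enriched locally generated categories. A factorization system $(\mathcal E,\mathcal M)$ on (the underlying category of) a $\mathcal V$-category $\mathcal K$ is a $\mathcal V$-factorization system if for all $e:A\to B$ in $\mathcal E$ and $m:C\to D$ in $\mathcal M$ the square in $\mathcal V$ formed by $\mathcal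 K(B,C)\to\mathcal K(A,C)$, $\mathcal K(B,C)\to\mathcal K(B,D)$, $\mathcal K(A,C)\to\mathcal K(A,D)$, $\mathcal K(B,D)\to\mathcal K(A,D)$ is a pullback. It is $\lambda$-convenient if (1) $\mathcal K$ is $\mathcal E$-cowellpowered, i.e. each object has only a set of $\mathcal E$-quotients up to isomorphism, and (2) for every $\lambda$-directed diagram of $\mathcal M$-morphisms the colimit cocone consists of $\mathcal M$-morphisms, and for every cocone of $\mathcal M$-morphisms the induced morphism from the colimit is in $\mathcal M$. An object $A$ is $\lambda$-generated w.r.t. $\mathcal M$ in the enriched sense if $\mathcal K(A,-):\mathcal K\to\mathcal V$ preserves (conical) $\lambda$-directed colimits of $\mathcal M$-morphisms. A $\mathcal V$-category $\mathcal K$ with a $\lambda$-convenient $\mathcal V$-factorization system $(\mathcal E,\mathcal M)$ is $\mathcal M$-locally $\lambda$-generated if it has weighted colimits and a set $\mathcal A$ of objects $\lambda$-generated w.r.t. $\mathcal M$ in the enriched sense such that every object of $\mathcal K$ is a $\lambda$-directed colimit of objects from $\mathcal A$ and $\mathcal M$-morphisms. $\mathcal V$ is $\mathcal M_{\mathcal V}$-locally $\lambda$-generated as a closed category if it is $\mathcal M_{\mathcal V}$-locally $\lambda$-generated in the enriched sense, the tensor unit $I$ is $\lambda$-generated w.r.t. $\mathcal M_{\mathcal V}$, and the tensor product of two objects $\lambda$-generated w.r.t. $\mathcal M_{\mathcal V}$ is $\lambda$-generated w.r.t. $\mathcal M_{\mathcal V}$. Enriched equational theories. A $\mathcal V$-equational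 theory over $\mathcal K$ is a $\mathcal V$-category $\Theta$ together with an identity-on-objects $\mathcal V$-functor $x_-:\mathcal A^{\mathrm{op}}\to\Theta$, where $\mathcal A$ is a full subcategory of $\mathcal K$ (the arities). A $\Theta$-algebra is an object $A$ of $\mathcal K$ together with a $\mathcal V$-functor $\hat A:\Theta\to\mathcal V$ whose composite with $x_-$ is $\mathcal K(-,A)$ restricted to $\mathcal A^{\mathrm{op}}$. A homomorphism $(A,\hat A)\to(B,\hat B)$ is a morphism $h:A\to B$ together with a $\mathcal V$-natural transformation $\hat h:\hat A\to\hat B$ whose restriction along $x_-$ is $\mathcal K(-,h)$. $\mathbf{Alg}(\Theta)$ is the corresponding $\mathcal V$-category, i.e. the pullback of $\mathcal K\to[\mathcal A^{\mathrm{op}},\mathcal V]$, $A\mapsto\mathcal K(-,A)$, along $[x_-,\mathcal V]:[\Theta,\mathcal V]\to[\mathcal A^{\mathrm{op}},\mathcal V]$, with its forgetful $\mathcal V$-functor to $\mathcal K$. Over an $\mathcal M$-locally $\lambda$-generated $\mathcal V$-category, the theory is $\lambda$-ary if $\mathcal A$ is a (representative small) full subcategory of the objects $\lambda$-generated w.r.t. $\mathcal M$ in the enriched sense. *)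

theory Defs
  imports Main "HOL-Library.FuncSet"
begin

unbundle cardinal_syntax

section \<open>Cardinals and smallness\<close>

text \<open>
  HOL has no proper classes. Size is measured against a fixed (uncountable) inaccessible
  cardinal \<open>\<kappa>\<close>, that is, against a Grothendieck universe: a ``set'' of the mathematical text is
  a HOL set of cardinality less than \<open>\<kappa>\<close>, and arbitrary HOL sets play the role of classes.
  Every small set has a bijective copy among the subsets of the type \<open>'u\<close> that carries \<open>\<kappa>\<close>, so
  quantification over all small index categories is quantification over those whose objects
  and arrows are built from \<open>'u\<close>.
\<close>

definition regular_cardinal :: "'l rel \<Rightarrow> bool" where
  "regular_cardinal r \<longleftrightarrow> Cinfinite r \<and> regularCard r"

definition inaccessible :: "'u rel \<Rightarrow> bool" where
  "inaccessible \<kappa> \<longleftrightarrow> regular_cardinal \<kappa> \<and> natLeq <o \<kappa> \<and>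
     (\<forall>S::'u set. |S| <o \<kappa> \<longrightarrow> |Pow S| <o \<kappa>)"

definition small :: "'u rel \<Rightarrow> 'a set \<Rightarrow> bool" where
  "small \<kappa> S \<longleftrightarrow> |S| <o \<kappa>"


section \<open>Ordinary categories\<close>

record ('o, 'a) cat =
  ob :: "'o set"
  ar :: "'a set"
  dm :: "'a \<Rightarrow> 'o"
  cd :: "'a \<Rightarrow> 'o"
  idn :: "'o \<Rightarrow> 'a"
  cmp :: "'a \<Rightarrow> 'a \<Rightarrow> 'a" (infixr "\<cdot>\<index>" 65)

definition hom :: "('o, 'a, 'z) cat_scheme \<Rightarrow> 'o \<Rightarrow> 'o \<Rightarrow> 'a set" where
  "hom C a b = {f \<in> ar C. dm C f = a \<and> cd C f = b}"

locale category =
  fixes C :: "('o, 'a, 'z) cat_scheme" (structure)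
  assumes dm_ob: "f \<in> ar C \<Longrightarrow> dm C f \<in> ob C"
    and cd_ob: "f \<in> ar C \<Longrightarrow> cd C f \<in> ob C"
    and idn_hom: "a \<in> ob C \<Longrightarrow> idn C a \<in> hom C a a"
    and cmp_hom: "f \<in> hom C a b \<Longrightarrow> g \<in> hom C b c \<Longrightarrow> g \<cdot> f \<in> hom C a c"
    and cmp_idn_left: "f \<in> hom C a b \<Longrightarrow> idn C b \<cdot> f = f"
    and cmp_idn_right: "f \<in> hom C a b \<Longrightarrow> f \<cdot> idn C a = f"
    and cmp_assoc: "f \<in> hom C a b \<Longrightarrow> g \<in> hom C b c \<Longrightarrow> h \<in> hom C c d \<Longrightarrow>
      h \<cdot> (g \<cdot> f) = (h \<cdot> g) \<cdot> f"

definition locally_small :: "'u rel \<Rightarrow> ('o, 'a, 'z) cat_scheme \<Rightarrow> bool" where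
  "locally_small \<kappa> C \<longleftrightarrow> (\<forall>a \<in> ob C. \<forall>b \<in> ob C. small \<kappa> (hom C a b))"

definition small_cat :: "'u rel \<Rightarrow> ('o, 'a, 'z) cat_scheme \<Rightarrow> bool" where
  "small_cat \<kappa> C \<longleftrightarrow> category C \<and> small \<kappa> (ob C) \<and> small \<kappa> (ar C)"

definition inverse_pair :: "('o, 'a, 'z) cat_scheme \<Rightarrow> 'a \<Rightarrow> 'a \<Rightarrow> bool" where
  "inverse_pair C f g \<longleftrightarrow> f \<in> ar C \<and> g \<in> hom C (cd C f) (dm C f) \<and>
     g \<cdot>\<^bsub>C\<^esub> f = idn C (dm C f) \<and> f \<cdot>\<^bsub>C\<^esub> g = idn C (cd C f)"

definition is_iso :: "('o, 'a, 'z) cat_scheme \<Rightarrow> 'a \<Rightarrow> bool" where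
  "is_iso C f \<longleftrightarrow> (\<exists>g. inverse_pair C f g)"

definition cinv :: "('o, 'a, 'z) cat_scheme \<Rightarrow> 'a \<Rightarrow> 'a" where
  "cinv C f = (THE g. inverse_pair C f g)"

definition isomorphic :: "('o, 'a, 'z) cat_scheme \<Rightarrow> 'o \<Rightarrow> 'o \<Rightarrow> bool" where
  "isomorphic C a b \<longleftrightarrow> (\<exists>f \<in> hom C a b. is_iso C f)"

definition cat_op :: "('o, 'a, 'z) cat_scheme \<Rightarrow> ('o, 'a) cat" where
  "cat_op C = \<lparr>ob = ob C, ar = ar C, dm = cd C, cd = dm C, idn = idn C,
     cmp = (\<lambda>g f. f \<cdot>\<^bsub>C\<^esub> g)\<rparr>"

record ('i, 'j, 'o, 'a) ofun =
  oo :: "'i \<Rightarrow> 'o"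
  oa :: "'j \<Rightarrow> 'a"

definition cat_functor ::
  "('i, 'j, 'y) cat_scheme \<Rightarrow> ('o, 'a, 'z) cat_scheme \<Rightarrow> ('i, 'j, 'o, 'a) ofun \<Rightarrow> bool" where
  "cat_functor J C D \<longleftrightarrow>
     (\<forall>i \<in> ob J. oo D i \<in> ob C) \<and>
     (\<forall>f \<in> ar J. oa D f \<in> hom C (oo D (dm J f)) (oo D (cd J f))) \<and>
     (\<forall>i \<in> ob J. oa D (idn J i) = idn C (oo D i)) \<and>
     (\<forall>f \<in> ar J. \<forall>g \<in> ar J. dm J g = cd J f \<longrightarrow>
        oa D (g \<cdot>\<^bsub>J\<^esub> f) = oa D g \<cdot>\<^bsub>C\<^esub> oa D f)"

definition is_cone ::
  "('o, 'a, 'z) cat_scheme \<Rightarrow> ('i, 'j, 'y) cat_scheme \<Rightarrow> ('i, 'j, 'o, 'a) ofun \<Rightarrow>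
   'o \<Rightarrow> ('i \<Rightarrow> 'a) \<Rightarrow> bool" where
  "is_cone C J D x p \<longleftrightarrow> x \<in> ob C \<and> (\<forall>i \<in> ob J. p i \<in> hom C x (oo D i)) \<and>
     (\<forall>f \<in> ar J. oa D f \<cdot>\<^bsub>C\<^esub> p (dm J f) = p (cd J f))"

definition is_lim ::
  "('o, 'a, 'z) cat_scheme \<Rightarrow> ('i, 'j, 'y) cat_scheme \<Rightarrow> ('i, 'j, 'o, 'a) ofun \<Rightarrow>
   'o \<Rightarrow> ('i \<Rightarrow> 'a) \<Rightarrow> bool" where
  "is_lim C J D x p \<longleftrightarrow> cat_functor J C D \<and> is_cone C J D x p \<and>
     (\<forall>y q. is_cone C J D y q \<longrightarrow> (\<exists>!u. u \<in> hom C y x \<and> (\<forall>i \<in> ob J. p i \<cdot>\<^bsub>C\<^esub> u = q i)))"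

definition is_cocone ::
  "('o, 'a, 'z) cat_scheme \<Rightarrow> ('i, 'j, 'y) cat_scheme \<Rightarrow> ('i, 'j, 'o, 'a) ofun \<Rightarrow>
   'o \<Rightarrow> ('i \<Rightarrow> 'a) \<Rightarrow> bool" where
  "is_cocone C J D x c \<longleftrightarrow> x \<in> ob C \<and> (\<forall>i \<in> ob J. c i \<in> hom C (oo D i) x) \<and>
     (\<forall>f \<in> ar J. c (cd J f) \<cdot>\<^bsub>C\<^esub> oa D f = c (dm J f))"

definition is_colim ::
  "('o, 'a, 'z) cat_scheme \<Rightarrow> ('i, 'j, 'y) cat_scheme \<Rightarrow> ('i, 'j, 'o, 'a) ofun \<Rightarrow>
   'o \<Rightarrow> ('i \<Rightarrow> 'a) \<Rightarrow> bool" where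
  "is_colim C J D x c \<longleftrightarrow> cat_functor J C D \<and> is_cocone C J D x c \<and>
     (\<forall>y d. is_cocone C J D y d \<longrightarrow> (\<exists>!u. u \<in> hom C x y \<and> (\<forall>i \<in> ob J. u \<cdot>\<^bsub>C\<^esub> c i = d i)))"

definition is_equalizer :: "('o, 'a, 'z) cat_scheme \<Rightarrow> 'a \<Rightarrow> 'a \<Rightarrow> 'a \<Rightarrow> bool" where
  "is_equalizer C f g e \<longleftrightarrow> e \<in> ar C \<and> cd C e = dm C f \<and> f \<cdot>\<^bsub>C\<^esub> e = g \<cdot>\<^bsub>C\<^esub> e \<and>
     (\<forall>h \<in> ar C. cd C h = dm C f \<and> f \<cdot>\<^bsub>C\<^esub> h = g \<cdot>\<^bsub>C\<^esub> h \<longrightarrow>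
        (\<exists>!u. u \<in> hom C (dm C h) (dm C e) \<and> e \<cdot>\<^bsub>C\<^esub> u = h))"

text \<open>\<open>is_pullback C f g p q\<close>: the cospan is \<open>(f, g)\<close> and the span is \<open>(p, q)\<close>.\<close>

definition is_pullback :: "('o, 'a, 'z) cat_scheme \<Rightarrow> 'a \<Rightarrow> 'a \<Rightarrow> 'a \<Rightarrow> 'a \<Rightarrow> bool" where
  "is_pullback C f g p q \<longleftrightarrow> f \<in> ar C \<and> g \<in> ar C \<and> cd C f = cd C g \<and>
     p \<in> ar C \<and> q \<in> ar C \<and> dm C p = dm C q \<and> cd C p = dm C f \<and> cd C q = dm C g \<and>
     f \<cdot>\<^bsub>C\<^esub> p = g \<cdot>\<^bsub>C\<^esub> q \<and>
     (\<forall>x h k. h \<in> hom C x (dm C f) \<and> k \<in> hom C x (dm C g) \<and> f \<cdot>\<^bsub>C\<^esub> h = g \<cdot>\<^bsub>C\<^esub> k \<longrightarrow>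
        (\<exists>!u. u \<in> hom C x (dm C p) \<and> p \<cdot>\<^bsub>C\<^esub> u = h \<and> q \<cdot>\<^bsub>C\<^esub> u = k))"

definition factorization_system ::
  "('o, 'a, 'z) cat_scheme \<Rightarrow> 'a set \<Rightarrow> 'a set \<Rightarrow> bool" where
  "factorization_system C E M \<longleftrightarrow> E \<subseteq> ar C \<and> M \<subseteq> ar C \<and>
     (\<forall>f. is_iso C f \<longrightarrow> f \<in> E \<and> f \<in> M) \<and>
     (\<forall>f \<in> E. \<forall>g \<in> E. dm C g = cd C f \<longrightarrow> g \<cdot>\<^bsub>C\<^esub> f \<in> E) \<and>
     (\<forall>f \<in> M. \<forall>g \<in> M. dm C g = cd C f \<longrightarrow> g \<cdot>\<^bsub>C\<^esub> f \<in> M) \<and>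
     (\<forall>f \<in> ar C. \<exists>e \<in> E. \<exists>m \<in> M. dm C m = cd C e \<and> f = m \<cdot>\<^bsub>C\<^esub> e) \<and>
     (\<forall>e \<in> E. \<forall>m \<in> M. \<forall>u \<in> hom C (dm C e) (dm C m). \<forall>v \<in> hom C (cd C e) (cd C m).
        m \<cdot>\<^bsub>C\<^esub> u = v \<cdot>\<^bsub>C\<^esub> e \<longrightarrow>
        (\<exists>!d. d \<in> hom C (cd C e) (dm C m) \<and> d \<cdot>\<^bsub>C\<^esub> e = u \<and> m \<cdot>\<^bsub>C\<^esub> d = v))"

text \<open>Each object has, up to isomorphism under it, only a small set of \<open>E\<close>-quotients.\<close>

definition cowellpowered :: "'u rel \<Rightarrow> ('o, 'a, 'z) cat_scheme \<Rightarrow> 'a set \<Rightarrow> bool" where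
  "cowellpowered \<kappa> C E \<longleftrightarrow> (\<forall>a \<in> ob C. \<exists>Q. small \<kappa> Q \<and> Q \<subseteq> {e \<in> E. dm C e = a} \<and>
     (\<forall>e \<in> E. dm C e = a \<longrightarrow>
        (\<exists>e' \<in> Q. \<exists>i \<in> hom C (cd C e') (cd C e). is_iso C i \<and> i \<cdot>\<^bsub>C\<^esub> e' = e)))"


subsection \<open>Directed and filtered diagrams\<close>

definition poset_cat :: "'i set \<Rightarrow> 'i rel \<Rightarrow> ('i, 'i \<times> 'i) cat" where
  "poset_cat I le = \<lparr>ob = I, ar = {(i, j). i \<in> I \<and> j \<in> I \<and> (i, j) \<in> le}, dm = fst, cd = snd,
     idn = (\<lambda>i. (i, i)), cmp = (\<lambda>g f. (fst f, snd g))\<rparr>"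

definition directed_poset :: "'l rel \<Rightarrow> 'i set \<Rightarrow> 'i rel \<Rightarrow> bool" where
  "directed_poset lam I le \<longleftrightarrow> partial_order_on I le \<and>
     (\<forall>S \<subseteq> I. |S| <o lam \<longrightarrow> (\<exists>u \<in> I. \<forall>s \<in> S. (s, u) \<in> le))"

text \<open>
  Every subgraph with fewer than \<open>\<mu>\<close> vertices and edges has a cocone. (Subgraphs rather than
  subcategories, so that the notion is the usual one also for \<open>\<mu> = \<aleph>\<^sub>0\<close>.)
\<close>

definition filtered_cat :: "'m rel \<Rightarrow> ('i, 'j, 'z) cat_scheme \<Rightarrow> bool" where
  "filtered_cat mu J \<longleftrightarrow>
     (\<forall>P S. P \<subseteq> ob J \<and> S \<subseteq> ar J \<and> |P| <o mu \<and> |S| <o mu \<and> dm J ` S \<subseteq> P \<and> cd J ` S \<subseteq> P \<longrightarrow>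
        (\<exists>c \<in> ob J. \<exists>t. (\<forall>i \<in> P. t i \<in> hom J i c) \<and>
           (\<forall>f \<in> S. t (cd J f) \<cdot>\<^bsub>J\<^esub> f = t (dm J f))))"

text \<open>Small \<open>\<lambda>\<close>-directed diagrams in \<open>C\<close> whose connecting morphisms lie in \<open>M\<close>.\<close>

definition directed_diagram ::
  "'u rel \<Rightarrow> 'l rel \<Rightarrow> ('o, 'a, 'z) cat_scheme \<Rightarrow> 'a set \<Rightarrow>
   'u set \<Rightarrow> 'u rel \<Rightarrow> ('u, 'u \<times> 'u, 'o, 'a) ofun \<Rightarrow> bool" where
  "directed_diagram \<kappa> lam C M I le D \<longleftrightarrow> small \<kappa> I \<and> directed_poset lam I le \<and>
     cat_functor (poset_cat I le) C D \<and> (\<forall>f \<in> ar (poset_cat I le). oa D f \<in> M)"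

text \<open>
  Colimits in the category of small sets: \<open>c j : S j \<rightarrow> X\<close> is a colimit cocone on the diagram with
  objects \<open>S j\<close> and transition functions \<open>h f\<close>. Up to bijection, the small sets over which the
  universal property has to be tested are subsets of \<open>'u\<close>.
\<close>

definition is_set_colim ::
  "'u rel \<Rightarrow> ('i, 'j, 'z) cat_scheme \<Rightarrow> ('i \<Rightarrow> 'x set) \<Rightarrow> ('j \<Rightarrow> 'x \<Rightarrow> 'x) \<Rightarrow>
   'x set \<Rightarrow> ('i \<Rightarrow> 'x \<Rightarrow> 'x) \<Rightarrow> bool" where
  "is_set_colim \<kappa> J S h X c \<longleftrightarrow>
     (\<forall>i \<in> ob J. c i \<in> S i \<rightarrow> X) \<and>
     (\<forall>f \<in> ar J. \<forall>s \<in> S (dm J f). c (cd J f) (h f s) = c (dm J f) s) \<and>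
     (\<forall>(Y::'u set) d. small \<kappa> Y \<and> (\<forall>i \<in> ob J. d i \<in> S i \<rightarrow> Y) \<and>
        (\<forall>f \<in> ar J. \<forall>s \<in> S (dm J f). d (cd J f) (h f s) = d (dm J f) s) \<longrightarrow>
        (\<exists>!u. u \<in> X \<rightarrow>\<^sub>E Y \<and> (\<forall>i \<in> ob J. \<forall>s \<in> S i. u (c i s) = d i s)))"

text \<open>
  \<open>A\<close> is \<open>\<lambda>\<close>-generated with respect to \<open>M\<close> in the ordinary sense: \<open>C(A, -)\<close>, as a functor into sets,
  preserves \<open>\<lambda>\<close>-directed colimits of \<open>M\<close>-morphisms.
\<close>

definition generated_object ::
  "'u rel \<Rightarrow> 'l rel \<Rightarrow> ('o, 'a, 'z) cat_scheme \<Rightarrow> 'a set \<Rightarrow> 'o \<Rightarrow> bool" where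
  "generated_object \<kappa> lam C M A \<longleftrightarrow> A \<in> ob C \<and>
     (\<forall>I le D x c. directed_diagram \<kappa> lam C M I le D \<and> is_colim C (poset_cat I le) D x c \<longrightarrow>
        is_set_colim \<kappa> (poset_cat I le) (\<lambda>i. hom C A (oo D i)) (\<lambda>f g. oa D f \<cdot>\<^bsub>C\<^esub> g)
          (hom C A x) (\<lambda>i g. c i \<cdot>\<^bsub>C\<^esub> g))"


section \<open>Symmetric monoidal closed categories\<close>

record ('o, 'a) smc = "('o, 'a) cat" +
  tensor :: "'o \<Rightarrow> 'o \<Rightarrow> 'o" (infixr "\<otimes>\<index>" 75)
  tensorm :: "'a \<Rightarrow> 'a \<Rightarrow> 'a" (infixr "\<odot>\<index>" 70)
  unt :: 'o
  ass :: "'o \<Rightarrow> 'o \<Rightarrow> 'o \<Rightarrow> 'a"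
  lun :: "'o \<Rightarrow> 'a"
  run :: "'o \<Rightarrow> 'a"
  swp :: "'o \<Rightarrow> 'o \<Rightarrow> 'a"
  ihom :: "'o \<Rightarrow> 'o \<Rightarrow> 'o"
  ev :: "'o \<Rightarrow> 'o \<Rightarrow> 'a"

locale symmetric_monoidal_closed = category V
  for V :: "('o, 'a, 'z) smc_scheme" (structure) +
  assumes tensor_ob: "a \<in> ob V \<Longrightarrow> b \<in> ob V \<Longrightarrow> a \<otimes> b \<in> ob V"
    and tensorm_hom: "f \<in> hom V a b \<Longrightarrow> g \<in> hom V c d \<Longrightarrow> f \<odot> g \<in> hom V (a \<otimes> c) (b \<otimes> d)"
    and tensorm_idn: "a \<in> ob V \<Longrightarrow> b \<in> ob V \<Longrightarrow> idn V a \<odot> idn V b = idn V (a \<otimes> b)"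
    and tensorm_cmp:
      "f \<in> hom V a b \<Longrightarrow> g \<in> hom V b c \<Longrightarrow> f' \<in> hom V a' b' \<Longrightarrow> g' \<in> hom V b' c' \<Longrightarrow>
       (g \<cdot> f) \<odot> (g' \<cdot> f') = (g \<odot> g') \<cdot> (f \<odot> f')"
    and unt_ob: "unt V \<in> ob V"
    and ass_hom: "a \<in> ob V \<Longrightarrow> b \<in> ob V \<Longrightarrow> c \<in> ob V \<Longrightarrow>
       ass V a b c \<in> hom V ((a \<otimes> b) \<otimes> c) (a \<otimes> (b \<otimes> c))"
    and ass_iso: "a \<in> ob V \<Longrightarrow> b \<in> ob V \<Longrightarrow> c \<in> ob V \<Longrightarrow> is_iso V (ass V a b c)"
    and ass_natural:
      "f \<in> hom V a a' \<Longrightarrow> g \<in> hom V b b' \<Longrightarrow> h \<in> hom V c c' \<Longrightarrow>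
       ass V a' b' c' \<cdot> ((f \<odot> g) \<odot> h) = (f \<odot> (g \<odot> h)) \<cdot> ass V a b c"
    and lun_hom: "a \<in> ob V \<Longrightarrow> lun V a \<in> hom V (unt V \<otimes> a) a"
    and lun_iso: "a \<in> ob V \<Longrightarrow> is_iso V (lun V a)"
    and lun_natural: "f \<in> hom V a b \<Longrightarrow> lun V b \<cdot> (idn V (unt V) \<odot> f) = f \<cdot> lun V a"
    and run_hom: "a \<in> ob V \<Longrightarrow> run V a \<in> hom V (a \<otimes> unt V) a"
    and run_iso: "a \<in> ob V \<Longrightarrow> is_iso V (run V a)"
    and run_natural: "f \<in> hom V a b \<Longrightarrow> run V b \<cdot> (f \<odot> idn V (unt V)) = f \<cdot> run V a"
    and swp_hom: "a \<in> ob V \<Longrightarrow> b \<in> ob V \<Longrightarrow> swp V a b \<in> hom V (a \<otimes> b) (b \<otimes> a)"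
    and swp_natural: "f \<in> hom V a a' \<Longrightarrow> g \<in> hom V b b' \<Longrightarrow>
       swp V a' b' \<cdot> (f \<odot> g) = (g \<odot> f) \<cdot> swp V a b"
    and swp_swp: "a \<in> ob V \<Longrightarrow> b \<in> ob V \<Longrightarrow> swp V b a \<cdot> swp V a b = idn V (a \<otimes> b)"
    and pentagon: "a \<in> ob V \<Longrightarrow> b \<in> ob V \<Longrightarrow> c \<in> ob V \<Longrightarrow> d \<in> ob V \<Longrightarrow>
       (idn V a \<odot> ass V b c d) \<cdot> ass V a (b \<otimes> c) d \<cdot> (ass V a b c \<odot> idn V d)
       = ass V a b (c \<otimes> d) \<cdot> ass V (a \<otimes> b) c d"
    and triangle: "a \<in> ob V \<Longrightarrow> b \<in> ob V \<Longrightarrow>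
       (idn V a \<odot> lun V b) \<cdot> ass V a (unt V) b = run V a \<odot> idn V b"
    and hexagon: "a \<in> ob V \<Longrightarrow> b \<in> ob V \<Longrightarrow> c \<in> ob V \<Longrightarrow>
       ass V b c a \<cdot> swp V a (b \<otimes> c) \<cdot> ass V a b c
       = (idn V b \<odot> swp V a c) \<cdot> ass V b a c \<cdot> (swp V a b \<odot> idn V c)"
    and ihom_ob: "b \<in> ob V \<Longrightarrow> c \<in> ob V \<Longrightarrow> ihom V b c \<in> ob V"
    and ev_hom: "b \<in> ob V \<Longrightarrow> c \<in> ob V \<Longrightarrow> ev V b c \<in> hom V (ihom V b c \<otimes> b) c"
    and ev_universal: "a \<in> ob V \<Longrightarrow> b \<in> ob V \<Longrightarrow> c \<in> ob V \<Longrightarrow> f \<in> hom V (a \<otimes> b) c \<Longrightarrow>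
       \<exists>!g. g \<in> hom V a (ihom V b c) \<and> ev V b c \<cdot> (g \<odot> idn V b) = f"

text \<open>The transpose \<open>a \<rightarrow> [b, c]\<close> of \<open>f : a \<otimes> b \<rightarrow> c\<close>.\<close>

definition curry_ar :: "('o, 'a, 'z) smc_scheme \<Rightarrow> 'o \<Rightarrow> 'o \<Rightarrow> 'o \<Rightarrow> 'a \<Rightarrow> 'a" where
  "curry_ar V a b c f =
     (THE g. g \<in> hom V a (ihom V b c) \<and> ev V b c \<cdot>\<^bsub>V\<^esub> (g \<odot>\<^bsub>V\<^esub> idn V b) = f)"


section \<open>Enriched categories\<close>

text \<open>The composition \<open>vcmp K a b c\<close> has type \<open>K(b,c) \<otimes> K(a,b) \<rightarrow> K(a,c)\<close>.\<close>

record ('k, 'o, 'a) vcat =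
  vob :: "'k set"
  vhom :: "'k \<Rightarrow> 'k \<Rightarrow> 'o"
  vid :: "'k \<Rightarrow> 'a"
  vcmp :: "'k \<Rightarrow> 'k \<Rightarrow> 'k \<Rightarrow> 'a"

locale vcategory =
  fixes V :: "('o, 'a, 'z) smc_scheme" (structure)
    and K :: "('k, 'o, 'a) vcat"
  assumes vhom_ob: "a \<in> vob K \<Longrightarrow> b \<in> vob K \<Longrightarrow> vhom K a b \<in> ob V"
    and vid_hom: "a \<in> vob K \<Longrightarrow> vid K a \<in> hom V (unt V) (vhom K a a)"
    and vcmp_hom: "a \<in> vob K \<Longrightarrow> b \<in> vob K \<Longrightarrow> c \<in> vob K \<Longrightarrow>
       vcmp K a b c \<in> hom V (vhom K b c \<otimes> vhom K a b) (vhom K a c)"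
    and vcmp_vid_left: "a \<in> vob K \<Longrightarrow> b \<in> vob K \<Longrightarrow>
       vcmp K a b b \<cdot> (vid K b \<odot> idn V (vhom K a b)) = lun V (vhom K a b)"
    and vcmp_vid_right: "a \<in> vob K \<Longrightarrow> b \<in> vob K \<Longrightarrow>
       vcmp K a a b \<cdot> (idn V (vhom K a b) \<odot> vid K a) = run V (vhom K a b)"
    and vcmp_assoc: "a \<in> vob K \<Longrightarrow> b \<in> vob K \<Longrightarrow> c \<in> vob K \<Longrightarrow> d \<in> vob K \<Longrightarrow>
       vcmp K a b d \<cdot> (vcmp K b c d \<odot> idn V (vhom K a b))
       = vcmp K a c d \<cdot> (idn V (vhom K c d) \<odot> vcmp K a b c)
           \<cdot> ass V (vhom K c d) (vhom K b c) (vhom K a b)"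

text \<open>
  The underlying ordinary category; an arrow \<open>a \<rightarrow> b\<close> is a triple \<open>(a, b, f)\<close> with
  \<open>f : I \<rightarrow> K(a,b)\<close>.
\<close>

definition und ::
  "('o, 'a, 'z) smc_scheme \<Rightarrow> ('k, 'o, 'a) vcat \<Rightarrow> ('k, 'k \<times> 'k \<times> 'a) cat" where
  "und V K = \<lparr>ob = vob K,
     ar = {(a, b, f). a \<in> vob K \<and> b \<in> vob K \<and> f \<in> hom V (unt V) (vhom K a b)},
     dm = (\<lambda>(a, b, f). a), cd = (\<lambda>(a, b, f). b),
     idn = (\<lambda>a. (a, a, vid K a)),
     cmp = (\<lambda>(b', c, g) (a, b, f).
       (a, c, vcmp K a b c \<cdot>\<^bsub>V\<^esub> (g \<odot>\<^bsub>V\<^esub> f) \<cdot>\<^bsub>V\<^esub> cinv V (lun V (unt V))))\<rparr>"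

text \<open>For underlying arrows \<open>g : y \<rightarrow> z\<close> and \<open>f : w \<rightarrow> x\<close>: the arrows
  \<open>K(x,g) : K(x,y) \<rightarrow> K(x,z)\<close> and \<open>K(f,y) : K(x,y) \<rightarrow> K(w,y)\<close> of \<open>V\<close>.\<close>

definition vpost ::
  "('o, 'a, 'z) smc_scheme \<Rightarrow> ('k, 'o, 'a) vcat \<Rightarrow> 'k \<Rightarrow> 'k \<times> 'k \<times> 'a \<Rightarrow> 'a" where
  "vpost V K x = (\<lambda>(y, z, g). vcmp K x y z \<cdot>\<^bsub>V\<^esub> (g \<odot>\<^bsub>V\<^esub> idn V (vhom K x y))
     \<cdot>\<^bsub>V\<^esub> cinv V (lun V (vhom K x y)))"

definition vpre ::
  "('o, 'a, 'z) smc_scheme \<Rightarrow> ('k, 'o, 'a) vcat \<Rightarrow> 'k \<times> 'k \<times> 'a \<Rightarrow> 'k \<Rightarrow> 'a" where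
  "vpre V K = (\<lambda>(w, x, f) y. vcmp K w x y \<cdot>\<^bsub>V\<^esub> (idn V (vhom K x y) \<odot>\<^bsub>V\<^esub> f)
     \<cdot>\<^bsub>V\<^esub> cinv V (run V (vhom K x y)))"

definition vop :: "('o, 'a, 'z) smc_scheme \<Rightarrow> ('k, 'o, 'a) vcat \<Rightarrow> ('k, 'o, 'a) vcat" where
  "vop V K = \<lparr>vob = vob K, vhom = (\<lambda>a b. vhom K b a), vid = vid K,
     vcmp = (\<lambda>a b c. vcmp K c b a \<cdot>\<^bsub>V\<^esub> swp V (vhom K c b) (vhom K b a))\<rparr>"

definition vfull :: "('k, 'o, 'a) vcat \<Rightarrow> 'k set \<Rightarrow> ('k, 'o, 'a) vcat" where
  "vfull K A = K\<lparr>vob := A\<rparr>"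

text \<open>\<open>V\<close> as a \<open>V\<close>-category, with hom-objects the internal homs.\<close>

definition self :: "('o, 'a, 'z) smc_scheme \<Rightarrow> ('o, 'o, 'a) vcat" where
  "self V = \<lparr>vob = ob V, vhom = ihom V,
     vid = (\<lambda>a. curry_ar V (unt V) a a (lun V a)),
     vcmp = (\<lambda>a b c. curry_ar V (ihom V b c \<otimes>\<^bsub>V\<^esub> ihom V a b) a c
       (ev V b c \<cdot>\<^bsub>V\<^esub> (idn V (ihom V b c) \<odot>\<^bsub>V\<^esub> ev V a b)
         \<cdot>\<^bsub>V\<^esub> ass V (ihom V b c) (ihom V a b) a))\<rparr>"

text \<open>A class of arrows of \<open>V\<close>, seen as a class of arrows of the underlying category of
  \<open>self V\<close>, via \<open>V(a,b) \<cong> V(I,[a,b])\<close>.\<close>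

definition self_arrows :: "('o, 'a, 'z) smc_scheme \<Rightarrow> 'a set \<Rightarrow> ('o \<times> 'o \<times> 'a) set" where
  "self_arrows V S = (\<lambda>f. (dm V f, cd V f,
     curry_ar V (unt V) (dm V f) (cd V f) (f \<cdot>\<^bsub>V\<^esub> lun V (dm V f)))) ` S"


subsection \<open>Enriched functors and natural transformations\<close>

record ('k, 'l, 'a) vfun =
  fo :: "'k \<Rightarrow> 'l"
  fm :: "'k \<Rightarrow> 'k \<Rightarrow> 'a"

locale vfunctor =
  fixes V :: "('o, 'a, 'z) smc_scheme" (structure)
    and K :: "('k, 'o, 'a) vcat"
    and L :: "('l, 'o, 'a) vcat"
    and F :: "('k, 'l, 'a) vfun"
  assumes fo_vob: "a \<in> vob K \<Longrightarrow> fo F a \<in> vob L"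
    and fm_hom: "a \<in> vob K \<Longrightarrow> b \<in> vob K \<Longrightarrow>
       fm F a b \<in> hom V (vhom K a b) (vhom L (fo F a) (fo F b))"
    and fm_vid: "a \<in> vob K \<Longrightarrow> fm F a a \<cdot> vid K a = vid L (fo F a)"
    and fm_vcmp: "a \<in> vob K \<Longrightarrow> b \<in> vob K \<Longrightarrow> c \<in> vob K \<Longrightarrow>
       fm F a c \<cdot> vcmp K a b c = vcmp L (fo F a) (fo F b) (fo F c) \<cdot> (fm F b c \<odot> fm F a b)"

definition vf_id :: "('o, 'a, 'z) smc_scheme \<Rightarrow> ('k, 'o, 'a) vcat \<Rightarrow> ('k, 'k, 'a) vfun" where
  "vf_id V K = \<lparr>fo = (\<lambda>a. a), fm = (\<lambda>a b. idn V (vhom K a b))\<rparr>"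

text \<open>\<open>vf_cmp V F G\<close> is \<open>G\<close> after \<open>F\<close>.\<close>

definition vf_cmp ::
  "('o, 'a, 'z) smc_scheme \<Rightarrow> ('k, 'l, 'a) vfun \<Rightarrow> ('l, 'h, 'a) vfun \<Rightarrow> ('k, 'h, 'a) vfun" where
  "vf_cmp V F G = \<lparr>fo = (\<lambda>a. fo G (fo F a)),
     fm = (\<lambda>a b. fm G (fo F a) (fo F b) \<cdot>\<^bsub>V\<^esub> fm F a b)\<rparr>"

definition vf_op :: "('k, 'l, 'a) vfun \<Rightarrow> ('k, 'l, 'a) vfun" where
  "vf_op F = \<lparr>fo = fo F, fm = (\<lambda>a b. fm F b a)\<rparr>"

definition vf_eq :: "('k, 'o, 'a) vcat \<Rightarrow> ('k, 'l, 'a) vfun \<Rightarrow> ('k, 'l, 'a) vfun \<Rightarrow> bool" where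
  "vf_eq K F G \<longleftrightarrow> (\<forall>a \<in> vob K. fo F a = fo G a) \<and>
     (\<forall>a \<in> vob K. \<forall>b \<in> vob K. fm F a b = fm G a b)"

text \<open>
  Functors that are objects of a functor category are normalised to \<open>undefined\<close> outside the domain
  category, so that equal functors are equal elements of type \<open>vfun\<close>.
\<close>

definition vf_restrict :: "('k, 'o, 'a) vcat \<Rightarrow> ('k, 'l, 'a) vfun \<Rightarrow> ('k, 'l, 'a) vfun" where
  "vf_restrict K F = \<lparr>fo = restrict (fo F) (vob K),
     fm = (\<lambda>a b. if a \<in> vob K \<and> b \<in> vob K then fm F a b else undefined)\<rparr>"

definition und_ar ::
  "('o, 'a, 'z) smc_scheme \<Rightarrow> ('k, 'l, 'a) vfun \<Rightarrow> 'k \<times> 'k \<times> 'a \<Rightarrow> 'l \<times> 'l \<times> 'a" where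
  "und_ar V F = (\<lambda>(a, b, f). (fo F a, fo F b, fm F a b \<cdot>\<^bsub>V\<^esub> f))"

locale vnat =
  fixes V :: "('o, 'a, 'z) smc_scheme" (structure)
    and K :: "('k, 'o, 'a) vcat"
    and L :: "('l, 'o, 'a) vcat"
    and F G :: "('k, 'l, 'a) vfun"
    and t :: "'k \<Rightarrow> 'a"
  assumes component_hom: "a \<in> vob K \<Longrightarrow> t a \<in> hom V (unt V) (vhom L (fo F a) (fo G a))"
    and natural: "a \<in> vob K \<Longrightarrow> b \<in> vob K \<Longrightarrow>
       vcmp L (fo F a) (fo F b) (fo G b) \<cdot> (t b \<odot> fm F a b) \<cdot> cinv V (lun V (vhom K a b))
       = vcmp L (fo F a) (fo G a) (fo G b) \<cdot> (fm G a b \<odot> t a) \<cdot> cinv V (run V (vhom K a b))"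

definition vnat_isomorphic ::
  "('o, 'a, 'z) smc_scheme \<Rightarrow> ('k, 'o, 'a) vcat \<Rightarrow> ('l, 'o, 'a) vcat \<Rightarrow>
   ('k, 'l, 'a) vfun \<Rightarrow> ('k, 'l, 'a) vfun \<Rightarrow> bool" where
  "vnat_isomorphic V K L F G \<longleftrightarrow>
     (\<exists>t. vnat V K L F G t \<and> (\<forall>a \<in> vob K. is_iso (und V L) (fo F a, fo G a, t a)))"

text \<open>The representable functors \<open>K(a,-) : K \<rightarrow> V\<close> and \<open>K(-,a) : K\<^sup>o\<^sup>p \<rightarrow> V\<close>.\<close>

definition vrep ::
  "('o, 'a, 'z) smc_scheme \<Rightarrow> ('k, 'o, 'a) vcat \<Rightarrow> 'k \<Rightarrow> ('k, 'o, 'a) vfun" where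
  "vrep V K a = \<lparr>fo = (\<lambda>b. vhom K a b),
     fm = (\<lambda>b c. curry_ar V (vhom K b c) (vhom K a b) (vhom K a c) (vcmp K a b c))\<rparr>"

definition vrep_contra ::
  "('o, 'a, 'z) smc_scheme \<Rightarrow> ('k, 'o, 'a) vcat \<Rightarrow> 'k \<Rightarrow> ('k, 'o, 'a) vfun" where
  "vrep_contra V K a = vrep V (vop V K) a"


subsection \<open>Functor categories\<close>

text \<open>
  The object of \<open>V\<close>-natural transformations from \<open>F\<close> to \<open>G\<close> is the end \<open>\<integral>\<^sub>d L(F d, G d)\<close>, that is, the
  universal family \<open>p d : e \<rightarrow> L(F d, G d)\<close> that is extraordinarily natural in \<open>d\<close>. Naturality is
  stated in transposed form, as equality of two arrows \<open>x \<otimes> D(d,d') \<rightarrow> L(F d, G d')\<close>.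
\<close>

definition natural_wedge ::
  "('o, 'a, 'z) smc_scheme \<Rightarrow> ('k, 'o, 'a) vcat \<Rightarrow> ('l, 'o, 'a) vcat \<Rightarrow>
   ('k, 'l, 'a) vfun \<Rightarrow> ('k, 'l, 'a) vfun \<Rightarrow> 'o \<Rightarrow> ('k \<Rightarrow> 'a) \<Rightarrow> bool" where
  "natural_wedge V D L F G x p \<longleftrightarrow> x \<in> ob V \<and>
     (\<forall>d \<in> vob D. p d \<in> hom V x (vhom L (fo F d) (fo G d))) \<and>
     (\<forall>d \<in> vob D. \<forall>d' \<in> vob D.
        vcmp L (fo F d) (fo G d) (fo G d') \<cdot>\<^bsub>V\<^esub> (fm G d d' \<odot>\<^bsub>V\<^esub> p d) \<cdot>\<^bsub>V\<^esub> swp V x (vhom D d d')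
        = vcmp L (fo F d) (fo F d') (fo G d') \<cdot>\<^bsub>V\<^esub> (p d' \<odot>\<^bsub>V\<^esub> fm F d d'))"

definition is_natobj ::
  "('o, 'a, 'z) smc_scheme \<Rightarrow> ('k, 'o, 'a) vcat \<Rightarrow> ('l, 'o, 'a) vcat \<Rightarrow>
   ('k, 'l, 'a) vfun \<Rightarrow> ('k, 'l, 'a) vfun \<Rightarrow> 'o \<Rightarrow> ('k \<Rightarrow> 'a) \<Rightarrow> bool" where
  "is_natobj V D L F G e p \<longleftrightarrow> natural_wedge V D L F G e p \<and>
     (\<forall>x q. natural_wedge V D L F G x q \<longrightarrow>
        (\<exists>!u. u \<in> hom V x e \<and> (\<forall>d \<in> vob D. p d \<cdot>\<^bsub>V\<^esub> u = q d)))"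

definition natobj ::
  "('o, 'a, 'z) smc_scheme \<Rightarrow> ('k, 'o, 'a) vcat \<Rightarrow> ('l, 'o, 'a) vcat \<Rightarrow>
   ('k, 'l, 'a) vfun \<Rightarrow> ('k, 'l, 'a) vfun \<Rightarrow> 'o \<times> ('k \<Rightarrow> 'a)" where
  "natobj V D L F G = (SOME (e, p). is_natobj V D L F G e p)"

abbreviation natobj_proj ::
  "('o, 'a, 'z) smc_scheme \<Rightarrow> ('k, 'o, 'a) vcat \<Rightarrow> ('l, 'o, 'a) vcat \<Rightarrow>
   ('k, 'l, 'a) vfun \<Rightarrow> ('k, 'l, 'a) vfun \<Rightarrow> 'k \<Rightarrow> 'a" where
  "natobj_proj V D L F G \<equiv> snd (natobj V D L F G)"

definition vfun_cat ::
  "('o, 'a, 'z) smc_scheme \<Rightarrow> ('k, 'o, 'a) vcat \<Rightarrow> ('l, 'o, 'a) vcat \<Rightarrow>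
   (('k, 'l, 'a) vfun, 'o, 'a) vcat" where
  "vfun_cat V D L = \<lparr>vob = {F. vfunctor V D L F \<and> vf_restrict D F = F},
     vhom = (\<lambda>F G. fst (natobj V D L F G)),
     vid = (\<lambda>F. THE u. u \<in> hom V (unt V) (fst (natobj V D L F F)) \<and>
       (\<forall>d \<in> vob D. natobj_proj V D L F F d \<cdot>\<^bsub>V\<^esub> u = vid L (fo F d))),
     vcmp = (\<lambda>F G H. THE u.
       u \<in> hom V (fst (natobj V D L G H) \<otimes>\<^bsub>V\<^esub> fst (natobj V D L F G)) (fst (natobj V D L F H)) \<and>
       (\<forall>d \<in> vob D. natobj_proj V D L F H d \<cdot>\<^bsub>V\<^esub> u =
          vcmp L (fo F d) (fo G d) (fo H d)
            \<cdot>\<^bsub>V\<^esub> (natobj_proj V D L G H d \<odot>\<^bsub>V\<^esub> natobj_proj V D L F G d)))\<rparr>"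

text \<open>\<open>[x, L] : [D', L] \<rightarrow> [D, L]\<close> for \<open>x : D \<rightarrow> D'\<close>.\<close>

definition vf_precompose ::
  "('o, 'a, 'z) smc_scheme \<Rightarrow> ('k, 'o, 'a) vcat \<Rightarrow> ('h, 'o, 'a) vcat \<Rightarrow> ('l, 'o, 'a) vcat \<Rightarrow>
   ('k, 'h, 'a) vfun \<Rightarrow> (('h, 'l, 'a) vfun, ('k, 'l, 'a) vfun, 'a) vfun" where
  "vf_precompose V D D' L x =
     (let R = (\<lambda>F. vf_restrict D (vf_cmp V x F)) in
      \<lparr>fo = R,
       fm = (\<lambda>F G. THE u.
         u \<in> hom V (vhom (vfun_cat V D' L) F G) (vhom (vfun_cat V D L) (R F) (R G)) \<and>
         (\<forall>d \<in> vob D. natobj_proj V D L (R F) (R G) d \<cdot>\<^bsub>V\<^esub> u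
            = natobj_proj V D' L F G (fo x d)))\<rparr>)"

text \<open>\<open>K \<rightarrow> [A\<^sup>o\<^sup>p, V]\<close>, \<open>k \<mapsto> K(-,k)\<close> restricted to \<open>A\<^sup>o\<^sup>p\<close>, for a full subcategory \<open>A\<close>.\<close>

definition nerve ::
  "('o, 'a, 'z) smc_scheme \<Rightarrow> ('k, 'o, 'a) vcat \<Rightarrow> 'k set \<Rightarrow> ('k, ('k, 'o, 'a) vfun, 'a) vfun" where
  "nerve V K A =
     (let Aop = vop V (vfull K A); N = (\<lambda>k. vf_restrict Aop (vrep_contra V K k)) in
      \<lparr>fo = N,
       fm = (\<lambda>k l. THE u. u \<in> hom V (vhom K k l) (vhom (vfun_cat V Aop (self V)) (N k) (N l)) \<and>
         (\<forall>a \<in> A. natobj_proj V Aop (self V) (N k) (N l) a \<cdot>\<^bsub>V\<^esub> u = fm (vrep V K a) k l))\<rparr>)"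


subsection \<open>Pullbacks of enriched categories\<close>

definition chosen_pullback :: "('o, 'a, 'z) cat_scheme \<Rightarrow> 'a \<Rightarrow> 'a \<Rightarrow> 'a \<times> 'a" where
  "chosen_pullback C f g = (SOME (p, q). is_pullback C f g p q)"

text \<open>The pullback of \<open>F : K \<rightarrow> C\<close> and \<open>G : L \<rightarrow> C\<close>: its objects are the pairs of objects with equal
  image, its hom-objects are pullbacks in \<open>V\<close>.\<close>

definition vpullback ::
  "('o, 'a, 'z) smc_scheme \<Rightarrow> ('k, 'o, 'a) vcat \<Rightarrow> ('l, 'o, 'a) vcat \<Rightarrow>
   ('k, 'c, 'a) vfun \<Rightarrow> ('l, 'c, 'a) vfun \<Rightarrow> ('k \<times> 'l, 'o, 'a) vcat" where
  "vpullback V K L F G =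
     (let P = (\<lambda>x y. fst (chosen_pullback V (fm F (fst x) (fst y)) (fm G (snd x) (snd y))));
          Q = (\<lambda>x y. snd (chosen_pullback V (fm F (fst x) (fst y)) (fm G (snd x) (snd y)))) in
      \<lparr>vob = {(k, l). k \<in> vob K \<and> l \<in> vob L \<and> fo F k = fo G l},
       vhom = (\<lambda>x y. dm V (P x y)),
       vid = (\<lambda>x. THE u. u \<in> hom V (unt V) (dm V (P x x)) \<and>
         P x x \<cdot>\<^bsub>V\<^esub> u = vid K (fst x) \<and> Q x x \<cdot>\<^bsub>V\<^esub> u = vid L (snd x)),
       vcmp = (\<lambda>x y z. THE u.
         u \<in> hom V (dm V (P y z) \<otimes>\<^bsub>V\<^esub> dm V (P x y)) (dm V (P x z)) \<and>
         P x z \<cdot>\<^bsub>V\<^esub> u = vcmp K (fst x) (fst y) (fst z) \<cdot>\<^bsub>V\<^esub> (P y z \<odot>\<^bsub>V\<^esub> P x y) \<and>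
         Q x z \<cdot>\<^bsub>V\<^esub> u = vcmp L (snd x) (snd y) (snd z) \<cdot>\<^bsub>V\<^esub> (Q y z \<odot>\<^bsub>V\<^esub> Q x y))\<rparr>)"

definition vpullback_fst ::
  "('o, 'a, 'z) smc_scheme \<Rightarrow> ('k, 'c, 'a) vfun \<Rightarrow> ('l, 'c, 'a) vfun \<Rightarrow>
   ('k \<times> 'l, 'k, 'a) vfun" where
  "vpullback_fst V F G = \<lparr>fo = fst,
     fm = (\<lambda>x y. fst (chosen_pullback V (fm F (fst x) (fst y)) (fm G (snd x) (snd y))))\<rparr>"


subsection \<open>Weighted and conical colimits\<close>

text \<open>
  \<open>c\<close> with unit \<open>\<gamma> : W \<rightarrow> K(G-,c)\<close> is the colimit of \<open>G : D \<rightarrow> K\<close> weighted by \<open>W : D\<^sup>o\<^sup>p \<rightarrow> V\<close>: for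
  each \<open>y\<close>, the family \<open>K(c,y) \<rightarrow> [K(G d,c), K(G d,y)] \<rightarrow> [W d, K(G d,y)]\<close> induced by \<open>\<gamma>\<close> exhibits
  \<open>K(c,y)\<close> as \<open>[D\<^sup>o\<^sup>p, V](W, K(G-,y))\<close>.
\<close>

definition is_weighted_colim ::
  "('o, 'a, 'z) smc_scheme \<Rightarrow> ('d, 'o, 'a) vcat \<Rightarrow> ('k, 'o, 'a) vcat \<Rightarrow>
   ('d, 'o, 'a) vfun \<Rightarrow> ('d, 'k, 'a) vfun \<Rightarrow> 'k \<Rightarrow> ('d \<Rightarrow> 'a) \<Rightarrow> bool" where
  "is_weighted_colim V D K W G c \<gamma> \<longleftrightarrow> c \<in> vob K \<and>
     vnat V (vop V D) (self V) W (vf_cmp V (vf_op G) (vrep_contra V K c)) \<gamma> \<and>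
     (\<forall>y \<in> vob K. is_natobj V (vop V D) (self V) W (vf_cmp V (vf_op G) (vrep_contra V K y))
        (vhom K c y)
        (\<lambda>d. vpre V (self V) (fo W d, vhom K (fo G d) c, \<gamma> d) (vhom K (fo G d) y)
           \<cdot>\<^bsub>V\<^esub> fm (vrep V K (fo G d)) c y))"

definition has_weighted_colimits ::
  "'u rel \<Rightarrow> ('o, 'a, 'z) smc_scheme \<Rightarrow> ('k, 'o, 'a) vcat \<Rightarrow> bool" where
  "has_weighted_colimits \<kappa> V K \<longleftrightarrow>
     (\<forall>(D::('u, 'o, 'a) vcat) W G. vcategory V D \<and> small \<kappa> (vob D) \<and>
        vfunctor V (vop V D) (self V) W \<and> vfunctor V D K G \<longrightarrow>
        (\<exists>c \<gamma>. is_weighted_colim V D K W G c \<gamma>))"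

text \<open>A cocone in the underlying category is a conical colimit in \<open>K\<close> if every \<open>K(-,y)\<close> sends it to
  a limit cone in \<open>V\<close>.\<close>

definition is_conical_colim ::
  "('o, 'a, 'z) smc_scheme \<Rightarrow> ('k, 'o, 'a) vcat \<Rightarrow> ('i, 'j, 'y) cat_scheme \<Rightarrow>
   ('i, 'j, 'k, 'k \<times> 'k \<times> 'a) ofun \<Rightarrow> 'k \<Rightarrow> ('i \<Rightarrow> 'k \<times> 'k \<times> 'a) \<Rightarrow> bool" where
  "is_conical_colim V K J D x c \<longleftrightarrow> cat_functor J (und V K) D \<and> is_cocone (und V K) J D x c \<and>
     (\<forall>y \<in> vob K. is_lim V (cat_op J)
        \<lparr>oo = (\<lambda>i. vhom K (oo D i) y), oa = (\<lambda>f. vpre V K (oa D f) y)\<rparr>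
        (vhom K x y) (\<lambda>i. vpre V K (c i) y))"

definition preserves_conical_colim ::
  "('o, 'a, 'z) smc_scheme \<Rightarrow> ('l, 'o, 'a) vcat \<Rightarrow> ('k, 'l, 'a) vfun \<Rightarrow>
   ('i, 'j, 'y) cat_scheme \<Rightarrow> ('i, 'j, 'k, 'k \<times> 'k \<times> 'a) ofun \<Rightarrow>
   'k \<Rightarrow> ('i \<Rightarrow> 'k \<times> 'k \<times> 'a) \<Rightarrow> bool" where
  "preserves_conical_colim V L F J D x c \<longleftrightarrow>
     is_conical_colim V L J \<lparr>oo = (\<lambda>i. fo F (oo D i)), oa = (\<lambda>f. und_ar V F (oa D f))\<rparr>
       (fo F x) (\<lambda>i. und_ar V F (c i))"

definition preserves_filtered_colimits ::
  "'u rel \<Rightarrow> 'm rel \<Rightarrow> ('o, 'a, 'z) smc_scheme \<Rightarrow> ('k, 'o, 'a) vcat \<Rightarrow> ('l, 'o, 'a) vcat \<Rightarrow>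
   ('k, 'l, 'a) vfun \<Rightarrow> bool" where
  "preserves_filtered_colimits \<kappa> mu V K L F \<longleftrightarrow>
     (\<forall>(J::('u, 'u) cat) D x c. small_cat \<kappa> J \<and> filtered_cat mu J \<and>
        is_conical_colim V K J D x c \<longrightarrow> preserves_conical_colim V L F J D x c)"

definition preserves_directed_colimits ::
  "'u rel \<Rightarrow> 'l rel \<Rightarrow> ('o, 'a, 'z) smc_scheme \<Rightarrow> ('k, 'o, 'a) vcat \<Rightarrow> ('k \<times> 'k \<times> 'a) set \<Rightarrow>
   ('h, 'o, 'a) vcat \<Rightarrow> ('k, 'h, 'a) vfun \<Rightarrow> bool" where
  "preserves_directed_colimits \<kappa> lam V K M L F \<longleftrightarrow>
     (\<forall>I le D x c. directed_diagram \<kappa> lam (und V K) M I le D \<and>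
        is_conical_colim V K (poset_cat I le) D x c \<longrightarrow>
        preserves_conical_colim V L F (poset_cat I le) D x c)"


section \<open>Locally presentable and locally generated enriched categories\<close>

definition locally_presentable ::
  "'u rel \<Rightarrow> 'm rel \<Rightarrow> ('o, 'a, 'z) smc_scheme \<Rightarrow> ('k, 'o, 'a) vcat \<Rightarrow> bool" where
  "locally_presentable \<kappa> mu V K \<longleftrightarrow> has_weighted_colimits \<kappa> V K \<and>
     (\<exists>A \<subseteq> vob K. small \<kappa> A \<and>
        (\<forall>a \<in> A. preserves_filtered_colimits \<kappa> mu V K (self V) (vrep V K a)) \<and>
        (\<forall>x \<in> vob K. \<exists>(J::('u, 'u) cat) D c. small_cat \<kappa> J \<and> filtered_cat mu J \<and>
           (\<forall>i \<in> ob J. oo D i \<in> A) \<and> is_conical_colim V K J D x c))"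

definition v_factorization_system ::
  "('o, 'a, 'z) smc_scheme \<Rightarrow> ('k, 'o, 'a) vcat \<Rightarrow>
   ('k \<times> 'k \<times> 'a) set \<Rightarrow> ('k \<times> 'k \<times> 'a) set \<Rightarrow> bool" where
  "v_factorization_system V K E M \<longleftrightarrow> factorization_system (und V K) E M \<and>
     (\<forall>e \<in> E. \<forall>m \<in> M. case e of (a, b, _) \<Rightarrow> case m of (c, d, _) \<Rightarrow>
        is_pullback V (vpost V K a m) (vpre V K e d) (vpre V K e c) (vpost V K b m))"

definition convenient ::
  "'u rel \<Rightarrow> 'l rel \<Rightarrow> ('o, 'a, 'z) smc_scheme \<Rightarrow> ('k, 'o, 'a) vcat \<Rightarrow>
   ('k \<times> 'k \<times> 'a) set \<Rightarrow> ('k \<times> 'k \<times> 'a) set \<Rightarrow> bool" where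
  "convenient \<kappa> lam V K E M \<longleftrightarrow> cowellpowered \<kappa> (und V K) E \<and>
     (\<forall>I le D x c. directed_diagram \<kappa> lam (und V K) M I le D \<and>
        is_conical_colim V K (poset_cat I le) D x c \<longrightarrow>
        (\<forall>i \<in> I. c i \<in> M) \<and>
        (\<forall>y d u. is_cocone (und V K) (poset_cat I le) D y d \<and> (\<forall>i \<in> I. d i \<in> M) \<and>
           u \<in> hom (und V K) x y \<and> (\<forall>i \<in> I. u \<cdot>\<^bsub>und V K\<^esub> c i = d i) \<longrightarrow> u \<in> M))"

definition v_generated_object ::
  "'u rel \<Rightarrow> 'l rel \<Rightarrow> ('o, 'a, 'z) smc_scheme \<Rightarrow> ('k, 'o, 'a) vcat \<Rightarrow> ('k \<times> 'k \<times> 'a) set \<Rightarrow>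
   'k \<Rightarrow> bool" where
  "v_generated_object \<kappa> lam V K M a \<longleftrightarrow> a \<in> vob K \<and>
     preserves_directed_colimits \<kappa> lam V K M (self V) (vrep V K a)"

definition locally_generated ::
  "'u rel \<Rightarrow> 'l rel \<Rightarrow> ('o, 'a, 'z) smc_scheme \<Rightarrow> ('k, 'o, 'a) vcat \<Rightarrow>
   ('k \<times> 'k \<times> 'a) set \<Rightarrow> ('k \<times> 'k \<times> 'a) set \<Rightarrow> bool" where
  "locally_generated \<kappa> lam V K E M \<longleftrightarrow>
     v_factorization_system V K E M \<and> convenient \<kappa> lam V K E M \<and> has_weighted_colimits \<kappa> V K \<and>
     (\<exists>A. small \<kappa> A \<and> (\<forall>a \<in> A. v_generated_object \<kappa> lam V K M a) \<and>
        (\<forall>x \<in> vob K. \<exists>I le D c. directed_diagram \<kappa> lam (und V K) M I le D \<and>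
           (\<forall>i \<in> I. oo D i \<in> A) \<and> is_conical_colim V K (poset_cat I le) D x c))"

text \<open>
  The conditions on the tensor unit and on tensor products use the ordinary notion of
  \<open>\<lambda>\<close>-generated object of \<open>V\<close>, as in the definition of categories locally presentable as closed
  categories. (In the enriched sense the unit would always be \<open>\<lambda>\<close>-generated, as \<open>[I,-] \<cong> Id\<close>.)
\<close>

definition locally_generated_closed ::
  "'u rel \<Rightarrow> 'l rel \<Rightarrow> ('o, 'a, 'z) smc_scheme \<Rightarrow> 'a set \<Rightarrow> 'a set \<Rightarrow> bool" where
  "locally_generated_closed \<kappa> lam V E M \<longleftrightarrow> E \<subseteq> ar V \<and> M \<subseteq> ar V \<and>
     locally_generated \<kappa> lam V (self V) (self_arrows V E) (self_arrows V M) \<and>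
     generated_object \<kappa> lam V M (unt V) \<and>
     (\<forall>a b. generated_object \<kappa> lam V M a \<and> generated_object \<kappa> lam V M b \<longrightarrow>
        generated_object \<kappa> lam V M (a \<otimes>\<^bsub>V\<^esub> b))"


section \<open>Enriched monads and their algebras\<close>

record ('k, 'a) vmnd =
  mfun :: "('k, 'k, 'a) vfun"
  munit :: "'k \<Rightarrow> 'a"
  mmult :: "'k \<Rightarrow> 'a"

abbreviation mob :: "('k, 'a) vmnd \<Rightarrow> 'k \<Rightarrow> 'k" where
  "mob T \<equiv> fo (mfun T)"

abbreviation munit_ar :: "('k, 'a) vmnd \<Rightarrow> 'k \<Rightarrow> 'k \<times> 'k \<times> 'a" where
  "munit_ar T a \<equiv> (a, mob T a, munit T a)"

abbreviation mmult_ar :: "('k, 'a) vmnd \<Rightarrow> 'k \<Rightarrow> 'k \<times> 'k \<times> 'a" where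
  "mmult_ar T a \<equiv> (mob T (mob T a), mob T a, mmult T a)"

locale vmonad =
  fixes V :: "('o, 'a, 'z) smc_scheme"
    and K :: "('k, 'o, 'a) vcat"
    and T :: "('k, 'a) vmnd"
  assumes mfun_vfunctor: "vfunctor V K K (mfun T)"
    and munit_vnat: "vnat V K K (vf_id V K) (mfun T) (munit T)"
    and mmult_vnat: "vnat V K K (vf_cmp V (mfun T) (mfun T)) (mfun T) (mmult T)"
    and mmult_assoc: "a \<in> vob K \<Longrightarrow>
       mmult_ar T a \<cdot>\<^bsub>und V K\<^esub> und_ar V (mfun T) (mmult_ar T a)
       = mmult_ar T a \<cdot>\<^bsub>und V K\<^esub> mmult_ar T (mob T a)"
    and mmult_munit_left: "a \<in> vob K \<Longrightarrow>
       mmult_ar T a \<cdot>\<^bsub>und V K\<^esub> munit_ar T (mob T a) = idn (und V K) (mob T a)"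
    and mmult_munit_right: "a \<in> vob K \<Longrightarrow>
       mmult_ar T a \<cdot>\<^bsub>und V K\<^esub> und_ar V (mfun T) (munit_ar T a) = idn (und V K) (mob T a)"

text \<open>
  The Eilenberg-Moore \<open>V\<close>-category. Objects are the algebras \<open>(a, h)\<close> with structure
  \<open>h : I \<rightarrow> K(T a, a)\<close>; the hom-object from \<open>(a, h)\<close> to \<open>(b, k)\<close> is the equalizer of
  \<open>K(a,b) \<rightarrow> K(T a,T b) \<rightarrow> K(T a,b)\<close> (using \<open>T\<close> and \<open>k\<close>) and \<open>K(a,b) \<rightarrow> K(T a,b)\<close> (using \<open>h\<close>).
\<close>

abbreviation alg_ar :: "('k, 'a) vmnd \<Rightarrow> 'k \<times> 'a \<Rightarrow> 'k \<times> 'k \<times> 'a" where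
  "alg_ar T x \<equiv> (mob T (fst x), fst x, snd x)"

definition is_EM_algebra ::
  "('o, 'a, 'z) smc_scheme \<Rightarrow> ('k, 'o, 'a) vcat \<Rightarrow> ('k, 'a) vmnd \<Rightarrow> 'k \<times> 'a \<Rightarrow> bool" where
  "is_EM_algebra V K T x \<longleftrightarrow> fst x \<in> vob K \<and> alg_ar T x \<in> ar (und V K) \<and>
     alg_ar T x \<cdot>\<^bsub>und V K\<^esub> munit_ar T (fst x) = idn (und V K) (fst x) \<and>
     alg_ar T x \<cdot>\<^bsub>und V K\<^esub> und_ar V (mfun T) (alg_ar T x)
       = alg_ar T x \<cdot>\<^bsub>und V K\<^esub> mmult_ar T (fst x)"

definition EM_hom ::
  "('o, 'a, 'z) smc_scheme \<Rightarrow> ('k, 'o, 'a) vcat \<Rightarrow> ('k, 'a) vmnd \<Rightarrow> 'k \<times> 'a \<Rightarrow> 'k \<times> 'a \<Rightarrow> 'a" where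
  "EM_hom V K T x y = (SOME e. is_equalizer V
     (vpost V K (mob T (fst x)) (alg_ar T y) \<cdot>\<^bsub>V\<^esub> fm (mfun T) (fst x) (fst y))
     (vpre V K (alg_ar T x) (fst y)) e)"

definition EM ::
  "('o, 'a, 'z) smc_scheme \<Rightarrow> ('k, 'o, 'a) vcat \<Rightarrow> ('k, 'a) vmnd \<Rightarrow> ('k \<times> 'a, 'o, 'a) vcat" where
  "EM V K T = \<lparr>vob = {x. is_EM_algebra V K T x},
     vhom = (\<lambda>x y. dm V (EM_hom V K T x y)),
     vid = (\<lambda>x. THE u. u \<in> hom V (unt V) (dm V (EM_hom V K T x x)) \<and>
       EM_hom V K T x x \<cdot>\<^bsub>V\<^esub> u = vid K (fst x)),
     vcmp = (\<lambda>x y z. THE u.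
       u \<in> hom V (dm V (EM_hom V K T y z) \<otimes>\<^bsub>V\<^esub> dm V (EM_hom V K T x y)) (dm V (EM_hom V K T x z)) \<and>
       EM_hom V K T x z \<cdot>\<^bsub>V\<^esub> u =
         vcmp K (fst x) (fst y) (fst z) \<cdot>\<^bsub>V\<^esub> (EM_hom V K T y z \<odot>\<^bsub>V\<^esub> EM_hom V K T x y))\<rparr>"

definition EM_forget ::
  "('o, 'a, 'z) smc_scheme \<Rightarrow> ('k, 'o, 'a) vcat \<Rightarrow> ('k, 'a) vmnd \<Rightarrow> ('k \<times> 'a, 'k, 'a) vfun" where
  "EM_forget V K T = \<lparr>fo = fst, fm = EM_hom V K T\<rparr>"


section \<open>Enriched equational theories\<close>

text \<open>
  The full subcategory \<open>A\<close> of arities is determined by its set of objects, which is \<open>vob \<Theta>\<close>, since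
  \<open>x : A\<^sup>o\<^sup>p \<rightarrow> \<Theta>\<close> is the identity on objects.
\<close>

definition equational_theory ::
  "('o, 'a, 'z) smc_scheme \<Rightarrow> ('k, 'o, 'a) vcat \<Rightarrow> ('k, 'o, 'a) vcat \<Rightarrow> ('k, 'k, 'a) vfun \<Rightarrow>
   bool" where
  "equational_theory V K \<Theta> x \<longleftrightarrow> vcategory V \<Theta> \<and> vob \<Theta> \<subseteq> vob K \<and>
     vfunctor V (vop V (vfull K (vob \<Theta>))) \<Theta> x \<and> (\<forall>a \<in> vob \<Theta>. fo x a = a)"

definition ary_equational_theory ::
  "'u rel \<Rightarrow> 'l rel \<Rightarrow> ('o, 'a, 'z) smc_scheme \<Rightarrow> ('k, 'o, 'a) vcat \<Rightarrow> ('k \<times> 'k \<times> 'a) set \<Rightarrow>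
   ('k, 'o, 'a) vcat \<Rightarrow> ('k, 'k, 'a) vfun \<Rightarrow> bool" where
  "ary_equational_theory \<kappa> lam V K M \<Theta> x \<longleftrightarrow> equational_theory V K \<Theta> x \<and> small \<kappa> (vob \<Theta>) \<and>
     (\<forall>a \<in> vob \<Theta>. v_generated_object \<kappa> lam V K M a) \<and>
     (\<forall>a. v_generated_object \<kappa> lam V K M a \<longrightarrow> (\<exists>b \<in> vob \<Theta>. isomorphic (und V K) a b))"

definition Alg ::
  "('o, 'a, 'z) smc_scheme \<Rightarrow> ('k, 'o, 'a) vcat \<Rightarrow> ('k, 'o, 'a) vcat \<Rightarrow> ('k, 'k, 'a) vfun \<Rightarrow>
   ('k \<times> ('k, 'o, 'a) vfun, 'o, 'a) vcat" where
  "Alg V K \<Theta> x = vpullback V K (vfun_cat V \<Theta> (self V)) (nerve V K (vob \<Theta>))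
     (vf_precompose V (vop V (vfull K (vob \<Theta>))) \<Theta> (self V) x)"

definition Alg_forget ::
  "('o, 'a, 'z) smc_scheme \<Rightarrow> ('k, 'o, 'a) vcat \<Rightarrow> ('k, 'o, 'a) vcat \<Rightarrow> ('k, 'k, 'a) vfun \<Rightarrow>
   ('k \<times> ('k, 'o, 'a) vfun, 'k, 'a) vfun" where
  "Alg_forget V K \<Theta> x = vpullback_fst V (nerve V K (vob \<Theta>))
     (vf_precompose V (vop V (vfull K (vob \<Theta>))) \<Theta> (self V) x)"


section \<open>Equivalence of concrete enriched categories\<close>

text \<open>\<open>(X, U)\<close> and \<open>(Y, W)\<close> are \<open>V\<close>-categories with \<open>V\<close>-functors to \<open>K\<close>. The equivalence and its
  quasi-inverse are required to commute strictly with \<open>U\<close> and \<open>W\<close>.\<close>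

definition concretely_equivalent ::
  "('o, 'a, 'z) smc_scheme \<Rightarrow> ('k, 'o, 'a) vcat \<Rightarrow>
   ('x, 'o, 'a) vcat \<Rightarrow> ('x, 'k, 'a) vfun \<Rightarrow> ('y, 'o, 'a) vcat \<Rightarrow> ('y, 'k, 'a) vfun \<Rightarrow> bool" where
  "concretely_equivalent V K X U Y W \<longleftrightarrow>
     vcategory V X \<and> vfunctor V X K U \<and> vcategory V Y \<and> vfunctor V Y K W \<and>
     (\<exists>F G. vfunctor V X Y F \<and> vfunctor V Y X G \<and>
        vf_eq X (vf_cmp V F W) U \<and> vf_eq Y (vf_cmp V G U) W \<and>
        vnat_isomorphic V X X (vf_id V X) (vf_cmp V F G) \<and>
        vnat_isomorphic V Y Y (vf_id V Y) (vf_cmp V G F))"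

end

theory Submission imports Defs begin

notation cmp (infixr "$\<index>" 65) and tensorm (infixr "**\<index>" 70) and tensor (infixr "@@\<index>" 75)

text \<open>
 The theory has the operations \<open>\<Theta>(a, b) = K(b, T a)\<close>, so it is the opposite of the full subcategory of free algebras
 on the arities. An Eilenberg-Moore algebra \<open>X\<close> acts by \<open>K(b, T a) \<otimes> K(a, X) \<rightarrow> K(b, X)\<close>. Conversely, every object is a
 directed colimit of arities along \<open>M\<close>-arrows, which \<open>T\<close> and \<open>K(b, -)\<close> preserve; hence arities are dense, the
 action of a \<open>\<Theta>\<close>-algebra on the arrows of a colimit cocone \<open>c i\<close> of \<open>X\<close> is composition with arrows \<open>T(c i) \<rightarrow> X\<close>, and
 these glue to a structure map \<open>T X \<rightarrow> X\<close>. The arities can be chosen to form a small set because the unit of \<open>V\<close> has a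
 rank, so that every generated object is a retract of the image of a colimit of boundedly many generators.
\<close>

section \<open>Small sets\<close>

text \<open>The classes \<open>M\<close> of K and \<open>MV\<close> of V are unrelated, so for a
  generated object \<open>G\<close> the functor K(G, -) need not send \<open>M\<close>-arrows to
  \<open>MV\<close>-arrows, and the hypothesis on the unit says nothing about the diagrams it
  produces. This forces the rank theorem: arrows from the unit into a sufficiently directed colimit
  of arbitrary arrows factor through a stage. Its proof replaces the diagram by a directed diagram
  of images, whose connecting arrows do lie in the right class. The unit need not generate V, so
  equations between arrows of V cannot be tested on elements. They are tested on jointly epic or
  jointly monic families coming from conical colimits; tensoring preserves jointly epic families
  because V is closed. The hom-objects in the definitions are chosen limits, while the hypotheses
  provide only colimits. Equalizers, pullbacks and ends in V are built from colimits and a small set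
  presenting all objects. Both categories of algebras are faithful over K, so a comparison of
  hom-objects over K is automatically functorial, and strict commutation with the forgetful functors
  costs nothing.\<close>

lemma card_order_inaccessible:
 assumes "inaccessible ka" shows "Card_order ka" "Cinfinite ka" "regularCard ka"
 using assms by (auto simp: inaccessible_def regular_cardinal_def)

lemma small_le: "|A| <=o |B| ==> small ka B ==> small ka A"
 unfolding small_def by (rule ordLeq_ordLess_trans)

lemma small_subset: "small ka B ==> A <= B ==> small ka A"
 by (rule small_le[OF card_of_mono1])

lemma small_image: "small ka A ==> small ka (f ` A)"
 by (rule small_le[OF card_of_image])

lemma small_inj: "inj_on f A ==> f ` A <= B ==> small ka B ==> small ka A"
 by (rule small_le) (auto simp: card_of_ordLeq[symmetric])

lemma small_embed:
 fixes ka :: "'u rel"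
 assumes "inaccessible ka" "small ka A"
 obtains fi :: "'a => 'u" where "inj_on fi A"
proof -
 have "|A| <=o |Field ka|"
  using assms card_of_Field_ordIso[OF card_order_inaccessible(1)[OF assms(1)]]
  by (meson ordIso_symmetric ordLess_imp_ordLeq ordLeq_ordIso_trans small_def)
 then show ?thesis using that by (auto simp: card_of_ordLeq[symmetric])
qed

lemma small_UN:
 assumes "inaccessible ka" "small ka A" "!!a. a : A ==> small ka (F a)"
 shows "small ka (UN a:A. F a)"
proof -
 have c: "Card_order ka" "regularCard ka" "\<not> finite (Field ka)"
  using card_order_inaccessible[OF assms(1)] by (auto simp: cinfinite_def)
 have "stable ka" using regularCard_stable[OF c(1) c(3) c(2)] .
 then show ?thesis using stable_UNION[of ka A F] assms(2,3) by (auto simp: small_def)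
qed

lemma small_finite:
 assumes "inaccessible ka" "finite A"
 shows "small ka A"
proof -
 have "|A| <o natLeq" using assms(2) finite_iff_ordLess_natLeq by blast
 moreover have "natLeq <o ka" using assms(1) by (simp add: inaccessible_def)
 ultimately show ?thesis unfolding small_def using ordLess_transitive by blast
qed

lemma small_Un:
 assumes "inaccessible ka" "small ka A" "small ka B"
 shows "small ka (A \<union> B)"
proof -
 have "small ka (UN b:{True, False}. if b then A else B)"
  by (rule small_UN[OF assms(1)]) (use assms in \<open>auto intro: small_finite\<close>)
 then show ?thesis by (simp add: Un_commute)
qed

lemma small_Sigma:
 assumes "inaccessible ka" "small ka A" "!!a. a : A ==> small ka (F a)"
 shows "small ka (Sigma A F)"
proof -
 have "Sigma A F = (UN a:A. Pair a ` F a)" by auto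
 moreover have "small ka (UN a:A. Pair a ` F a)"
  by (intro small_UN[OF assms(1,2)] small_image assms(3))
 ultimately show ?thesis by simp
qed

lemma small_Plus:
 assumes "inaccessible ka" "small ka A" "small ka B"
 shows "small ka (A <+> B)"
 unfolding Plus_def by (intro small_Un small_image assms)

text \<open>Inaccessibility speaks only of sets over the type that carries \<open>ka\<close>, so the
  set is first embedded there; the image map on its subsets is injective.\<close>

lemma small_Pow:
 fixes ka :: "'u rel"
 assumes "inaccessible ka" "small ka A"
 shows "small ka (Pow A)"
proof -
 obtain fi :: "'a => 'u" where fi: "inj_on fi A" using small_embed[OF assms] .
 have "small ka (fi ` A)" using assms(2) by (rule small_image)
 then have "small ka (Pow (fi ` A))" using assms(1) by (auto simp: inaccessible_def small_def)
 moreover have "inj_on (image fi) (Pow A)" using fi by (rule inj_on_image_Pow)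
 ultimately show ?thesis by (rule small_inj[rotated 2]) auto
qed

text \<open>Members of \<open>PiE A F\<close> are fixed outside \<open>A\<close>, hence determined
  by their graphs, which are subsets of the small set \<open>Sigma A F\<close>.\<close>

lemma small_PiE:
 assumes "inaccessible ka" "small ka A" "!!a. a : A ==> small ka (F a)"
 shows "small ka (PiE A F)"
proof -
 have "small ka (Pow (Sigma A F))" by (intro small_Pow small_Sigma assms)
 moreover have "inj_on (%f. {(a, f a) | a. a : A}) (PiE A F)"
 proof (rule inj_onI)
  fix f g assume f: "f : PiE A F" and g: "g : PiE A F"
  and eq: "{(a, f a) | a. a : A} = {(a, g a) | a. a : A}"
  show "f = g"
  proof (rule PiE_ext[OF f g])
  fix a assume "a : A"
  then have "(a, f a) : {(a, g a) | a. a : A}" unfolding eq[symmetric] by auto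
  then show "f a = g a" by auto
  qed
 qed
 ultimately show ?thesis by (rule small_inj[rotated 2]) auto
qed

lemma small_Field:
 assumes "Card_order r" "r <o ka"
 shows "small ka (Field r)"
 unfolding small_def using assms card_of_Field_ordIso ordIso_ordLess_trans by blast


section \<open>Ordinary categories\<close>

lemma hom_iff [simp]: "f : hom C a b \<longleftrightarrow> f : ar C & dm C f = a & cd C f = b"
 by (auto simp: hom_def)

context category
begin

lemmas [simp] = dm_ob cd_ob

lemma idn_simps [simp]:
 assumes "a : ob C"
 shows "idn C a : ar C" "dm C (idn C a) = a" "cd C (idn C a) = a"
 using idn_hom[OF assms] by auto

lemma cmp_simps [simp]:
 assumes "f : ar C" "g : ar C" "dm C g = cd C f"
 shows "g $ f : ar C" "dm C (g $ f) = dm C f" "cd C (g $ f) = cd C g"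
 using cmp_hom[of f "dm C f" "cd C f" g "cd C g"] assms by auto

lemma idl [simp]: "f : ar C ==> cd C f = b ==> idn C b $ f = f"
 using cmp_idn_left[of f "dm C f" b] by auto

lemma idr [simp]: "f : ar C ==> dm C f = a ==> f $ idn C a = f"
 using cmp_idn_right[of f a "cd C f"] by auto

lemma assoc [simp]:
 "f : ar C ==> g : ar C ==> h : ar C ==> dm C h = cd C g ==> dm C g = cd C f ==>
 (h $ g) $ f = h $ g $ f"
 using cmp_assoc[of f "dm C f" "cd C f" g "cd C g" h "cd C h"] by auto

text \<open>Turns an equation between composites into a rewrite rule for right-nested composites.\<close>

lemma extend:
 assumes "g $ f = k" "f : ar C" "g : ar C" "r : ar C" "dm C g = cd C f" "dm C f = cd C r"
 shows "g $ f $ r = k $ r"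
 using assms by (metis assoc)

lemma inverse_pair_unique:
 assumes "inverse_pair C f g" "inverse_pair C f h" shows "g = h"
proof -
 have "g = g $ (f $ h)" using assms by (simp add: inverse_pair_def)
 also have "... = (g $ f) $ h" using assms assoc[of h f g] by (simp add: inverse_pair_def)
 also have "... = h" using assms by (simp add: inverse_pair_def)
 finally show ?thesis .
qed

lemma cinv_eq: "inverse_pair C f g ==> cinv C f = g"
 unfolding cinv_def using inverse_pair_unique by blast

lemma inverse_pair_cinv: "is_iso C f ==> inverse_pair C f (cinv C f)"
 unfolding is_iso_def using cinv_eq by auto

lemma cinv_simps [simp]:
 assumes "is_iso C f"
 shows "f : ar C" "cinv C f : ar C" "dm C (cinv C f) = cd C f" "cd C (cinv C f) = dm C f"
  "cinv C f $ f = idn C (dm C f)" "f $ cinv C f = idn C (cd C f)"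
 using inverse_pair_cinv[OF assms] by (auto simp: inverse_pair_def)

lemma cinv_cancel_left [simp]:
 assumes "is_iso C f" "g : ar C" "cd C g = dm C f"
 shows "cinv C f $ f $ g = g"
 using assms by (subst assoc[symmetric], simp, simp, simp, simp, simp) (simp del: assoc)

lemma cinv_cancel_right [simp]:
 assumes "is_iso C f" "g : ar C" "cd C g = cd C f"
 shows "f $ cinv C f $ g = g"
 using assms by (subst assoc[symmetric], simp, simp, simp, simp, simp) (simp del: assoc)

lemma is_isoI:
 assumes "f : hom C a b" "g : hom C b a" "g $ f = idn C a" "f $ g = idn C b"
 shows "is_iso C f"
 unfolding is_iso_def inverse_pair_def by (rule exI[of _ g]) (use assms in simp)

lemma is_iso_idn [simp]: "a : ob C ==> is_iso C (idn C a)"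
 by (rule is_isoI[where g = "idn C a"]) auto

lemma is_iso_cmp [simp]:
 assumes "is_iso C f" "is_iso C g" "dm C g = cd C f"
 shows "is_iso C (g $ f)"
 by (rule is_isoI[where g = "cinv C f $ cinv C g"]) (use assms in auto)

lemma is_iso_cinv [simp]: "is_iso C f ==> is_iso C (cinv C f)"
 by (rule is_isoI[where g = f and a = "cd C f" and b = "dm C f"]) auto

lemma iso_epi:
 assumes "is_iso C f" "g $ f = h $ f" "g : ar C" "h : ar C" "dm C g = cd C f" "dm C h = cd C f"
 shows "g = h"
proof -
 have "(g $ f) $ cinv C f = (h $ f) $ cinv C f" by (simp only: assms(2))
 then show ?thesis using assms(1,3-6) by simp
qed

lemma iso_mono:
 assumes "is_iso C f" "f $ g = f $ h" "g : ar C" "h : ar C" "cd C g = dm C f" "cd C h = dm C f"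
 shows "g = h"
proof -
 have "cinv C f $ f $ g = cinv C f $ f $ h" using assms by simp
 then show ?thesis using assms(1,3-6) by simp
qed

end


subsection \<open>Colimits of graphs\<close>

text \<open>
 The diagram has vertices \<open>b z\<close> for \<open>z \<in> S\<close>, and an element \<open>(z, z', w)\<close> of \<open>R\<close> is an edge
 \<open>w : b z \<rightarrow> b z'\<close>.
\<close>

definition gdiagram ::
 "('o, 'a, 'z) cat_scheme => 's set => ('s => 'o) => ('s \<times> 's \<times> 'a) set => bool" where
 "gdiagram C S b R \<longleftrightarrow> (ALL z:S. b z : ob C) &
  (ALL (z, z', w):R. z : S & z' : S & w : hom C (b z) (b z'))"

definition gcocone ::
 "('o, 'a, 'z) cat_scheme => 's set => ('s => 'o) => ('s \<times> 's \<times> 'a) set => 'o => ('s => 'a) => bool"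
 where
 "gcocone C S b R x e \<longleftrightarrow> x : ob C & (ALL z:S. e z : hom C (b z) x) &
  (ALL (z, z', w):R. e z' $\<^bsub>C\<^esub> w = e z)"

definition gcolim ::
 "('o, 'a, 'z) cat_scheme => 's set => ('s => 'o) => ('s \<times> 's \<times> 'a) set => 'o => ('s => 'a) => bool"
 where
 "gcolim C S b R x e \<longleftrightarrow> gcocone C S b R x e &
  (ALL y d. gcocone C S b R y d --> (EX! u. u : hom C x y & (ALL z:S. u $\<^bsub>C\<^esub> e z = d z)))"

definition poset_edges :: "'i set => 'i rel => ('i, 'i \<times> 'i, 'o, 'a) ofun => ('i \<times> 'i \<times> 'a) set" where
 "poset_edges I le D = {(i, j, oa D (i, j)) | i j. i : I & j : I & (i, j) : le}"

lemma is_colim_poset_iff_gcolim: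
 assumes "cat_functor (poset_cat I le) C D"
 shows "is_colim C (poset_cat I le) D x c \<longleftrightarrow> gcolim C I (oo D) (poset_edges I le D) x c"
proof -
 have "is_cocone C (poset_cat I le) D y d \<longleftrightarrow> gcocone C I (oo D) (poset_edges I le D) y d" for y d
  by (auto simp: is_cocone_def gcocone_def poset_edges_def poset_cat_def)
 then show ?thesis using assms by (simp add: is_colim_def gcolim_def poset_cat_def)
qed

text \<open>A definition cannot quantify over index types, so only vertex sets over
  \<open>'u\<close> are tested; \<open>gcolim_exists\<close> recovers all small vertex sets by
  reindexing. Graphs as shapes keep the later constructions free of composition conditions.\<close>

definition graph_cocomplete :: "'u rel => ('o, 'a, 'z) cat_scheme => bool" where
 "graph_cocomplete ka C \<longleftrightarrow> (ALL (S :: 'u set) b R. small ka S & small ka R & gdiagram C S b R -->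
  (EX x e. gcolim C S b R x e))"

lemma gcolim_reindex:
 assumes fi: "inj_on fi S" and d: "gdiagram C S b R"
  and colim: "gcolim C (fi ` S) (b \<circ> inv_into S fi) ((%(z, z', w). (fi z, fi z', w)) ` R) x e"
 shows "gcolim C S b R x (e \<circ> fi)"
proof -
 let ?R = "(%(z, z', w). (fi z, fi z', w)) ` R" and ?b = "b \<circ> inv_into S fi"
 have inv: "inv_into S fi (fi z) = z" if "z : S" for z using fi that by simp
 have R: "z : S & z' : S" if "(z, z', w) : R" for z z' w
  using d that by (auto simp: gdiagram_def)
 have edges: "(ALL (z, z', w):?R. f z' $\<^bsub>C\<^esub> w = f z) \<longleftrightarrow> (ALL (z, z', w):R. f (fi z') $\<^bsub>C\<^esub> w = f (fi z))"
  for f :: "_ => _"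
  unfolding ball_simps by (intro ball_cong refl) (simp add: split_beta)
 have co: "gcocone C (fi ` S) ?b ?R y f \<longleftrightarrow> gcocone C S b R y (f \<circ> fi)" for y f
  unfolding gcocone_def edges by (simp add: inv)
 have co': "gcocone C (fi ` S) ?b ?R y (f \<circ> inv_into S fi)" if "gcocone C S b R y f" for y f
 proof -
  have "f z' $\<^bsub>C\<^esub> w = f z" if "(z, z', w) : R" for z z' w
  using \<open>gcocone C S b R y f\<close> that by (auto simp: gcocone_def)
  then have "(ALL (z, z', w):R. (f \<circ> inv_into S fi \<circ> fi) z' $\<^bsub>C\<^esub> w = (f \<circ> inv_into S fi \<circ> fi) z)"
  using R by (auto simp: inv)
  then show ?thesis using that unfolding co by (simp add: gcocone_def inv)
 qed
 have "EX! u. u : hom C x y & (ALL z:S. u $\<^bsub>C\<^esub> (e \<circ> fi) z = f z)" if "gcocone C S b R y f" for y f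
 proof -
  have "EX! u. u : hom C x y & (ALL z:fi ` S. u $\<^bsub>C\<^esub> e z = (f \<circ> inv_into S fi) z)"
  using colim co'[OF that] unfolding gcolim_def by blast
  then show ?thesis by (simp add: inv)
 qed
 moreover have "gcocone C S b R x (e \<circ> fi)" using colim unfolding gcolim_def co by blast
 ultimately show ?thesis unfolding gcolim_def by blast
qed

lemma gcolim_exists:
 fixes ka :: "'u rel"
 assumes "inaccessible ka" "graph_cocomplete ka C" "small ka S" "small ka R" "gdiagram C S b R"
 obtains x e where "gcolim C S b R x e"
proof -
 obtain fi :: "_ => 'u" where fi: "inj_on fi S" using small_embed[OF assms(1,3)] .
 let ?R = "(%(z, z', w). (fi z, fi z', w)) ` R"
 have "gdiagram C (fi ` S) (b \<circ> inv_into S fi) ?R"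
  using assms(5) fi unfolding gdiagram_def by fastforce
 moreover have "small ka (fi ` S)" "small ka ?R" by (intro small_image assms)+
 ultimately obtain x e where "gcolim C (fi ` S) (b \<circ> inv_into S fi) ?R x e"
  using assms(2) unfolding graph_cocomplete_def by blast
 from that[OF gcolim_reindex[OF fi assms(5) this]] show ?thesis .
qed

lemma gcolim_cocone: "gcolim C S b R x e ==> gcocone C S b R x e"
 by (simp add: gcolim_def)

lemma gcolim_arr:
 assumes "gcolim C S b R x e"
 shows "x : ob C" "z : S ==> e z : ar C" "z : S ==> dm C (e z) = b z" "z : S ==> cd C (e z) = x"
  "(z, z', w) : R ==> e z' $\<^bsub>C\<^esub> w = e z"
 using gcolim_cocone[OF assms] by (auto simp: gcocone_def)

lemma gcolim_induced:
 assumes "gcolim C S b R x e" "gcocone C S b R y d"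
 obtains u where "u : hom C x y" "!!z. z : S ==> u $\<^bsub>C\<^esub> e z = d z"
 using assms unfolding gcolim_def by metis

lemma (in category) gcolim_ext:
 assumes "gcolim C S b R x e" "gdiagram C S b R" "u : ar C" "v : ar C" "dm C u = x" "dm C v = x"
  "cd C v = cd C u" "!!z. z : S ==> u $ e z = v $ e z"
 shows "u = v"
proof -
 note [simp] = gcolim_arr[OF assms(1)]
 have "u $ e z' $ w = u $ e z" if "(z, z', w) : R" for z z' w
  using that by simp
 then have "gcocone C S b R (cd C u) (%z. u $ e z)"
  using assms(2,3,5) unfolding gcocone_def gdiagram_def by fastforce
 then have "EX! w. w : hom C x (cd C u) & (ALL z:S. w $ e z = u $ e z)"
  using assms(1) unfolding gcolim_def by blast
 moreover have "u : hom C x (cd C u) & (ALL z:S. u $ e z = u $ e z)"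
  "v : hom C x (cd C u) & (ALL z:S. v $ e z = u $ e z)"
  using assms(3-8) by auto
 ultimately show ?thesis by blast
qed

section \<open>Symmetric monoidal closed categories\<close>

context symmetric_monoidal_closed
begin

lemmas [simp] = tensor_ob unt_ob ass_iso lun_iso run_iso ihom_ob tensorm_idn swp_swp

lemma tensorm_simps [simp]:
 assumes "f : ar V" "g : ar V"
 shows "f ** g : ar V" "dm V (f ** g) = dm V f @@ dm V g" "cd V (f ** g) = cd V f @@ cd V g"
 using tensorm_hom[of f "dm V f" "cd V f" g "dm V g" "cd V g"] assms by auto

lemma ass_simps [simp]:
 assumes "a : ob V" "b : ob V" "c : ob V"
 shows "dm V (ass V a b c) = (a @@ b) @@ c" "cd V (ass V a b c) = a @@ (b @@ c)"
 using ass_hom[OF assms] by auto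

lemma unitor_simps [simp]:
 assumes "a : ob V"
 shows "dm V (lun V a) = unt V @@ a" "cd V (lun V a) = a" "dm V (run V a) = a @@ unt V" "cd V (run V a) = a"
 using lun_hom[OF assms] run_hom[OF assms] by auto

lemma swp_ev_simps [simp]:
 assumes "a : ob V" "b : ob V"
 shows "swp V a b : ar V" "dm V (swp V a b) = a @@ b" "cd V (swp V a b) = b @@ a"
  "ev V a b : ar V" "dm V (ev V a b) = ihom V a b @@ a" "cd V (ev V a b) = b"
 using swp_hom[OF assms] ev_hom[OF assms] by auto

lemma swp_iso [simp]: "a : ob V ==> b : ob V ==> is_iso V (swp V a b)"
 by (rule is_isoI[where g = "swp V b a"]) auto

lemma interchange [simp]:
 assumes "f : ar V" "g : ar V" "f' : ar V" "g' : ar V" "dm V f' = cd V f" "dm V g' = cd V g"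
 shows "(f' ** g') $ (f ** g) = (f' $ f) ** (g' $ g)"
 using tensorm_cmp[of f "dm V f" "cd V f" f' "cd V f'" g "dm V g" "cd V g" g' "cd V g'"] assms by simp

lemma interchange' [simp]:
 assumes "f : ar V" "g : ar V" "f' : ar V" "g' : ar V" "dm V f' = cd V f" "dm V g' = cd V g"
  "r : ar V" "cd V r = dm V f @@ dm V g"
 shows "(f' ** g') $ (f ** g) $ r = ((f' $ f) ** (g' $ g)) $ r"
 by (rule extend) (use assms in simp_all)

lemma is_iso_tensorm [simp]:
 assumes "is_iso V f" "is_iso V g" shows "is_iso V (f ** g)"
 by (rule is_isoI[where g = "cinv V f ** cinv V g"]) (use assms in simp_all)

lemma ass_nat:
 assumes "f : ar V" "g : ar V" "h : ar V" "cd V f = a" "cd V g = b" "cd V h = c"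
 shows "ass V a b c $ ((f ** g) ** h) = (f ** (g ** h)) $ ass V (dm V f) (dm V g) (dm V h)"
 using ass_natural[of f "dm V f" a g "dm V g" b h "dm V h" c] assms by simp

lemma lun_nat:
 assumes "f : ar V" "cd V f = b"
 shows "lun V b $ (idn V (unt V) ** f) = f $ lun V (dm V f)"
 using lun_natural[of f "dm V f" b] assms by simp

lemma run_nat:
 assumes "f : ar V" "cd V f = b"
 shows "run V b $ (f ** idn V (unt V)) = f $ run V (dm V f)"
 using run_natural[of f "dm V f" b] assms by simp

lemma swp_nat:
 assumes "f : ar V" "g : ar V" "cd V f = a" "cd V g = b"
 shows "swp V a b $ (f ** g) = (g ** f) $ swp V (dm V f) (dm V g)"
 using swp_natural[of f "dm V f" a g "dm V g" b] assms by simp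

lemmas ass_nat' = extend[OF ass_nat] and lun_nat' = extend[OF lun_nat]
 and run_nat' = extend[OF run_nat] and swp_nat' = extend[OF swp_nat]

lemma swp_swp' [simp]:
 "a : ob V ==> b : ob V ==> r : ar V ==> cd V r = a @@ b ==> swp V b a $ swp V a b $ r = r"
 by (subst extend[OF swp_swp]) auto

text \<open>Naturality of the isomorphism \<open>lun\<close> identifies tensoring with the unit with
  the identity functor.\<close>

lemma unt_tensor_faithful:
 assumes "idn V (unt V) ** f = idn V (unt V) ** g" "f : ar V" "g : ar V" "dm V f = dm V g" "cd V f = cd V g"
 shows "f = g"
proof (rule iso_epi[of "lun V (dm V g)"])
 show "f $ lun V (dm V g) = g $ lun V (dm V g)"
  using lun_nat[of f "cd V g"] lun_nat[of g "cd V g"] assms by simp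
qed (use assms in simp_all)

lemma tensor_unt_faithful:
 assumes "f ** idn V (unt V) = g ** idn V (unt V)" "f : ar V" "g : ar V" "dm V f = dm V g" "cd V f = cd V g"
 shows "f = g"
proof (rule iso_epi[of "run V (dm V g)"])
 show "f $ run V (dm V g) = g $ run V (dm V g)"
  using run_nat[of f "cd V g"] run_nat[of g "cd V g"] assms by simp
qed (use assms in simp_all)

text \<open>Kelly's derivation of the remaining unit laws from the pentagon and the triangle.\<close>

lemma lun_ass:
 assumes "a : ob V" "b : ob V"
 shows "lun V (a @@ b) $ ass V (unt V) a b = lun V a ** idn V b"
proof (rule unt_tensor_faithful)
 let ?I = "unt V" and ?i = "idn V (unt V)"
 \<comment> \<open>An isomorphism along one leg of the pentagon for I, I, \<open>a\<close>,
   \<open>b\<close>; cancelling it reduces the claim to the triangle.\<close>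
 let ?k = "ass V ?I (?I @@ a) b $ (ass V ?I ?I a ** idn V b)"
 show "?i ** (lun V (a @@ b) $ ass V ?I a b) = ?i ** (lun V a ** idn V b)"
 proof (rule iso_epi[of ?k])
  have "(?i ** (lun V (a @@ b) $ ass V ?I a b)) $ ?k
  = (?i ** lun V (a @@ b)) $ (?i ** ass V ?I a b) $ ?k"
  using assms by simp
  also have "... = (?i ** lun V (a @@ b)) $ ass V ?I ?I (a @@ b) $ ass V (?I @@ ?I) a b"
  using pentagon[of ?I ?I a b] assms by simp
  also have "... = (run V ?I ** idn V (a @@ b)) $ ass V (?I @@ ?I) a b"
  by (rule extend[OF triangle]) (use assms in simp_all)
  also have "... = (run V ?I ** (idn V a ** idn V b)) $ ass V (?I @@ ?I) a b"
  using assms by simp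
  also have "... = ass V ?I a b $ ((run V ?I ** idn V a) ** idn V b)"
  using assms by (subst ass_nat) (simp_all del: tensorm_idn)
  also have "... = ass V ?I a b $ (((?i ** lun V a) $ ass V ?I ?I a) ** idn V b)"
  using assms by (simp add: triangle)
  also have "... = ass V ?I a b $ ((?i ** lun V a) ** idn V b) $ (ass V ?I ?I a ** idn V b)"
  using assms by simp
  also have "... = (?i ** (lun V a ** idn V b)) $ ?k"
  using assms by (subst ass_nat') simp_all
  finally show "(?i ** (lun V (a @@ b) $ ass V ?I a b)) $ ?k = (?i ** (lun V a ** idn V b)) $ ?k" .
 qed (use assms in simp_all)
qed (use assms in simp_all)

lemma run_ass:
 assumes "a : ob V" "b : ob V"
 shows "(idn V a ** run V b) $ ass V a b (unt V) = run V (a @@ b)"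
proof (rule tensor_unt_faithful)
 let ?I = "unt V" and ?i = "idn V (unt V)"
 show "((idn V a ** run V b) $ ass V a b ?I) ** ?i = run V (a @@ b) ** ?i"
 proof (rule iso_mono[of "ass V a b ?I"])
  have "ass V a b ?I $ (((idn V a ** run V b) $ ass V a b ?I) ** ?i)
  = ass V a b ?I $ ((idn V a ** run V b) ** ?i) $ (ass V a b ?I ** ?i)"
  using assms by simp
  also have "... = (idn V a ** (run V b ** ?i)) $ ass V a (b @@ ?I) ?I $ (ass V a b ?I ** ?i)"
  using assms by (subst ass_nat') simp_all
  also have "... = (idn V a ** ((idn V b ** lun V ?I) $ ass V b ?I ?I)) $ ass V a (b @@ ?I) ?I $ (ass V a b ?I ** ?i)"
  using assms by (simp add: triangle)
  also have "... = (idn V a ** (idn V b ** lun V ?I)) $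
  ((idn V a ** ass V b ?I ?I) $ ass V a (b @@ ?I) ?I $ (ass V a b ?I ** ?i))"
  using assms by simp
  also have "... = (idn V a ** (idn V b ** lun V ?I)) $ ass V a b (?I @@ ?I) $ ass V (a @@ b) ?I ?I"
  by (simp only: pentagon[OF assms unt_ob unt_ob])
  also have "... = ass V a b ?I $ ((idn V a ** idn V b) ** lun V ?I) $ ass V (a @@ b) ?I ?I"
  using assms by (subst ass_nat') (simp_all del: tensorm_idn)
  also have "... = ass V a b ?I $ (idn V (a @@ b) ** lun V ?I) $ ass V (a @@ b) ?I ?I"
  using assms by simp
  also have "... = ass V a b ?I $ (run V (a @@ b) ** ?i)"
  using assms by (simp add: triangle)
  finally show "ass V a b ?I $ (((idn V a ** run V b) $ ass V a b ?I) ** ?i)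
  = ass V a b ?I $ (run V (a @@ b) ** ?i)" .
 qed (use assms in simp_all)
qed (use assms in simp_all)

lemma run_unt: "run V (unt V) = lun V (unt V)"
proof (rule tensor_unt_faithful)
 let ?I = "unt V" and ?i = "idn V (unt V)"
 \<comment> \<open>\<open>lun\<close> is monic, so its naturality square at \<open>lun V ?I\<close>
   itself forces this equation.\<close>
 have "lun V (?I @@ ?I) = ?i ** lun V ?I"
  by (rule iso_mono[of "lun V ?I"]) (use lun_nat[of "lun V ?I" ?I] in simp_all)
 then show "run V ?I ** ?i = lun V ?I ** ?i"
  using lun_ass[of ?I ?I] triangle[of ?I ?I] by simp
qed simp_all

text \<open>Both sides are compared after tensoring with the unit and composing with the symmetry;
  the hexagon for \<open>a\<close>, I, I and the unit laws already proved then turn one into the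
  other.\<close>

lemma lun_swp:
 assumes "a : ob V"
 shows "lun V a $ swp V a (unt V) = run V a"
proof (rule tensor_unt_faithful)
 let ?I = "unt V" and ?i = "idn V (unt V)"
 show "(lun V a $ swp V a ?I) ** ?i = run V a ** ?i"
 proof (rule iso_mono[of "swp V a ?I"])
  have "swp V a ?I $ (run V a ** ?i) = swp V a ?I $ (idn V a ** lun V ?I) $ ass V a ?I ?I"
  using assms by (simp add: triangle)
  also have "... = (lun V ?I ** idn V a) $ swp V a (?I @@ ?I) $ ass V a ?I ?I"
  using assms by (subst swp_nat') simp_all
  also have "... = lun V (?I @@ a) $ ass V ?I ?I a $ swp V a (?I @@ ?I) $ ass V a ?I ?I"
  by (rule extend[OF lun_ass, symmetric]) (use assms in simp_all)
  also have "... = lun V (?I @@ a) $ (?i ** swp V a ?I) $ ass V ?I a ?I $ (swp V a ?I ** ?i)"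
  using assms by (simp add: hexagon)
  also have "... = swp V a ?I $ lun V (a @@ ?I) $ ass V ?I a ?I $ (swp V a ?I ** ?i)"
  using assms by (subst lun_nat') simp_all
  also have "... = swp V a ?I $ (lun V a ** ?i) $ (swp V a ?I ** ?i)"
  using assms by (subst extend[OF lun_ass]) simp_all
  also have "... = swp V a ?I $ ((lun V a $ swp V a ?I) ** ?i)"
  using assms by simp
  finally show "swp V a ?I $ ((lun V a $ swp V a ?I) ** ?i) = swp V a ?I $ (run V a ** ?i)" by simp
 qed (use assms in simp_all)
qed (use assms in simp_all)

lemma run_swp:
 assumes "a : ob V"
 shows "run V a $ swp V (unt V) a = lun V a"
 using assms by (simp add: lun_swp[symmetric])


subsection \<open>Transposition\<close>

lemma curry_hom_ev:
 assumes "a : ob V" "b : ob V" "c : ob V" "f : ar V" "dm V f = a @@ b" "cd V f = c"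
 shows "curry_ar V a b c f : hom V a (ihom V b c)"
  and "ev V b c $ (curry_ar V a b c f ** idn V b) = f"
 using theI'[OF ev_universal[OF assms(1-3), of f]] assms unfolding curry_ar_def by auto

lemma curry_simps [simp]:
 assumes "a : ob V" "b : ob V" "c : ob V" "f : ar V" "dm V f = a @@ b" "cd V f = c"
 shows "curry_ar V a b c f : ar V" "dm V (curry_ar V a b c f) = a" "cd V (curry_ar V a b c f) = ihom V b c"
 using curry_hom_ev(1)[OF assms] by auto

lemma ev_curry_cmp [simp]:
 assumes "a : ob V" "b : ob V" "c : ob V" "f : ar V" "dm V f = a @@ b" "cd V f = c"
  "p : ar V" "cd V p = a" "g : ar V" "cd V g = b"
 shows "ev V b c $ ((curry_ar V a b c f $ p) ** g) = f $ (p ** g)"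
proof -
 have "(curry_ar V a b c f $ p) ** g = (curry_ar V a b c f ** idn V b) $ (p ** g)" using assms by simp
 then show ?thesis using extend[OF curry_hom_ev(2)[OF assms(1-6)], of "p ** g"] assms by simp
qed

lemma ev_curry [simp]:
 assumes "a : ob V" "b : ob V" "c : ob V" "f : ar V" "dm V f = a @@ b" "cd V f = c"
  "g : ar V" "cd V g = b"
 shows "ev V b c $ (curry_ar V a b c f ** g) = f $ (idn V a ** g)"
 using ev_curry_cmp[OF assms(1-6), of "idn V a" g] assms by simp

lemma ev_curry_cmp' [simp]:
 assumes "a : ob V" "b : ob V" "c : ob V" "f : ar V" "dm V f = a @@ b" "cd V f = c"
  "p : ar V" "cd V p = a" "g : ar V" "cd V g = b" "r : ar V" "cd V r = dm V p @@ dm V g"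
 shows "ev V b c $ ((curry_ar V a b c f $ p) ** g) $ r = f $ (p ** g) $ r"
 using assms by (subst extend[OF ev_curry_cmp]) simp_all

lemma ev_curry' [simp]:
 assumes "a : ob V" "b : ob V" "c : ob V" "f : ar V" "dm V f = a @@ b" "cd V f = c"
  "g : ar V" "cd V g = b" "r : ar V" "cd V r = a @@ dm V g"
 shows "ev V b c $ (curry_ar V a b c f ** g) $ r = f $ (idn V a ** g) $ r"
 using assms by (subst extend[OF ev_curry]) simp_all

lemma ev_ext:
 assumes "ev V b c $ (f ** idn V b) = ev V b c $ (g ** idn V b)" "f : hom V a (ihom V b c)"
  "g : hom V a (ihom V b c)" "b : ob V" "c : ob V"
 shows "f = g"
proof -
 have "a : ob V" using assms(2) by auto
 moreover have "ev V b c $ (g ** idn V b) : hom V (a @@ b) c" using assms by simp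
 ultimately have "EX! h. h : hom V a (ihom V b c) & ev V b c $ (h ** idn V b) = ev V b c $ (g ** idn V b)"
  using assms(4,5) by (intro ev_universal)
 then show ?thesis using assms(1-3) by blast
qed

lemma curry_eqI:
 assumes "a : ob V" "b : ob V" "c : ob V" "g : hom V a (ihom V b c)" "ev V b c $ (g ** idn V b) = f"
 shows "curry_ar V a b c f = g"
proof (rule ev_ext[of b c _ _ a])
 have f: "f : hom V (a @@ b) c" using assms(1-4) by (simp add: assms(5)[symmetric])
 show "ev V b c $ (curry_ar V a b c f ** idn V b) = ev V b c $ (g ** idn V b)"
  unfolding assms(5) using f assms(1-3) by simp
 show "curry_ar V a b c f : hom V a (ihom V b c)" using f assms(1-3) by simp
qed (use assms in simp_all)

end

section \<open>Enriched categories\<close>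

lemma und_simps [simp]:
 "ob (und V K) = vob K" "dm (und V K) (a, b, f) = a" "cd (und V K) (a, b, f) = b"
 "idn (und V K) a = (a, a, vid K a)"
 "(a, b, f) : ar (und V K) \<longleftrightarrow> a : vob K & b : vob K & f : ar V & dm V f = unt V & cd V f = vhom K a b"
 by (auto simp: und_def)

locale enriched = symmetric_monoidal_closed V + vcategory V K
 for V :: "('o, 'a, 'z) smc_scheme" (structure) and K :: "('k, 'o, 'a) vcat"
begin

lemmas [simp] = vhom_ob

lemma vid_simps [simp]:
 assumes "a : vob K"
 shows "vid K a : ar V" "dm V (vid K a) = unt V" "cd V (vid K a) = vhom K a a"
 using vid_hom[OF assms] by auto

lemma vcmp_simps [simp]:
 assumes "a : vob K" "b : vob K" "c : vob K"
 shows "vcmp K a b c : ar V" "dm V (vcmp K a b c) = vhom K b c @@ vhom K a b" "cd V (vcmp K a b c) = vhom K a c"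
 using vcmp_hom[OF assms] by auto

lemma vid_left:
 assumes "a : vob K" "b : vob K" "f : ar V" "cd V f = vhom K a b"
 shows "vcmp K a b b $ (vid K b ** f) = f $ lun V (dm V f)"
proof -
 have "vcmp K a b b $ (vid K b ** f) = vcmp K a b b $ (vid K b ** idn V (vhom K a b)) $ (idn V (unt V) ** f)"
  using assms by simp
 also have "... = lun V (vhom K a b) $ (idn V (unt V) ** f)"
  by (rule extend[OF vcmp_vid_left]) (use assms in simp_all)
 finally show ?thesis using assms by (simp add: lun_nat)
qed

lemma vid_right:
 assumes "a : vob K" "b : vob K" "f : ar V" "cd V f = vhom K a b"
 shows "vcmp K a a b $ (f ** vid K a) = f $ run V (dm V f)"
proof -
 have "vcmp K a a b $ (f ** vid K a) = vcmp K a a b $ (idn V (vhom K a b) ** vid K a) $ (f ** idn V (unt V))"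
  using assms by simp
 also have "... = run V (vhom K a b) $ (f ** idn V (unt V))"
  by (rule extend[OF vcmp_vid_right]) (use assms in simp_all)
 finally show ?thesis using assms by (simp add: run_nat)
qed

lemma vassoc:
 assumes "a : vob K" "b : vob K" "c : vob K" "d : vob K" "f : ar V" "g : ar V" "h : ar V"
  "cd V f = vhom K a b" "cd V g = vhom K b c" "cd V h = vhom K c d"
 shows "vcmp K a b d $ ((vcmp K b c d $ (h ** g)) ** f)
  = vcmp K a c d $ (h ** (vcmp K a b c $ (g ** f))) $ ass V (dm V h) (dm V g) (dm V f)"
proof -
 have "vcmp K a b d $ ((vcmp K b c d $ (h ** g)) ** f)
  = (vcmp K a b d $ (vcmp K b c d ** idn V (vhom K a b))) $ ((h ** g) ** f)"
  using assms by simp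
 also have "... = vcmp K a c d $ (idn V (vhom K c d) ** vcmp K a b c)
  $ ass V (vhom K c d) (vhom K b c) (vhom K a b) $ ((h ** g) ** f)"
  using assms by (simp only: vcmp_assoc) simp
 also have "... = vcmp K a c d $ (idn V (vhom K c d) ** vcmp K a b c)
  $ (h ** (g ** f)) $ ass V (dm V h) (dm V g) (dm V f)"
  using assms by (simp add: ass_nat)
 finally show ?thesis using assms by simp
qed


subsection \<open>Composition with an arrow of the underlying category\<close>

lemma vpost_simps [simp]:
 assumes "x : vob K" "(y, z, g) : ar (und V K)"
 shows "vpost V K x (y, z, g) : ar V" "dm V (vpost V K x (y, z, g)) = vhom K x y"
  "cd V (vpost V K x (y, z, g)) = vhom K x z"
 using assms by (simp_all add: vpost_def)

lemma vpre_simps [simp]: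
 assumes "y : vob K" "(w, x, f) : ar (und V K)"
 shows "vpre V K (w, x, f) y : ar V" "dm V (vpre V K (w, x, f) y) = vhom K x y"
  "cd V (vpre V K (w, x, f) y) = vhom K w y"
 using assms by (simp_all add: vpre_def)

text \<open>\<open>vpost\<close> contains an inverse unitor. Composed with the unitor it becomes
  plain composition; equations are proved in that form and the unitor is cancelled by
  \<open>iso_epi\<close>.\<close>

lemma vpost_lun:
 assumes "x : vob K" "(y, z, g) : ar (und V K)" "f : ar V" "cd V f = vhom K x y"
 shows "vpost V K x (y, z, g) $ f $ lun V (dm V f) = vcmp K x y z $ (g ** f)"
proof -
 have "f $ lun V (dm V f) = lun V (vhom K x y) $ (idn V (unt V) ** f)"
  using assms by (simp add: lun_nat)
 then show ?thesis using assms by (simp add: vpost_def)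
qed

lemma vpre_run:
 assumes "y : vob K" "(w, x, f) : ar (und V K)" "g : ar V" "cd V g = vhom K x y"
 shows "vpre V K (w, x, f) y $ g $ run V (dm V g) = vcmp K w x y $ (g ** f)"
proof -
 have "g $ run V (dm V g) = run V (vhom K x y) $ (g ** idn V (unt V))"
  using assms by (simp add: run_nat)
 then show ?thesis using assms by (simp add: vpre_def)
qed

lemma vpost_lun1:
 assumes "x : vob K" "(y, z, g) : ar (und V K)"
 shows "vpost V K x (y, z, g) $ lun V (vhom K x y) = vcmp K x y z $ (g ** idn V (vhom K x y))"
 using vpost_lun[OF assms, of "idn V (vhom K x y)"] assms by simp

lemma vpre_run1:
 assumes "y : vob K" "(w, x, f) : ar (und V K)"
 shows "vpre V K (w, x, f) y $ run V (vhom K x y) = vcmp K w x y $ (idn V (vhom K x y) ** f)"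
 using vpre_run[OF assms, of "idn V (vhom K x y)"] assms by simp

lemma vpost_eqI:
 assumes "x : vob K" "(y, z, g) : ar (und V K)" "f : ar V" "cd V f = vhom K x y"
  "h : hom V (dm V f) (vhom K x z)" "vcmp K x y z $ (g ** f) = h $ lun V (dm V f)"
 shows "vpost V K x (y, z, g) $ f = h"
 by (rule iso_epi[of "lun V (dm V f)"]) (use assms vpost_lun[OF assms(1-4)] in simp_all)

lemma vpre_eqI:
 assumes "y : vob K" "(w, x, f) : ar (und V K)" "g : ar V" "cd V g = vhom K x y"
  "h : hom V (dm V g) (vhom K w y)" "vcmp K w x y $ (g ** f) = h $ run V (dm V g)"
 shows "vpre V K (w, x, f) y $ g = h"
 by (rule iso_epi[of "run V (dm V g)"]) (use assms vpre_run[OF assms(1-4)] in simp_all)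

text \<open>On an element of a hom-object both sides are the same composite in K. The left unitor of
  one and the right unitor of the other agree at the unit by \<open>run_unt\<close>.\<close>

lemma vpre_elt:
 assumes "(x, y, f) : ar (und V K)" "(y, z, g) : ar (und V K)"
 shows "vpre V K (x, y, f) z $ g = vpost V K x (y, z, g) $ f"
 by (rule vpre_eqI) (use assms vpost_lun[of x y z g f] in \<open>simp_all add: run_unt\<close>)

lemma und_cmp [simp]:
 assumes "(x, y, f) : ar (und V K)" "(y, z, g) : ar (und V K)"
 shows "(y, z, g) $\<^bsub>und V K\<^esub> (x, y, f) = (x, z, vpost V K x (y, z, g) $ f)"
proof -
 have "vpost V K x (y, z, g) $ f = vcmp K x y z $ (g ** f) $ cinv V (lun V (unt V))"
  by (rule vpost_eqI) (use assms in simp_all)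
 then show ?thesis by (simp add: und_def)
qed

text \<open>This lemma and the next two are associativity of composition with an underlying arrow at
  the left end, at the right end and in the middle. The unit law for the associator behind them is
  \<open>lun_ass\<close>, \<open>run_ass\<close> and \<open>triangle\<close>, respectively.\<close>

lemma vpost_vcmp:
 assumes "(c, d, g) : ar (und V K)" "a : vob K" "b : vob K" "p : ar V" "q : ar V"
  "cd V p = vhom K b c" "cd V q = vhom K a b"
 shows "vpost V K a (c, d, g) $ vcmp K a b c $ (p ** q) = vcmp K a b d $ ((vpost V K b (c, d, g) $ p) ** q)"
proof (rule vpost_eqI)
 let ?P = "dm V p" and ?Q = "dm V q"
 show "vcmp K a c d $ (g ** (vcmp K a b c $ (p ** q)))
  = (vcmp K a b d $ ((vpost V K b (c, d, g) $ p) ** q)) $ lun V (dm V (vcmp K a b c $ (p ** q)))"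
 proof (rule iso_epi[of "ass V (unt V) ?P ?Q"])
  have "(vcmp K a c d $ (g ** (vcmp K a b c $ (p ** q)))) $ ass V (unt V) ?P ?Q
  = vcmp K a b d $ ((vcmp K b c d $ (g ** p)) ** q)"
  using assms by (simp add: vassoc)
  also have "... = vcmp K a b d $ ((vpost V K b (c, d, g) $ p $ lun V ?P) ** q)"
  using assms by (subst vpost_lun) simp_all
  also have "... = (vcmp K a b d $ ((vpost V K b (c, d, g) $ p) ** q)) $ (lun V ?P ** idn V ?Q)"
  using assms by simp
  also have "... = (vcmp K a b d $ ((vpost V K b (c, d, g) $ p) ** q)) $ lun V (?P @@ ?Q) $ ass V (unt V) ?P ?Q"
  using assms by (subst lun_ass) simp_all
  finally show "(vcmp K a c d $ (g ** (vcmp K a b c $ (p ** q)))) $ ass V (unt V) ?P ?Q =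
  ((vcmp K a b d $ ((vpost V K b (c, d, g) $ p) ** q)) $ lun V (dm V (vcmp K a b c $ (p ** q)))) $ ass V (unt V) ?P ?Q"
  using assms by simp
 qed (use assms in simp_all)
qed (use assms in simp_all)

lemma vpre_vcmp:
 assumes "(a', a, f) : ar (und V K)" "b : vob K" "c : vob K" "p : ar V" "q : ar V"
  "cd V p = vhom K b c" "cd V q = vhom K a b"
 shows "vpre V K (a', a, f) c $ vcmp K a b c $ (p ** q) = vcmp K a' b c $ (p ** (vpre V K (a', a, f) b $ q))"
proof (rule vpre_eqI)
 let ?P = "dm V p" and ?Q = "dm V q"
 have "vcmp K a' a c $ ((vcmp K a b c $ (p ** q)) ** f)
  = vcmp K a' b c $ (p ** (vcmp K a' a b $ (q ** f))) $ ass V ?P ?Q (unt V)"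
  using assms by (simp add: vassoc)
 also have "... = vcmp K a' b c $ (p ** (vpre V K (a', a, f) b $ q $ run V ?Q)) $ ass V ?P ?Q (unt V)"
  using assms by (subst vpre_run) simp_all
 also have "... = (vcmp K a' b c $ (p ** (vpre V K (a', a, f) b $ q))) $ (idn V ?P ** run V ?Q) $ ass V ?P ?Q (unt V)"
  using assms by simp
 also have "... = (vcmp K a' b c $ (p ** (vpre V K (a', a, f) b $ q))) $ run V (?P @@ ?Q)"
  using assms by (subst run_ass) simp_all
 finally show "vcmp K a' a c $ ((vcmp K a b c $ (p ** q)) ** f)
  = (vcmp K a' b c $ (p ** (vpre V K (a', a, f) b $ q))) $ run V (dm V (vcmp K a b c $ (p ** q)))"
  using assms by simp
qed (use assms in simp_all)

lemma vpre_vpost_vcmp: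
 assumes "(b, b', f) : ar (und V K)" "a : vob K" "c : vob K" "p : ar V" "q : ar V"
  "cd V p = vhom K b' c" "cd V q = vhom K a b"
 shows "vcmp K a b c $ ((vpre V K (b, b', f) c $ p) ** q) = vcmp K a b' c $ (p ** (vpost V K a (b, b', f) $ q))"
proof (rule iso_epi[of "run V (dm V p) ** idn V (dm V q)"])
 let ?P = "dm V p" and ?Q = "dm V q"
 have "(vcmp K a b c $ ((vpre V K (b, b', f) c $ p) ** q)) $ (run V ?P ** idn V ?Q)
  = vcmp K a b c $ ((vpre V K (b, b', f) c $ p $ run V ?P) ** q)"
  using assms by simp
 also have "... = vcmp K a b c $ ((vcmp K b b' c $ (p ** f)) ** q)"
  using assms by (subst vpre_run) simp_all
 also have "... = vcmp K a b' c $ (p ** (vcmp K a b b' $ (f ** q))) $ ass V ?P (unt V) ?Q"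
  using assms by (simp add: vassoc)
 also have "... = vcmp K a b' c $ (p ** (vpost V K a (b, b', f) $ q $ lun V ?Q)) $ ass V ?P (unt V) ?Q"
  using assms by (subst vpost_lun) simp_all
 also have "... = (vcmp K a b' c $ (p ** (vpost V K a (b, b', f) $ q))) $ (idn V ?P ** lun V ?Q) $ ass V ?P (unt V) ?Q"
  using assms by simp
 finally show "(vcmp K a b c $ ((vpre V K (b, b', f) c $ p) ** q)) $ (run V ?P ** idn V ?Q) =
  (vcmp K a b' c $ (p ** (vpost V K a (b, b', f) $ q))) $ (run V ?P ** idn V ?Q)"
  using assms by (simp add: triangle)
qed (use assms in simp_all)

lemma vpost_vcmp1:
 assumes "(c, d, g) : ar (und V K)" "a : vob K" "b : vob K"
 shows "vpost V K a (c, d, g) $ vcmp K a b c = vcmp K a b d $ (vpost V K b (c, d, g) ** idn V (vhom K a b))"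
 using vpost_vcmp[OF assms, of "idn V (vhom K b c)" "idn V (vhom K a b)"] assms by simp

lemma vpost_vid [simp]: "x : vob K ==> y : vob K ==> vpost V K x (y, y, vid K y) = idn V (vhom K x y)"
 using vpost_eqI[of x y y "vid K y" "idn V (vhom K x y)" "idn V (vhom K x y)"] by (simp add: vid_left)

lemma vpre_vid [simp]: "x : vob K ==> y : vob K ==> vpre V K (x, x, vid K x) y = idn V (vhom K x y)"
 using vpre_eqI[of y x x "vid K x" "idn V (vhom K x y)" "idn V (vhom K x y)"] by (simp add: vid_right)

lemma vpost_vpre:
 assumes "(w, x, f) : ar (und V K)" "(y, z, g) : ar (und V K)"
 shows "vpost V K w (y, z, g) $ vpre V K (w, x, f) y = vpre V K (w, x, f) z $ vpost V K x (y, z, g)"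
proof (rule iso_epi[of "run V (vhom K x y)"])
 have "(vpost V K w (y, z, g) $ vpre V K (w, x, f) y) $ run V (vhom K x y)
  = vpost V K w (y, z, g) $ vcmp K w x y $ (idn V (vhom K x y) ** f)"
  using assms by (simp add: vpre_run1)
 also have "... = vcmp K w x z $ (vpost V K x (y, z, g) ** f)"
  using assms by (simp add: vpost_vcmp)
 also have "... = vpre V K (w, x, f) z $ vpost V K x (y, z, g) $ run V (vhom K x y)"
  using vpre_run[of z w x f "vpost V K x (y, z, g)"] assms by simp
 finally show "(vpost V K w (y, z, g) $ vpre V K (w, x, f) y) $ run V (vhom K x y)
  = (vpre V K (w, x, f) z $ vpost V K x (y, z, g)) $ run V (vhom K x y)" using assms by simp
qed (use assms in simp_all)

lemma vpost_cmp:
 assumes "x : vob K" "(y, z, g) : ar (und V K)" "(z, w, h) : ar (und V K)"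
 shows "vpost V K x (y, w, vpost V K y (z, w, h) $ g) = vpost V K x (z, w, h) $ vpost V K x (y, z, g)"
proof (rule iso_epi[of "lun V (vhom K x y)"])
 have "vpost V K x (y, w, vpost V K y (z, w, h) $ g) $ lun V (vhom K x y)
  = vcmp K x y w $ ((vpost V K y (z, w, h) $ g) ** idn V (vhom K x y))"
  using assms by (subst vpost_lun1) simp_all
 also have "... = vpost V K x (z, w, h) $ vcmp K x y z $ (g ** idn V (vhom K x y))"
  using assms by (subst vpost_vcmp) simp_all
 finally show "vpost V K x (y, w, vpost V K y (z, w, h) $ g) $ lun V (vhom K x y)
  = (vpost V K x (z, w, h) $ vpost V K x (y, z, g)) $ lun V (vhom K x y)"
  using assms by (simp add: vpost_lun1)
qed (use assms in simp_all)

lemma vpre_cmp: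
 assumes "w : vob K" "(x, y, f) : ar (und V K)" "(y, z, g) : ar (und V K)"
 shows "vpre V K (x, z, vpost V K x (y, z, g) $ f) w = vpre V K (x, y, f) w $ vpre V K (y, z, g) w"
proof (rule iso_epi[of "run V (vhom K z w)"])
 have "vpre V K (x, z, vpost V K x (y, z, g) $ f) w $ run V (vhom K z w)
  = vcmp K x z w $ (idn V (vhom K z w) ** (vpre V K (x, y, f) z $ g))"
  using assms by (subst vpre_run1) (simp_all add: vpre_elt)
 also have "... = vpre V K (x, y, f) w $ vcmp K y z w $ (idn V (vhom K z w) ** g)"
  using assms by (subst vpre_vcmp) simp_all
 finally show "vpre V K (x, z, vpost V K x (y, z, g) $ f) w $ run V (vhom K z w)
  = (vpre V K (x, y, f) w $ vpre V K (y, z, g) w) $ run V (vhom K z w)"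
  using assms by (simp add: vpre_run1)
qed (use assms in simp_all)

lemma category_und: "category (und V K)"
proof
 fix f assume "f : ar (und V K)"
 then show "dm (und V K) f : ob (und V K)" "cd (und V K) f : ob (und V K)" by (cases f; simp)+
next
 fix f g a b c assume "f : hom (und V K) a b" "g : hom (und V K) b c"
 then show "g $\<^bsub>und V K\<^esub> f : hom (und V K) a c" by (cases f; cases g) auto
next
 fix f a b assume "f : hom (und V K) a b"
 then show "idn (und V K) b $\<^bsub>und V K\<^esub> f = f" by (cases f) auto
next
 fix f a b assume "f : hom (und V K) a b"
 then show "f $\<^bsub>und V K\<^esub> idn (und V K) a = f"
  by (cases f) (auto simp: vpre_elt[symmetric])
next
 fix f g h a b c d
 assume "f : hom (und V K) a b" "g : hom (und V K) b c" "h : hom (und V K) c d"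
 then show "h $\<^bsub>und V K\<^esub> g $\<^bsub>und V K\<^esub> f = (h $\<^bsub>und V K\<^esub> g) $\<^bsub>und V K\<^esub> f"
  by (cases f; cases g; cases h) (auto simp: vpost_cmp)
qed auto

sublocale und: category "und V K" by (rule category_und)

end


subsection \<open>The base as an enriched category\<close>

lemma self_simps [simp]: "vob (self V) = ob V" "vhom (self V) = ihom V"
 by (simp_all add: self_def)

context symmetric_monoidal_closed
begin

lemma self_vid [simp]:
 assumes "a : ob V"
 shows "vid (self V) a : ar V" "dm V (vid (self V) a) = unt V" "cd V (vid (self V) a) = ihom V a a"
  "g : ar V ==> cd V g = a ==> ev V a a $ (vid (self V) a ** g) = g $ lun V (dm V g)"
 using assms by (simp_all add: self_def lun_nat)

lemma self_vcmp [simp]: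
 assumes "a : ob V" "b : ob V" "c : ob V"
 shows "vcmp (self V) a b c : ar V" "dm V (vcmp (self V) a b c) = ihom V b c @@ ihom V a b"
  "cd V (vcmp (self V) a b c) = ihom V a c"
 using assms by (simp_all add: self_def)

lemma ev_self_vcmp:
 assumes "a : ob V" "b : ob V" "c : ob V" "f : ar V" "g : ar V" "h : ar V"
  "cd V f = ihom V b c" "cd V g = ihom V a b" "cd V h = a"
 shows "ev V a c $ ((vcmp (self V) a b c $ (f ** g)) ** h)
  = ev V b c $ (f ** (ev V a b $ (g ** h))) $ ass V (dm V f) (dm V g) (dm V h)"
 using assms by (simp add: self_def ass_nat)

lemma vcategory_self: "vcategory V (self V)"
proof
 fix a b assume ab: "a : vob (self V)" "b : vob (self V)"
 show "vcmp (self V) a b b $ (vid (self V) b ** idn V (vhom (self V) a b)) = lun V (vhom (self V) a b)"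
 proof (rule ev_ext[of a b])
  have "ev V b b $ (vid (self V) b ** ev V a b) $ ass V (unt V) (ihom V a b) a
  = ev V a b $ lun V (ihom V a b @@ a) $ ass V (unt V) (ihom V a b) a"
  using ab by (subst extend[OF self_vid(4)]) simp_all
  then show "ev V a b $ ((vcmp (self V) a b b $ (vid (self V) b ** idn V (vhom (self V) a b))) ** idn V a)
  = ev V a b $ (lun V (vhom (self V) a b) ** idn V a)"
  using ab by (simp add: ev_self_vcmp lun_ass)
 qed (use ab in simp_all)
 show "vcmp (self V) a a b $ (idn V (vhom (self V) a b) ** vid (self V) a) = run V (vhom (self V) a b)"
  by (rule ev_ext[of a b]) (use ab in \<open>simp_all add: ev_self_vcmp triangle[symmetric]\<close>)
next
 fix a b c d assume abcd: "a : vob (self V)" "b : vob (self V)" "c : vob (self V)" "d : vob (self V)"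
 let ?H = "ihom V c d" and ?G = "ihom V b c" and ?F = "ihom V a b"
 show "vcmp (self V) a b d $ (vcmp (self V) b c d ** idn V (vhom (self V) a b))
  = vcmp (self V) a c d $ (idn V (vhom (self V) c d) ** vcmp (self V) a b c)
  $ ass V (vhom (self V) c d) (vhom (self V) b c) (vhom (self V) a b)"
 proof (rule ev_ext[of a d])
  have "ev V a d $ ((vcmp (self V) a b d $ (vcmp (self V) b c d ** idn V ?F)) ** idn V a)
  = ev V b d $ (vcmp (self V) b c d ** ev V a b) $ ass V (?H @@ ?G) ?F a"
  using abcd by (simp add: ev_self_vcmp)
  also have "... = ev V b d $ ((vcmp (self V) b c d $ (idn V ?H ** idn V ?G)) ** ev V a b) $ ass V (?H @@ ?G) ?F a"
  using abcd by simp
  also have "... = ev V c d $ (idn V ?H ** (ev V b c $ (idn V ?G ** ev V a b)))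
  $ ass V ?H ?G (?F @@ a) $ ass V (?H @@ ?G) ?F a"
  using abcd by (subst extend[OF ev_self_vcmp]) simp_all
  also have "... = ev V c d $ (idn V ?H ** (ev V b c $ (idn V ?G ** ev V a b)))
  $ (idn V ?H ** ass V ?G ?F a) $ ass V ?H (?G @@ ?F) a $ (ass V ?H ?G ?F ** idn V a)"
  using abcd by (simp add: pentagon)
  also have "... = ev V c d $ (idn V ?H ** (ev V b c $ (idn V ?G ** ev V a b) $ ass V ?G ?F a))
  $ ass V ?H (?G @@ ?F) a $ (ass V ?H ?G ?F ** idn V a)"
  using abcd by simp
  also have "... = ev V c d $ (idn V ?H ** (ev V a c $ ((vcmp (self V) a b c $ (idn V ?G ** idn V ?F)) ** idn V a)))
  $ ass V ?H (?G @@ ?F) a $ (ass V ?H ?G ?F ** idn V a)"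
  using abcd by (subst ev_self_vcmp) simp_all
  also have "... = ev V c d $ (idn V ?H ** (ev V a c $ (vcmp (self V) a b c ** idn V a)))
  $ ass V ?H (?G @@ ?F) a $ (ass V ?H ?G ?F ** idn V a)"
  using abcd by simp
  also have "... = ev V a d $ ((vcmp (self V) a c d $ (idn V ?H ** vcmp (self V) a b c)) ** idn V a)
  $ (ass V ?H ?G ?F ** idn V a)"
  using abcd by (subst extend[OF ev_self_vcmp]) simp_all
  finally show "ev V a d $ ((vcmp (self V) a b d $ (vcmp (self V) b c d ** idn V (vhom (self V) a b))) ** idn V a)
  = ev V a d $ ((vcmp (self V) a c d $ (idn V (vhom (self V) c d) ** vcmp (self V) a b c)
  $ ass V (vhom (self V) c d) (vhom (self V) b c) (vhom (self V) a b)) ** idn V a)"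
  using abcd by simp
 qed (use abcd in simp_all)
qed auto

end

section \<open>Names of arrows, and opposites\<close>

context symmetric_monoidal_closed
begin

abbreviation "Vs \<equiv> self V"

lemma enriched_self: "enriched V (self V)"
 by (intro enriched.intro vcategory_self symmetric_monoidal_closed_axioms)

sublocale self: enriched V "self V"
 by (rule enriched_self)

lemma enrichedI: "vcategory V K ==> enriched V K"
 by (intro enriched.intro symmetric_monoidal_closed_axioms)

text \<open>The name of an arrow: the arrow as an element of the internal hom, in the form that
  \<open>self_arrows\<close> uses. \<open>named_arrow\<close> is the inverse passage.\<close>

definition arrow_name :: "'a => 'a" where
 "arrow_name f = curry_ar V (unt V) (dm V f) (cd V f) (f $ lun V (dm V f))"

definition named_arrow :: "'o => 'o => 'a => 'a" where
 "named_arrow a b h = ev V a b $ (h ** idn V a) $ cinv V (lun V a)"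

lemma arrow_name_simps [simp]:
 assumes "f : ar V"
 shows "arrow_name f : ar V" "dm V (arrow_name f) = unt V" "cd V (arrow_name f) = ihom V (dm V f) (cd V f)"
 using assms by (simp_all add: arrow_name_def)

lemma ev_arrow_name:
 assumes "f : ar V" "dm V f = a" "cd V f = b" "q : ar V" "cd V q = a"
 shows "ev V a b $ (arrow_name f ** q) = f $ q $ lun V (dm V q)"
 using assms(1,4,5) unfolding assms(2,3)[symmetric] by (simp add: arrow_name_def lun_nat)

lemma named_arrow_simps [simp]:
 assumes "a : ob V" "b : ob V" "h : ar V" "dm V h = unt V" "cd V h = ihom V a b"
 shows "named_arrow a b h : ar V" "dm V (named_arrow a b h) = a" "cd V (named_arrow a b h) = b"
 using assms by (simp_all add: named_arrow_def)

lemma named_arrow_name [simp]: "f : ar V ==> dm V f = a ==> cd V f = b ==> named_arrow a b (arrow_name f) = f"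
 unfolding named_arrow_def by (subst extend[OF ev_arrow_name]) auto

lemma arrow_name_named [simp]:
 assumes "a : ob V" "b : ob V" "h : ar V" "dm V h = unt V" "cd V h = ihom V a b"
 shows "arrow_name (named_arrow a b h) = h"
 unfolding arrow_name_def by (rule curry_eqI) (use assms in \<open>simp_all add: named_arrow_def\<close>)

lemma arrow_name_inj:
 assumes "arrow_name f = arrow_name g" "f : hom V a b" "g : hom V a b" shows "f = g"
 using named_arrow_name[of f a b] named_arrow_name[of g a b] assms by simp

lemma self_arrows_eq: "self_arrows V S = (%f. (dm V f, cd V f, arrow_name f)) ` S"
 by (simp add: self_arrows_def arrow_name_def)

text \<open>Evaluation determines arrows into internal homs, so this identifies precomposition in
  \<open>self V\<close> with the contravariant action of the internal hom;
  \<open>ev_self_vpost\<close> is its covariant companion.\<close>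

lemma ev_self_vpre:
 assumes "f : ar V" "dm V f = a" "cd V f = b" "y : ob V" "p : ar V" "cd V p = ihom V b y" "q : ar V" "cd V q = a"
 shows "ev V a y $ ((vpre V (self V) (a, b, arrow_name f) y $ p) ** q) = ev V b y $ (p ** (f $ q))"
proof (rule iso_epi[of "run V (dm V p) ** idn V (dm V q)"])
 have ab: "a : ob V" "b : ob V" using assms(1-3) by auto
 note [simp] = ab
 have "(ev V a y $ ((vpre V (self V) (a, b, arrow_name f) y $ p) ** q)) $ (run V (dm V p) ** idn V (dm V q))
  = ev V a y $ ((vcmp (self V) a b y $ (p ** arrow_name f)) ** q)"
  using assms self.vpre_run[of y a b "arrow_name f" p] by simp
 also have "... = ev V b y $ (p ** (f $ q $ lun V (dm V q))) $ ass V (dm V p) (unt V) (dm V q)"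
  using assms by (subst ev_self_vcmp) (simp_all add: ev_arrow_name)
 also have "... = ev V b y $ (p ** (f $ q)) $ (idn V (dm V p) ** lun V (dm V q)) $ ass V (dm V p) (unt V) (dm V q)"
  using assms by simp
 also have "... = ev V b y $ (p ** (f $ q)) $ (run V (dm V p) ** idn V (dm V q))"
  using assms by (subst triangle) simp_all
 finally show "(ev V a y $ ((vpre V (self V) (a, b, arrow_name f) y $ p) ** q)) $ (run V (dm V p) ** idn V (dm V q))
  = (ev V b y $ (p ** (f $ q))) $ (run V (dm V p) ** idn V (dm V q))" using assms by simp
qed (use assms in auto)

lemma ev_self_vpost:
 assumes "f : ar V" "dm V f = a" "cd V f = b" "x : ob V" "p : ar V" "cd V p = ihom V x a" "q : ar V" "cd V q = x"
 shows "ev V x b $ ((vpost V (self V) x (a, b, arrow_name f) $ p) ** q) = f $ ev V x a $ (p ** q)"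
proof (rule iso_epi[of "lun V (dm V p) ** idn V (dm V q)"])
 have ab: "a : ob V" "b : ob V" using assms(1-3) by auto
 note [simp] = ab
 have "(ev V x b $ ((vpost V (self V) x (a, b, arrow_name f) $ p) ** q)) $ (lun V (dm V p) ** idn V (dm V q))
  = ev V x b $ ((vcmp (self V) x a b $ (arrow_name f ** p)) ** q)"
  using assms self.vpost_lun[of x a b "arrow_name f" p] by simp
 also have "... = ev V a b $ (arrow_name f ** (ev V x a $ (p ** q))) $ ass V (unt V) (dm V p) (dm V q)"
  using assms by (subst ev_self_vcmp) simp_all
 also have "... = f $ ev V x a $ (p ** q) $ lun V (dm V p @@ dm V q) $ ass V (unt V) (dm V p) (dm V q)"
  using assms by (subst extend[OF ev_arrow_name]) simp_all
 also have "... = f $ ev V x a $ (p ** q) $ (lun V (dm V p) ** idn V (dm V q))"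
  using assms by (simp add: lun_ass)
 finally show "(ev V x b $ ((vpost V (self V) x (a, b, arrow_name f) $ p) ** q)) $ (lun V (dm V p) ** idn V (dm V q))
  = (f $ ev V x a $ (p ** q)) $ (lun V (dm V p) ** idn V (dm V q))" using assms by simp
qed (use assms in auto)

lemma arrow_name_cmp:
 assumes "f : hom V a b" "g : hom V b c"
 shows "arrow_name (g $ f) = vpost V (self V) a (b, c, arrow_name g) $ arrow_name f"
proof (rule ev_ext[of a c _ _ "unt V"])
 have "a : ob V" "b : ob V" "c : ob V" using assms by auto
 note [simp] = this
 show "ev V a c $ (arrow_name (g $ f) ** idn V a)
  = ev V a c $ ((vpost V (self V) a (b, c, arrow_name g) $ arrow_name f) ** idn V a)"
  using assms by (subst ev_self_vpost) (simp_all add: ev_arrow_name)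
qed (use assms in auto)

lemma arrow_name_idn: "a : ob V ==> arrow_name (idn V a) = vid (self V) a"
 by (rule ev_ext[of a a _ _ "unt V"]) (simp_all add: ev_arrow_name)


subsection \<open>Opposites\<close>

lemma vop_simps [simp]: "vob (vop V K) = vob K" "vhom (vop V K) a b = vhom K b a" "vid (vop V K) = vid K"
 "vcmp (vop V K) a b c = vcmp K c b a $ swp V (vhom K c b) (vhom K b a)"
 by (simp_all add: vop_def)

text \<open>The hexagon for the other bracketing. For a symmetry it follows from the given hexagon,
  by cancelling the swap of the whole product.\<close>

lemma swp_tensor_left:
 assumes "x : ob V" "y : ob V" "z : ob V"
 shows "swp V (y @@ x) z
  = ass V z y x $ (swp V y z ** idn V x) $ cinv V (ass V y z x) $ (idn V y ** swp V x z) $ ass V y x z"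
proof (rule iso_epi[of "swp V z (y @@ x) $ ass V z y x"])
 have "(ass V z y x $ (swp V y z ** idn V x) $ cinv V (ass V y z x) $ (idn V y ** swp V x z) $ ass V y x z)
  $ (swp V z (y @@ x) $ ass V z y x)
  = ass V z y x $ (swp V y z ** idn V x) $ cinv V (ass V y z x) $ (idn V y ** swp V x z)
  $ (ass V y x z $ swp V z (y @@ x) $ ass V z y x)"
  using assms by simp
 also have "... = ass V z y x"
  using assms by (simp add: hexagon)
 finally show "swp V (y @@ x) z $ (swp V z (y @@ x) $ ass V z y x) =
  (ass V z y x $ (swp V y z ** idn V x) $ cinv V (ass V y z x) $ (idn V y ** swp V x z) $ ass V y x z)
  $ (swp V z (y @@ x) $ ass V z y x)"
  using assms by simp
qed (use assms in simp_all)

text \<open>The two ways of reversing a threefold product, starting from either bracketing, agree.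
  Associativity in the opposite category compares exactly these two.\<close>

lemma swp_reverse:
 assumes "x : ob V" "y : ob V" "z : ob V"
 shows "(idn V z ** swp V x y) $ swp V (x @@ y) z
  = ass V z y x $ (swp V y z ** idn V x) $ swp V x (y @@ z) $ ass V x y z"
proof -
 have "swp V x (y @@ z) $ ass V x y z = cinv V (ass V y z x) $ (ass V y z x $ swp V x (y @@ z) $ ass V x y z)"
  using assms by simp
 also have "... = cinv V (ass V y z x) $ (idn V y ** swp V x z) $ ass V y x z $ (swp V x y ** idn V z)"
  by (simp only: hexagon[OF assms])
 finally have "ass V z y x $ (swp V y z ** idn V x) $ swp V x (y @@ z) $ ass V x y z
  = swp V (y @@ x) z $ (swp V x y ** idn V z)"
  using assms by (simp add: swp_tensor_left)
 also have "... = (idn V z ** swp V x y) $ swp V (x @@ y) z"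
  using assms by (simp add: swp_nat)
 finally show ?thesis by simp
qed

end

context enriched
begin

lemma vcategory_vop: "vcategory V (vop V K)"
proof
 fix a b assume ab: "a : vob (vop V K)" "b : vob (vop V K)"
 then show "vcmp (vop V K) a b b $ (vid (vop V K) b ** idn V (vhom (vop V K) a b)) = lun V (vhom (vop V K) a b)"
  by (simp add: swp_nat extend[OF vcmp_vid_right] run_swp)
 show "vcmp (vop V K) a a b $ (idn V (vhom (vop V K) a b) ** vid (vop V K) a) = run V (vhom (vop V K) a b)"
  using ab by (simp add: swp_nat extend[OF vcmp_vid_left] lun_swp)
next
 fix a b c d assume abcd: "a : vob (vop V K)" "b : vob (vop V K)" "c : vob (vop V K)" "d : vob (vop V K)"
 let ?X = "vhom K d c" and ?Y = "vhom K c b" and ?Z = "vhom K b a"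
 have "vcmp K d b a $ swp V (vhom K d b) ?Z $ ((vcmp K d c b $ swp V ?X ?Y) ** idn V ?Z)
  = vcmp K d b a $ (idn V ?Z ** vcmp K d c b) $ (idn V ?Z ** swp V ?X ?Y) $ swp V (?X @@ ?Y) ?Z"
  using abcd by (simp add: swp_nat)
 also have "... = vcmp K d b a $ (idn V ?Z ** vcmp K d c b) $ ass V ?Z ?Y ?X $ (swp V ?Y ?Z ** idn V ?X)
  $ swp V ?X (?Y @@ ?Z) $ ass V ?X ?Y ?Z"
  using abcd by (simp add: swp_reverse)
 also have "... = (vcmp K d c a $ (vcmp K c b a ** idn V ?X)) $ (swp V ?Y ?Z ** idn V ?X)
  $ swp V ?X (?Y @@ ?Z) $ ass V ?X ?Y ?Z"
  using abcd by (simp only: vcmp_assoc vop_simps) simp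
 also have "... = vcmp K d c a $ swp V ?X (vhom K c a) $ (idn V ?X ** (vcmp K c b a $ swp V ?Y ?Z)) $ ass V ?X ?Y ?Z"
  using abcd by (subst swp_nat') simp_all
 finally show "vcmp (vop V K) a b d $ (vcmp (vop V K) b c d ** idn V (vhom (vop V K) a b))
  = vcmp (vop V K) a c d $ (idn V (vhom (vop V K) c d) ** vcmp (vop V K) a b c)
  $ ass V (vhom (vop V K) c d) (vhom (vop V K) b c) (vhom (vop V K) a b)"
  using abcd by simp
qed auto

lemma enriched_vop: "enriched V (vop V K)"
 by (rule enrichedI[OF vcategory_vop])

end


subsection \<open>Enriched functors\<close>

locale enriched_functor = K: enriched V K + L: enriched V L + vfunctor V K L F
 for V :: "('o, 'a, 'z) smc_scheme" (structure) and K :: "('k, 'o, 'a) vcat"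
  and L :: "('l, 'o, 'a) vcat" and F :: "('k, 'l, 'a) vfun"
begin

lemmas [simp] = fo_vob

lemma fm_simps [simp]:
 assumes "a : vob K" "b : vob K"
 shows "fm F a b : ar V" "dm V (fm F a b) = vhom K a b" "cd V (fm F a b) = vhom L (fo F a) (fo F b)"
 using fm_hom[OF assms] by auto

lemma fm_vcmp_elt:
 assumes "a : vob K" "b : vob K" "c : vob K" "p : ar V" "q : ar V" "cd V p = vhom K b c" "cd V q = vhom K a b"
 shows "fm F a c $ vcmp K a b c $ (p ** q)
  = vcmp L (fo F a) (fo F b) (fo F c) $ ((fm F b c $ p) ** (fm F a b $ q))"
 using assms by (subst K.extend[OF fm_vcmp]) simp_all

lemma und_ar_simp [simp]: "und_ar V F (a, b, f) = (fo F a, fo F b, fm F a b $ f)"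
 by (simp add: und_ar_def)

lemma fm_vpost:
 assumes "x : vob K" "(y, z, g) : ar (und V K)"
 shows "fm F x z $ vpost V K x (y, z, g) = vpost V L (fo F x) (fo F y, fo F z, fm F y z $ g) $ fm F x y"
proof (rule L.vpost_eqI[symmetric])
 show "vcmp L (fo F x) (fo F y) (fo F z) $ ((fm F y z $ g) ** fm F x y) =
  (fm F x z $ vpost V K x (y, z, g)) $ lun V (dm V (fm F x y))"
  using assms fm_vcmp_elt[of x y z g "idn V (vhom K x y)"] by (simp add: K.vpost_lun1)
qed (use assms in simp_all)

lemma fm_vpre:
 assumes "y : vob K" "(w, x, f) : ar (und V K)"
 shows "fm F w y $ vpre V K (w, x, f) y = vpre V L (fo F w, fo F x, fm F w x $ f) (fo F y) $ fm F x y"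
proof (rule L.vpre_eqI[symmetric])
 show "vcmp L (fo F w) (fo F x) (fo F y) $ (fm F x y ** (fm F w x $ f)) =
  (fm F w y $ vpre V K (w, x, f) y) $ run V (dm V (fm F x y))"
  using assms fm_vcmp_elt[of w x y "idn V (vhom K x y)" f] by (simp add: K.vpre_run1)
qed (use assms in simp_all)

end

lemma (in symmetric_monoidal_closed) enriched_functorI:
 "enriched V K ==> enriched V L ==> vfunctor V K L F ==> enriched_functor V K L F"
 by (intro enriched_functor.intro)

text \<open>Rewrites the naturality axiom, which carries inverse unitors, as a commuting square of
  pre- and postcompositions.\<close>

lemma vnat_vpost_vpre:
 fixes V (structure)
 assumes "enriched_functor V K L F" "enriched_functor V K L G" "vnat V K L F G t" "a : vob K" "b : vob K"
 shows "vpost V L (fo F a) (fo F b, fo G b, t b) $ fm F a b = vpre V L (fo F a, fo G a, t a) (fo G b) $ fm G a b"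
proof -
 interpret F: enriched_functor V K L F by fact
 interpret G: enriched_functor V K L G by fact
 interpret vnat V K L F G t by fact
 have t: "t c : ar V" "dm V (t c) = unt V" "cd V (t c) = vhom L (fo F c) (fo G c)" if "c : vob K" for c
  using component_hom[OF that] by auto
 have "vpost V L (fo F a) (fo F b, fo G b, t b) $ fm F a b
  = vcmp L (fo F a) (fo F b) (fo G b) $ (t b ** fm F a b) $ cinv V (lun V (vhom K a b))"
  by (rule F.L.vpost_eqI) (use assms t in simp_all)
 moreover have "vpre V L (fo F a, fo G a, t a) (fo G b) $ fm G a b
  = vcmp L (fo F a) (fo G a) (fo G b) $ (fm G a b ** t a) $ cinv V (run V (vhom K a b))"
  by (rule F.L.vpre_eqI) (use assms t in simp_all)
 ultimately show ?thesis using natural assms(4,5) by simp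
qed

section \<open>Representable functors\<close>

context enriched
begin

lemma vrep_simps [simp]: "fo (vrep V K a) = vhom K a"
 by (auto simp: vrep_def)

lemma vrep_fm_simps [simp]:
 assumes "a : vob K" "b : vob K" "c : vob K"
 shows "fm (vrep V K a) b c : ar V" "dm V (fm (vrep V K a) b c) = vhom K b c"
  "cd V (fm (vrep V K a) b c) = ihom V (vhom K a b) (vhom K a c)"
 using assms by (simp_all add: vrep_def)

lemma ev_vrep:
 assumes "a : vob K" "b : vob K" "c : vob K" "p : ar V" "q : ar V" "cd V p = vhom K b c" "cd V q = vhom K a b"
 shows "ev V (vhom K a b) (vhom K a c) $ ((fm (vrep V K a) b c $ p) ** q) = vcmp K a b c $ (p ** q)"
 using assms by (simp add: vrep_def)

lemma ev_vrep1:
 assumes "a : vob K" "b : vob K" "c : vob K" "q : ar V" "cd V q = vhom K a b"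
 shows "ev V (vhom K a b) (vhom K a c) $ (fm (vrep V K a) b c ** q) = vcmp K a b c $ (idn V (vhom K b c) ** q)"
 using assms by (simp add: vrep_def)

lemma vfunctor_vrep:
 assumes "a : vob K"
 shows "vfunctor V K (self V) (vrep V K a)"
proof
 fix b assume b: "b : vob K"
 show "fm (vrep V K a) b b $ vid K b = vid (self V) (fo (vrep V K a) b)"
  by (rule ev_ext[of "vhom K a b" "vhom K a b"]) (use assms b in \<open>simp_all add: ev_vrep vid_left\<close>)
next
 fix b c d assume bcd: "b : vob K" "c : vob K" "d : vob K"
 let ?x = "vhom K c d @@ vhom K b c" and ?i = "idn V (vhom K a b)"
 have "ev V (vhom K a b) (vhom K a d) $ ((fm (vrep V K a) b d $ vcmp K b c d) ** ?i)
  = vcmp K a c d $ (idn V (vhom K c d) ** vcmp K a b c) $ ass V (vhom K c d) (vhom K b c) (vhom K a b)"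
  using assms bcd by (simp add: ev_vrep vcmp_assoc)
 moreover have "ev V (vhom K a b) (vhom K a d) $ ((vcmp (self V) (vhom K a b) (vhom K a c) (vhom K a d)
  $ (fm (vrep V K a) c d ** fm (vrep V K a) b c)) ** ?i)
  = ev V (vhom K a c) (vhom K a d) $ (fm (vrep V K a) c d ** vcmp K a b c) $ ass V (vhom K c d) (vhom K b c) (vhom K a b)"
  using assms bcd by (subst ev_self_vcmp) (simp_all add: ev_vrep1)
 moreover have "... = vcmp K a c d $ (idn V (vhom K c d) ** vcmp K a b c) $ ass V (vhom K c d) (vhom K b c) (vhom K a b)"
  by (rule extend[OF ev_vrep1, THEN trans]) (use assms bcd in simp_all)
 ultimately have eq: "ev V (vhom K a b) (vhom K a d) $ ((fm (vrep V K a) b d $ vcmp K b c d) ** ?i)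
  = ev V (vhom K a b) (vhom K a d) $ ((vcmp (self V) (vhom K a b) (vhom K a c) (vhom K a d)
  $ (fm (vrep V K a) c d ** fm (vrep V K a) b c)) ** ?i)" by (simp only:)
 show "fm (vrep V K a) b d $ vcmp K b c d = vcmp (self V) (fo (vrep V K a) b) (fo (vrep V K a) c) (fo (vrep V K a) d)
  $ (fm (vrep V K a) c d ** fm (vrep V K a) b c)"
  unfolding vrep_simps by (rule ev_ext[OF eq, of ?x]) (use assms bcd in simp_all)
qed (use assms in auto)

lemma enriched_functor_vrep: "a : vob K ==> enriched_functor V K (self V) (vrep V K a)"
 by (intro enriched_functor.intro vfunctor_vrep enriched_axioms enriched_self)

text \<open>The bridge between \<open>vrep\<close> and \<open>vpost\<close>: a representable sends
  an element to the name of postcomposition with it.\<close>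

lemma vrep_arrow:
 assumes "a : vob K" "(y, z, g) : ar (und V K)"
 shows "fm (vrep V K a) y z $ g = arrow_name (vpost V K a (y, z, g))"
 by (rule ev_ext[of "vhom K a y" "vhom K a z" _ _ "unt V"])
  (use assms in \<open>simp_all add: ev_vrep ev_arrow_name vpost_lun1\<close>)

end

section \<open>Faithful enriched categories over a base\<close>

definition is_mono :: "('o, 'a, 'z) cat_scheme => 'a => bool" where
 "is_mono C f \<longleftrightarrow> f : ar C & (ALL g:ar C. ALL h:ar C. dm C g = dm C h & cd C g = dm C f & cd C h = dm C f &
  f $\<^bsub>C\<^esub> g = f $\<^bsub>C\<^esub> h --> g = h)"

lemma is_monoD:
 assumes "is_mono C f" "f $\<^bsub>C\<^esub> g = f $\<^bsub>C\<^esub> h" "g : hom C a (dm C f)" "h : hom C a (dm C f)"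
 shows "g = h"
 using assms unfolding is_mono_def by fastforce

lemma (in category) equalizer_mono:
 assumes "is_equalizer C f g e" "f : ar C" "g : ar C" "dm C g = dm C f"
 shows "is_mono C e"
 unfolding is_mono_def
proof (intro conjI ballI impI)
 show "e : ar C" using assms by (simp add: is_equalizer_def)
 fix h k assume hk: "h : ar C" "k : ar C"
  "dm C h = dm C k & cd C h = dm C e & cd C k = dm C e & e $ h = e $ k"
 have e: "e : ar C" "cd C e = dm C f" "f $ e = g $ e" using assms by (auto simp: is_equalizer_def)
 have "f $ e $ h = (f $ e) $ h" by (rule assoc[symmetric]) (use assms e hk in simp_all)
 also have "... = (g $ e) $ h" by (simp only: e(3))
 also have "... = g $ e $ h" by (rule assoc) (use assms e hk in simp_all)
 finally have "EX! u. u : hom C (dm C (e $ h)) (dm C e) & e $ u = e $ h"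
  using assms(1) e(1,2) hk unfolding is_equalizer_def by (metis cmp_simps(1,3))
 moreover have "h : hom C (dm C (e $ h)) (dm C e)" "k : hom C (dm C (e $ h)) (dm C e)"
  using e hk by auto
 ultimately show "h = k" using hk(3) by metis
qed

context enriched
begin

text \<open>Each \<open>fm U x y\<close> is monic, so the laws need only hold after applying it,
  where they are laws of K. Eilenberg-Moore algebras, Kleisli arrows and algebras of a theory are
  all treated this way.\<close>

lemma faithful_vcategory:
 fixes X :: "('x, 'o, 'a) vcat" and U :: "('x, 'k, 'a) vfun"
 assumes ob: "!!x. x : vob X ==> fo U x : vob K"
  and hom: "!!x y. x : vob X ==> y : vob X ==> fm U x y : hom V (vhom X x y) (vhom K (fo U x) (fo U y))"
  and mono: "!!x y. x : vob X ==> y : vob X ==> is_mono V (fm U x y)"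
  and id: "!!x. x : vob X ==> vid X x : hom V (unt V) (vhom X x x) & fm U x x $ vid X x = vid K (fo U x)"
  and cmp: "!!x y z. x : vob X ==> y : vob X ==> z : vob X ==>
  vcmp X x y z : hom V (vhom X y z @@ vhom X x y) (vhom X x z) &
  fm U x z $ vcmp X x y z = vcmp K (fo U x) (fo U y) (fo U z) $ (fm U y z ** fm U x y)"
 shows "vcategory V X" "vfunctor V X K U"
proof -
 have ar [simp]: "fm U x y : ar V" "dm V (fm U x y) = vhom X x y" "cd V (fm U x y) = vhom K (fo U x) (fo U y)"
  "vhom X x y : ob V" if "x : vob X" "y : vob X" for x y
  using hom[OF that] dm_ob[of "fm U x y"] by auto
 have id' [simp]: "vid X x : ar V" "dm V (vid X x) = unt V" "cd V (vid X x) = vhom X x x"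
  "fm U x x $ vid X x = vid K (fo U x)" if "x : vob X" for x
  using id[OF that] by auto
 have cmp' [simp]: "vcmp X x y z : ar V" "dm V (vcmp X x y z) = vhom X y z @@ vhom X x y" "cd V (vcmp X x y z) = vhom X x z"
  "fm U x z $ vcmp X x y z = vcmp K (fo U x) (fo U y) (fo U z) $ (fm U y z ** fm U x y)"
  if "x : vob X" "y : vob X" "z : vob X" for x y z
  using cmp[OF that] by auto
 have cmp'': "fm U x z $ vcmp X x y z $ r = vcmp K (fo U x) (fo U y) (fo U z) $ (fm U y z ** fm U x y) $ r"
  if "x : vob X" "y : vob X" "z : vob X" "r : ar V" "cd V r = vhom X y z @@ vhom X x y" for x y z r
  using that ob by (subst extend[OF cmp'(4)]) simp_all
 note [simp] = ob
 show "vcategory V X"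
 proof
  fix x y assume xy: "x : vob X" "y : vob X"
  show "vcmp X x y y $ (vid X y ** idn V (vhom X x y)) = lun V (vhom X x y)"
  by (rule is_monoD[OF mono[OF xy]]) (use xy in \<open>simp_all add: cmp'' vid_left\<close>)
  show "vcmp X x x y $ (idn V (vhom X x y) ** vid X x) = run V (vhom X x y)"
  by (rule is_monoD[OF mono[OF xy]]) (use xy in \<open>simp_all add: cmp'' vid_right\<close>)
 next
  fix x y z w assume xyzw: "x : vob X" "y : vob X" "z : vob X" "w : vob X"
  show "vcmp X x y w $ (vcmp X y z w ** idn V (vhom X x y)) = vcmp X x z w $ (idn V (vhom X z w) ** vcmp X x y z)
  $ ass V (vhom X z w) (vhom X y z) (vhom X x y)"
  by (rule is_monoD[OF mono[OF xyzw(1,4)]]) (use xyzw in \<open>simp_all add: cmp'' vassoc\<close>)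
 qed (use id cmp in auto)
 show "vfunctor V X K U" by unfold_locales (use hom in auto)
qed

text \<open>The forgetful arrows are monic, so a comparison of hom-objects over K is unique if it
  exists. A bijection on objects over K with comparisons in both directions is therefore already an
  isomorphism of categories over K.\<close>

lemma concretely_equivalentI:
 fixes X :: "('x, 'o, 'a) vcat" and Y :: "('y, 'o, 'a) vcat"
 assumes X: "vcategory V X" "vfunctor V X K U" and Y: "vcategory V Y" "vfunctor V Y K W"
  and mono_U: "!!x y. x : vob X ==> y : vob X ==> is_mono V (fm U x y)"
  and mono_W: "!!x y. x : vob Y ==> y : vob Y ==> is_mono V (fm W x y)"
  and fi: "!!x. x : vob X ==> fi x : vob Y & fo W (fi x) = fo U x & ps (fi x) = x"
  and ps: "!!y. y : vob Y ==> ps y : vob X & fi (ps y) = y"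
  and i: "!!x y. x : vob X ==> y : vob X ==> EX i. i : hom V (vhom X x y) (vhom Y (fi x) (fi y)) & fm W (fi x) (fi y) $ i = fm U x y"
  and j: "!!x y. x : vob X ==> y : vob X ==> EX j. j : hom V (vhom Y (fi x) (fi y)) (vhom X x y) & fm U x y $ j = fm W (fi x) (fi y)"
 shows "concretely_equivalent V K X U Y W"
proof -
 interpret U: enriched_functor V X K U
  by (intro enriched_functorI enrichedI X enriched_axioms)
 interpret W: enriched_functor V Y K W
  by (intro enriched_functorI enrichedI Y enriched_axioms)
 \<comment> \<open>Comparisons that exist hom-object by hom-object are automatically functorial:
   identities and composites are tested after the monic \<open>fm Q\<close>.\<close>
 have lift: "vfunctor V A B \<lparr>fo = th, fm = k\<rparr>"
  if A: "enriched_functor V A K P" and B: "enriched_functor V B K Q"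
  and mono_Q: "!!x y. x : vob B ==> y : vob B ==> is_mono V (fm Q x y)"
  and th: "!!x. x : vob A ==> th x : vob B & fo Q (th x) = fo P x"
  and k: "!!x y. x : vob A ==> y : vob A ==> k x y : hom V (vhom A x y) (vhom B (th x) (th y)) & fm Q (th x) (th y) $ k x y = fm P x y"
  for A :: "('s, 'o, 'a) vcat" and B :: "('t, 'o, 'a) vcat" and P Q th k
 proof -
  interpret P: enriched_functor V A K P by fact
  interpret Q: enriched_functor V B K Q by fact
  have k' [simp]: "k x y : ar V" "dm V (k x y) = vhom A x y" "cd V (k x y) = vhom B (th x) (th y)"
  "fm Q (th x) (th y) $ k x y = fm P x y" if "x : vob A" "y : vob A" for x y
  using k[OF that] by auto
  have th' [simp]: "th x : vob B" "fo Q (th x) = fo P x" if "x : vob A" for x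
  using th[OF that] by auto
  show ?thesis
  proof
  fix x assume x: "x : vob A"
  have "k x x $ vid A x = vid B (th x)"
  proof (rule is_monoD[OF mono_Q[of "th x" "th x"]])
  show "fm Q (th x) (th x) $ k x x $ vid A x = fm Q (th x) (th x) $ vid B (th x)"
  using x by (subst extend[OF k'(4)]) (simp_all add: P.fm_vid Q.fm_vid)
  qed (use x in simp_all)
  then show "fm \<lparr>fo = th, fm = k\<rparr> x x $ vid A x = vid B (fo \<lparr>fo = th, fm = k\<rparr> x)" by simp
  next
  fix x y z assume xyz: "x : vob A" "y : vob A" "z : vob A"
  have "k x z $ vcmp A x y z = vcmp B (th x) (th y) (th z) $ (k y z ** k x y)"
  proof (rule is_monoD[OF mono_Q[of "th x" "th z"]])
  have "fm Q (th x) (th z) $ k x z $ vcmp A x y z = fm P x z $ vcmp A x y z"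
  using xyz by (subst extend[OF k'(4)]) simp_all
  also have "... = vcmp K (fo P x) (fo P y) (fo P z) $ (fm P y z ** fm P x y)"
  using xyz by (simp add: P.fm_vcmp)
  also have "... = fm Q (th x) (th z) $ vcmp B (th x) (th y) (th z) $ (k y z ** k x y)"
  using xyz by (subst Q.fm_vcmp_elt) simp_all
  finally show "fm Q (th x) (th z) $ k x z $ vcmp A x y z
  = fm Q (th x) (th z) $ vcmp B (th x) (th y) (th z) $ (k y z ** k x y)" .
  qed (use xyz in simp_all)
  then show "fm \<lparr>fo = th, fm = k\<rparr> x z $ vcmp A x y z = vcmp B (fo \<lparr>fo = th, fm = k\<rparr> x) (fo \<lparr>fo = th, fm = k\<rparr> y) (fo \<lparr>fo = th, fm = k\<rparr> z) $
  (fm \<lparr>fo = th, fm = k\<rparr> y z ** fm \<lparr>fo = th, fm = k\<rparr> x y)" by simp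
  qed simp_all
 qed
 \<comment> \<open>The two composites act as the identity on objects and hom-objects, so the
   identities serve as components of the natural isomorphisms.\<close>
 have vnat_id: "vnat_isomorphic V A A (vf_id V A) G"
  if A: "vcategory V A" and G: "!!x. x : vob A ==> fo G x = x"
  "!!x y. x : vob A ==> y : vob A ==> fm G x y = idn V (vhom A x y)" for A :: "('s, 'o, 'a) vcat" and G
 proof -
  interpret A: enriched V A by (rule enrichedI[OF A])
  have "vnat V A A (vf_id V A) G (vid A)"
  by unfold_locales (simp_all add: vf_id_def G extend[OF A.vcmp_vid_left] extend[OF A.vcmp_vid_right])
  moreover have "is_iso (und V A) (fo (vf_id V A) x, fo G x, vid A x)" if "x : vob A" for x
  using A.und.is_iso_idn[of x] that G by (simp add: vf_id_def)
  ultimately show ?thesis unfolding vnat_isomorphic_def by blast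
 qed
 obtain i where i': "!!x y. x : vob X ==> y : vob X ==> i x y : hom V (vhom X x y) (vhom Y (fi x) (fi y)) & fm W (fi x) (fi y) $ i x y = fm U x y"
  using i by metis
 obtain j where j': "!!x y. x : vob X ==> y : vob X ==> j x y : hom V (vhom Y (fi x) (fi y)) (vhom X x y) & fm U x y $ j x y = fm W (fi x) (fi y)"
  using j by metis
 define F where "F = \<lparr>fo = fi, fm = i\<rparr>"
 define G where "G = \<lparr>fo = ps, fm = (%x y. j (ps x) (ps y))\<rparr>"
 have F: "vfunctor V X Y F" unfolding F_def
  by (rule lift[of X U Y W]) (use fi i' mono_W in \<open>auto intro: U.enriched_functor_axioms W.enriched_functor_axioms\<close>)
 have fips: "fo U (ps y) = fo W y" if "y : vob Y" for y using fi[of "ps y"] ps[OF that] by simp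
 have G: "vfunctor V Y X G" unfolding G_def
 proof (rule lift[of Y W X U])
  fix x y assume "x : vob Y" "y : vob Y"
  then show "j (ps x) (ps y) : hom V (vhom Y x y) (vhom X (ps x) (ps y)) & fm U (ps x) (ps y) $ j (ps x) (ps y) = fm W x y"
  using j'[of "ps x" "ps y"] ps by simp
 qed (use ps fips mono_U in \<open>auto intro: U.enriched_functor_axioms W.enriched_functor_axioms\<close>)
 have ji: "j x y $ i x y = idn V (vhom X x y)" if "x : vob X" "y : vob X" for x y
 proof (rule is_monoD[OF mono_U[OF that]])
  note [simp] = i'[OF that, simplified] j'[OF that, simplified]
  have "fm U x y $ j x y $ i x y = (fm U x y $ j x y) $ i x y"
  using that by (intro assoc[symmetric]) auto
  also have "... = fm U x y $ idn V (vhom X x y)" using that by simp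
  finally show "fm U x y $ j x y $ i x y = fm U x y $ idn V (vhom X x y)" .
 qed (use that i'[OF that] j'[OF that] in auto)
 have ij: "i x y $ j x y = idn V (vhom Y (fi x) (fi y))" if "x : vob X" "y : vob X" for x y
 proof (rule is_monoD[OF mono_W[of "fi x" "fi y"]])
  note [simp] = i'[OF that, simplified] j'[OF that, simplified]
  have "fm W (fi x) (fi y) $ i x y $ j x y = (fm W (fi x) (fi y) $ i x y) $ j x y"
  using that fi by (intro assoc[symmetric]) auto
  also have "... = fm W (fi x) (fi y) $ idn V (vhom Y (fi x) (fi y))" using that fi by simp
  finally show "fm W (fi x) (fi y) $ i x y $ j x y = fm W (fi x) (fi y) $ idn V (vhom Y (fi x) (fi y))" .
 qed (use that fi i'[OF that] j'[OF that] in auto)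
 have "vf_eq X (vf_cmp V F W) U" "vf_eq Y (vf_cmp V G U) W"
  using fi ps fips i' j' by (auto simp: vf_eq_def vf_cmp_def F_def G_def)
 moreover have "vnat_isomorphic V X X (vf_id V X) (vf_cmp V F G)"
  by (rule vnat_id[OF X(1)]) (use fi ji in \<open>auto simp: vf_cmp_def F_def G_def\<close>)
 moreover have "vnat_isomorphic V Y Y (vf_id V Y) (vf_cmp V G F)"
  by (rule vnat_id[OF Y(1)]) (use ps ij in \<open>auto simp: vf_cmp_def F_def G_def\<close>)
 ultimately show ?thesis
  unfolding concretely_equivalent_def using X Y F G by blast
qed

end

section \<open>Enriched monads and their algebras\<close>

locale enriched_monad = enriched V K + vmonad V K T
 for V :: "('o, 'a, 'z) smc_scheme" (structure) and K :: "('k, 'o, 'a) vcat" and T :: "('k, 'a) vmnd"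
begin

abbreviation "Kh \<equiv> vhom K"
abbreviation "Kpo \<equiv> vpost V K"
abbreviation "Kpe \<equiv> vpre V K"
abbreviation "Tm \<equiv> fm (mfun T)"
abbreviation "is_EM \<equiv> is_EM_algebra V K T"

sublocale T: enriched_functor V K K "mfun T"
 by (intro enriched_functor.intro enriched_axioms mfun_vfunctor)

lemma vfunctor_id: "vfunctor V K K (vf_id V K)"
 by unfold_locales (simp_all add: vf_id_def)

lemma vfunctor_TT: "vfunctor V K K (vf_cmp V (mfun T) (mfun T))"
proof
 fix a b c assume abc: "a : vob K" "b : vob K" "c : vob K"
 have "Tm (mob T a) (mob T c) $ Tm a c $ vcmp K a b c
  = Tm (mob T a) (mob T c) $ vcmp K (mob T a) (mob T b) (mob T c) $ (Tm b c ** Tm a b)"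
  using abc T.fm_vcmp by simp
 also have "... = vcmp K (mob T (mob T a)) (mob T (mob T b)) (mob T (mob T c))
  $ ((Tm (mob T b) (mob T c) $ Tm b c) ** (Tm (mob T a) (mob T b) $ Tm a b))"
  using abc by (subst T.fm_vcmp_elt) simp_all
 finally show "fm (vf_cmp V (mfun T) (mfun T)) a c $ vcmp K a b c =
  vcmp K (fo (vf_cmp V (mfun T) (mfun T)) a) (fo (vf_cmp V (mfun T) (mfun T)) b) (fo (vf_cmp V (mfun T) (mfun T)) c)
  $ (fm (vf_cmp V (mfun T) (mfun T)) b c ** fm (vf_cmp V (mfun T) (mfun T)) a b)"
  using abc by (simp add: vf_cmp_def)
qed (simp_all add: vf_cmp_def T.fm_vid)

lemma unit_mult_arr [simp]:
 assumes "a : vob K"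
 shows "munit T a : ar V" "dm V (munit T a) = unt V" "cd V (munit T a) = Kh a (mob T a)"
  "mmult T a : ar V" "dm V (mmult T a) = unt V" "cd V (mmult T a) = Kh (mob T (mob T a)) (mob T a)"
 using vnat.component_hom[OF munit_vnat assms] vnat.component_hom[OF mmult_vnat assms]
 by (auto simp: vf_id_def vf_cmp_def)

lemma unit_natural:
 assumes "a : vob K" "b : vob K"
 shows "Kpo a (munit_ar T b) = Kpe (munit_ar T a) (mob T b) $ Tm a b"
 using vnat_vpost_vpre[OF enriched_functorI[OF enriched_axioms enriched_axioms vfunctor_id] T.enriched_functor_axioms munit_vnat assms] assms
 by (simp add: vf_id_def)

lemma mult_natural:
 assumes "a : vob K" "b : vob K"
 shows "Kpo (mob T (mob T a)) (mmult_ar T b) $ Tm (mob T a) (mob T b) $ Tm a b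
  = Kpe (mmult_ar T a) (mob T b) $ Tm a b"
 using vnat_vpost_vpre[OF enriched_functorI[OF enriched_axioms enriched_axioms vfunctor_TT] T.enriched_functor_axioms mmult_vnat assms] assms
 by (simp add: vf_cmp_def)

lemma free_algebra: "a : vob K ==> is_EM (mob T a, mmult T a)"
 using mmult_assoc mmult_munit_left by (simp add: is_EM_algebra_def)

lemma EM_algebraD:
 assumes "is_EM (x, h)"
 shows "x : vob K" "h : ar V" "dm V h = unt V" "cd V h = Kh (mob T x) x"
  "Kpo x (mob T x, x, h) $ munit T x = vid K x"
  "Kpo (mob T (mob T x)) (mob T x, x, h) $ Tm (mob T x) x $ h
  = Kpo (mob T (mob T x)) (mob T x, x, h) $ mmult T x"
proof -
 show "x : vob K" "h : ar V" "dm V h = unt V" "cd V h = Kh (mob T x) x"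
  using assms by (auto simp: is_EM_algebra_def)
 note [simp] = this
 show "Kpo x (mob T x, x, h) $ munit T x = vid K x"
  "Kpo (mob T (mob T x)) (mob T x, x, h) $ Tm (mob T x) x $ h
  = Kpo (mob T (mob T x)) (mob T x, x, h) $ mmult T x"
  using assms by (auto simp: is_EM_algebra_def)
qed

text \<open>The extension operator \<open>K(a, x) \<rightarrow> K(T a, x)\<close>, \<open>f \<mapsto> h \<circ> T f\<close>, of an algebra \<open>(x, h)\<close>.\<close>

definition ext :: "'k => 'k \<times> 'a => 'a" where
 "ext a X = Kpo (mob T a) (alg_ar T X) $ Tm a (fst X)"

lemma ext_simps [simp]:
 assumes "a : vob K" "is_EM X"
 shows "ext a X : ar V" "dm V (ext a X) = Kh a (fst X)" "cd V (ext a X) = Kh (mob T a) (fst X)"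
proof -
 obtain x h where X: "X = (x, h)" by force
 note [simp] = EM_algebraD(1-4)[OF assms(2)[unfolded X]] assms(1)
 show "ext a X : ar V" "dm V (ext a X) = Kh a (fst X)" "cd V (ext a X) = Kh (mob T a) (fst X)"
  by (simp_all add: ext_def X)
qed

text \<open>h . T f . eta = h . eta . f = f, by naturality of the unit and the unit law of the
  algebra. Thus \<open>ext\<close> is a split mono, with restriction along the unit as
  retraction.\<close>

lemma ext_retract:
 assumes "a : vob K" "is_EM X"
 shows "Kpe (munit_ar T a) (fst X) $ ext a X = idn V (Kh a (fst X))"
proof -
 obtain x h where X: "X = (x, h)" by force
 note [simp] = EM_algebraD(1-4)[OF assms(2)[unfolded X]] assms(1)
 have "Kpe (munit_ar T a) x $ ext a X
  = (Kpe (munit_ar T a) x $ Kpo (mob T a) (mob T x, x, h)) $ Tm a x"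
  by (simp add: ext_def X)
 also have "... = Kpo a (mob T x, x, h) $ Kpo a (munit_ar T x)"
  by (simp add: vpost_vpre[symmetric] unit_natural)
 also have "... = Kpo a (x, x, Kpo x (mob T x, x, h) $ munit T x)"
  by (subst vpost_cmp) simp_all
 finally show ?thesis using EM_algebraD(5)[OF assms(2)[unfolded X]] X by simp
qed

text \<open>Functoriality of T, associativity of the algebra and naturality of the multiplication
  make every extension a homomorphism on the free algebra.\<close>

lemma ext_homomorphic:
 assumes "a : vob K" "is_EM X"
 shows "Kpo (mob T (mob T a)) (alg_ar T X) $ Tm (mob T a) (fst X) $ ext a X
  = Kpe (mmult_ar T a) (fst X) $ ext a X"
proof -
 obtain x h where X: "X = (x, h)" by force
 note [simp] = EM_algebraD(1-4)[OF assms(2)[unfolded X]] assms(1)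
 let ?TT = "mob T (mob T a)" and ?h = "(mob T x, x, h)"
 have "Kpo ?TT ?h $ Tm (mob T a) x $ Kpo (mob T a) ?h $ Tm a x
  = Kpo ?TT ?h $ Kpo ?TT (mob T (mob T x), mob T x, Tm (mob T x) x $ h)
  $ Tm (mob T a) (mob T x) $ Tm a x"
  by (subst extend[OF T.fm_vpost]) simp_all
 also have "... = Kpo ?TT (mob T (mob T x), x, Kpo (mob T (mob T x)) ?h $ Tm (mob T x) x $ h)
  $ Tm (mob T a) (mob T x) $ Tm a x"
  by (subst vpost_cmp) simp_all
 also have "... = Kpo ?TT (mob T (mob T x), x, Kpo (mob T (mob T x)) ?h $ mmult T x)
  $ Tm (mob T a) (mob T x) $ Tm a x"
  by (simp add: EM_algebraD(6)[OF assms(2)[unfolded X]])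
 also have "... = Kpo ?TT ?h $ Kpo ?TT (mmult_ar T x) $ Tm (mob T a) (mob T x) $ Tm a x"
  by (subst vpost_cmp) simp_all
 also have "... = (Kpo ?TT ?h $ Kpe (mmult_ar T a) (mob T x)) $ Tm a x"
  by (simp add: mult_natural)
 also have "... = Kpe (mmult_ar T a) x $ Kpo (mob T a) ?h $ Tm a x"
  by (subst vpost_vpre) simp_all
 finally show ?thesis by (simp add: ext_def X)
qed

lemma mult_unit_right:
 assumes "a : vob K"
 shows "Kpo (mob T a) (mmult_ar T a) $ Tm a (mob T a) $ munit T a = vid K (mob T a)"
 using mmult_munit_right[OF assms] assms by simp

text \<open>A homomorphism out of a free algebra is the extension of its restriction along the unit:
  the homomorphism equation moves the structure map past \<open>t\<close>, and the right unit law of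
  the monad finishes.\<close>

lemma ext_factor:
 assumes "a : vob K" "is_EM X" "t : ar V" "cd V t = Kh (mob T a) (fst X)"
  "Kpo (mob T (mob T a)) (alg_ar T X) $ Tm (mob T a) (fst X) $ t = Kpe (mmult_ar T a) (fst X) $ t"
 shows "ext a X $ Kpe (munit_ar T a) (fst X) $ t = t"
proof -
 obtain x h where X: "X = (x, h)" by force
 note [simp] = EM_algebraD(1-4)[OF assms(2)[unfolded X]] assms(1,3)
 have t [simp]: "cd V t = Kh (mob T a) x" using assms(4) X by simp
 let ?h = "(mob T x, x, h)" and ?Te = "(mob T a, mob T (mob T a), Tm a (mob T a) $ munit T a)"
 have "ext a X $ Kpe (munit_ar T a) x $ t
  = Kpo (mob T a) ?h $ Kpe ?Te (mob T x) $ Tm (mob T a) x $ t"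
  unfolding ext_def X by (simp, subst extend[OF T.fm_vpre]) simp_all
 also have "... = (Kpo (mob T a) ?h $ Kpe ?Te (mob T x)) $ Tm (mob T a) x $ t"
  by simp
 also have "... = Kpe ?Te x $ Kpo (mob T (mob T a)) ?h $ Tm (mob T a) x $ t"
  by (subst vpost_vpre) simp_all
 also have "... = Kpe ?Te x $ Kpe (mmult_ar T a) x $ t"
  using assms(5) X by simp
 also have "... = Kpe (mob T a, mob T a, Kpo (mob T a) (mmult_ar T a) $ Tm a (mob T a) $ munit T a) x $ t"
  by (subst vpre_cmp) simp_all
 finally show ?thesis using X by (simp add: mult_unit_right)
qed

text \<open>The universal property of free algebras, for hom-objects: \<open>ext_factor\<close>
  gives existence of the factorization, the retraction of \<open>ext\<close> its uniqueness.\<close>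

lemma is_equalizer_ext:
 assumes "a : vob K" "is_EM X"
 shows "is_equalizer V (Kpo (mob T (mob T a)) (alg_ar T X) $ Tm (mob T a) (fst X))
  (Kpe (mmult_ar T a) (fst X)) (ext a X)"
proof -
 obtain x h where X: "X = (x, h)" by force
 note [simp] = EM_algebraD(1-4)[OF assms(2)[unfolded X]] assms(1)
 have [simp]: "is_EM (x, h)" using assms(2) X by simp
 let ?f = "Kpo (mob T (mob T a)) (mob T x, x, h) $ Tm (mob T a) x"
 have ret: "Kpe (munit_ar T a) x $ ext a (x, h) = idn V (Kh a x)"
  using ext_retract[OF assms] X by simp
 have eq: "?f $ ext a (x, h) = Kpe (mmult_ar T a) x $ ext a (x, h)"
  using ext_homomorphic[OF assms] X by simp
 have "EX! u. u : hom V (dm V t) (Kh a x) & ext a (x, h) $ u = t"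
  if t: "t : ar V" "cd V t = Kh (mob T a) x" "?f $ t = Kpe (mmult_ar T a) x $ t" for t
 proof (rule ex1I[of _ "Kpe (munit_ar T a) x $ t"])
  show "Kpe (munit_ar T a) x $ t : hom V (dm V t) (Kh a x) & ext a (x, h) $ Kpe (munit_ar T a) x $ t = t"
  using ext_factor[OF assms, of t] t X by simp
  fix u assume u: "u : hom V (dm V t) (Kh a x) & ext a (x, h) $ u = t"
  then have "Kpe (munit_ar T a) x $ t = (Kpe (munit_ar T a) x $ ext a (x, h)) $ u" by auto
  then show "u = Kpe (munit_ar T a) x $ t" using u by (simp add: ret)
 qed
 then have "ALL t:ar V. cd V t = dm V ?f & ?f $ t = Kpe (mmult_ar T a) x $ t -->
  (EX! u. u : hom V (dm V t) (dm V (ext a (x, h))) & ext a (x, h) $ u = t)"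
  by (intro ballI impI, elim conjE) simp
 then show ?thesis unfolding X is_equalizer_def using eq by simp
qed


subsection \<open>Categories of algebras\<close>

text \<open>
 A \<open>V\<close>-category of algebras, for a family of algebras and a choice of equalizers that define the
 hom-objects. The Eilenberg-Moore category and the Kleisli category are both of this form: between a
 free algebra and an arbitrary algebra, \<^const>\<open>ext\<close> is such an equalizer.
\<close>

definition is_algebra_family :: "'i set => ('i => 'k \<times> 'a) => ('i => 'i => 'a) => bool" where
 "is_algebra_family O' alg e \<longleftrightarrow> (ALL i:O'. is_EM (alg i)) &
  (ALL i:O'. ALL j:O'. is_equalizer V
  (Kpo (mob T (fst (alg i))) (alg_ar T (alg j)) $ Tm (fst (alg i)) (fst (alg j)))
  (Kpe (alg_ar T (alg i)) (fst (alg j))) (e i j))"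

definition algebra_vcat :: "'i set => ('i => 'k \<times> 'a) => ('i => 'i => 'a) => ('i, 'o, 'a) vcat" where
 "algebra_vcat O' alg e = \<lparr>vob = O', vhom = (%x y. dm V (e x y)),
  vid = (%x. THE u. u : hom V (unt V) (dm V (e x x)) & e x x $ u = vid K (fst (alg x))),
  vcmp = (%x y z. THE u.
  u : hom V (dm V (e y z) @@ dm V (e x y)) (dm V (e x z)) &
  e x z $ u = vcmp K (fst (alg x)) (fst (alg y)) (fst (alg z)) $ (e y z ** e x y))\<rparr>"

lemma algebra_vcat_simps [simp]:
 "vob (algebra_vcat O' alg e) = O'" "vhom (algebra_vcat O' alg e) x y = dm V (e x y)"
 by (simp_all add: algebra_vcat_def)

lemma is_algebra_familyD:
 assumes "is_algebra_family O' alg e" "i : O'" "j : O'"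
 shows "fst (alg i) : vob K" "e i j : ar V" "cd V (e i j) = Kh (fst (alg i)) (fst (alg j))"
  "Kpo (mob T (fst (alg i))) (alg_ar T (alg j)) $ Tm (fst (alg i)) (fst (alg j)) $ e i j
  = Kpe (alg_ar T (alg i)) (fst (alg j)) $ e i j"
  "is_mono V (e i j)"
proof -
 obtain x h y k where xy: "alg i = (x, h)" "alg j = (y, k)" by force
 have alg: "is_EM (x, h)" "is_EM (y, k)"
  using assms xy unfolding is_algebra_family_def by metis+
 note [simp] = xy EM_algebraD(1-4)[OF alg(1)] EM_algebraD(1-4)[OF alg(2)]
 have eq: "is_equalizer V (Kpo (mob T x) (mob T y, y, k) $ Tm x y)
  (Kpe (mob T x, x, h) y) (e i j)"
  using assms unfolding is_algebra_family_def by fastforce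
 show "fst (alg i) : vob K" by simp
 show e: "e i j : ar V" "cd V (e i j) = Kh (fst (alg i)) (fst (alg j))"
  using eq by (auto simp: is_equalizer_def)
 show "Kpo (mob T (fst (alg i))) (alg_ar T (alg j)) $ Tm (fst (alg i)) (fst (alg j)) $ e i j
  = Kpe (alg_ar T (alg i)) (fst (alg j)) $ e i j"
  using eq e by (simp add: is_equalizer_def)
 show "is_mono V (e i j)" by (rule equalizer_mono[OF eq]) simp_all
qed

lemma is_algebra_family_factor:
 assumes "is_algebra_family O' alg e" "i : O'" "j : O'" "t : hom V z (Kh (fst (alg i)) (fst (alg j)))"
  "Kpo (mob T (fst (alg i))) (alg_ar T (alg j)) $ Tm (fst (alg i)) (fst (alg j)) $ t
  = Kpe (alg_ar T (alg i)) (fst (alg j)) $ t"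
 shows "EX! u. u : hom V z (dm V (e i j)) & e i j $ u = t"
proof -
 obtain x h y k where xy: "alg i = (x, h)" "alg j = (y, k)" by force
 have alg: "is_EM (x, h)" "is_EM (y, k)"
  using assms xy unfolding is_algebra_family_def by metis+
 note [simp] = xy EM_algebraD(1-4)[OF alg(1)] EM_algebraD(1-4)[OF alg(2)]
 have eq: "is_equalizer V (Kpo (mob T x) (mob T y, y, k) $ Tm x y)
  (Kpe (mob T x, x, h) y) (e i j)"
  using assms unfolding is_algebra_family_def by fastforce
 then have "t : ar V & cd V t = dm V (Kpo (mob T x) (mob T y, y, k) $ Tm x y) &
  (Kpo (mob T x) (mob T y, y, k) $ Tm x y) $ t = Kpe (mob T x, x, h) y $ t ==>
  EX! u. u : hom V (dm V t) (dm V (e i j)) & e i j $ u = t"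
  unfolding is_equalizer_def by blast
 then show ?thesis using assms(4,5) by simp
qed

text \<open>Identities and composites of K satisfy the homomorphism equation and so factor through
  the equalizers; these factorizations are what the definite descriptions in
  \<open>algebra_vcat\<close> pick out.\<close>

lemma algebra_vcat_structure:
 assumes fam: "is_algebra_family O' alg e" and xyz: "x : O'" "y : O'" "z : O'"
 shows "vid (algebra_vcat O' alg e) x : hom V (unt V) (dm V (e x x)) &
  e x x $ vid (algebra_vcat O' alg e) x = vid K (fst (alg x))" (is ?id)
  and "vcmp (algebra_vcat O' alg e) x y z : hom V (dm V (e y z) @@ dm V (e x y)) (dm V (e x z)) &
  e x z $ vcmp (algebra_vcat O' alg e) x y z
  = vcmp K (fst (alg x)) (fst (alg y)) (fst (alg z)) $ (e y z ** e x y)" (is ?cmp)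
proof -
 obtain X h Y k Z l where alg: "alg x = (X, h)" "alg y = (Y, k)" "alg z = (Z, l)" by force
 have EM: "is_EM (X, h)" "is_EM (Y, k)" "is_EM (Z, l)"
  using fam xyz alg unfolding is_algebra_family_def by metis+
 note [simp] = alg EM_algebraD(1-4)[OF EM(1)] EM_algebraD(1-4)[OF EM(2)] EM_algebraD(1-4)[OF EM(3)]
  is_algebra_familyD(2,3)[OF fam xyz(1,1)] is_algebra_familyD(2,3)[OF fam xyz(1,2)] is_algebra_familyD(2,3)[OF fam xyz(2,3)]
 have "Kpo (mob T X) (mob T X, X, h) $ Tm X X $ vid K X = Kpe (mob T X, X, h) X $ vid K X"
  using vpre_elt[of "mob T X" X h X "vid K X"]
  und.idr[of "(mob T X, X, h)" "mob T X"] by (simp add: T.fm_vid)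
 then have "EX! u. u : hom V (unt V) (dm V (e x x)) & e x x $ u = vid K (fst (alg x))"
  by (intro is_algebra_family_factor[OF fam]) (use xyz in simp_all)
 from theI'[OF this] show ?id by (simp add: algebra_vcat_def)
 have h1: "Kpo (mob T X) (mob T Y, Y, k) $ Tm X Y $ e x y = Kpe (mob T X, X, h) Y $ e x y"
  using is_algebra_familyD(4)[OF fam xyz(1,2)] by simp
 have h2: "Kpo (mob T Y) (mob T Z, Z, l) $ Tm Y Z $ e y z = Kpe (mob T Y, Y, k) Z $ e y z"
  using is_algebra_familyD(4)[OF fam xyz(2,3)] by simp
 let ?c = "vcmp K X Y Z $ (e y z ** e x y)"
 have "Kpo (mob T X) (mob T Z, Z, l) $ Tm X Z $ ?c
  = Kpo (mob T X) (mob T Z, Z, l) $ vcmp K (mob T X) (mob T Y) (mob T Z) $ ((Tm Y Z $ e y z) ** (Tm X Y $ e x y))"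
  by (subst T.fm_vcmp_elt) simp_all
 also have "... = vcmp K (mob T X) (mob T Y) Z $ ((Kpe (mob T Y, Y, k) Z $ e y z) ** (Tm X Y $ e x y))"
  by (subst vpost_vcmp) (simp_all add: h2)
 also have "... = vcmp K (mob T X) Y Z $ (e y z ** (Kpe (mob T X, X, h) Y $ e x y))"
  by (subst vpre_vpost_vcmp) (simp_all add: h1)
 also have "... = Kpe (mob T X, X, h) Z $ ?c"
  by (subst vpre_vcmp) simp_all
 finally have "EX! u. u : hom V (dm V (e y z) @@ dm V (e x y)) (dm V (e x z)) &
  e x z $ u = vcmp K (fst (alg x)) (fst (alg y)) (fst (alg z)) $ (e y z ** e x y)"
  by (intro is_algebra_family_factor[OF fam]) (use xyz in simp_all)
 from theI'[OF this] show ?cmp by (simp add: algebra_vcat_def)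
qed

lemma vcategory_algebra_vcat:
 assumes fam: "is_algebra_family O' alg e"
 shows "vcategory V (algebra_vcat O' alg e)"
  "vfunctor V (algebra_vcat O' alg e) K \<lparr>fo = %x. fst (alg x), fm = e\<rparr>"
proof -
 have "vcategory V (algebra_vcat O' alg e) & vfunctor V (algebra_vcat O' alg e) K \<lparr>fo = %x. fst (alg x), fm = e\<rparr>"
  by (intro conjI faithful_vcategory[where U = "\<lparr>fo = %x. fst (alg x), fm = e\<rparr>"])
  (use is_algebra_familyD[OF fam] algebra_vcat_structure[OF fam] in auto)
 then show "vcategory V (algebra_vcat O' alg e)"
  "vfunctor V (algebra_vcat O' alg e) K \<lparr>fo = %x. fst (alg x), fm = e\<rparr>" by auto
qed

lemma EM_eq_algebra_vcat: "EM V K T = algebra_vcat {x. is_EM x} (%x. x) (EM_hom V K T)"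
 by (simp add: EM_def algebra_vcat_def)

text \<open>\<open>EM_hom\<close> is a choice that is meaningful only if these equalizers exist. The
  predicate records this until limits in V are available.\<close>

definition EM_equalizers :: bool where
 "EM_equalizers \<longleftrightarrow> (ALL x y. is_EM x --> is_EM y --> (EX e. is_equalizer V
  (Kpo (mob T (fst x)) (alg_ar T y) $ Tm (fst x) (fst y))
  (Kpe (alg_ar T x) (fst y)) e))"

lemma EM_family:
 assumes "EM_equalizers"
 shows "is_algebra_family {x. is_EM x} (%x. x) (EM_hom V K T)"
 unfolding is_algebra_family_def
proof (intro conjI ballI)
 fix x y assume "x : {x. is_EM x}" "y : {x. is_EM x}"
 then have "EX e. is_equalizer V (Kpo (mob T (fst x)) (alg_ar T y) $ Tm (fst x) (fst y))
  (Kpe (alg_ar T x) (fst y)) e" using assms unfolding EM_equalizers_def by blast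
 then show "is_equalizer V (Kpo (mob T (fst x)) (alg_ar T y) $ Tm (fst x) (fst y))
  (Kpe (alg_ar T x) (fst y)) (EM_hom V K T x y)"
  unfolding EM_hom_def by (rule someI_ex)
qed simp

text \<open>
 The Kleisli category and the Eilenberg-Moore category glued along the hom-objects
 \<open>K(a, x) \<cong> EM(T a, x)\<close>; the summand \<open>Inl\<close> is the Kleisli category.
\<close>

definition collage_alg :: "'k + 'k \<times> 'a => 'k \<times> 'a" where
 "collage_alg i = (case i of Inl a => (mob T a, mmult T a) | Inr x => x)"

definition collage_hom :: "'k + 'k \<times> 'a => 'k + 'k \<times> 'a => 'a" where
 "collage_hom i j = (case i of Inl a => ext a (collage_alg j) | Inr x => EM_hom V K T x (collage_alg j))"

definition collage :: "('k + 'k \<times> 'a, 'o, 'a) vcat" where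
 "collage = algebra_vcat (vob K <+> {x. is_EM x}) collage_alg collage_hom"

lemma collage_alg_EM: "i : vob K <+> {x. is_EM x} ==> is_EM (collage_alg i)"
 by (auto simp: collage_alg_def free_algebra)

lemma collage_family:
 assumes "EM_equalizers"
 shows "is_algebra_family (vob K <+> {x. is_EM x}) collage_alg collage_hom"
 unfolding is_algebra_family_def
proof (intro conjI ballI)
 fix i j assume ij: "i : vob K <+> {x. is_EM x}" "j : vob K <+> {x. is_EM x}"
 note j = collage_alg_EM[OF ij(2)]
 show "is_equalizer V
  (Kpo (mob T (fst (collage_alg i))) (alg_ar T (collage_alg j)) $ Tm (fst (collage_alg i)) (fst (collage_alg j)))
  (Kpe (alg_ar T (collage_alg i)) (fst (collage_alg j))) (collage_hom i j)"
 proof (cases i)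
  case (Inl a)
  then have "a : vob K" using ij by auto
  from is_equalizer_ext[OF this j] show ?thesis by (simp add: Inl collage_hom_def collage_alg_def)
 next
  case (Inr x)
  then have "x : {x. is_EM x}" using ij by auto
  moreover have "collage_alg j : {x. is_EM x}" using j by simp
  ultimately have "is_equalizer V
  (Kpo (mob T (fst x)) (alg_ar T (collage_alg j)) $ Tm (fst x) (fst (collage_alg j)))
  (Kpe (alg_ar T x) (fst (collage_alg j))) (EM_hom V K T x (collage_alg j))"
  using EM_family[OF assms] unfolding is_algebra_family_def by blast
  moreover have "collage_alg i = x" "collage_hom i j = EM_hom V K T x (collage_alg j)"
  by (simp_all add: Inr collage_hom_def collage_alg_def)
  ultimately show ?thesis by (simp only:)
 qed
qed (rule collage_alg_EM)

lemma enriched_collage: "EM_equalizers ==> enriched V collage"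
 unfolding collage_def by (intro enrichedI vcategory_algebra_vcat(1) collage_family)

lemma collage_simps [simp]:
 "vob collage = vob K <+> {x. is_EM x}"
 "a : vob K ==> j : vob K <+> {x. is_EM x} ==> vhom collage (Inl a) j = Kh a (fst (collage_alg j))"
 using collage_alg_EM[of j] by (simp_all add: collage_def collage_hom_def)

text \<open>Kleisli identities are the units of the monad: the identity of the free algebra is
  carried back along the retraction of \<open>ext\<close>.\<close>

lemma collage_vid:
 assumes "EM_equalizers" "a : vob K"
 shows "vid collage (Inl a) = munit T a"
proof -
 let ?O = "vob K <+> {x. is_EM x}" and ?X = "(mob T a, mmult T a)"
 note [simp] = assms(2) free_algebra[OF assms(2)]
 have e: "collage_hom (Inl a) (Inl a) = ext a ?X" by (simp add: collage_hom_def collage_alg_def)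
 have id: "vid collage (Inl a) : hom V (unt V) (Kh a (mob T a))" "ext a ?X $ vid collage (Inl a) = vid K (mob T a)"
  using algebra_vcat_structure(1)[OF collage_family[OF assms(1)] InlI InlI InlI, OF assms(2,2,2)]
  by (simp_all add: collage_def[symmetric] e) (simp add: collage_alg_def)
 have "vid collage (Inl a) = (Kpe (munit_ar T a) (fst ?X) $ ext a ?X) $ vid collage (Inl a)"
  using id(1) by (subst ext_retract) simp_all
 also have "... = Kpe (munit_ar T a) (mob T a) $ vid K (mob T a)"
  using id by simp
 also have "... = munit T a" by (subst vpre_elt) simp_all
 finally show ?thesis .
qed

text \<open>Kleisli composition extends the outer arrow and then composes in K. Applying the
  retraction of \<open>ext\<close> at \<open>b\<close> cancels the extension of the inner
  arrow.\<close>

lemma collage_vcmp: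
 assumes "EM_equalizers" "a : vob K" "b : vob K" "j : vob K <+> {x. is_EM x}"
 shows "vcmp collage (Inl b) (Inl a) j
  = vcmp K b (mob T a) (fst (collage_alg j)) $ (ext a (collage_alg j) ** idn V (Kh b (mob T a)))"
proof -
 let ?O = "vob K <+> {x. is_EM x}" and ?X = "collage_alg j" and ?A = "(mob T a, mmult T a)"
 have X [simp]: "is_EM ?X" by (rule collage_alg_EM[OF assms(4)])
 have x [simp]: "fst ?X : vob K" using X by (simp add: is_EM_algebra_def)
 note [simp] = assms(2,3) free_algebra[OF assms(2)]
 have e: "collage_hom (Inl b) j = ext b ?X" "collage_hom (Inl a) j = ext a ?X" "collage_hom (Inl b) (Inl a) = ext b ?A"
  by (simp_all add: collage_hom_def collage_alg_def)
 let ?u = "vcmp collage (Inl b) (Inl a) j"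
 have u: "?u : hom V (Kh a (fst ?X) @@ Kh b (mob T a)) (Kh b (fst ?X))"
  "ext b ?X $ ?u = vcmp K (mob T b) (mob T a) (fst ?X) $ (ext a ?X ** ext b ?A)"
  using algebra_vcat_structure(2)[OF collage_family[OF assms(1)] InlI InlI assms(4), OF assms(3,2)]
  by (simp_all add: collage_def[symmetric] e) (simp add: collage_alg_def)
 have "?u = (Kpe (munit_ar T b) (fst ?X) $ ext b ?X) $ ?u"
  using u(1) by (subst ext_retract) simp_all
 also have "... = Kpe (munit_ar T b) (fst ?X) $ vcmp K (mob T b) (mob T a) (fst ?X) $ (ext a ?X ** ext b ?A)"
  using u by simp
 also have "... = vcmp K b (mob T a) (fst ?X) $ (ext a ?X ** (Kpe (munit_ar T b) (fst ?A) $ ext b ?A))"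
  by (subst vpre_vcmp) simp_all
 also have "... = vcmp K b (mob T a) (fst ?X) $ (ext a ?X ** idn V (Kh b (mob T a)))"
  by (subst ext_retract) simp_all
 finally show ?thesis .
qed

end

section \<open>Conical colimits from weighted colimits\<close>

definition is_initial :: "('o, 'a, 'z) cat_scheme => 'o => bool" where
 "is_initial C z \<longleftrightarrow> z : ob C & (ALL y:ob C. EX! u. u : hom C z y)"

lemma initial_eq:
 assumes "is_initial C z" "f : hom C z y" "g : hom C z y" "y : ob C"
 shows "f = g"
 using assms unfolding is_initial_def by blast

definition from_initial :: "('o, 'a, 'z) cat_scheme => 'o => 'o => 'a" where
 "from_initial C z y = (THE u. u : hom C z y)"

lemma from_initial_hom: "is_initial C z ==> y : ob C ==> from_initial C z y : hom C z y"
 unfolding is_initial_def from_initial_def by (metis theI')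

lemma from_initial_simps [simp]:
 assumes "is_initial C z" "y : ob C"
 shows "from_initial C z y : ar C" "dm C (from_initial C z y) = z" "cd C (from_initial C z y) = y"
 using from_initial_hom[OF assms] by auto

lemma poset_cat_simps [simp]:
 "ob (poset_cat I le) = I" "dm (poset_cat I le) = fst" "cd (poset_cat I le) = snd"
 "idn (poset_cat I le) = (%i. (i, i))" "g $\<^bsub>poset_cat I le\<^esub> f = (fst f, snd g)"
 "(i, j) : ar (poset_cat I le) \<longleftrightarrow> i : I & j : I & (i, j) : le"
 by (auto simp: poset_cat_def)

lemma cat_op_simps [simp]:
 "ob (cat_op C) = ob C" "ar (cat_op C) = ar C" "dm (cat_op C) = cd C" "cd (cat_op C) = dm C"
 "idn (cat_op C) = idn C" "g $\<^bsub>cat_op C\<^esub> f = f $\<^bsub>C\<^esub> g"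
 by (auto simp: cat_op_def)

lemma cat_functor_posetD:
 assumes "cat_functor (poset_cat I le) C D"
 shows "i : I ==> oo D i : ob C"
  "i : I ==> j : I ==> (i, j) : le ==> oa D (i, j) : hom C (oo D i) (oo D j)"
  "i : I ==> oa D (i, i) = idn C (oo D i)"
  "i : I ==> j : I ==> k : I ==> (i, j) : le ==> (j, k) : le ==> oa D (i, k) = oa D (j, k) $\<^bsub>C\<^esub> oa D (i, j)"
proof -
 show "i : I ==> oo D i : ob C" using assms by (simp add: cat_functor_def)
 show "oa D (i, j) : hom C (oo D i) (oo D j)" if "i : I" "j : I" "(i, j) : le"
 proof -
  have "ALL f:ar (poset_cat I le). oa D f : hom C (oo D (dm (poset_cat I le) f)) (oo D (cd (poset_cat I le) f))"
  using assms unfolding cat_functor_def by blast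
  from bspec[OF this, of "(i, j)"] that show ?thesis by simp
 qed
 show "i : I ==> oa D (i, i) = idn C (oo D i)" using assms by (simp add: cat_functor_def)
 show "oa D (i, k) = oa D (j, k) $\<^bsub>C\<^esub> oa D (i, j)"
  if "i : I" "j : I" "k : I" "(i, j) : le" "(j, k) : le"
 proof -
  have "ALL f:ar (poset_cat I le). ALL g:ar (poset_cat I le). dm (poset_cat I le) g = cd (poset_cat I le) f -->
  oa D (g $\<^bsub>poset_cat I le\<^esub> f) = oa D g $\<^bsub>C\<^esub> oa D f"
  using assms unfolding cat_functor_def by blast
  from bspec[OF bspec[OF this, of "(i, j)"], of "(j, k)"] that show ?thesis by simp
 qed
qed

lemma (in category) iso_epi_iff:
 assumes "is_iso C f" "g : ar C" "h : ar C" "dm C g = cd C f" "dm C h = cd C f"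
 shows "g $ f = h $ f \<longleftrightarrow> g = h"
 using iso_epi[OF assms(1) _ assms(2-5)] by blast

context symmetric_monoidal_closed
begin

text \<open>Arrows out of the tensor product transpose to arrows out of \<open>z\<close>, of which
  there is exactly one into each object.\<close>

lemma initial_tensor_left:
 assumes "is_initial V z" "x : ob V"
 shows "is_initial V (z @@ x)"
 unfolding is_initial_def
proof (intro conjI ballI ex1I)
 have z: "z : ob V" using assms by (simp add: is_initial_def)
 show "z @@ x : ob V" using z assms by simp
 fix y assume y: "y : ob V"
 show "ev V x y $ (from_initial V z (ihom V x y) ** idn V x) : hom V (z @@ x) y"
  using assms y by simp
 fix u assume u: "u : hom V (z @@ x) y"
 have "curry_ar V z x y u = from_initial V z (ihom V x y)"
  by (rule initial_eq[OF assms(1), of _ "ihom V x y"]) (use u y z assms in simp_all)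
 then show "u = ev V x y $ (from_initial V z (ihom V x y) ** idn V x)"
  using curry_hom_ev(2)[of z x y u] u y z assms by simp
qed

lemma initial_tensor_right:
 assumes "is_initial V z" "x : ob V"
 shows "is_initial V (x @@ z)"
 unfolding is_initial_def
proof (intro conjI ballI ex1I)
 have z: "z : ob V" using assms by (simp add: is_initial_def)
 show "x @@ z : ob V" using z assms by simp
 fix y assume y: "y : ob V"
 note i = initial_tensor_left[OF assms]
 show "from_initial V (z @@ x) y $ swp V x z : hom V (x @@ z) y" using i y z assms by simp
 fix u assume u: "u : hom V (x @@ z) y"
 have "u $ swp V z x = from_initial V (z @@ x) y"
  by (rule initial_eq[OF i, of _ y]) (use u y z assms i in simp_all)
 then have "(u $ swp V z x) $ swp V x z = from_initial V (z @@ x) y $ swp V x z" by simp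
 then show "u = from_initial V (z @@ x) y $ swp V x z" using u z assms by simp
qed

lemma initial_exists:
 fixes ka :: "'u rel"
 assumes "inaccessible ka" "has_weighted_colimits ka V (self V)"
 obtains z where "is_initial V z"
proof -
 \<comment> \<open>The empty V-category. Functors and weights on it carry no data, so
   \<open>undefined\<close> is one.\<close>
 let ?D = "\<lparr>vob = {}, vhom = undefined, vid = undefined, vcmp = undefined\<rparr> :: ('u, 'o, 'a) vcat"
 have "vcategory V ?D" "vfunctor V (vop V ?D) (self V) undefined" "vfunctor V ?D (self V) undefined"
  by (unfold_locales; simp)+
 moreover have "small ka (vob ?D)" by (simp add: small_finite[OF assms(1)])
 ultimately obtain c ga where c: "is_weighted_colim V ?D (self V) undefined undefined c ga"
  using assms(2) unfolding has_weighted_colimits_def by blast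
 have "EX! u. u : hom V c y" if y: "y : ob V" for y
 proof -
  have c_ob: "c : ob V" using c by (simp add: is_weighted_colim_def)
  have "EX p. is_natobj V (vop V ?D) (self V) undefined (vf_cmp V (vf_op undefined) (vrep_contra V (self V) y)) (ihom V c y) p"
  using c y unfolding is_weighted_colim_def self_simps by blast
  \<comment> \<open>Over the empty category every object is the vertex of a wedge; taking the vertex
    I shows that [c, y] has exactly one element.\<close>
  moreover have "natural_wedge V (vop V ?D) (self V) undefined (vf_cmp V (vf_op undefined) (vrep_contra V (self V) y)) (unt V) undefined"
  by (simp add: natural_wedge_def)
  ultimately obtain p where "EX! u. u : hom V (unt V) (ihom V c y) & (ALL d:vob (vop V ?D). p d $ u = undefined d)"
  unfolding is_natobj_def by blast
  then have ex: "EX! u. u : hom V (unt V) (ihom V c y)" by simp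
  show ?thesis
  proof (rule ex_ex1I)
  obtain u where "u : hom V (unt V) (ihom V c y)" using ex by blast
  then show "EX u. u : hom V c y" using c_ob y by (intro exI[of _ "named_arrow c y u"]) simp
  fix f g assume fg: "f : hom V c y" "g : hom V c y"
  then have "arrow_name f : hom V (unt V) (ihom V c y)" "arrow_name g : hom V (unt V) (ihom V c y)" by simp_all
  then have "arrow_name f = arrow_name g" using ex by blast
  then show "f = g" using fg by (rule arrow_name_inj)
  qed
 qed
 moreover have "c : ob V" using c by (simp add: is_weighted_colim_def)
 ultimately show ?thesis using that unfolding is_initial_def by blast
qed


subsection \<open>The free enriched category on a preorder\<close>

text \<open>The hom-objects of a free V-category are copowers of the unit. For a preorder these are
  the unit itself or the empty copower, the initial object \<open>z\<close>, so no coproducts are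
  needed.\<close>

definition preorder_vcat :: "'i set => 'i rel => 'o => ('i, 'o, 'a) vcat" where
 "preorder_vcat P le z = \<lparr>vob = P, vhom = (%i j. if (i, j) : le then unt V else z), vid = (%i. idn V (unt V)),
  vcmp = (%i j k. if (i, j) : le & (j, k) : le then lun V (unt V)
  else from_initial V ((if (j, k) : le then unt V else z) @@ (if (i, j) : le then unt V else z))
  (if (i, k) : le then unt V else z))\<rparr>"

lemma preorder_vcat_simps [simp]:
 "vob (preorder_vcat P le z) = P" "vhom (preorder_vcat P le z) i j = (if (i, j) : le then unt V else z)"
 "vid (preorder_vcat P le z) i = idn V (unt V)"
 by (simp_all add: preorder_vcat_def)

lemma initial_preorder_pair:
 assumes "is_initial V z" "\<not> ((i, j) : le & (j, k) : le)"
 shows "is_initial V ((if (j, k) : le then unt V else z) @@ (if (i, j) : le then unt V else z))"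
proof -
 have "z : ob V" using assms(1) by (simp add: is_initial_def)
 then show ?thesis using assms by (auto intro: initial_tensor_left initial_tensor_right)
qed

lemma vcmp_preorder_vcat:
 assumes "is_initial V z" "trans le"
 shows "vcmp (preorder_vcat P le z) i j k : ar V"
  "dm V (vcmp (preorder_vcat P le z) i j k) = (if (j, k) : le then unt V else z) @@ (if (i, j) : le then unt V else z)"
  "cd V (vcmp (preorder_vcat P le z) i j k) = (if (i, k) : le then unt V else z)"
proof -
 have z: "z : ob V" using assms(1) by (simp add: is_initial_def)
 have "vcmp (preorder_vcat P le z) i j k : hom V ((if (j, k) : le then unt V else z) @@ (if (i, j) : le then unt V else z))
  (if (i, k) : le then unt V else z)"
 proof (cases "(i, j) : le & (j, k) : le")
  case True
  then have "(i, k) : le" using assms(2) by (meson transD)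
  then show ?thesis using True by (simp add: preorder_vcat_def)
 next
  case False
  have "vcmp (preorder_vcat P le z) i j k
  = from_initial V ((if (j, k) : le then unt V else z) @@ (if (i, j) : le then unt V else z)) (if (i, k) : le then unt V else z)"
  by (simp only: preorder_vcat_def vcat.simps if_not_P[OF False])
  then show ?thesis
  using from_initial_hom[OF initial_preorder_pair[OF assms(1) False], of "if (i, k) : le then unt V else z"] z
  by (simp only:) simp
 qed
 then show "vcmp (preorder_vcat P le z) i j k : ar V"
  "dm V (vcmp (preorder_vcat P le z) i j k) = (if (j, k) : le then unt V else z) @@ (if (i, j) : le then unt V else z)"
  "cd V (vcmp (preorder_vcat P le z) i j k) = (if (i, k) : le then unt V else z)" by auto
qed

lemma vcmp_preorder_vcat_le [simp]:
 "(i, j) : le ==> (j, k) : le ==> vcmp (preorder_vcat P le z) i j k = lun V (unt V)"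
 by (simp add: preorder_vcat_def)

lemma vcategory_preorder_vcat:
 assumes z: "is_initial V z" and "trans le" and refl: "!!i. i : P ==> (i, i) : le"
 shows "vcategory V (preorder_vcat P le z)"
proof -
 let ?D = "preorder_vcat P le z"
 note cmp = vcmp_preorder_vcat[OF assms(1,2), of P]
 have z_ob [simp]: "z : ob V" using z by (simp add: is_initial_def)
 show ?thesis
 proof
  fix i j assume ij: "i : vob ?D" "j : vob ?D"
  note [simp] = cmp[of i j j] cmp[of i i j]
  show "vcmp ?D i j j $ (vid ?D j ** idn V (vhom ?D i j)) = lun V (vhom ?D i j)"
  proof (cases "(i, j) : le")
  case True then show ?thesis using ij refl by simp
  next
  case False
  show ?thesis
  by (rule initial_eq[OF initial_tensor_right[OF z, of "unt V"], of _ z]) (use False ij refl in simp_all)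
  qed
  show "vcmp ?D i i j $ (idn V (vhom ?D i j) ** vid ?D i) = run V (vhom ?D i j)"
  proof (cases "(i, j) : le")
  case True then show ?thesis using ij refl by (simp add: run_unt)
  next
  case False
  show ?thesis
  by (rule initial_eq[OF initial_tensor_left[OF z, of "unt V"], of _ z]) (use False ij refl in simp_all)
  qed
 next
  fix i j k l assume ijkl: "i : vob ?D" "j : vob ?D" "k : vob ?D" "l : vob ?D"
  note [simp] = cmp[of i j l] cmp[of j k l] cmp[of i k l] cmp[of i j k]
  show "vcmp ?D i j l $ (vcmp ?D j k l ** idn V (vhom ?D i j))
  = vcmp ?D i k l $ (idn V (vhom ?D k l) ** vcmp ?D i j k) $ ass V (vhom ?D k l) (vhom ?D j k) (vhom ?D i j)"
  proof (cases "(i, j) : le & (j, k) : le & (k, l) : le")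
  case True
  then have "(i, k) : le" "(j, l) : le" using assms(2) by (meson transD)+
  then show ?thesis using True by (simp add: triangle run_unt)
  next
  case False
  have "is_initial V ((vhom ?D k l @@ vhom ?D j k) @@ vhom ?D i j)"
  using False by (auto intro!: initial_tensor_left[OF initial_tensor_left[OF z]]
  initial_tensor_left[OF initial_tensor_right[OF z]] initial_tensor_right[OF z])
  then show ?thesis by (rule initial_eq[of _ _ _ "vhom ?D i l"]) simp_all
  qed
 next
  fix i j k show "vcmp ?D i j k : hom V (vhom ?D j k @@ vhom ?D i j) (vhom ?D i k)"
  using cmp[of i j k] by simp
 qed (use refl in simp_all)
qed

text \<open>The constant weight at the unit; colimits weighted by it are conical.\<close>

definition preorder_weight :: "'i rel => 'o => ('i, 'o, 'a) vfun" where
 "preorder_weight le z = \<lparr>fo = (%i. unt V), fm = (%i j. if (j, i) : le then vid (self V) (unt V)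
  else from_initial V z (ihom V (unt V) (unt V)))\<rparr>"

lemma vfunctor_preorder_weight:
 assumes z: "is_initial V z" and "trans le" and refl: "!!i. i : P ==> (i, i) : le"
 shows "vfunctor V (vop V (preorder_vcat P le z)) (self V) (preorder_weight le z)"
proof -
 let ?D = "preorder_vcat P le z" and ?W = "preorder_weight le z"
 have z_ob [simp]: "z : ob V" using z by (simp add: is_initial_def)
 have W [simp]: "fm ?W i j : ar V" "dm V (fm ?W i j) = (if (j, i) : le then unt V else z)"
  "cd V (fm ?W i j) = ihom V (unt V) (unt V)" for i j
  using z by (auto simp: preorder_weight_def)
 have fo [simp]: "fo ?W i = unt V" for i by (simp add: preorder_weight_def)
 show ?thesis
 proof
  fix i j k assume ijk: "i : vob (vop V ?D)" "j : vob (vop V ?D)" "k : vob (vop V ?D)"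
  note [simp] = vcmp_preorder_vcat[OF assms(1,2), of P k j i]
  show "fm ?W i k $ vcmp (vop V ?D) i j k
  = vcmp (self V) (fo ?W i) (fo ?W j) (fo ?W k) $ (fm ?W j k ** fm ?W i j)"
  proof (cases "(k, j) : le & (j, i) : le")
  case True
  then have "(k, i) : le" using assms(2) by (meson transD)
  then show ?thesis using True self.vid_left[of "unt V" "unt V" "vid (self V) (unt V)"]
  by (simp add: preorder_weight_def lun_swp run_unt)
  next
  case False
  then have "is_initial V ((if (k, j) : le then unt V else z) @@ (if (j, i) : le then unt V else z))"
  by (auto intro: initial_tensor_left[OF z] initial_tensor_right[OF z])
  then show ?thesis by (rule initial_eq[of _ _ _ "ihom V (unt V) (unt V)"]) simp_all
  qed
 qed (use refl z in \<open>simp_all add: preorder_weight_def\<close>)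
qed

text \<open>The bijection \<open>hom(x, [I, y]) \<cong> hom(x, y)\<close>.\<close>

definition unt_eval :: "'o => 'a => 'a" where
 "unt_eval y q = ev V (unt V) y $ (q ** idn V (unt V)) $ cinv V (run V (dm V q))"

lemma unt_eval_simps [simp]:
 assumes "y : ob V" "q : ar V" "cd V q = ihom V (unt V) y"
 shows "unt_eval y q : ar V" "dm V (unt_eval y q) = dm V q" "cd V (unt_eval y q) = y"
 using assms by (simp_all add: unt_eval_def)

lemma unt_eval_run:
 assumes "y : ob V" "q : ar V" "cd V q = ihom V (unt V) y"
 shows "unt_eval y q $ run V (dm V q) = ev V (unt V) y $ (q ** idn V (unt V))"
 using assms by (simp add: unt_eval_def)

lemma unt_eval_eqI:
 assumes "y : ob V" "q : ar V" "cd V q = ihom V (unt V) y" "f : hom V (dm V q) y"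
  "ev V (unt V) y $ (q ** idn V (unt V)) = f $ run V (dm V q)"
 shows "unt_eval y q = f"
 by (rule iso_epi[of "run V (dm V q)"]) (use assms unt_eval_run[of y q] in simp_all)

lemma unt_eval_cmp:
 assumes "y : ob V" "q : ar V" "cd V q = ihom V (unt V) y" "p : ar V" "cd V p = dm V q"
 shows "unt_eval y (q $ p) = unt_eval y q $ p"
proof (rule unt_eval_eqI)
 have "ev V (unt V) y $ ((q $ p) ** idn V (unt V)) = ev V (unt V) y $ (q ** idn V (unt V)) $ (p ** idn V (unt V))"
  using assms by simp
 also have "... = unt_eval y q $ run V (dm V q) $ (p ** idn V (unt V))"
  using assms by (intro extend[THEN trans, OF unt_eval_run[symmetric]]) simp_all
 finally show "ev V (unt V) y $ ((q $ p) ** idn V (unt V)) = (unt_eval y q $ p) $ run V (dm V (q $ p))"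
  using assms by (simp add: run_nat)
qed (use assms in simp_all)

lemma unt_eval_inj:
 assumes "unt_eval y q = unt_eval y q'" "q : hom V x (ihom V (unt V) y)" "q' : hom V x (ihom V (unt V) y)" "y : ob V"
 shows "q = q'"
proof (rule ev_ext[of "unt V" y _ _ x])
 show "ev V (unt V) y $ (q ** idn V (unt V)) = ev V (unt V) y $ (q' ** idn V (unt V))"
  using assms unt_eval_run[of y q] unt_eval_run[of y q'] by simp
qed (use assms in auto)

lemma unt_eval_surj:
 assumes "p : hom V x y"
 obtains q where "q : hom V x (ihom V (unt V) y)" "unt_eval y q = p"
proof
 have xy [simp]: "x : ob V" "y : ob V" using assms by auto
 show "curry_ar V x (unt V) y (p $ run V x) : hom V x (ihom V (unt V) y)" using assms by simp
 show "unt_eval y (curry_ar V x (unt V) y (p $ run V x)) = p"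
  by (rule unt_eval_eqI) (use assms in simp_all)
qed

lemma unt_eval_vpost:
 assumes "rh : hom V a b" "q : hom V x (ihom V (unt V) a)"
 shows "unt_eval b (vpost V (self V) (unt V) (a, b, arrow_name rh) $ q) = rh $ unt_eval a q"
proof (rule unt_eval_eqI)
 have ab [simp]: "a : ob V" "b : ob V" "x : ob V" using assms by auto
 show "ev V (unt V) b $ ((vpost V (self V) (unt V) (a, b, arrow_name rh) $ q) ** idn V (unt V))
  = (rh $ unt_eval a q) $ run V (dm V (vpost V (self V) (unt V) (a, b, arrow_name rh) $ q))"
  using assms by (subst ev_self_vpost) (simp_all add: unt_eval_run[symmetric])
qed (use assms in auto)

end

lemma (in enriched) vpost_vop:
 assumes "x : vob K" "(z, y, g) : ar (und V K)"
 shows "vpost V (vop V K) x (y, z, g) = vpre V K (z, y, g) x"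
proof -
 interpret op: enriched V "vop V K" by (rule enriched_vop)
 have "vpost V (vop V K) x (y, z, g) $ idn V (vhom K y x) = vpre V K (z, y, g) x"
 proof (rule op.vpost_eqI)
  have "vcmp (vop V K) x y z $ (g ** idn V (vhom K y x))
  = vcmp K z y x $ (idn V (vhom K y x) ** g) $ swp V (unt V) (vhom K y x)"
  using assms by (simp add: swp_nat)
  also have "... = vpre V K (z, y, g) x $ run V (vhom K y x) $ swp V (unt V) (vhom K y x)"
  using assms by (intro extend[THEN trans, OF vpre_run1[symmetric]]) simp_all
  finally show "vcmp (vop V K) x y z $ (g ** idn V (vhom K y x)) = vpre V K (z, y, g) x $ lun V (dm V (idn V (vhom K y x)))"
  using assms by (simp add: run_swp)
 qed (use assms in simp_all)
 then show ?thesis using assms op.vpost_simps[of x y z g] by simp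
qed

section \<open>Conical colimits over preorders\<close>

context enriched
begin

definition arr_of :: "('i, 'i \<times> 'i, 'k, 'k \<times> 'k \<times> 'a) ofun => 'i => 'i => 'a" where
 "arr_of D i j = snd (snd (oa D (i, j)))"

lemma poset_functor_arr:
 assumes "cat_functor (poset_cat P le) (und V K) D" "i : P" "j : P" "(i, j) : le"
 shows "oa D (i, j) = (oo D i, oo D j, arr_of D i j)" "oo D i : vob K" "oo D j : vob K"
  "arr_of D i j : ar V" "dm V (arr_of D i j) = unt V" "cd V (arr_of D i j) = vhom K (oo D i) (oo D j)"
 using cat_functor_posetD(2)[OF assms] unfolding arr_of_def by (cases "oa D (i, j)"; simp)+

lemma poset_functor_arr_cmp:
 assumes "cat_functor (poset_cat P le) (und V K) D" "trans le" "i : P" "j : P" "k : P" "(i, j) : le" "(j, k) : le"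
 shows "arr_of D i k = vpost V K (oo D i) (oo D j, oo D k, arr_of D j k) $ arr_of D i j"
proof -
 have "(i, k) : le" using assms(2,6,7) by (rule transD)
 from cat_functor_posetD(4)[OF assms(1,3-7)] poset_functor_arr[OF assms(1,3,4,6)]
  poset_functor_arr[OF assms(1,4,5,7)] poset_functor_arr[OF assms(1,3,5) this]
 show ?thesis by simp
qed

definition preorder_functor :: "'i rel => 'o => ('i, 'i \<times> 'i, 'k, 'k \<times> 'k \<times> 'a) ofun => ('i, 'k, 'a) vfun" where
 "preorder_functor le z D = \<lparr>fo = oo D, fm = (%i j. if (i, j) : le then arr_of D i j
  else from_initial V z (vhom K (oo D i) (oo D j)))\<rparr>"

lemma vfunctor_preorder_functor:
 assumes z: "is_initial V z" and "trans le" and refl: "!!i. i : P ==> (i, i) : le"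
  and D: "cat_functor (poset_cat P le) (und V K) D"
 shows "vfunctor V (preorder_vcat P le z) K (preorder_functor le z D)"
proof -
 let ?D = "preorder_vcat P le z" and ?G = "preorder_functor le z D"
 have z_ob [simp]: "z : ob V" using z by (simp add: is_initial_def)
 have ob [simp]: "oo D i : vob K" if "i : P" for i using cat_functor_posetD(1)[OF D that] by simp
 have fo [simp]: "fo ?G i = oo D i" for i by (simp add: preorder_functor_def)
 have G [simp]: "fm ?G i j : ar V" "dm V (fm ?G i j) = (if (i, j) : le then unt V else z)"
  "cd V (fm ?G i j) = vhom K (oo D i) (oo D j)" if "i : P" "j : P" for i j
  using poset_functor_arr[OF D that] z that by (auto simp: preorder_functor_def)
 show ?thesis
 proof
  fix i assume "i : vob ?D"
  then show "fm ?G i i $ vid ?D i = vid K (fo ?G i)"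
  using refl poset_functor_arr[OF D, of i i] cat_functor_posetD(3)[OF D, of i] by (simp add: preorder_functor_def)
 next
  fix i j k assume ijk: "i : vob ?D" "j : vob ?D" "k : vob ?D"
  note [simp] = vcmp_preorder_vcat[OF assms(1,2), of P i j k]
  show "fm ?G i k $ vcmp ?D i j k = vcmp K (fo ?G i) (fo ?G j) (fo ?G k) $ (fm ?G j k ** fm ?G i j)"
  proof (cases "(i, j) : le & (j, k) : le")
  case True
  then have ik: "(i, k) : le" using assms(2) by (meson transD)
  have P: "i : P" "j : P" "k : P" using ijk by simp_all
  note [simp] = poset_functor_arr(4-6)[OF D P(1,2)] poset_functor_arr(4-6)[OF D P(2,3)]
  have "(vpost V K (oo D i) (oo D j, oo D k, arr_of D j k) $ arr_of D i j) $ lun V (unt V)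
  = vcmp K (oo D i) (oo D j) (oo D k) $ (arr_of D j k ** arr_of D i j)"
  using True P vpost_lun[of "oo D i" "oo D j" "oo D k" "arr_of D j k" "arr_of D i j"] by simp
  then show ?thesis
  using True ik P poset_functor_arr_cmp[OF D assms(2) P] by (simp add: preorder_functor_def)
  next
  case False
  then have "is_initial V ((if (j, k) : le then unt V else z) @@ (if (i, j) : le then unt V else z))"
  by (rule initial_preorder_pair[OF z])
  then show ?thesis by (rule initial_eq[of _ _ _ "vhom K (oo D i) (oo D k)"]) (use ijk in simp_all)
  qed
 qed simp_all
qed

text \<open>For unrelated indices the naturality square starts at a tensor product with the initial
  object and commutes by itself. For related ones it is the cone condition, read through the
  bijection \<open>unt_eval\<close>.\<close>

lemma preorder_wedge_iff:
 assumes z: "is_initial V z" and "trans le" and refl: "!!i. i : P ==> (i, i) : le"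
  and D: "cat_functor (poset_cat P le) (und V K) D" and y: "y : vob K"
 shows "natural_wedge V (vop V (preorder_vcat P le z)) (self V) (preorder_weight le z)
  (vf_cmp V (vf_op (preorder_functor le z D)) (vrep_contra V K y)) t q \<longleftrightarrow>
  t : ob V & (ALL i:P. q i : hom V t (ihom V (unt V) (vhom K (oo D i) y))) &
  (ALL i:P. ALL j:P. (i, j) : le --> vpre V K (oo D i, oo D j, arr_of D i j) y $ unt_eval (vhom K (oo D j) y) (q j)
  = unt_eval (vhom K (oo D i) y) (q i))"
  (is "natural_wedge V ?Dop (self V) ?W ?H t q \<longleftrightarrow> _")
proof -
 interpret op: enriched V "vop V K" by (rule enriched_vop)
 have z_ob [simp]: "z : ob V" using z by (simp add: is_initial_def)
 have ob [simp]: "oo D i : vob K" if "i : P" for i using cat_functor_posetD(1)[OF D that] by simp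
 note [simp] = y
 have fo [simp]: "fo ?W i = unt V" "fo ?H i = vhom K (oo D i) y" for i
  by (simp_all add: preorder_weight_def vf_cmp_def vf_op_def preorder_functor_def vrep_contra_def)
 have W [simp]: "fm ?W i j : ar V" "dm V (fm ?W i j) = (if (j, i) : le then unt V else z)"
  "cd V (fm ?W i j) = ihom V (unt V) (unt V)" for i j
  using z by (auto simp: preorder_weight_def)
 have H_le: "fm ?H j i = arrow_name (vpre V K (oo D i, oo D j, arr_of D i j) y)"
  if "i : P" "j : P" "(i, j) : le" for i j
 proof -
  note [simp] = poset_functor_arr(4-6)[OF D that] that
  have "fm ?H j i = fm (vrep V (vop V K) y) (oo D j) (oo D i) $ arr_of D i j"
  by (simp add: vf_cmp_def vf_op_def preorder_functor_def vrep_contra_def)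
  also have "... = arrow_name (vpost V (vop V K) y (oo D j, oo D i, arr_of D i j))"
  by (rule op.vrep_arrow) simp_all
  finally show ?thesis by (simp add: vpost_vop)
 qed
 have H [simp]: "fm ?H j i : ar V" "dm V (fm ?H j i) = (if (i, j) : le then unt V else z)"
  "cd V (fm ?H j i) = ihom V (vhom K (oo D j) y) (vhom K (oo D i) y)" if "i : P" "j : P" for i j
 proof -
  have "fm ?H j i : hom V (if (i, j) : le then unt V else z) (ihom V (vhom K (oo D j) y) (vhom K (oo D i) y))"
  proof (cases "(i, j) : le")
  case True
  then show ?thesis using that H_le[OF that] poset_functor_arr(4-6)[OF D that] by simp
  next
  case False
  then show ?thesis using that z op.vrep_fm_simps[of y "oo D j" "oo D i"]
  by (simp add: vf_cmp_def vf_op_def preorder_functor_def vrep_contra_def)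
  qed
  then show "fm ?H j i : ar V" "dm V (fm ?H j i) = (if (i, j) : le then unt V else z)"
  "cd V (fm ?H j i) = ihom V (vhom K (oo D j) y) (vhom K (oo D i) y)" by auto
 qed
 have square: "vcmp (self V) (unt V) (vhom K (oo D j) y) (vhom K (oo D i) y) $ (fm ?H j i ** q j) $ swp V t (vhom ?Dop j i)
  = vcmp (self V) (unt V) (unt V) (vhom K (oo D i) y) $ (q i ** fm ?W j i) \<longleftrightarrow>
  ((i, j) : le --> vpre V K (oo D i, oo D j, arr_of D i j) y $ unt_eval (vhom K (oo D j) y) (q j)
  = unt_eval (vhom K (oo D i) y) (q i))" (is "?l = ?r \<longleftrightarrow> _")
  if t: "t : ob V" and ij: "i : P" "j : P"
  and q: "q i : hom V t (ihom V (unt V) (vhom K (oo D i) y))" "q j : hom V t (ihom V (unt V) (vhom K (oo D j) y))" for i j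
 proof (cases "(i, j) : le")
  case False
  have "is_initial V (t @@ z)" by (rule initial_tensor_right[OF z t])
  then have "?l = ?r"
  by (rule initial_eq[of _ _ _ "ihom V (unt V) (vhom K (oo D i) y)"]) (use t ij q False in simp_all)
  then show ?thesis using False by simp
 next
  case True
  note [simp] = poset_functor_arr(4-6)[OF D ij True] ij t q[simplified]
  let ?rh = "vpre V K (oo D i, oo D j, arr_of D i j) y"
  let ?P = "vpost V (self V) (unt V) (vhom K (oo D j) y, vhom K (oo D i) y, arrow_name ?rh)"
  have "?l = (?P $ q j $ lun V t) $ swp V t (unt V)"
  using True self.vpost_lun[of "unt V" "vhom K (oo D j) y" "vhom K (oo D i) y" "arrow_name ?rh" "q j"]
  by (simp add: H_le)
  also have "... = (?P $ q j) $ run V t" by (simp add: lun_swp)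
  finally have l: "?l = (?P $ q j) $ run V t" .
  have r: "?r = q i $ run V t"
  using True self.vid_right[of "unt V" "vhom K (oo D i) y" "q i"] by (simp add: preorder_weight_def)
  have "?l = ?r \<longleftrightarrow> ?P $ q j = q i"
  unfolding l r by (rule iso_epi_iff) simp_all
  also have "... \<longleftrightarrow> unt_eval (vhom K (oo D i) y) (?P $ q j) = unt_eval (vhom K (oo D i) y) (q i)"
  by (auto intro: unt_eval_inj[of _ _ _ t])
  also have "... \<longleftrightarrow> ?rh $ unt_eval (vhom K (oo D j) y) (q j) = unt_eval (vhom K (oo D i) y) (q i)"
  by (subst unt_eval_vpost[of _ _ _ _ t]) simp_all
  finally show ?thesis using True by simp
 qed
 show ?thesis
  unfolding natural_wedge_def self_simps fo vop_simps(1) preorder_vcat_simps(1) using square by meson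
qed

lemma conical_colim_exists:
 fixes ka :: "'u rel" and P :: "'u set"
 assumes "inaccessible ka" "has_weighted_colimits ka V (self V)" "has_weighted_colimits ka V K"
  and "small ka P" and tr: "trans le" and refl: "!!i. i : P ==> (i, i) : le"
  and D: "cat_functor (poset_cat P le) (und V K) D"
 obtains x c where "is_conical_colim V K (poset_cat P le) D x c"
proof -
 obtain z where z: "is_initial V z" using initial_exists[OF assms(1,2)] .
 let ?D = "preorder_vcat P le z" and ?W = "preorder_weight le z" and ?G = "preorder_functor le z D"
 have "small ka (vob ?D)" using assms(4) by simp
 then have "vcategory V ?D & small ka (vob ?D) & vfunctor V (vop V ?D) (self V) ?W & vfunctor V ?D K ?G"
  by (intro conjI vcategory_preorder_vcat[OF z tr refl] vfunctor_preorder_weight[OF z tr refl]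
  vfunctor_preorder_functor[OF z tr refl D])
 from assms(3)[unfolded has_weighted_colimits_def, rule_format, OF this]
 obtain x ga where x: "is_weighted_colim V ?D K ?W ?G x ga" by (elim exE)
 have x_ob [simp]: "x : vob K" using x by (simp add: is_weighted_colim_def)
 have ob [simp]: "oo D i : vob K" if "i : P" for i using cat_functor_posetD(1)[OF D that] by simp
 have fo: "fo ?W i = unt V" "fo ?G i = oo D i" for i
  by (simp_all add: preorder_weight_def preorder_functor_def)
 have ga [simp]: "ga i : ar V" "dm V (ga i) = unt V" "cd V (ga i) = ihom V (unt V) (vhom K (oo D i) x)" if "i : P" for i
 proof -
  have "vnat V (vop V ?D) (self V) ?W (vf_cmp V (vf_op ?G) (vrep_contra V K x)) ga"
  using x by (simp add: is_weighted_colim_def)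
  from vnat.component_hom[OF this, of i] that
  show "ga i : ar V" "dm V (ga i) = unt V" "cd V (ga i) = ihom V (unt V) (vhom K (oo D i) x)"
  by (simp_all add: preorder_weight_def vf_cmp_def vf_op_def preorder_functor_def vrep_contra_def vrep_def)
 qed
 \<comment> \<open>The unit of the weighted colimit consists of elements of [I, K(D i, x)];
   \<open>c i\<close> is the arrow from I to K(D i, x) that such an element names.\<close>
 define c where "c = (%i. named_arrow (unt V) (vhom K (oo D i) x) (ga i))"
 have c [simp]: "c i : ar V" "dm V (c i) = unt V" "cd V (c i) = vhom K (oo D i) x" if "i : P" for i
  using that by (simp_all add: c_def)
 define p where "p = (%y i. vpre V (self V) (unt V, vhom K (oo D i) x, ga i) (vhom K (oo D i) y) $ fm (vrep V K (oo D i)) x y)"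
 have p_arr [simp]: "p y i : ar V" "dm V (p y i) = vhom K x y" "cd V (p y i) = ihom V (unt V) (vhom K (oo D i) y)"
  if "i : P" "y : vob K" for i y
  using that by (simp_all add: p_def)
 have nat: "is_natobj V (vop V ?D) (self V) ?W (vf_cmp V (vf_op ?G) (vrep_contra V K y)) (vhom K x y) (p y)"
  if "y : vob K" for y
  using x that unfolding is_weighted_colim_def fo p_def by blast
 \<comment> \<open>Under \<open>unt_eval\<close> the universal wedge becomes precomposition with the
   cocone, the shape required of a conical colimit.\<close>
 have p_eval: "unt_eval (vhom K (oo D i) y) (p y i) = vpre V K (oo D i, x, c i) y" if "i : P" "y : vob K" for i y
 proof (rule unt_eval_eqI)
  have "ga i = arrow_name (c i)" using that by (simp add: c_def)
  then have "ev V (unt V) (vhom K (oo D i) y) $ (p y i ** idn V (unt V))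
  = ev V (vhom K (oo D i) x) (vhom K (oo D i) y) $ (fm (vrep V K (oo D i)) x y ** c i)"
  unfolding p_def using that by (simp only:) (subst ev_self_vpre, simp_all)
  also have "... = vpre V K (oo D i, x, c i) y $ run V (vhom K x y)"
  using that by (subst ev_vrep1) (simp_all add: vpre_run1)
  finally show "ev V (unt V) (vhom K (oo D i) y) $ (p y i ** idn V (unt V))
  = vpre V K (oo D i, x, c i) y $ run V (dm V (p y i))" using that by simp
 qed (use that in simp_all)
 have wedge_p: "vpre V K (oo D i, oo D j, arr_of D i j) y $ vpre V K (oo D j, x, c j) y = vpre V K (oo D i, x, c i) y"
  if "i : P" "j : P" "(i, j) : le" "y : vob K" for i j y
 proof -
  have "natural_wedge V (vop V ?D) (self V) ?W (vf_cmp V (vf_op ?G) (vrep_contra V K y)) (vhom K x y) (p y)"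
  using nat[OF that(4)] by (simp add: is_natobj_def)
  then show ?thesis
  using that preorder_wedge_iff[OF z tr refl D that(4), of "vhom K x y" "p y"] by (simp add: p_eval)
 qed
 let ?J = "poset_cat P le"
 let ?c = "%i. (oo D i, x, c i)"
 let ?H = "%y. \<lparr>oo = (%i. vhom K (oo D i) y), oa = (%f. vpre V K (oa D f) y)\<rparr>"
 have cocone: "is_cocone (und V K) ?J D x ?c"
  unfolding is_cocone_def
 proof (intro conjI ballI)
  fix f assume "f : ar ?J"
  then obtain i j where f: "f = (i, j)" and ij: "i : P" "j : P" "(i, j) : le" by (cases f) auto
  note [simp] = poset_functor_arr[OF D ij] ij
  have cj: "c j = vpre V K (oo D j, x, c j) x $ vid K x"
  by (subst vpre_elt) simp_all
  have "vpost V K (oo D i) (oo D j, x, c j) $ arr_of D i j = vpre V K (oo D i, oo D j, arr_of D i j) x $ c j"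
  by (subst vpre_elt) simp_all
  also have "... = vpre V K (oo D i, oo D j, arr_of D i j) x $ vpre V K (oo D j, x, c j) x $ vid K x"
  by (rule arg_cong[OF cj])
  also have "... = vpre V K (oo D i, x, c i) x $ vid K x"
  by (rule extend[OF wedge_p]) simp_all
  also have "... = c i"
  by (subst vpre_elt) simp_all
  finally show "?c (cd ?J f) $\<^bsub>und V K\<^esub> oa D f = ?c (dm ?J f)" using f by simp
 qed simp_all
 have lim: "is_lim V (cat_op ?J) (?H y) (vhom K x y) (%i. vpre V K (?c i) y)" if y: "y : vob K" for y
  unfolding is_lim_def
 proof (intro conjI allI impI)
  note [simp] = y
  show "cat_functor (cat_op ?J) V (?H y)"
  unfolding cat_functor_def
  proof (intro conjI ballI impI)
  fix f assume "f : ar (cat_op ?J)"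
  then obtain i j where f: "f = (i, j)" and ij: "i : P" "j : P" "(i, j) : le" by (cases f) auto
  show "oa (?H y) f : hom V (oo (?H y) (dm (cat_op ?J) f)) (oo (?H y) (cd (cat_op ?J) f))"
  using poset_functor_arr[OF D ij] f by simp
  next
  fix i assume "i : ob (cat_op ?J)"
  then show "oa (?H y) (idn (cat_op ?J) i) = idn V (oo (?H y) i)"
  using cat_functor_posetD(3)[OF D, of i] by simp
  next
  fix f g assume fg: "f : ar (cat_op ?J)" "g : ar (cat_op ?J)" "dm (cat_op ?J) g = cd (cat_op ?J) f"
  then obtain i j k where fg': "f = (j, k)" "g = (i, j)" and ijk: "i : P" "j : P" "k : P" "(i, j) : le" "(j, k) : le"
  by (cases f; cases g) auto
  have ik: "(i, k) : le" using tr ijk(4,5) by (rule transD)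
  note [simp] = poset_functor_arr[OF D ijk(1,2,4)] poset_functor_arr[OF D ijk(2,3,5)] poset_functor_arr[OF D ijk(1,3) ik]
  show "oa (?H y) (g $\<^bsub>cat_op ?J\<^esub> f) = oa (?H y) g $ oa (?H y) f"
  using fg' poset_functor_arr_cmp[OF D tr ijk] by (simp add: vpre_cmp)
  qed simp
  show "is_cone V (cat_op ?J) (?H y) (vhom K x y) (%i. vpre V K (?c i) y)"
  unfolding is_cone_def
  proof (intro conjI ballI)
  fix f assume "f : ar (cat_op ?J)"
  then obtain i j where f: "f = (i, j)" and ij: "i : P" "j : P" "(i, j) : le" by (cases f) auto
  show "oa (?H y) f $ vpre V K (?c (dm (cat_op ?J) f)) y = vpre V K (?c (cd (cat_op ?J) f)) y"
  using wedge_p[OF ij y] poset_functor_arr(1)[OF D ij] f by simp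
  qed simp_all
  fix t q assume cone: "is_cone V (cat_op ?J) (?H y) t q"
  have t [simp]: "t : ob V" using cone by (simp add: is_cone_def)
  have q: "q i : hom V t (vhom K (oo D i) y)" if "i : P" for i using cone that by (simp add: is_cone_def)
  have "EX q'. q' : hom V t (ihom V (unt V) (vhom K (oo D i) y)) & unt_eval (vhom K (oo D i) y) q' = q i" if "i : P" for i
  using unt_eval_surj[OF q[OF that]] by blast
  then obtain q' where q': "!!i. i : P ==> q' i : hom V t (ihom V (unt V) (vhom K (oo D i) y))"
  "!!i. i : P ==> unt_eval (vhom K (oo D i) y) (q' i) = q i" by metis
  have "vpre V K (oo D i, oo D j, arr_of D i j) y $ q j = q i" if ij: "i : P" "j : P" "(i, j) : le" for i j
  proof -
  have "ALL f:ar (cat_op ?J). oa (?H y) f $ q (dm (cat_op ?J) f) = q (cd (cat_op ?J) f)"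
  using cone unfolding is_cone_def by blast
  from bspec[OF this, of "(i, j)"] ij poset_functor_arr(1)[OF D ij] show ?thesis by simp
  qed
  then have "natural_wedge V (vop V ?D) (self V) ?W (vf_cmp V (vf_op ?G) (vrep_contra V K y)) t q'"
  using preorder_wedge_iff[OF z tr refl D y, of t q'] q' by simp
  then have "EX! u. u : hom V t (vhom K x y) & (ALL i:P. p y i $ u = q' i)"
  using nat[OF y] unfolding is_natobj_def by simp
  moreover have "p y i $ u = q' i \<longleftrightarrow> vpre V K (?c i) y $ u = q i" if "i : P" "u : hom V t (vhom K x y)" for i u
  proof -
  have "p y i $ u = q' i \<longleftrightarrow> unt_eval (vhom K (oo D i) y) (p y i $ u) = unt_eval (vhom K (oo D i) y) (q' i)"
  using that q'(1)[OF that(1)] by (auto intro: unt_eval_inj[of _ _ _ t])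
  then show ?thesis using that q'(2)[OF that(1)] by (simp add: unt_eval_cmp p_eval)
  qed
  ultimately have "EX! u. u : hom V t (vhom K x y) & (ALL i:P. vpre V K (?c i) y $ u = q i)"
  by (smt (verit, ccfv_SIG))
  then show "EX! u. u : hom V t (vhom K x y) & (ALL i:ob (cat_op ?J). vpre V K (?c i) y $ u = q i)"
  by simp
 qed
 have "is_conical_colim V K ?J D x ?c"
  unfolding is_conical_colim_def using D cocone lim by blast
 then show ?thesis by (rule that)
qed

end

section \<open>Ordinary colimits\<close>

lemma ex1_unique: "EX! x. P x ==> P a ==> P b ==> a = b"
 by blast

context enriched
begin

lemma conical_colimD:
 assumes "is_conical_colim V K (poset_cat I le) D x c"
 shows "cat_functor (poset_cat I le) (und V K) D" "x : vob K"
  "i : I ==> oo D i : vob K" "i : I ==> c i = (oo D i, x, snd (snd (c i)))"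
  "i : I ==> snd (snd (c i)) : ar V" "i : I ==> dm V (snd (snd (c i))) = unt V"
  "i : I ==> cd V (snd (snd (c i))) = vhom K (oo D i) x"
  "i : I ==> j : I ==> (i, j) : le ==> c j $\<^bsub>und V K\<^esub> oa D (i, j) = c i"
proof -
 show D: "cat_functor (poset_cat I le) (und V K) D" using assms by (simp add: is_conical_colim_def)
 have c: "is_cocone (und V K) (poset_cat I le) D x c" using assms by (simp add: is_conical_colim_def)
 show "x : vob K" using c by (simp add: is_cocone_def)
 show "oo D i : vob K" if "i : I" using cat_functor_posetD(1)[OF D that] by simp
 have "c i : hom (und V K) (oo D i) x" if "i : I" using c that by (simp add: is_cocone_def)
 then show "i : I ==> c i = (oo D i, x, snd (snd (c i)))" "i : I ==> snd (snd (c i)) : ar V"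
  "i : I ==> dm V (snd (snd (c i))) = unt V" "i : I ==> cd V (snd (snd (c i))) = vhom K (oo D i) x"
  by (cases "c i"; auto)+
 show "c j $\<^bsub>und V K\<^esub> oa D (i, j) = c i" if "i : I" "j : I" "(i, j) : le"
 proof -
  have "ALL f:ar (poset_cat I le). c (cd (poset_cat I le) f) $\<^bsub>und V K\<^esub> oa D f = c (dm (poset_cat I le) f)"
  using c unfolding is_cocone_def by blast
  from bspec[OF this, of "(i, j)"] that show ?thesis by simp
 qed
qed

lemma conical_colim_simps:
 assumes "is_conical_colim V K (poset_cat I le) D x c" "i : I" "y : vob K"
 shows "vpre V K (c i) y : ar V" "dm V (vpre V K (c i) y) = vhom K x y" "cd V (vpre V K (c i) y) = vhom K (oo D i) y"
proof -
 obtain f where f: "c i = (oo D i, x, f)" using conical_colimD(4)[OF assms(1,2)] by blast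
 then show "vpre V K (c i) y : ar V" "dm V (vpre V K (c i) y) = vhom K x y" "cd V (vpre V K (c i) y) = vhom K (oo D i) y"
  using conical_colimD(2)[OF assms(1)] conical_colimD(3)[OF assms(1,2)]
  conical_colimD(5-7)[OF assms(1,2), unfolded f, simplified] assms(3) by simp_all
qed

lemma conical_colim_vpre_compat:
 assumes "is_conical_colim V K (poset_cat I le) D x c" "i : I" "j : I" "(i, j) : le" "y : vob K"
 shows "vpre V K (oa D (i, j)) y $ vpre V K (c j) y = vpre V K (c i) y"
proof -
 note arr = poset_functor_arr[OF conical_colimD(1)[OF assms(1)] assms(2-4)]
 obtain f g where f: "c i = (oo D i, x, f)" and g: "c j = (oo D j, x, g)"
  using conical_colimD(4)[OF assms(1,2)] conical_colimD(4)[OF assms(1,3)] by blast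
 note [simp] = arr conical_colimD(2)[OF assms(1)]
  conical_colimD(5-7)[OF assms(1,2), unfolded f, simplified] conical_colimD(5-7)[OF assms(1,3), unfolded g, simplified]
 show ?thesis
  using conical_colimD(8)[OF assms(1-4)] assms(5) by (simp add: f g vpre_cmp[symmetric])
qed

lemma conical_colim_universal:
 assumes colim: "is_conical_colim V K (poset_cat I le) D x c" and "y : vob K" "t : ob V"
  and q: "!!i. i : I ==> q i : hom V t (vhom K (oo D i) y)"
  and compat: "!!i j. i : I ==> j : I ==> (i, j) : le ==> vpre V K (oa D (i, j)) y $ q j = q i"
 shows "EX! u. u : hom V t (vhom K x y) & (ALL i:I. vpre V K (c i) y $ u = q i)"
proof -
 let ?H = "\<lparr>oo = (%i. vhom K (oo D i) y), oa = (%f. vpre V K (oa D f) y)\<rparr>"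
 let ?J = "cat_op (poset_cat I le)"
 have "is_lim V ?J ?H (vhom K x y) (%i. vpre V K (c i) y)"
  using assms(1,2) by (simp add: is_conical_colim_def)
 moreover have "is_cone V ?J ?H t q"
  using q compat assms(3) by (auto simp: is_cone_def)
 ultimately have "EX! u. u : hom V t (vhom K x y) & (ALL i:ob ?J. vpre V K (c i) y $ u = q i)"
  unfolding is_lim_def by blast
 then show ?thesis by simp
qed

lemma conical_colim_ext:
 assumes colim: "is_conical_colim V K (poset_cat I le) D x c" and "y : vob K"
  and u: "u : hom V t (vhom K x y)" "v : hom V t (vhom K x y)"
  and eq: "!!i. i : I ==> vpre V K (c i) y $ u = vpre V K (c i) y $ v"
 shows "u = v"
proof -
 have "EX! w. w : hom V t (vhom K x y) & (ALL i:I. vpre V K (c i) y $ w = vpre V K (c i) y $ u)"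
 proof (rule conical_colim_universal[OF colim assms(2)])
  show "t : ob V" using u by auto
  show "vpre V K (c i) y $ u : hom V t (vhom K (oo D i) y)" if "i : I" for i
  using conical_colim_simps[OF colim that assms(2)] u by simp
  show "vpre V K (oa D (i, j)) y $ vpre V K (c j) y $ u = vpre V K (c i) y $ u"
  if ij: "i : I" "j : I" "(i, j) : le" for i j
  proof (rule extend[OF conical_colim_vpre_compat[OF colim ij assms(2)]])
  have "vpre V K (oa D (i, j)) y : ar V" "dm V (vpre V K (oa D (i, j)) y) = vhom K (oo D j) y"
  using poset_functor_arr[OF conical_colimD(1)[OF colim] ij] assms(2) by simp_all
  then show "vpre V K (oa D (i, j)) y : ar V" "dm V (vpre V K (oa D (i, j)) y) = cd V (vpre V K (c j) y)"
  using conical_colim_simps[OF colim ij(2) assms(2)] by simp_all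
  qed (use conical_colim_simps[OF colim ij(2) assms(2)] u in simp_all)
 qed
 then show ?thesis
  by (rule ex1_unique) (use u eq in simp_all)
qed

text \<open>Arrows out of \<open>x\<close> are elements of K(x, y), so the ordinary universal
  property is the limit property tested on cones with vertex I.\<close>

lemma conical_colim_is_colim:
 assumes colim: "is_conical_colim V K (poset_cat I le) D x c"
 shows "is_colim (und V K) (poset_cat I le) D x c"
 unfolding is_colim_def
proof (intro conjI allI impI)
 note D = conical_colimD(1)[OF colim]
 show "cat_functor (poset_cat I le) (und V K) D" "is_cocone (und V K) (poset_cat I le) D x c"
  using colim by (auto simp: is_conical_colim_def)
 fix y d assume d: "is_cocone (und V K) (poset_cat I le) D y d"
 have y: "y : vob K" using d by (simp add: is_cocone_def)
 note x = conical_colimD(2)[OF colim]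
 have dh: "d i : hom (und V K) (oo D i) y" if "i : I" for i using d that by (simp add: is_cocone_def)
 define q where "q i = snd (snd (d i))" for i
 have dq: "d i = (oo D i, y, q i)" and q: "q i : hom V (unt V) (vhom K (oo D i) y)" if "i : I" for i
  using dh[OF that] by (cases "d i"; auto simp: q_def)+
 have "EX! u. u : hom V (unt V) (vhom K x y) & (ALL i:I. vpre V K (c i) y $ u = q i)"
 proof (rule conical_colim_universal[OF colim y _ q])
  fix i j assume ij: "i : I" "j : I" "(i, j) : le"
  note [simp] = poset_functor_arr[OF D ij] y
  have "ALL f:ar (poset_cat I le). d (cd (poset_cat I le) f) $\<^bsub>und V K\<^esub> oa D f = d (dm (poset_cat I le) f)"
  using d unfolding is_cocone_def by blast
  from bspec[OF this, of "(i, j)"] ij have "d j $\<^bsub>und V K\<^esub> oa D (i, j) = d i" by simp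
  then show "vpre V K (oa D (i, j)) y $ q j = q i"
  using ij q[OF ij(2)] by (simp add: dq vpre_elt)
 qed auto
 then obtain u where u: "u : hom V (unt V) (vhom K x y) & (ALL i:I. vpre V K (c i) y $ u = q i)"
  and uniq: "ALL v. v : hom V (unt V) (vhom K x y) & (ALL i:I. vpre V K (c i) y $ v = q i) --> v = u"
  by (rule ex1E)
 have cmp: "(x, y, v) $\<^bsub>und V K\<^esub> c i = d i \<longleftrightarrow> vpre V K (c i) y $ v = q i"
  if iv: "i : I" "v : hom V (unt V) (vhom K x y)" for i v
 proof -
  obtain f where f: "c i = (oo D i, x, f)" using conical_colimD(4)[OF colim iv(1)] by blast
  note [simp] = conical_colimD(3)[OF colim iv(1)] conical_colimD(5-7)[OF colim iv(1), unfolded f, simplified] x y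
  show ?thesis using iv by (simp add: f dq vpre_elt)
 qed
 show "EX! w. w : hom (und V K) x y & (ALL i:ob (poset_cat I le). w $\<^bsub>und V K\<^esub> c i = d i)"
 proof (rule ex1I[of _ "(x, y, u)"])
  show "(x, y, u) : hom (und V K) x y & (ALL i:ob (poset_cat I le). (x, y, u) $\<^bsub>und V K\<^esub> c i = d i)"
  using u x y cmp by simp
  fix w assume w: "w : hom (und V K) x y & (ALL i:ob (poset_cat I le). w $\<^bsub>und V K\<^esub> c i = d i)"
  then obtain v where v: "w = (x, y, v)" "v : hom V (unt V) (vhom K x y)" by (cases w) auto
  then have "ALL i:I. vpre V K (c i) y $ v = q i" using w cmp by simp
  with uniq v(2) have "v = u" by blast
  then show "w = (x, y, u)" using v(1) by simp
 qed
qed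

end


subsection \<open>Reindexing\<close>

text \<open>Diagrams in the definitions are indexed by subsets of \<open>'u\<close>, while the
  posets that arise later consist of sets of arrows or of indices. They are transported along an
  injection.\<close>

definition image_rel :: "('i => 'j) => 'i set => 'i rel => 'j rel" where
 "image_rel fi P le = {(fi i, fi j) | i j. i : P & j : P & (i, j) : le}"

definition image_fun :: "('i => 'j) => 'i set => ('i, 'i \<times> 'i, 'o, 'a) ofun => ('j, 'j \<times> 'j, 'o, 'a) ofun" where
 "image_fun fi P D = \<lparr>oo = oo D \<circ> inv_into P fi, oa = (%(u, v). oa D (inv_into P fi u, inv_into P fi v))\<rparr>"

lemma image_rel_iff:
 "inj_on fi P ==> i : P ==> j : P ==> (fi i, fi j) : image_rel fi P le \<longleftrightarrow> (i, j) : le"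
 unfolding image_rel_def by (auto dest: inj_onD)

lemma image_fun_simps:
 assumes "inj_on fi P"
 shows "i : P ==> oo (image_fun fi P D) (fi i) = oo D i"
  "i : P ==> j : P ==> oa (image_fun fi P D) (fi i, fi j) = oa D (i, j)"
 using assms by (simp_all add: image_fun_def)

lemma trans_image_rel: "inj_on fi P ==> trans le ==> trans (image_rel fi P le)"
 unfolding image_rel_def by (rule transI) (auto dest: inj_onD intro: transD)

lemma refl_image_rel: "(!!i. i : P ==> (i, i) : le) ==> j : fi ` P ==> (j, j) : image_rel fi P le"
 unfolding image_rel_def by auto

lemma cat_functor_image:
 assumes fi: "inj_on fi P" and D: "cat_functor (poset_cat P le) C D"
 shows "cat_functor (poset_cat (fi ` P) (image_rel fi P le)) C (image_fun fi P D)"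
 unfolding cat_functor_def
proof (intro conjI ballI impI)
 note [simp] = image_fun_simps[OF fi]
 let ?J = "poset_cat (fi ` P) (image_rel fi P le)"
 fix i assume "i : ob ?J"
 then obtain i' where i: "i = fi i'" "i' : P" by auto
 then show "oo (image_fun fi P D) i : ob C" "oa (image_fun fi P D) (idn ?J i) = idn C (oo (image_fun fi P D) i)"
  using cat_functor_posetD(1,3)[OF D i(2)] by simp_all
next
 note [simp] = image_fun_simps[OF fi]
 let ?J = "poset_cat (fi ` P) (image_rel fi P le)"
 fix f assume "f : ar ?J"
 then obtain i j where f: "f = (fi i, fi j)" and ij: "i : P" "j : P" "(i, j) : le"
  by (cases f) (auto simp: image_rel_iff[OF fi])
 show "oa (image_fun fi P D) f : hom C (oo (image_fun fi P D) (dm ?J f)) (oo (image_fun fi P D) (cd ?J f))"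
  using cat_functor_posetD(2)[OF D ij] f ij by simp
next
 note [simp] = image_fun_simps[OF fi]
 let ?J = "poset_cat (fi ` P) (image_rel fi P le)"
 fix f g assume fg: "f : ar ?J" "g : ar ?J" "dm ?J g = cd ?J f"
 from fg(1) obtain i j where f: "f = (fi i, fi j)" and ij: "i : P" "j : P" "(i, j) : le"
  by (cases f) (auto simp: image_rel_iff[OF fi])
 from fg(2) obtain j' k where g: "g = (fi j', fi k)" and jk: "j' : P" "k : P" "(j', k) : le"
  by (cases g) (auto simp: image_rel_iff[OF fi])
 have "j' = j" using fg(3) f g ij jk inj_onD[OF fi] by simp
 then show "oa (image_fun fi P D) (g $\<^bsub>?J\<^esub> f) = oa (image_fun fi P D) g $\<^bsub>C\<^esub> oa (image_fun fi P D) f"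
  using cat_functor_posetD(4)[OF D ij(1,2) jk(2) ij(3)] f g ij jk by simp
qed

lemma poset_edges_image:
 assumes "inj_on fi P"
 shows "poset_edges (fi ` P) (image_rel fi P le) (image_fun fi P D) = (%(z, z', w). (fi z, fi z', w)) ` poset_edges P le D"
proof -
 have "poset_edges (fi ` P) (image_rel fi P le) (image_fun fi P D)
  = {(fi i, fi j, oa (image_fun fi P D) (fi i, fi j)) | i j. i : P & j : P & (fi i, fi j) : image_rel fi P le}"
  unfolding poset_edges_def by blast
 also have "... = {(fi i, fi j, oa D (i, j)) | i j. i : P & j : P & (i, j) : le}"
  using image_rel_iff[OF assms] image_fun_simps(2)[OF assms] by (metis (no_types, lifting))
 also have "... = (%(z, z', w). (fi z, fi z', w)) ` poset_edges P le D"
  unfolding poset_edges_def by (force simp: image_iff)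
 finally show ?thesis .
qed

lemma gdiagram_poset:
 assumes "cat_functor (poset_cat P le) C D"
 shows "gdiagram C P (oo D) (poset_edges P le D)"
 using cat_functor_posetD(1,2)[OF assms] by (fastforce simp: gdiagram_def poset_edges_def)

lemma directed_poset_image:
 assumes fi: "inj_on fi P" and "directed_poset lam P le"
 shows "directed_poset lam (fi ` P) (image_rel fi P le)"
 unfolding directed_poset_def
proof (intro conjI allI impI)
 have po: "partial_order_on P le" using assms(2) by (simp add: directed_poset_def)
 then have tr: "trans le" and rf: "!!i. i : P ==> (i, i) : le" and an: "antisym le"
  by (auto simp: partial_order_on_def preorder_on_def refl_on_def)
 have "antisym (image_rel fi P le)"
  unfolding image_rel_def using fi an by (intro antisymI) (auto dest: inj_onD antisymD)
 moreover have "refl_on (fi ` P) (image_rel fi P le)"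
  using refl_image_rel[of P le _ fi] rf unfolding refl_on_def by (auto simp: image_rel_def)
 moreover have "image_rel fi P le <= fi ` P \<times> fi ` P" by (auto simp: image_rel_def)
 ultimately show "partial_order_on (fi ` P) (image_rel fi P le)"
  unfolding partial_order_on_def preorder_on_def
  using trans_image_rel[OF fi tr] by blast
 show "EX u:fi ` P. ALL s:S. (s, u) : image_rel fi P le" if "S <= fi ` P" "|S| <o lam" for S
 proof -
  have "inv_into P fi ` S <= P" using that(1) by (auto intro: inv_into_into)
  moreover have "|inv_into P fi ` S| <o lam" using card_of_image that(2) by (rule ordLeq_ordLess_trans)
  ultimately have "EX u:P. ALL s:inv_into P fi ` S. (s, u) : le"
  using assms(2) unfolding directed_poset_def by blast
  then obtain u where u: "u : P" "ALL s:inv_into P fi ` S. (s, u) : le" ..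
  have "(s, fi u) : image_rel fi P le" if s: "s : S" for s
  proof -
  obtain p where p: "s = fi p" "p : P" using s \<open>S <= fi ` P\<close> by auto
  then have "inv_into P fi s = p" using fi by simp
  then have "(p, u) : le" using u(2) s by blast
  then show ?thesis using p u(1) image_rel_iff[OF fi] by simp
  qed
  then show ?thesis using u(1) by blast
 qed
qed


subsection \<open>Graph colimits from poset colimits\<close>

text \<open>
 An edge \<open>w : b z \<rightarrow> b z'\<close> is replaced by the zigzag \<open>b z \<leftarrow> b z \<rightarrow> b z \<leftarrow> b z \<rightarrow> b z'\<close> of three identities
 and \<open>w\<close>, with three new vertices, numbered \<open>0\<close>, \<open>2\<close>, \<open>1\<close>. (Subdividing less would not turn a loop
 into a poset.)
\<close>

definition zigzag_rel :: "('s + ('s \<times> 's \<times> 'a) \<times> nat) rel" where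
 "zigzag_rel = Id \<union> {(Inr ((z, z', w), 0), Inl z) | z z' w. True} \<union> {(Inr (r, 0), Inr (r, 2)) | r. True}
  \<union> {(Inr (r, 1), Inr (r, 2)) | r. True} \<union> {(Inr ((z, z', w), 1), Inl z') | z z' w. True}"

definition zigzag_fun :: "('o, 'a, 'z) cat_scheme => ('s => 'o) =>
 ('s + ('s \<times> 's \<times> 'a) \<times> nat, ('s + ('s \<times> 's \<times> 'a) \<times> nat) \<times> ('s + ('s \<times> 's \<times> 'a) \<times> nat), 'o, 'a) ofun" where
 "zigzag_fun C b = \<lparr>oo = (%i. case i of Inl z => b z | Inr ((z, z', w), n) => b z),
  oa = (%(i, j). case i of Inl z => idn C (b z) | Inr ((z, z', w), n) =>
  (case j of Inl z'' => if n = 1 then w else idn C (b z) | Inr r => idn C (b z)))\<rparr>"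

lemma trans_zigzag_rel: "trans zigzag_rel"
 unfolding zigzag_rel_def by (rule transI) auto

lemma refl_zigzag_rel: "(i, i) : zigzag_rel"
 by (simp add: zigzag_rel_def)

context category
begin

lemma cat_functor_zigzag:
 assumes "gdiagram C S b R"
 shows "cat_functor (poset_cat (S <+> R \<times> {0, 1, 2}) zigzag_rel) C (zigzag_fun C b)"
proof -
 have b [simp]: "b z : ob C" if "z : S" for z using assms that by (simp add: gdiagram_def)
 have R: "z : S" "z' : S" "w : ar C" "dm C w = b z" "cd C w = b z'" if "(z, z', w) : R" for z z' w
  using assms that by (auto simp: gdiagram_def)
 let ?P = "S <+> R \<times> {0, 1, 2 :: nat}" and ?D = "zigzag_fun C b"
 have ob: "oo ?D i : ob C" if "i : ?P" for i using that R(1) by (auto simp: zigzag_fun_def)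
 have id: "oa ?D (i, i) = idn C (oo ?D i)" if "i : ?P" for i
  using that by (auto simp: zigzag_fun_def)
 have hom: "oa ?D (i, j) : hom C (oo ?D i) (oo ?D j)" if "i : ?P" "j : ?P" "(i, j) : zigzag_rel" for i j
 proof (cases "i = j")
  case True then show ?thesis using id[OF that(1)] ob[OF that(1)] by simp
 next
  case False then show ?thesis using that R by (auto simp: zigzag_rel_def zigzag_fun_def)
 qed
 \<comment> \<open>Nontrivial relations start at vertices numbered 0 or 1 and end at old vertices or
   at those numbered 2, so two of them never compose.\<close>
 have triv: "i = j \<or> j = k" if "(i, j) : zigzag_rel" "(j, k) : zigzag_rel" for i j k :: "'s + ('s \<times> 's \<times> 'a) \<times> nat"
  using that by (auto simp: zigzag_rel_def)
 show ?thesis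
  unfolding cat_functor_def
 proof (intro conjI ballI impI)
  let ?J = "poset_cat ?P zigzag_rel"
  fix f g assume fg: "f : ar ?J" "g : ar ?J" "dm ?J g = cd ?J f"
  obtain i j k where ijk: "f = (i, j)" "g = (j, k)" using fg(3) by (cases f; cases g) auto
  then have P: "i : ?P" "j : ?P" "k : ?P" "(i, j) : zigzag_rel" "(j, k) : zigzag_rel" using fg by auto
  have "i = j \<or> j = k" using triv P by blast
  then have "oa ?D (i, k) = oa ?D (j, k) $ oa ?D (i, j)"
  proof
  assume "i = j"
  then show ?thesis using id[OF P(2)] hom[OF P(2,3,5)] by (simp only:) simp
  next
  assume "j = k"
  then show ?thesis using id[OF P(2)] hom[OF P(1,2,4)] by (simp only:) simp
  qed
  then show "oa ?D (g $\<^bsub>?J\<^esub> f) = oa ?D g $ oa ?D f" by (simp add: ijk)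
 next
  fix f assume "f : ar (poset_cat ?P zigzag_rel)"
  then show "oa ?D f : hom C (oo ?D (dm (poset_cat ?P zigzag_rel) f)) (oo ?D (cd (poset_cat ?P zigzag_rel) f))"
  by (cases f) (use hom in auto)
 qed (use ob id in auto)
qed

text \<open>The three identity edges force a cocone to take the same value at \<open>Inl z\<close>
  and at all new vertices of an edge out of \<open>z\<close>; the fourth edge then states the cocone
  equation of the original edge.\<close>

lemma gcolim_zigzag:
 assumes d: "gdiagram C S b R"
  and colim: "gcolim C (S <+> R \<times> {0, 1, 2}) (oo (zigzag_fun C b)) (poset_edges (S <+> R \<times> {0, 1, 2}) zigzag_rel (zigzag_fun C b)) x e"
 shows "gcolim C S b R x (e \<circ> Inl)"
proof -
 have b [simp]: "b z : ob C" if "z : S" for z using d that by (simp add: gdiagram_def)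
 have R: "z : S" "z' : S" "w : ar C" "dm C w = b z" "cd C w = b z'" if "(z, z', w) : R" for z z' w
  using d that by (auto simp: gdiagram_def)
 let ?P = "S <+> R \<times> {0, 1, 2 :: nat}" and ?D = "zigzag_fun C b"
 let ?co = "gcocone C ?P (oo ?D) (poset_edges ?P zigzag_rel ?D)"
 have oo: "oo ?D (Inl z) = b z" "oo ?D (Inr ((z, z', w), n)) = b z" for z z' w n
  by (simp_all add: zigzag_fun_def)
 have edge: "f j $ oa ?D (i, j) = f i"
  if "?co y f" "i : ?P" "j : ?P" "(i, j) : zigzag_rel" for y f i j
  using that by (auto simp: gcocone_def poset_edges_def)
 have co1: "gcocone C S b R y (f \<circ> Inl)" "!!z z' w n. (z, z', w) : R ==> n : {0, 1, 2} ==> f (Inr ((z, z', w), n)) = f (Inl z)"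
  if co: "?co y f" for y f
 proof -
  have fP: "f i : hom C (oo ?D i) y" if "i : ?P" for i using co that unfolding gcocone_def by blast
  have f: "f (Inl z) : hom C (b z) y" if "z : S" for z
  using fP[OF InlI[OF that]] by (simp only: oo)
  have f': "f (Inr ((z, z', w), n)) : hom C (b z) y" if "(z, z', w) : R" "n : {0, 1, 2}" for z z' w n
  using fP[OF InrI[OF SigmaI[OF that]]] by (simp only: oo)
  have e0: "f (Inl z) = f (Inr ((z, z', w), 0))" "f (Inr ((z, z', w), 2)) = f (Inr ((z, z', w), 0))"
  "f (Inr ((z, z', w), 2)) = f (Inr ((z, z', w), 1))" "f (Inl z') $ w = f (Inr ((z, z', w), 1))" if r: "(z, z', w) : R" for z z' w
  using edge[OF co, of "Inr ((z, z', w), 0)" "Inl z"] edge[OF co, of "Inr ((z, z', w), 0)" "Inr ((z, z', w), 2)"]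
  edge[OF co, of "Inr ((z, z', w), 1)" "Inr ((z, z', w), 2)"] edge[OF co, of "Inr ((z, z', w), 1)" "Inl z'"]
  R[OF r] r f[of z] f'[OF r] by (auto simp: zigzag_rel_def zigzag_fun_def)
  show "f (Inr ((z, z', w), n)) = f (Inl z)" if "(z, z', w) : R" "n : {0, 1, 2}" for z z' w n
  using e0[OF that(1)] that(2) by auto
  show "gcocone C S b R y (f \<circ> Inl)"
  using co f e0 by (auto simp: gcocone_def)
 qed
 have co2: "?co y (%i. case i of Inl z => f z | Inr ((z, z', w), n) => f z)" if co: "gcocone C S b R y f" for y f
 proof -
  let ?f = "%i. case i of Inl z => f z | Inr ((z, z', w), n) => f z"
  have f: "f z : ar C" "dm C (f z) = b z" "cd C (f z) = y" if "z : S" for z using co that by (auto simp: gcocone_def)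
  have fw: "f z' $ w = f z" if "(z, z', w) : R" for z z' w using co that by (auto simp: gcocone_def)
  have "?f j $ oa ?D (i, j) = ?f i" if "i : ?P" "j : ?P" "(i, j) : zigzag_rel" for i j
  proof (cases "i = j")
  case True then show ?thesis using that f R(1) by (auto simp: zigzag_fun_def)
  next
  case False then show ?thesis using that f R fw by (auto simp: zigzag_rel_def zigzag_fun_def)
  qed
  moreover have "?f i : hom C (oo ?D i) y" if "i : ?P" for i using that f R(1) by (auto simp: oo)
  moreover have "y : ob C" using co by (simp add: gcocone_def)
  ultimately show ?thesis unfolding gcocone_def poset_edges_def by blast
 qed
 have "EX! u. u : hom C x y & (ALL z:S. u $ (e \<circ> Inl) z = f z)" if "gcocone C S b R y f" for y f
 proof -
  have "EX! u. u : hom C x y & (ALL i:?P. u $ e i = (case i of Inl z => f z | Inr ((z, z', w), n) => f z))"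
  using colim co2[OF that] unfolding gcolim_def by blast
  moreover have "(ALL i:?P. u $ e i = (case i of Inl z => f z | Inr ((z, z', w), n) => f z)) \<longleftrightarrow> (ALL z:S. u $ (e \<circ> Inl) z = f z)" for u
  proof (intro iffI ballI)
  fix z assume "ALL i:?P. u $ e i = (case i of Inl z => f z | Inr ((z, z', w), n) => f z)" "z : S"
  from bspec[OF this(1) InlI[OF this(2)]] show "u $ (e \<circ> Inl) z = f z" by simp
  next
  fix i assume *: "ALL z:S. u $ (e \<circ> Inl) z = f z" and "i : ?P"
  then show "u $ e i = (case i of Inl z => f z | Inr ((z, z', w), n) => f z)"
  proof (cases i)
  case (Inl z) then show ?thesis using * \<open>i : ?P\<close> by auto
  next
  case (Inr r)
  then obtain z z' w n where r: "r = ((z, z', w), n)" "(z, z', w) : R" "n : {0, 1, 2}"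
  using \<open>i : ?P\<close> by (cases r) auto
  have "e i = e (Inl z)"
  unfolding Inr r(1) by (rule co1(2)[OF gcolim_cocone[OF colim] r(2,3)])
  then show ?thesis using * R(1)[OF r(2)] by (simp add: Inr r(1))
  qed
  qed
  ultimately show ?thesis by simp
 qed
 then show ?thesis using co1(1)[OF gcolim_cocone[OF colim]] unfolding gcolim_def by blast
qed

text \<open>Colimits over preorders are what the weighted colimits supply; subdividing edges turns
  any small graph into such a shape.\<close>

lemma graph_cocompleteI:
 fixes ka :: "'u rel"
 assumes ka: "inaccessible ka"
  and poset: "!!(P :: 'u set) le D. small ka P ==> trans le ==> (!!i. i : P ==> (i, i) : le) ==>
  cat_functor (poset_cat P le) C D ==> EX x c. is_colim C (poset_cat P le) D x c"
 shows "graph_cocomplete ka C"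
 unfolding graph_cocomplete_def
proof (intro allI impI, elim conjE)
 fix S :: "'u set" and b R assume S: "small ka S" "small ka R" and d: "gdiagram C S b R"
 let ?P = "S <+> R \<times> {0, 1, 2 :: nat}" and ?D = "zigzag_fun C b"
 have "small ka ?P" by (intro small_Plus small_Sigma ka S small_finite) auto
 then obtain fi :: "_ => 'u" where fi: "inj_on fi ?P" using small_embed[OF ka] by blast
 have D: "cat_functor (poset_cat (fi ` ?P) (image_rel fi ?P zigzag_rel)) C (image_fun fi ?P ?D)"
  by (rule cat_functor_image[OF fi cat_functor_zigzag[OF d]])
 obtain x c where "is_colim C (poset_cat (fi ` ?P) (image_rel fi ?P zigzag_rel)) (image_fun fi ?P ?D) x c"
  using poset[OF small_image[OF \<open>small ka ?P\<close>] trans_image_rel[OF fi trans_zigzag_rel] refl_image_rel[OF refl_zigzag_rel] D] by blast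
 then have c: "gcolim C (fi ` ?P) (oo ?D \<circ> inv_into ?P fi) ((%(z, z', w). (fi z, fi z', w)) ` poset_edges ?P zigzag_rel ?D) x c"
  unfolding is_colim_poset_iff_gcolim[OF D] poset_edges_image[OF fi] by (simp add: image_fun_def)
 have "gcolim C ?P (oo ?D) (poset_edges ?P zigzag_rel ?D) x (c \<circ> fi)"
  by (rule gcolim_reindex[OF fi gdiagram_poset[OF cat_functor_zigzag[OF d]] c])
 from gcolim_zigzag[OF d this] show "EX x e. gcolim C S b R x e" by blast
qed

end

lemma (in enriched) graph_cocomplete_und:
 assumes "inaccessible ka" "has_weighted_colimits ka V (self V)" "has_weighted_colimits ka V K"
 shows "graph_cocomplete ka (und V K)"
 by (rule und.graph_cocompleteI[OF assms(1)]) (metis conical_colim_exists[OF assms] conical_colim_is_colim)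

section \<open>Passage between arrows of V and their names\<close>

context symmetric_monoidal_closed
begin

definition name_ar :: "'a => 'o \<times> 'o \<times> 'a" where
 "name_ar f = (dm V f, cd V f, arrow_name f)"

definition unname_ar :: "'o \<times> 'o \<times> 'a => 'a" where
 "unname_ar = (%(a, b, h). named_arrow a b h)"

lemma name_ar_hom: "f : hom V a b ==> name_ar f : hom (und V (self V)) a b"
 by (auto simp: name_ar_def)

lemma unname_ar_hom: "t : hom (und V (self V)) a b ==> unname_ar t : hom V a b"
 by (cases t) (auto simp: unname_ar_def)

lemma unname_name_ar: "f : ar V ==> unname_ar (name_ar f) = f"
 by (simp add: name_ar_def unname_ar_def)

lemma name_unname_ar: "t : ar (und V (self V)) ==> name_ar (unname_ar t) = t"
 by (cases t) (auto simp: name_ar_def unname_ar_def)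

lemma name_ar_cmp:
 assumes "f : hom V a b" "g : hom V b c"
 shows "name_ar (g $ f) = name_ar g $\<^bsub>und V (self V)\<^esub> name_ar f"
proof -
 have "a : ob V" "b : ob V" "c : ob V" using assms by auto
 then show ?thesis using assms arrow_name_cmp[OF assms] by (simp add: name_ar_def)
qed

lemma unname_ar_cmp:
 assumes "s : hom (und V (self V)) a b" "t : hom (und V (self V)) b c"
 shows "unname_ar (t $\<^bsub>und V (self V)\<^esub> s) = unname_ar t $ unname_ar s"
proof -
 have h: "unname_ar s : hom V a b" "unname_ar t : hom V b c" using assms by (auto intro: unname_ar_hom simp del: hom_iff)
 have "name_ar (unname_ar t $ unname_ar s) = t $\<^bsub>und V (self V)\<^esub> s"
  using name_ar_cmp[OF h] assms by (simp add: name_unname_ar)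
 then show ?thesis using unname_name_ar[of "unname_ar t $ unname_ar s"] h by simp
qed

lemma name_ar_idn: "a : ob V ==> name_ar (idn V a) = idn (und V (self V)) a"
 by (simp add: name_ar_def arrow_name_idn)

definition unname_edges :: "('s \<times> 's \<times> 'o \<times> 'o \<times> 'a) set => ('s \<times> 's \<times> 'a) set" where
 "unname_edges R = (%(z, z', w). (z, z', unname_ar w)) ` R"

lemma gdiagram_unname:
 assumes "gdiagram (und V (self V)) S b R"
 shows "gdiagram V S b (unname_edges R)"
proof -
 have "z : S & z' : S & unname_ar w : hom V (b z) (b z')" if "(z, z', w) : R" for z z' w
  using assms that unname_ar_hom[of w "b z" "b z'"] unfolding gdiagram_def by fastforce
 then show ?thesis using assms unfolding gdiagram_def unname_edges_def by auto
qed

lemma gcolim_unname: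
 assumes d: "gdiagram (und V (self V)) S b R" and colim: "gcolim (und V (self V)) S b R x e"
 shows "gcolim V S b (unname_edges R) x (%z. unname_ar (e z))"
proof -
 let ?U = "und V (self V)"
 have R: "z : S" "z' : S" "w : hom ?U (b z) (b z')" if "(z, z', w) : R" for z z' w
  using d that unfolding gdiagram_def by auto
 have co1: "gcocone V S b (unname_edges R) y (%z. unname_ar (f z))" if co: "gcocone ?U S b R y f" for y f
 proof -
  have f: "f z : hom ?U (b z) y" if "z : S" for z using co that unfolding gcocone_def by blast
  have "unname_ar (f z') $ unname_ar w = unname_ar (f z)" if r: "(z, z', w) : R" for z z' w
  proof -
  have "f z' $\<^bsub>?U\<^esub> w = f z" using co r unfolding gcocone_def by blast
  then show ?thesis using unname_ar_cmp[OF R(3)[OF r] f[OF R(2)[OF r]]] by simp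
  qed
  then show ?thesis using co unname_ar_hom[OF f] unfolding gcocone_def unname_edges_def by auto
 qed
 have co2: "gcocone ?U S b R y (%z. name_ar (f z))" if co: "gcocone V S b (unname_edges R) y f" for y f
 proof -
  have f: "f z : hom V (b z) y" if "z : S" for z using co that unfolding gcocone_def by blast
  have "name_ar (f z') $\<^bsub>?U\<^esub> w = name_ar (f z)" if r: "(z, z', w) : R" for z z' w
  proof -
  have "(z, z', unname_ar w) : unname_edges R" unfolding unname_edges_def using r by force
  then have "f z' $ unname_ar w = f z" using co unfolding gcocone_def by blast
  moreover have "name_ar (f z' $ unname_ar w) = name_ar (f z') $\<^bsub>?U\<^esub> w"
  using name_ar_cmp[OF unname_ar_hom[OF R(3)[OF r]] f[OF R(2)[OF r]]] R(3)[OF r]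
  by (simp add: name_unname_ar)
  ultimately show ?thesis by simp
  qed
  then show ?thesis using co name_ar_hom[OF f] unfolding gcocone_def by auto
 qed
 note e = gcolim_arr[OF colim]
 have "EX! u. u : hom V x y & (ALL z:S. u $ unname_ar (e z) = f z)" if co: "gcocone V S b (unname_edges R) y f" for y f
 proof -
  have f: "f z : hom V (b z) y" if "z : S" for z using co that unfolding gcocone_def by blast
  have eh: "e z : hom ?U (b z) x" if "z : S" for z using e that by simp
  have ex: "EX! v. v : hom ?U x y & (ALL z:S. v $\<^bsub>?U\<^esub> e z = name_ar (f z))"
  using colim co2[OF co] unfolding gcolim_def by blast
  show ?thesis
  proof (rule ex_ex1I)
  obtain v where v: "v : hom ?U x y" "ALL z:S. v $\<^bsub>?U\<^esub> e z = name_ar (f z)" using ex by blast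
  have "unname_ar v $ unname_ar (e z) = f z" if "z : S" for z
  using unname_ar_cmp[OF eh[OF that] v(1)] v(2) f[OF that] that by (simp add: unname_name_ar)
  then show "EX u. u : hom V x y & (ALL z:S. u $ unname_ar (e z) = f z)"
  using unname_ar_hom[OF v(1)] by blast
  next
  fix u u' assume u: "u : hom V x y & (ALL z:S. u $ unname_ar (e z) = f z)"
  and u': "u' : hom V x y & (ALL z:S. u' $ unname_ar (e z) = f z)"
  have "name_ar w : hom ?U x y & (ALL z:S. name_ar w $\<^bsub>?U\<^esub> e z = name_ar (f z))"
  if "w : hom V x y & (ALL z:S. w $ unname_ar (e z) = f z)" for w
  proof (intro conjI ballI name_ar_hom)
  fix z assume z: "z : S"
  have "name_ar (w $ unname_ar (e z)) = name_ar w $\<^bsub>?U\<^esub> name_ar (unname_ar (e z))"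
  using that by (intro name_ar_cmp[OF unname_ar_hom[OF eh[OF z]]]) blast
  then show "name_ar w $\<^bsub>?U\<^esub> e z = name_ar (f z)"
  using that z eh[OF z] by (simp add: name_unname_ar)
  qed (use that in blast)
  from ex1_unique[OF ex this[OF u] this[OF u']] have "name_ar u = name_ar u'" .
  moreover have "u : ar V" "u' : ar V" using u u' by (simp_all only: hom_iff)
  ultimately show "u = u'" by (metis unname_name_ar)
  qed
 qed
 then show ?thesis using co1[OF gcolim_cocone[OF colim]] unfolding gcolim_def by blast
qed

lemma graph_cocomplete_base:
 fixes ka :: "'u rel"
 assumes "inaccessible ka" "has_weighted_colimits ka V (self V)"
 shows "graph_cocomplete ka V"
 unfolding graph_cocomplete_def
proof (intro allI impI, elim conjE)
 fix S :: "'u set" and b R assume S: "small ka S" "small ka R" and d: "gdiagram V S b R"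
 let ?R = "(%(z, z', w). (z, z', name_ar w)) ` R"
 have R: "z : S" "z' : S" "w : hom V (b z) (b z')" if "(z, z', w) : R" for z z' w
  using d that unfolding gdiagram_def by auto
 have "gdiagram (und V (self V)) S b ?R"
  unfolding gdiagram_def using R name_ar_hom[OF R(3)] d
  by (auto simp: gdiagram_def)
 moreover from this obtain x e where "gcolim (und V (self V)) S b ?R x e"
  using self.graph_cocomplete_und[OF assms(1,2,2)] S small_image[OF S(2)] unfolding graph_cocomplete_def by blast
 ultimately have "gcolim V S b (unname_edges ?R) x (%z. unname_ar (e z))" by (rule gcolim_unname)
 moreover have "unname_edges ?R = R"
 proof -
  have "unname_edges ?R = (%r. r) ` R"
  unfolding unname_edges_def image_image
  by (rule image_cong[OF refl]) (use R(3) in \<open>auto simp: unname_name_ar\<close>)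
  then show ?thesis by simp
 qed
 ultimately show "EX x e. gcolim V S b R x e" by auto
qed

end


section \<open>Representability\<close>

definition jointly_epic :: "('o, 'a, 'z) cat_scheme => 'o => 'a set => bool" where
 "jointly_epic C x F \<longleftrightarrow> x : ob C & (ALL f:F. f : ar C & cd C f = x) &
  (ALL u:ar C. ALL v:ar C. dm C u = x & dm C v = x & cd C u = cd C v & (ALL f:F. u $\<^bsub>C\<^esub> f = v $\<^bsub>C\<^esub> f) --> u = v)"

lemma (in category) jointly_epic_gcolim:
 assumes "gdiagram C S b R" "gcolim C S b R x e"
 shows "jointly_epic C x (e ` S)"
 unfolding jointly_epic_def
proof (intro conjI ballI impI)
 show "x : ob C" using gcolim_arr(1)[OF assms(2)] .
 show "f : ar C" "cd C f = x" if "f : e ` S" for f using that gcolim_arr(2,4)[OF assms(2)] by auto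
 show "u = v" if "u : ar C" "v : ar C" "dm C u = x & dm C v = x & cd C u = cd C v & (ALL f:e ` S. u $ f = v $ f)" for u v
  by (rule gcolim_ext[OF assms(2,1)]) (use that in auto)
qed

text \<open>Weaker than density: each object is the colimit of some small diagram in
  \<open>A\<close>, not necessarily of the canonical one.\<close>

definition densely_generated :: "'u rel => ('o, 'a, 'z) cat_scheme => 'o set => bool" where
 "densely_generated ka C A \<longleftrightarrow> A <= ob C & (ALL y:ob C. EX (S :: 'u set) b R e.
  gdiagram C S b R & gcolim C S b R y e & b ` S <= A)"

text \<open>
 \<open>N x p\<close> says that the family \<open>p\<close> with vertex \<open>x\<close> is a wedge. A weakly universal wedge is the colimit of
 all wedges with vertex in the dense set \<open>A\<close>; coequalizing all its endomorphisms makes it universal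
 (Freyd).
\<close>

lemma (in category) universal_wedge_exists:
 fixes ka :: "'u rel" and N :: "'o => ('d => 'a) => bool"
 assumes ka: "inaccessible ka" and cocomplete: "graph_cocomplete ka C" and ls: "locally_small ka C"
  and A: "small ka A" "densely_generated ka C A" and I: "small ka I" "!!d. d : I ==> c d : ob C"
  and N_hom: "!!x p d. N x p ==> x : ob C & (d : I --> p d : hom C x (c d))"
  and N_cong: "!!x p q. N x p ==> (!!d. d : I ==> p d = q d) ==> N x q"
  and N_cmp: "!!x y p u. N x p ==> u : hom C y x ==> N y (%d. p d $ u)"
  and N_glue: "!!x p F. jointly_epic C x F ==> (!!d. d : I ==> p d : hom C x (c d)) ==>
  (!!f. f : F ==> N (dm C f) (%d. p d $ f)) ==> N x p"
 obtains x p where "N x p" "!!y q. N y q ==> EX! u. u : hom C y x & (ALL d:I. p d $ u = q d)"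
proof -
 have A_ob: "a : ob C" if "a : A" for a using A(2) that by (auto simp: densely_generated_def)
 have small_hom: "small ka (hom C a b)" if "a : ob C" "b : ob C" for a b
  using ls that by (simp add: locally_small_def)
 \<comment> \<open>All wedges with vertex in \<open>A\<close>. The families are taken extensional on
   \<open>I\<close>, so that they form a small set.\<close>
 define S where "S = {(a, p). a : A & p : PiE I (%d. hom C a (c d)) & N a p}"
 have "small ka (SIGMA a:A. PiE I (%d. hom C a (c d)))"
  by (intro small_Sigma small_PiE ka A(1) I small_hom A_ob)
 then have S_small: "small ka S" by (rule small_subset) (auto simp: S_def)
 define R where "R = {(z, z', w). z : S & z' : S & w : hom C (fst z) (fst z') & (ALL d:I. snd z' d $ w = snd z d)}"
 have "small ka (SIGMA z:S. SIGMA z':S. hom C (fst z) (fst z'))"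
  by (intro small_Sigma ka S_small small_hom) (auto simp: S_def intro: A_ob)
 then have R_small: "small ka R" by (rule small_subset) (auto simp: R_def)
 have d0: "gdiagram C S fst R" by (auto simp: gdiagram_def R_def S_def intro: A_ob)
 obtain x0 e0 where colim0: "gcolim C S fst R x0 e0"
  using gcolim_exists[OF ka cocomplete S_small R_small d0] .
 note e0 = gcolim_arr[OF colim0]
 have S_hom: "snd z d : hom C (fst z) (c d)" if "z : S" "d : I" for z d
  using that by (auto simp: S_def simp del: hom_iff)
 have "EX u. u : hom C x0 (c d) & (ALL z:S. u $ e0 z = snd z d)" if d: "d : I" for d
 proof -
  have "gcocone C S fst R (c d) (%z. snd z d)"
  unfolding gcocone_def using I(2)[OF d] S_hom[OF _ d] d by (auto simp: R_def)
  from gcolim_induced[OF colim0 this] show ?thesis by metis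
 qed
 then obtain p0 where p0: "!!d. d : I ==> p0 d : hom C x0 (c d)" "!!d z. d : I ==> z : S ==> p0 d $ e0 z = snd z d"
  by metis
 have N0: "N x0 p0"
 proof (rule N_glue[OF jointly_epic_gcolim[OF d0 colim0] p0(1)])
  fix f assume "f : e0 ` S"
  then obtain z where z: "z : S" "f = e0 z" by auto
  have "N (fst z) (snd z)" using z(1) by (auto simp: S_def)
  then show "N (dm C f) (%d. p0 d $ f)" unfolding z(2) e0(3)[OF z(1)] by (rule N_cong) (simp add: p0(2) z(1))
 qed
 have weak: "EX u. u : hom C y x0 & (ALL d:I. p0 d $ u = q d)" if q: "N y q" for y q
 proof -
  have y: "y : ob C" using N_hom[OF q] by blast
  have qh: "q d : hom C y (c d)" if "d : I" for d using N_hom[OF q] that by blast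
  obtain S' :: "'u set" and b R' e where colim: "gdiagram C S' b R'" "gcolim C S' b R' y e" "b ` S' <= A"
  using A(2) y unfolding densely_generated_def by blast
  note e = gcolim_arr[OF colim(2)]
  \<comment> \<open>An arbitrary wedge is restricted along the legs of a presentation of its vertex
    by \<open>A\<close>. The restrictions are vertices of the diagram \<open>S\<close>, which yields
    an arrow to \<open>x0\<close>.\<close>
  define z where "z k = (b k, restrict (%d. q d $ e k) I)" for k
  have zS: "z k : S" if k: "k : S'" for k
  proof -
  have "N (b k) (%d. q d $ e k)" using N_cmp[OF q, of "e k" "b k"] e k by simp
  then have "N (b k) (restrict (%d. q d $ e k) I)" by (rule N_cong) simp
  moreover have "b k : A" using colim(3) k by blast
  moreover have "restrict (%d. q d $ e k) I : PiE I (%d. hom C (b k) (c d))"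
  using e k qh by auto
  ultimately show ?thesis by (simp add: S_def z_def)
  qed
  have "gcocone C S' b R' x0 (%k. e0 (z k))"
  unfolding gcocone_def
  proof (intro conjI ballI)
  show "x0 : ob C" by (rule e0(1))
  show "e0 (z k) : hom C (b k) x0" if "k : S'" for k using e0(2-4)[OF zS[OF that]] by (simp add: z_def)
  fix r assume r: "r : R'"
  obtain k k' w where kw: "r = (k, k', w)" by (cases r)
  have k: "k : S'" "k' : S'" and w: "w : hom C (b k) (b k')"
  using colim(1) r kw by (auto simp: gdiagram_def)
  have "q d $ e k' $ w = q d $ e k" for d using e(5) r kw by simp
  then have "(z k, z k', w) : R"
  using k zS w e qh by (simp add: R_def) (simp add: z_def)
  then show "case r of (k, k', w) => e0 (z k') $ w = e0 (z k)" using e0(5) kw by simp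
  qed
  then obtain u where u: "u : hom C y x0" "!!k. k : S' ==> u $ e k = e0 (z k)"
  using gcolim_induced[OF colim(2)] by metis
  have "p0 d $ u = q d" if d: "d : I" for d
  proof (rule gcolim_ext[OF colim(2,1)])
  fix k assume k: "k : S'"
  have "(p0 d $ u) $ e k = p0 d $ e0 (z k)" using u(1) u(2)[OF k] p0(1)[OF d] e k by simp
  also have "... = q d $ e k" using p0(2)[OF d zS[OF k]] d by (simp add: z_def)
  finally show "(p0 d $ u) $ e k = q d $ e k" .
  qed (use u(1) p0(1)[OF d] qh[OF d] in simp_all)
  then show ?thesis using u(1) by blast
 qed
 \<comment> \<open>Endomorphisms of the weakly universal wedge; \<open>x\<close> below is their
   joint coequalizer, with quotient arrow \<open>w\<close>.\<close>
 define W where "W = {u : hom C x0 x0. ALL d:I. p0 d $ u = p0 d}"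
 have W_small: "small ka ((%u. ((), (), u)) ` W)"
  by (rule small_image, rule small_subset[OF small_hom[OF e0(1) e0(1)]]) (auto simp: W_def)
 have d1: "gdiagram C {()} (%_. x0) ((%u. ((), (), u)) ` W)"
  using e0(1) by (auto simp: gdiagram_def W_def)
 obtain x e1 where colim1: "gcolim C {()} (%_. x0) ((%u. ((), (), u)) ` W) x e1"
  using gcolim_exists[OF ka cocomplete small_finite[OF ka] W_small d1] by blast
 define w where "w = e1 ()"
 have w: "w : ar C" "dm C w = x0" "cd C w = x" "x : ob C" "!!u. u : W ==> w $ u = w"
  using gcolim_arr[OF colim1] by (auto simp: w_def)
 have w_epi: "u = v" if "u : ar C" "v : ar C" "dm C u = x" "dm C v = x" "cd C v = cd C u" "u $ w = v $ w" for u v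
  by (rule gcolim_ext[OF colim1 d1]) (use that in \<open>simp_all add: w_def\<close>)
 have "EX u. u : hom C x (c d) & u $ w = p0 d" if d: "d : I" for d
 proof -
  have "gcocone C {()} (%_. x0) ((%u. ((), (), u)) ` W) (c d) (%_. p0 d)"
  unfolding gcocone_def using p0(1)[OF d] I(2)[OF d] d by (auto simp: W_def)
  from gcolim_induced[OF colim1 this] show ?thesis by (metis w_def insertI1)
 qed
 then obtain p where p: "!!d. d : I ==> p d : hom C x (c d)" "!!d. d : I ==> p d $ w = p0 d" by metis
 have N1: "N x p"
 proof (rule N_glue[OF jointly_epic_gcolim[OF d1 colim1] p(1)])
  fix f assume "f : e1 ` {()}"
  then have f: "f = w" by (simp add: w_def)
  show "N (dm C f) (%d. p d $ f)" unfolding f w(2) using N0 by (rule N_cong) (simp add: p(2))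
 qed
 have "EX! u. u : hom C y x & (ALL d:I. p d $ u = q d)" if q: "N y q" for y q
 proof (rule ex_ex1I)
  obtain u where u: "u : hom C y x0" "ALL d:I. p0 d $ u = q d" using weak[OF q] by blast
  have "p d $ w $ u = q d" if d: "d : I" for d
  using u d extend[OF p(2)[OF d], of u] w p(1)[OF d] by simp
  then show "EX u. u : hom C y x & (ALL d:I. p d $ u = q d)" using u(1) w by (intro exI[of _ "w $ u"]) simp
 next
  fix u v assume u: "u : hom C y x & (ALL d:I. p d $ u = q d)" and v: "v : hom C y x & (ALL d:I. p d $ v = q d)"
  have y: "y : ob C" using N_hom[OF q] by blast
  \<comment> \<open>The coequalizer of \<open>u\<close> and \<open>v\<close>, as the colimit of a
    two-vertex graph. It inherits a wedge, which weak universality sends back to \<open>x0\<close>;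
    the resulting endomorphism of \<open>x0\<close> is absorbed by \<open>w\<close>, so the quotient
    arrow \<open>f\<close> is split monic and \<open>u = v\<close>.\<close>
  let ?b = "%i. if i then y else x" and ?R = "{(True, False, u), (True, False, v)}"
  have d2: "gdiagram C UNIV ?b ?R" using u v y w(4) by (simp add: gdiagram_def)
  obtain r e2 where colim2: "gcolim C UNIV ?b ?R r e2"
  using gcolim_exists[OF ka cocomplete small_finite[OF ka] small_finite[OF ka] d2] by auto
  define f where "f = e2 False"
  have f: "f : ar C" "dm C f = x" "cd C f = r" "r : ob C" "f $ u = e2 True" "f $ v = e2 True"
  using gcolim_arr[OF colim2] by (auto simp: f_def)
  have "EX s. s : hom C r (c d) & s $ f = p d" if d: "d : I" for d
  proof -
  have "gcocone C UNIV ?b ?R (c d) (%i. if i then q d else p d)"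
  unfolding gcocone_def using p(1)[OF d] I(2)[OF d] d u v N_hom[OF q, of d] by auto
  from gcolim_induced[OF colim2 this] show ?thesis unfolding f_def by (metis UNIV_I)
  qed
  then obtain s where s: "!!d. d : I ==> s d : hom C r (c d)" "!!d. d : I ==> s d $ f = p d" by metis
  have "N r s"
  proof (rule N_glue[OF jointly_epic_gcolim[OF d2 colim2] s(1)])
  fix g assume "g : range e2"
  then consider "g = f" | "g = f $ u" using f(5) unfolding f_def by (metis (full_types) rangeE)
  then show "N (dm C g) (%d. s d $ g)"
  proof cases
  case 1 show ?thesis unfolding 1 f(2) using N1 by (rule N_cong) (simp add: s(2))
  next
  case 2
  have "dm C g = y" using 2 f(5) gcolim_arr(3)[OF colim2, of True] by simp
  moreover have "q d = s d $ g" if d: "d : I" for d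
  proof -
  have "s d $ f $ u = p d $ u" by (rule extend[OF s(2)[OF d]]) (use s(1)[OF d] f u in simp_all)
  then show ?thesis using 2 u d by simp
  qed
  ultimately show ?thesis using N_cong[OF q] by simp
  qed
  qed
  then obtain t where t: "t : hom C r x0" "ALL d:I. p0 d $ t = s d" using weak by blast
  have "t $ f $ w : W"
  proof -
  have "p0 d $ t $ f $ w = p0 d" if d: "d : I" for d
  proof -
  have "p0 d $ t $ f $ w = s d $ f $ w"
  by (rule extend) (use t d p0(1)[OF d] f w in simp_all)
  also have "... = p d $ w" by (rule extend[OF s(2)[OF d]]) (use s(1)[OF d] f w in simp_all)
  finally show ?thesis using p(2)[OF d] by simp
  qed
  then show ?thesis using t f w by (simp add: W_def)
  qed
  then have "w $ t $ f $ w = w" by (rule w(5))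
  then have weq: "(w $ t $ f) $ w = idn C x $ w" using t(1) f(1-4) w(1-4) by simp
  have id: "w $ t $ f = idn C x"
  by (rule w_epi[OF _ _ _ _ _ weq]) (use t(1) f(1-4) w(1-4) in simp_all)
  have uv: "u : hom C y x" "v : hom C y x" using u v by blast+
  have "(w $ t $ f) $ u = w $ t $ f $ u" using t(1) f(1-4) w(1-4) uv by simp
  also have "f $ u = f $ v" by (simp only: f(5,6))
  also have "w $ t $ f $ v = (w $ t $ f) $ v" using t(1) f(1-4) w(1-4) uv by simp
  finally show "u = v" unfolding id using uv by simp
 qed
 with N1 show ?thesis by (rule that)
qed

section \<open>Limits in the base\<close>

text \<open>Transposition makes tensoring with \<open>b\<close> a left adjoint, which preserves
  jointly epic families.\<close>

lemma (in symmetric_monoidal_closed) jointly_epic_tensor: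
 assumes "jointly_epic V x F" "b : ob V" "u : hom V (x @@ b) c" "v : hom V (x @@ b) c"
  and eq: "!!f. f : F ==> u $ (f ** idn V b) = v $ (f ** idn V b)"
 shows "u = v"
proof -
 have x: "x : ob V" and c: "c : ob V" using assms(1,3) by (auto simp: jointly_epic_def)
 note [simp] = x c assms(2)
 have F: "f : ar V" "cd V f = x" if "f : F" for f using assms(1) that by (auto simp: jointly_epic_def)
 have "curry_ar V x b c u $ f = curry_ar V x b c v $ f" if f: "f : F" for f
  by (rule ev_ext[of b c _ _ "dm V f"]) (use F[OF f] assms(3,4) eq[OF f] in simp_all)
 moreover have "curry_ar V x b c u : hom V x (ihom V b c)" "curry_ar V x b c v : hom V x (ihom V b c)"
  using assms(3,4) by simp_all
 ultimately have eq: "curry_ar V x b c u = curry_ar V x b c v"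
  using assms(1) unfolding jointly_epic_def hom_iff by metis
 have "u = ev V b c $ (curry_ar V x b c u ** idn V b)" using curry_hom_ev(2)[of x b c u] assms(3) by simp
 also have "... = v" unfolding eq using curry_hom_ev(2)[of x b c v] assms(4) by simp
 finally show ?thesis .
qed

section \<open>Equalizers, pullbacks and ends in the base\<close>

locale complete_base = symmetric_monoidal_closed V
 for V :: "('o, 'a, 'z) smc_scheme" (structure) +
 fixes ka :: "'u rel" and AV :: "'o set"
 assumes ka: "inaccessible ka" and cocomplete: "graph_cocomplete ka V" and locally_small: "locally_small ka V"
  and A_small: "small ka AV" and A_dense: "densely_generated ka V AV"
begin

lemmas universal_wedge = universal_wedge_exists[OF ka cocomplete locally_small A_small A_dense]

lemma equalizer_exists:
 assumes "f : ar V" "g : ar V" "dm V g = dm V f" "cd V g = cd V f"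
 shows "EX e. is_equalizer V f g e"
proof -
 define N where "N x p \<longleftrightarrow> x : ob V & p () : hom V x (dm V f) & f $ p () = g $ p ()" for x and p :: "unit => 'a"
 obtain x p where xp: "N x p" and univ: "!!y q. N y q ==> EX! u. u : hom V y x & (ALL d:UNIV. p d $ u = q d)"
 proof (rule universal_wedge[where N = N and I = "UNIV :: unit set" and c = "%_. dm V f"])
  show "small ka (UNIV :: unit set)" by (rule small_finite[OF ka]) simp
  show "N y (%d. p d $ u)" if "N x p" "u : hom V y x" for x y p u
  using that assms extend[of f "p ()" "g $ p ()" u] by (auto simp: N_def)
  show "N x p" if F: "jointly_epic V x F" and p: "!!d. d : UNIV ==> p d : hom V x (dm V f)"
  and NF: "!!h. h : F ==> N (dm V h) (%d. p d $ h)" for x p F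
  proof -
  have "(f $ p ()) $ h = (g $ p ()) $ h" if "h : F" for h
  using NF[OF that] F that p[of "()"] assms by (simp add: N_def jointly_epic_def)
  moreover have "f $ p () : hom V x (cd V f)" "g $ p () : hom V x (cd V f)"
  using p[of "()"] assms by simp_all
  ultimately have "f $ p () = g $ p ()"
  using F unfolding jointly_epic_def hom_iff by metis
  moreover have "x : ob V" using F by (simp add: jointly_epic_def)
  ultimately show ?thesis using p[of "()"] by (simp add: N_def)
  qed
 qed (use assms in \<open>auto simp: N_def\<close>)
 have "EX! u. u : hom V (dm V h) (dm V (p ())) & p () $ u = h" if "h : ar V" "cd V h = dm V f" "f $ h = g $ h" for h
  using univ[of "dm V h" "%_. h"] that xp by (simp add: N_def)
 then have "is_equalizer V f g (p ())"
  using xp unfolding is_equalizer_def N_def by simp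
 then show ?thesis ..
qed

lemma pullback_exists:
 assumes "f : ar V" "g : ar V" "cd V g = cd V f"
 shows "EX p q. is_pullback V f g p q"
proof -
 define c where "c i = (if i then dm V f else dm V g)" for i
 define N where "N x p \<longleftrightarrow> x : ob V & (ALL i. p i : hom V x (c i)) & f $ p True = g $ p False" for x and p :: "bool => 'a"
 have c [simp]: "c True = dm V f" "c False = dm V g" "c i : ob V" for i using assms by (auto simp: c_def)
 obtain x p where xp: "N x p" and univ: "!!y q. N y q ==> EX! u. u : hom V y x & (ALL d:UNIV. p d $ u = q d)"
 proof (rule universal_wedge[where N = N and I = "UNIV :: bool set" and c = c])
  show "small ka (UNIV :: bool set)" by (rule small_finite[OF ka]) simp
  show "N y (%d. p d $ u)" if "N x p" "u : hom V y x" for x y p u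
  proof -
  have "f $ p True $ u = (g $ p False) $ u"
  by (rule extend) (use that assms in \<open>auto simp: N_def\<close>)
  then show ?thesis using that assms by (auto simp: N_def)
  qed
  show "N x p" if F: "jointly_epic V x F" and p: "!!d. d : UNIV ==> p d : hom V x (c d)"
  and NF: "!!h. h : F ==> N (dm V h) (%d. p d $ h)" for x p F
  proof -
  have "(f $ p True) $ h = (g $ p False) $ h" if "h : F" for h
  using NF[OF that] F that p[of True] p[of False] assms by (simp add: N_def jointly_epic_def)
  moreover have "f $ p True : hom V x (cd V f)" "g $ p False : hom V x (cd V f)"
  using p[of True] p[of False] assms by simp_all
  ultimately have "f $ p True = g $ p False"
  using F unfolding jointly_epic_def hom_iff by metis
  moreover have "x : ob V" using F by (simp add: jointly_epic_def)
  ultimately show ?thesis using p by (simp add: N_def)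
  qed
 qed (auto simp: N_def)
 have "EX! u. u : hom V y x & p True $ u = h & p False $ u = k"
  if "h : hom V y (dm V f)" "k : hom V y (dm V g)" "f $ h = g $ k" for y h k
 proof -
  have "N y (%i. if i then h else k)" using that by (auto simp: N_def)
  from univ[OF this] show ?thesis by (simp add: UNIV_bool conj_commute)
 qed
 moreover have p: "p True : hom V x (dm V f)" "p False : hom V x (dm V g)" "f $ p True = g $ p False"
  using xp c(1,2) unfolding N_def by metis+
 ultimately have "is_pullback V f g (p True) (p False)"
  unfolding is_pullback_def using assms p by (simp only: hom_iff) metis
 then show ?thesis by blast
qed

text \<open>The two sides of the naturality square for a wedge precomposed with \<open>u\<close> are
  the old sides composed with \<open>u\<close> tensor an identity. This gives stability under
  precomposition and, read backwards, gluing along jointly epic families.\<close>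

lemma natural_wedge_precompose:
 assumes "vcategory V D" "vfunctor V D (self V) F" "vfunctor V D (self V) G" "d : vob D" "d' : vob D"
  and p: "p : hom V x (ihom V (fo F d) (fo G d))" and u: "u : hom V y x" and p': "p' : hom V x (ihom V (fo F d') (fo G d'))"
 shows "vcmp (self V) (fo F d) (fo G d) (fo G d') $ (fm G d d' ** (p $ u)) $ swp V y (vhom D d d')
  = (vcmp (self V) (fo F d) (fo G d) (fo G d') $ (fm G d d' ** p) $ swp V x (vhom D d d')) $ (u ** idn V (vhom D d d'))"
  and "vcmp (self V) (fo F d) (fo F d') (fo G d') $ ((p' $ u) ** fm F d d')
  = (vcmp (self V) (fo F d) (fo F d') (fo G d') $ (p' ** fm F d d')) $ (u ** idn V (vhom D d d'))"
  and "vcmp (self V) (fo F d) (fo G d) (fo G d') $ (fm G d d' ** p) $ swp V x (vhom D d d')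
  : hom V (x @@ vhom D d d') (ihom V (fo F d) (fo G d'))"
  and "vcmp (self V) (fo F d) (fo F d') (fo G d') $ (p' ** fm F d d') : hom V (x @@ vhom D d d') (ihom V (fo F d) (fo G d'))"
proof -
 interpret F: enriched_functor V D "self V" F by (intro enriched_functorI enrichedI assms enriched_self)
 interpret G: enriched_functor V D "self V" G by (intro enriched_functorI enrichedI assms enriched_self)
 have [simp]: "x : ob V" "y : ob V" using u by auto
 have [simp]: "fo F d : ob V" "fo G d : ob V" "fo F d' : ob V" "fo G d' : ob V"
  using F.fo_vob[of d] F.fo_vob[of d'] G.fo_vob[of d] G.fo_vob[of d'] assms(4,5) by simp_all
 have "swp V x (vhom D d d') $ (u ** idn V (vhom D d d')) = (idn V (vhom D d d') ** u) $ swp V y (vhom D d d')"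
  using u assms(4,5) by (simp add: swp_nat)
 then show "vcmp (self V) (fo F d) (fo G d) (fo G d') $ (fm G d d' ** (p $ u)) $ swp V y (vhom D d d')
  = (vcmp (self V) (fo F d) (fo G d) (fo G d') $ (fm G d d' ** p) $ swp V x (vhom D d d')) $ (u ** idn V (vhom D d d'))"
  using p u assms(4,5) by simp
 show "vcmp (self V) (fo F d) (fo F d') (fo G d') $ ((p' $ u) ** fm F d d')
  = (vcmp (self V) (fo F d) (fo F d') (fo G d') $ (p' ** fm F d d')) $ (u ** idn V (vhom D d d'))"
  "vcmp (self V) (fo F d) (fo G d) (fo G d') $ (fm G d d' ** p) $ swp V x (vhom D d d')
  : hom V (x @@ vhom D d d') (ihom V (fo F d) (fo G d'))"
  "vcmp (self V) (fo F d) (fo F d') (fo G d') $ (p' ** fm F d d') : hom V (x @@ vhom D d d') (ihom V (fo F d) (fo G d'))"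
  using p p' u assms(4,5) by simp_all
qed

lemma natobj_exists:
 fixes D :: "('d, 'o, 'a) vcat"
 assumes D: "vcategory V D" "small ka (vob D)" and FG: "vfunctor V D (self V) F" "vfunctor V D (self V) G"
 shows "EX e p. is_natobj V D (self V) F G e p"
proof -
 note pre = natural_wedge_precompose[OF D(1) FG]
 let ?N = "natural_wedge V D (self V) F G"
 have ob: "fo F d : ob V" "fo G d : ob V" if "d : vob D" for d
  using vfunctor.fo_vob[OF FG(1) that] vfunctor.fo_vob[OF FG(2) that] by simp_all
 have vh: "vhom D d d' : ob V" if "d : vob D" "d' : vob D" for d d'
  using vcategory.vhom_ob[OF D(1) that] .
 have N_hom: "x : ob V & (d : vob D --> p d : hom V x (ihom V (fo F d) (fo G d)))" if "?N x p" for x p d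
  using that unfolding natural_wedge_def self_simps by blast
 have N_sq: "vcmp (self V) (fo F d) (fo G d) (fo G d') $ (fm G d d' ** p d) $ swp V x (vhom D d d')
  = vcmp (self V) (fo F d) (fo F d') (fo G d') $ (p d' ** fm F d d')"
  if "?N x p" "d : vob D" "d' : vob D" for x p d d'
  using that unfolding natural_wedge_def by blast
 have N_I: "?N x p" if "x : ob V" "!!d. d : vob D ==> p d : hom V x (ihom V (fo F d) (fo G d))"
  "!!d d'. d : vob D ==> d' : vob D ==> vcmp (self V) (fo F d) (fo G d) (fo G d') $ (fm G d d' ** p d) $ swp V x (vhom D d d')
  = vcmp (self V) (fo F d) (fo F d') (fo G d') $ (p d' ** fm F d d')" for x p
  using that unfolding natural_wedge_def self_simps by blast
 obtain x p where "?N x p" "!!y q. ?N y q ==> EX! u. u : hom V y x & (ALL d:vob D. p d $ u = q d)"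
 proof (rule universal_wedge[where N = ?N and I = "vob D" and c = "%d. ihom V (fo F d) (fo G d)"])
  show "?N x q" if N: "?N x p" and eq: "!!d. d : vob D ==> p d = q d" for x p q
  by (rule N_I) (use N_hom[OF N] N_sq[OF N] eq in metis)+
  show "?N y (%d. p d $ u)" if N: "?N x p" and u: "u : hom V y x" for x y p u
  proof (rule N_I)
  have ph: "p d : hom V x (ihom V (fo F d) (fo G d))" if "d : vob D" for d using N_hom[OF N] that by blast
  show "y : ob V" using u by auto
  show "p d $ u : hom V y (ihom V (fo F d) (fo G d))" if "d : vob D" for d using ph[OF that] u by simp
  show "vcmp (self V) (fo F d) (fo G d) (fo G d') $ (fm G d d' ** (p d $ u)) $ swp V y (vhom D d d')
  = vcmp (self V) (fo F d) (fo F d') (fo G d') $ ((p d' $ u) ** fm F d d')" if "d : vob D" "d' : vob D" for d d'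
  unfolding pre(1)[OF that ph[OF that(1)] u ph[OF that(2)]] pre(2)[OF that ph[OF that(1)] u ph[OF that(2)]]
  by (simp only: N_sq[OF N that])
  qed
  show "?N x p" if F: "jointly_epic V x Fs" and ph: "!!d. d : vob D ==> p d : hom V x (ihom V (fo F d) (fo G d))"
  and NF: "!!h. h : Fs ==> ?N (dm V h) (%d. p d $ h)" for x p Fs
  proof (rule N_I)
  show x: "x : ob V" using F by (simp add: jointly_epic_def)
  fix d d' assume dd: "d : vob D" "d' : vob D"
  have u: "idn V x : hom V x x" using x by simp
  show "vcmp (self V) (fo F d) (fo G d) (fo G d') $ (fm G d d' ** p d) $ swp V x (vhom D d d')
  = vcmp (self V) (fo F d) (fo F d') (fo G d') $ (p d' ** fm F d d')"
  proof (rule jointly_epic_tensor[OF F vh[OF dd] pre(3)[OF dd ph[OF dd(1)] u ph[OF dd(2)]] pre(4)[OF dd ph[OF dd(1)] u ph[OF dd(2)]]])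
  fix h assume h: "h : Fs"
  then have hh: "h : hom V (dm V h) x" using F by (simp add: jointly_epic_def)
  show "(vcmp (self V) (fo F d) (fo G d) (fo G d') $ (fm G d d' ** p d) $ swp V x (vhom D d d')) $ (h ** idn V (vhom D d d'))
  = (vcmp (self V) (fo F d) (fo F d') (fo G d') $ (p d' ** fm F d d')) $ (h ** idn V (vhom D d d'))"
  unfolding pre(1)[OF dd ph[OF dd(1)] hh ph[OF dd(2)], symmetric] pre(2)[OF dd ph[OF dd(1)] hh ph[OF dd(2)], symmetric]
  by (rule N_sq[OF NF[OF h] dd])
  qed
  qed (rule ph)
 qed (use D(2) N_hom ob in \<open>simp_all add: ihom_ob\<close>)
 then show ?thesis unfolding is_natobj_def by blast
qed

end


section \<open>Factorization systems\<close>

locale factorization = category C for C :: "('o, 'a, 'z) cat_scheme" (structure) +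
 fixes E M :: "'a set"
 assumes fs: "factorization_system C E M"
begin

lemma E_ar [simp]: "e : E ==> e : ar C" and M_ar [simp]: "m : M ==> m : ar C"
 using fs by (auto simp: factorization_system_def)

lemma iso_E: "is_iso C f ==> f : E" and iso_M: "is_iso C f ==> f : M"
 using fs by (auto simp: factorization_system_def)

lemma E_cmp: "f : E ==> g : E ==> dm C g = cd C f ==> g $ f : E"
 using fs unfolding factorization_system_def by blast

lemma M_cmp: "f : M ==> g : M ==> dm C g = cd C f ==> g $ f : M"
 using fs unfolding factorization_system_def by blast

lemma factor:
 assumes "f : ar C"
 obtains e m where "e : E" "m : M" "dm C m = cd C e" "f = m $ e"
 using fs assms unfolding factorization_system_def by metis

lemma fill:
 assumes "e : E" "m : M" "u : hom C (dm C e) (dm C m)" "v : hom C (cd C e) (cd C m)" "m $ u = v $ e"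
 shows "EX! d. d : hom C (cd C e) (dm C m) & d $ e = u & m $ d = v"
 using fs assms unfolding factorization_system_def by blast

end

text \<open>
 Wide pushouts of \<open>e\<close> along itself are again in \<open>E\<close>, so there are only few of them. But a pair of
 distinct arrows that \<open>e\<close> equalizes gives \<open>2\<^sup>L\<close> arrows out of the \<open>L\<close>-fold pushout.
\<close>

lemma (in factorization) E_epi:
 fixes ka :: "'u rel"
 assumes ka: "inaccessible ka" and cocomplete: "graph_cocomplete ka C" and ls: "locally_small ka C"
  and cwp: "cowellpowered ka C E"
  and e: "e : E" and fg: "f : hom C (cd C e) x" "g : hom C (cd C e) x" "f $ e = g $ e"
 shows "f = g"
proof (rule ccontr)
 assume ne: "f \<noteq> g"
 let ?a = "dm C e" and ?b = "cd C e"
 have x: "x : ob C" using fg(1) by auto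
 have "?a : ob C" using e by simp
 from bspec[OF cwp[unfolded cowellpowered_def] this]
 obtain Q where Q: "small ka Q" "Q <= {q : E. dm C q = ?a}"
  "ALL k:E. dm C k = ?a --> (EX q:Q. EX i:hom C (cd C q) (cd C k). is_iso C i & i $ q = k)"
  by (elim exE conjE)
 \<comment> \<open>\<open>La\<close> contains all arrows into \<open>x\<close> from the chosen
   quotients of the domain of \<open>e\<close>, so that the arrows into \<open>x\<close> from the
   \<open>La\<close>-fold pushout would inject into \<open>La\<close>.\<close>
 define La where "La = (UN q:Q. hom C (cd C q) x)"
 have "small ka La"
  unfolding La_def
 proof (rule small_UN[OF ka Q(1)])
  fix q assume "q : Q"
  then have "cd C q : ob C" using Q(2) by auto
  then show "small ka (hom C (cd C q) x)" using ls x unfolding locally_small_def by blast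
 qed
 define S where "S = {None} \<union> Some ` La"
 define b where "b z = (case z of None => ?a | Some s => ?b)" for z :: "'a option"
 define R where "R = (%s. (None :: 'a option, Some s, e)) ` La"
 have S: "small ka S" unfolding S_def
  by (intro small_Un ka small_image \<open>small ka La\<close> small_finite) auto
 have R: "small ka R" unfolding R_def by (rule small_image[OF \<open>small ka La\<close>])
 have d: "gdiagram C S b R" using e by (auto simp: gdiagram_def S_def b_def R_def)
 obtain P h where colim: "gcolim C S b R P h" using gcolim_exists[OF ka cocomplete S R d] .
 note hP = gcolim_arr[OF colim]
 define k where "k = h None"
 have k: "k : hom C ?a P" using hP(2-4)[of None] by (simp add: S_def k_def b_def)
 have hs: "h (Some s) : hom C ?b P" "h (Some s) $ e = k" if "s : La" for s
  using hP(2-4)[of "Some s"] hP(5)[of None "Some s" e] that by (auto simp: S_def b_def k_def R_def)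
 have cocone: "gcocone C S b R y (%z. case z of None => u | Some s => v s)"
  if "u : hom C ?a y" "!!s. s : La ==> v s : hom C ?b y & v s $ e = u" for y u v
  using that unfolding gcocone_def by (auto simp: S_def b_def R_def)
 \<comment> \<open>Fillers for the individual legs against the \<open>M\<close>-part of
   \<open>k\<close> assemble to an inverse of that part.\<close>
 have "k : E"
 proof -
  obtain e1 m where em: "e1 : E" "m : M" "dm C m = cd C e1" "k = m $ e1" using factor[of k] k by auto
  have e1: "dm C e1 = ?a" and m: "cd C m = P" using em k by auto
  have "EX d. d : hom C ?b (dm C m) & d $ e = e1 & m $ d = h (Some s)" if s: "s : La" for s
  using fill[OF e em(2), of e1 "h (Some s)"] hs[OF s] em e1 m by auto
  then obtain d where d: "!!s. s : La ==> d s : hom C ?b (dm C m)" "!!s. s : La ==> d s $ e = e1"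
  "!!s. s : La ==> m $ d s = h (Some s)" by metis
  have "gcocone C S b R (dm C m) (%z. case z of None => e1 | Some s => d s)"
  by (rule cocone) (use em e1 d in auto)
  then obtain r where r: "r : hom C P (dm C m)" "!!z. z : S ==> r $ h z = (case z of None => e1 | Some s => d s)"
  using gcolim_induced[OF colim] by metis
  have rk: "r $ k = e1" using r(2)[of None] by (simp add: S_def k_def)
  have mr: "m $ r = idn C P"
  proof (rule gcolim_ext[OF colim \<open>gdiagram C S b R\<close>])
  fix z assume z: "z : S"
  show "(m $ r) $ h z = idn C P $ h z"
  proof (cases z)
  case None
  then show ?thesis using r em rk k m hP(1) by (simp add: k_def[symmetric])
  next
  case (Some s)
  then have "s : La" using z by (auto simp: S_def)
  then show ?thesis using Some r(1) r(2)[OF z] em m hP(1) hs d by simp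
  qed
  qed (use r em m hP(1) in auto)
  have "r $ m = idn C (dm C m)"
  proof (rule ex1_unique[OF fill[OF em(1,2), of e1 m]])
  have "(r $ m) $ e1 = e1" using r(1) em rk m by simp
  moreover have "m $ r $ m = (m $ r) $ m" by (rule assoc[symmetric]) (use r(1) em m in auto)
  ultimately show "r $ m : hom C (cd C e1) (dm C m) & (r $ m) $ e1 = e1 & m $ r $ m = m"
  using r(1) em m mr by simp
  qed (use em e1 in auto)
  then have "is_iso C m" using mr r(1) em m by (intro is_isoI[of m "dm C m" P r]) auto
  then show ?thesis using E_cmp[OF em(1) iso_E em(3)] em(4) by simp
 qed
 then obtain q i where q: "q : Q" "i : hom C (cd C q) P" "is_iso C i" "i $ q = k"
  using Q(3) k by fastforce
 \<comment> \<open>A subset \<open>T\<close> selects the copies on which to use \<open>f\<close>,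
   the others use \<open>g\<close>; since \<open>f\<close> and \<open>g\<close> agree after
   \<open>e\<close>, this is a cocone.\<close>
 have "EX fi. fi : hom C P x & (ALL s:La. fi $ h (Some s) = (if s : T then f else g))" for T
 proof -
  have "gcocone C S b R x (%z. case z of None => f $ e | Some s => (if s : T then f else g))"
  by (rule cocone) (use fg e in auto)
  then obtain fi where fi: "fi : hom C P x" "!!z. z : S ==> fi $ h z = (case z of None => f $ e | Some s => (if s : T then f else g))"
  using gcolim_induced[OF colim] by metis
  then have "fi $ h (Some s) = (if s : T then f else g)" if "s : La" for s
  using fi(2)[of "Some s"] that by (simp add: S_def)
  then show ?thesis using fi(1) by blast
 qed
 then obtain fi where fi: "!!T. fi T : hom C P x" "!!T s. s : La ==> fi T $ h (Some s) = (if s : T then f else g)"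
  by metis
 have inj: "inj_on (%T. fi T $ i) (Pow La)"
 proof (rule inj_onI)
  fix T T' assume T: "T : Pow La" "T' : Pow La" "fi T $ i = fi T' $ i"
  have eq: "fi T = fi T'" by (rule iso_epi[OF q(3) T(3)]) (use fi(1) q(2) in auto)
  have "s : T \<longleftrightarrow> s : T'" if "s : La" for s
  using fi(2)[OF that, of T] fi(2)[OF that, of T'] eq ne by (auto split: if_splits)
  then show "T = T'" using T by blast
 qed
 have "(%T. fi T $ i) ` Pow La <= La"
  using fi(1) q(1,2) by (fastforce simp: La_def)
 with inj have "|Pow La| <=o |La|" by (auto simp: card_of_ordLeq[symmetric])
 then show False using card_of_Pow[of La] not_ordLess_ordLeq by blast
qed

section \<open>Generated objects have rank\<close>

lemma card_of_finite_infinite: "finite A ==> infinite B ==> |A| <=o |B|"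
 by (meson finite_iff_ordLess_natLeq infinite_iff_natLeq_ordLeq ordLess_imp_ordLeq ordLeq_transitive)

lemma card_of_Un_le_infinite:
 assumes "infinite B" "|A1| <=o |B|" "|A2| <=o |B|"
 shows "|A1 \<union> A2| <=o |B|"
proof -
 have "|UN b:{True, False}. if b then A1 else A2| <=o |B|"
  by (rule card_of_UNION_ordLeq_infinite[OF assms(1) card_of_finite_infinite[OF _ assms(1)]])
  (use assms(2,3) in auto)
 then show ?thesis by (simp add: Un_commute)
qed

text \<open>Lifting \<open>f\<close> against the \<open>E\<close>-part of its own factorization
  splits that part on one side; uniqueness of fillers splits it on the other, so it is
  invertible.\<close>

lemma (in factorization) M_orthogonal:
 assumes f: "f : ar C"
  and orth: "!!e u v. e : E ==> u : hom C (dm C e) (dm C f) ==> v : hom C (cd C e) (cd C f) ==> f $ u = v $ e ==>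
  EX d. d : hom C (cd C e) (dm C f) & d $ e = u & f $ d = v"
 shows "f : M"
proof -
 obtain e m where em: "e : E" "m : M" "dm C m = cd C e" "f = m $ e" using factor[OF f] .
 have ar: "e : ar C" "m : ar C" using em by auto
 have fd: "dm C f = dm C e" "cd C f = cd C m" using em(3,4) ar by auto
 have "EX d. d : hom C (cd C e) (dm C f) & d $ e = idn C (dm C e) & f $ d = m"
  by (rule orth[OF em(1)]) (use em(3) ar fd f in \<open>auto simp: em(4)\<close>)
 then obtain d where d: "d : hom C (cd C e) (dm C e)" "d $ e = idn C (dm C e)" "f $ d = m" unfolding fd by (elim exE conjE)
 have "EX! w. w : hom C (cd C e) (dm C m) & w $ e = e & m $ w = m"
  by (rule fill[OF em(1,2)]) (use ar em(3) in auto)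
 moreover have "e $ d : hom C (cd C e) (dm C m) & (e $ d) $ e = e & m $ e $ d = m"
  using d ar em(3,4) by simp
 moreover have "idn C (cd C e) : hom C (cd C e) (dm C m) & idn C (cd C e) $ e = e & m $ idn C (cd C e) = m"
  using ar em(3) by simp
 ultimately have "e $ d = idn C (cd C e)" by (rule ex1_unique)
 then have "is_iso C e" by (intro is_isoI[of e "dm C e" "cd C e" d]) (use ar d in auto)
 then show ?thesis unfolding em(4) by (rule M_cmp[OF iso_M em(2,3)])
qed

text \<open>A lift against the composite gives the upper triangle; uniqueness of fillers against
  \<open>g\<close> recovers the lower one.\<close>

lemma (in factorization) M_left_cancel:
 assumes gf: "g $ f : M" and g: "g : M" and f: "f : ar C" "cd C f = dm C g"
 shows "f : M"
proof (rule M_orthogonal[OF f(1)])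
 fix e u v
 assume e: "e : E" and u: "u : hom C (dm C e) (dm C f)" and v: "v : hom C (cd C e) (cd C f)" and sq: "f $ u = v $ e"
 have [simp]: "e : ar C" "g : ar C" using e g by auto
 have "(g $ f) $ u = g $ f $ u" using u f by simp
 also have "... = (g $ v) $ e" unfolding sq using v f by simp
 finally have "EX! d. d : hom C (cd C e) (dm C (g $ f)) & d $ e = u & (g $ f) $ d = g $ v"
  by (intro fill[OF e gf]) (use u v f in auto)
 then obtain d where d: "d : hom C (cd C e) (dm C (g $ f))" "d $ e = u" "(g $ f) $ d = g $ v" by (elim ex1E conjE)
 have dh: "d : ar C" "dm C d = cd C e" "cd C d = dm C f" using d(1) f by auto
 have "EX! w. w : hom C (cd C e) (dm C g) & w $ e = f $ u & g $ w = g $ v"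
  by (intro fill[OF e g]) (use u v f sq in auto)
 moreover have "f $ d : hom C (cd C e) (dm C g) & (f $ d) $ e = f $ u & g $ f $ d = g $ v"
  using dh d(2,3) f by simp
 moreover have "v : hom C (cd C e) (dm C g) & v $ e = f $ u & g $ v = g $ v" using v f sq by simp
 ultimately have "f $ d = v" by (rule ex1_unique)
 then show "EX d. d : hom C (cd C e) (dm C f) & d $ e = u & f $ d = v" using dh d(2) by (intro exI[of _ d]) simp
qed

definition quotient_reps :: "('o, 'a, 'z) cat_scheme => 'a set => 'o => 'a set => bool" where
 "quotient_reps C E l Q \<longleftrightarrow> Q <= {q : E. dm C q = l} &
  (ALL k:E. dm C k = l --> (EX q:Q. EX i:hom C (cd C q) (cd C k). is_iso C i & i $\<^bsub>C\<^esub> q = k))"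

text \<open>\<open>good\<close> abstracts being a conical colimit, and \<open>a0\<close> is the
  object whose rank is wanted. Of the preservation of these colimits by the functors that
  \<open>a0\<close> and the members of \<open>A\<close> represent, only one half is kept, in
  \<open>good_factor\<close>: arrows into the colimit factor through a stage.\<close>

locale generated_category = factorization C E M
 for C :: "('o, 'a, 'z) cat_scheme" (structure) and E M :: "'a set" +
 fixes ka :: "'u rel" and lam :: "'l rel" and A :: "'o set" and a0 :: 'o
  and good :: "'u set => 'u rel => ('u, 'u \<times> 'u, 'o, 'a) ofun => 'o => ('u => 'a) => bool"
 assumes ka: "inaccessible ka" and lam: "regular_cardinal lam" and lam_small: "lam <o ka"
  and cocomplete: "graph_cocomplete ka C" and ls: "locally_small ka C" and cwp: "cowellpowered ka C E"
  and A_small: "small ka A" and A_ob: "A <= ob C"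
  and good_exists: "directed_diagram ka lam C M I le D ==> EX x c. good I le D x c"
  and good_colim: "directed_diagram ka lam C M I le D ==> good I le D x c ==> is_colim C (poset_cat I le) D x c"
  and good_factor: "directed_diagram ka lam C M I le D ==> good I le D x c ==> a : insert a0 A ==>
  f : hom C a x ==> EX i:I. EX g:hom C a (oo D i). c i $ g = f"
  and good_dense: "y : ob C ==> EX I le D c. directed_diagram ka lam C M I le D & good I le D y c & (ALL i:I. oo D i : A)"
begin

lemma epi:
 assumes "e : E" "f $ e = g $ e" "f : hom C (cd C e) x" "g : hom C (cd C e) x"
 shows "f = g"
 using E_epi[OF ka cocomplete ls cwp assms(1,3,4,2)] .

end

text \<open>\<open>D\<close> is a diagram of arbitrary arrows over a preorder that has upper bounds
  for sets of size |B|. The set \<open>B\<close> bounds the vertices, edges and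
  \<open>E\<close>-quotients belonging to diagrams of fewer than \<open>lam\<close> objects of
  \<open>A\<close>.\<close>

locale rank_argument = generated_category C E M ka lam A a0 good
 for C :: "('o, 'a, 'z) cat_scheme" (structure) and E M :: "'a set" and ka :: "'u rel" and lam :: "'l rel"
  and A :: "'o set" and a0 :: 'o
  and good :: "'u set => 'u rel => ('u, 'u \<times> 'u, 'o, 'a) ofun => 'o => ('u => 'a) => bool" +
 fixes B :: "'b set" and J :: "'j set" and lej :: "'j rel" and D :: "('j, 'j \<times> 'j, 'o, 'a) ofun"
  and x :: 'o and c :: "'j => 'a"
 assumes B_inf: "infinite B"
  and few: "!!(S :: ('o \<times> 'j \<times> 'a) set) b R. |S| <o lam ==> b ` S <= A ==> gdiagram C S b R ==>
  |S| <=o |B| & |R| <=o |B| & (EX l e Q. gcolim C S b R l e & |Q| <=o |B| & quotient_reps C E l Q)"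
  and J_small: "small ka J" and tr_J: "trans lej" and refl_J: "!!i. i : J ==> (i, i) : lej"
  and ub_J: "!!S. S <= J ==> |S| <=o |B| ==> EX u:J. ALL s:S. (s, u) : lej"
  and D: "cat_functor (poset_cat J lej) C D"
  and colim_D: "gcolim C J (oo D) (poset_edges J lej D) x c"
begin

abbreviation tr :: "'j => 'j => 'a" where "tr i j \<equiv> oa D (i, j)"

lemma D_simps [simp]: "i : J ==> oo D i : ob C"
 using cat_functor_posetD(1)[OF D] by simp

lemma tr_simps:
 assumes "i : J" "j : J" "(i, j) : lej"
 shows "tr i j : ar C" "dm C (tr i j) = oo D i" "cd C (tr i j) = oo D j"
 using cat_functor_posetD(2)[OF D assms] by auto

lemma tr_id: "i : J ==> tr i i = idn C (oo D i)"
 using cat_functor_posetD(3)[OF D] by simp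

lemma tr_cmp: "i : J ==> j : J ==> k : J ==> (i, j) : lej ==> (j, k) : lej ==> tr j k $ tr i j = tr i k"
 using cat_functor_posetD(4)[OF D] by simp

lemma le_trans: "(i, j) : lej ==> (j, k) : lej ==> (i, k) : lej"
 using tr_J by (rule transD)

lemma ub2: "i : J ==> j : J ==> EX k:J. (i, k) : lej & (j, k) : lej"
proof -
 assume "i : J" "j : J"
 moreover have "|{i, j}| <=o |B|" using B_inf by (intro card_of_finite_infinite) auto
 ultimately show ?thesis using ub_J[of "{i, j}"] by auto
qed

lemma c_simps:
 assumes "i : J" shows "c i : ar C" "dm C (c i) = oo D i" "cd C (c i) = x"
 using gcolim_arr(2-4)[OF colim_D assms] by auto

lemma c_tr: "i : J ==> j : J ==> (i, j) : lej ==> c j $ tr i j = c i"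
 using gcolim_arr(5)[OF colim_D] by (auto simp: poset_edges_def)

text \<open>Generalized elements of the diagram. The colimit of \<open>D\<close> is rebuilt from
  sets of fewer than \<open>lam\<close> of them.\<close>

definition Z :: "('o \<times> 'j \<times> 'a) set" where
 "Z = {(a, j, g). a : A & j : J & g : hom C a (oo D j)}"

abbreviation stage :: "'o \<times> 'j \<times> 'a => 'j" where "stage z \<equiv> fst (snd z)"

definition at :: "'j => 'o \<times> 'j \<times> 'a => 'a" where
 "at i z = tr (stage z) i $ snd (snd z)"

lemma Z_simps:
 assumes "z : Z"
 shows "fst z : A" "fst z : ob C" "stage z : J" "snd (snd z) : ar C" "dm C (snd (snd z)) = fst z"
  "cd C (snd (snd z)) = oo D (stage z)"
 using assms A_ob by (auto simp: Z_def)

lemma at_simps: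
 assumes "z : Z" "i : J" "(stage z, i) : lej"
 shows "at i z : ar C" "dm C (at i z) = fst z" "cd C (at i z) = oo D i"
 using Z_simps[OF assms(1)] tr_simps[OF Z_simps(3)[OF assms(1)] assms(2,3)] by (auto simp: at_def)

lemma tr_at:
 assumes "z : Z" "i : J" "j : J" "(stage z, i) : lej" "(i, j) : lej"
 shows "tr i j $ at i z = at j z"
proof -
 have "tr i j $ tr (stage z) i $ snd (snd z) = tr (stage z) j $ snd (snd z)"
  by (rule extend[OF tr_cmp]) (use assms Z_simps[OF assms(1)] tr_simps tr_simps[OF Z_simps(3)[OF assms(1)] assms(2,4)] in auto)
 then show ?thesis by (simp add: at_def)
qed

lemma c_at:
 assumes "z : Z" "i : J" "(stage z, i) : lej"
 shows "c i $ at i z = c (stage z) $ snd (snd z)"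
 unfolding at_def
 by (rule extend[OF c_tr])
  (use assms Z_simps[OF assms(1)] c_simps[OF assms(2)] tr_simps[OF Z_simps(3)[OF assms(1)] assms(2,3)] in auto)

definition P :: "('o \<times> 'j \<times> 'a) set set" where
 "P = {s. s <= Z & |s| <o lam}"

text \<open>Edges are the identifications that hold at some stage. The colimit \<open>L s\<close> of
  this graph is the object presented by the elements in \<open>s\<close> and all their eventual
  relations.\<close>

definition rels :: "('o \<times> 'j \<times> 'a) set => (('o \<times> 'j \<times> 'a) \<times> ('o \<times> 'j \<times> 'a) \<times> 'a) set" where
 "rels s = {(z, z', w). z : s & z' : s & w : hom C (fst z) (fst z') &
  (EX i:J. (stage z, i) : lej & (stage z', i) : lej & at i z' $ w = at i z)}"

lemma gdiagram_rels: "s <= Z ==> gdiagram C s fst (rels s)"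
 using Z_simps(2) by (auto simp: gdiagram_def rels_def)

lemma rels_mono: "s <= s' ==> rels s <= rels s'"
 by (auto simp: rels_def)

lemma rels_later:
 assumes "s <= Z" "(z, z', w) : rels s" "i : J" "j : J" "(stage z, i) : lej" "(stage z', i) : lej"
  "at i z' $ w = at i z" "(i, j) : lej"
 shows "at j z' $ w = at j z"
proof -
 have z: "z : Z" "z' : Z" and w: "w : hom C (fst z) (fst z')" using assms(1,2) by (auto simp: rels_def)
 have "at j z' $ w = (tr i j $ at i z') $ w" by (simp add: tr_at[OF z(2) assms(3,4,6,8)])
 also have "... = tr i j $ at i z' $ w"
  by (rule assoc) (use w at_simps[OF z(2) assms(3,6)] tr_simps[OF assms(3,4,8)] in auto)
 finally show ?thesis by (simp add: assms(7) tr_at[OF z(1) assms(3,4,5,8)])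
qed

lemma few_P:
 assumes "s : P"
 shows "|s| <=o |B|" "|rels s| <=o |B|"
  "EX l e Q. gcolim C s fst (rels s) l e & |Q| <=o |B| & quotient_reps C E l Q"
proof -
 have s: "s <= Z" "|s| <o lam" using assms by (auto simp: P_def)
 have "fst ` s <= A" using s(1) Z_simps(1) by auto
 from few[OF s(2) this gdiagram_rels[OF s(1)]]
 show "|s| <=o |B|" "|rels s| <=o |B|"
  "EX l e Q. gcolim C s fst (rels s) l e & |Q| <=o |B| & quotient_reps C E l Q" by blast+
qed

definition is_base :: "('o \<times> 'j \<times> 'a) set => 'j => bool" where
 "is_base s i \<longleftrightarrow> i : J & (ALL z:s. (stage z, i) : lej) & (ALL (z, z', w):rels s. at i z' $ w = at i z)"

lemma is_baseD:
 assumes "is_base s i"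
 shows "i : J" "z : s ==> (stage z, i) : lej" "(z, z', w) : rels s ==> at i z' $ w = at i z"
 using assms by (auto simp: is_base_def)

text \<open>There are at most |B| relations, so one stage bounds all the stages at which they first
  hold, and \<open>rels_later\<close> carries them there.\<close>

lemma base_exists:
 assumes "s : P" shows "EX i. is_base s i"
proof -
 have s: "s <= Z" using assms by (simp add: P_def)
 have "ALL r:rels s. EX i. i : J & (case r of (z, z', w) => (stage z, i) : lej & (stage z', i) : lej & at i z' $ w = at i z)"
  by (auto simp: rels_def)
 then obtain k where k: "ALL r:rels s. k r : J & (case r of (z, z', w) => (stage z, k r) : lej & (stage z', k r) : lej & at (k r) z' $ w = at (k r) z)"
  by (rule bchoice[THEN exE])
 let ?U = "stage ` s \<union> k ` rels s"
 have "|stage ` s| <=o |B|" "|k ` rels s| <=o |B|"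
  using ordLeq_transitive[OF card_of_image few_P(1)[OF assms]] ordLeq_transitive[OF card_of_image few_P(2)[OF assms]] by auto
 then have "|?U| <=o |B|" by (rule card_of_Un_le_infinite[OF B_inf])
 moreover have "?U <= J" using s Z_simps(3) k by auto
 ultimately obtain i where i: "i : J" "ALL u:?U. (u, i) : lej" using ub_J by meson
 have "at i z' $ w = at i z" if r: "(z, z', w) : rels s" for z z' w
  by (rule rels_later[OF s r, of "k (z, z', w)"]) (use k r i in auto)
 then have "ALL (z, z', w):rels s. at i z' $ w = at i z" by blast
 then show ?thesis unfolding is_base_def using i by blast
qed

lemma is_base_later:
 assumes "s <= Z" "is_base s i" "j : J" "(i, j) : lej"
 shows "is_base s j"
 unfolding is_base_def
proof (intro conjI ballI)
 note b = is_baseD[OF assms(2)]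
 show "j : J" by fact
 show "(stage z, j) : lej" if "z : s" for z using b(2)[OF that] assms(4) by (rule le_trans)
 show "case r of (z, z', w) => at j z' $ w = at j z" if "r : rels s" for r
 proof -
  obtain z z' w where r: "r = (z, z', w)" by (cases r)
  have "z : s" "z' : s" using that r by (auto simp: rels_def)
  then have "at j z' $ w = at j z"
  by (intro rels_later[OF assms(1) _ b(1) assms(3) b(2) b(2) b(3) assms(4)]) (use that r in auto)
  then show ?thesis by (simp add: r)
 qed
qed

definition Lc where
 "Lc s = (SOME t. gcolim C s fst (rels s) (fst t) (fst (snd t)) & |snd (snd t)| <=o |B| &
  quotient_reps C E (fst t) (snd (snd t)))"
definition L where "L s = fst (Lc s)"
definition e where "e s = fst (snd (Lc s))"
definition Qs where "Qs s = snd (snd (Lc s))"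

lemma Lc:
 assumes "s : P"
 shows "gcolim C s fst (rels s) (L s) (e s)" "|Qs s| <=o |B|" "Qs s <= {q : E. dm C q = L s}"
  "ALL k:E. dm C k = L s --> (EX q:Qs s. EX i:hom C (cd C q) (cd C k). is_iso C i & i $ q = k)"
proof -
 obtain l h Q where "gcolim C s fst (rels s) l h & |Q| <=o |B| & quotient_reps C E l Q"
  using few_P(3)[OF assms] by blast
 then have "gcolim C s fst (rels s) (fst (l, h, Q)) (fst (snd (l, h, Q))) & |snd (snd (l, h, Q))| <=o |B| &
  quotient_reps C E (fst (l, h, Q)) (snd (snd (l, h, Q)))" by (simp only: fst_conv snd_conv)
 then have "gcolim C s fst (rels s) (L s) (e s) & |Qs s| <=o |B| & quotient_reps C E (L s) (Qs s)"
  unfolding L_def e_def Qs_def Lc_def by (rule someI)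
 then show "gcolim C s fst (rels s) (L s) (e s)" "|Qs s| <=o |B|" "Qs s <= {q : E. dm C q = L s}"
  "ALL k:E. dm C k = L s --> (EX q:Qs s. EX i:hom C (cd C q) (cd C k). is_iso C i & i $ q = k)"
  unfolding quotient_reps_def by blast+
qed

lemma P_sub: "s : P ==> s <= Z" by (simp add: P_def)

lemma L_ext:
 assumes "s : P" "u : hom C (L s) y" "v : hom C (L s) y" "!!z. z : s ==> u $ e s z = v $ e s z"
 shows "u = v"
 by (rule gcolim_ext[OF Lc(1)[OF assms(1)] gdiagram_rels[OF P_sub[OF assms(1)]]]) (use assms in auto)

lemma e_simps:
 assumes "s : P"
 shows "L s : ob C" "z : s ==> e s z : ar C" "z : s ==> dm C (e s z) = fst z" "z : s ==> cd C (e s z) = L s"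
  "(z, z', w) : rels s ==> e s z' $ w = e s z"
 using gcolim_arr[OF Lc(1)[OF assms]] by auto

definition ga where "ga s i = (SOME u. u : hom C (L s) (oo D i) & (ALL z:s. u $ e s z = at i z))"

lemma ga:
 assumes "s : P" "is_base s i"
 shows "ga s i : ar C" "dm C (ga s i) = L s" "cd C (ga s i) = oo D i" "z : s ==> ga s i $ e s z = at i z"
proof -
 note b = is_baseD[OF assms(2)]
 have "gcocone C s fst (rels s) (oo D i) (at i)"
  unfolding gcocone_def using b at_simps[of _ i] P_sub[OF assms(1)] by auto
 from gcolim_induced[OF Lc(1)[OF assms(1)] this]
 have "EX u. u : hom C (L s) (oo D i) & (ALL z:s. u $ e s z = at i z)" by metis
 from someI_ex[OF this]
 show "ga s i : ar C" "dm C (ga s i) = L s" "cd C (ga s i) = oo D i" "z : s ==> ga s i $ e s z = at i z"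
  unfolding ga_def by auto
qed

lemma tr_ga:
 assumes s: "s : P" "is_base s i" and j: "j : J" "(i, j) : lej"
 shows "tr i j $ ga s i = ga s j"
proof (rule L_ext[OF s(1)])
 note b = is_baseD[OF s(2)]
 note bj = is_base_later[OF P_sub[OF s(1)] s(2) j]
 note g = ga[OF s] ga[OF s(1) bj] and t = tr_simps[OF b(1) j]
 show "tr i j $ ga s i : hom C (L s) (oo D j)" "ga s j : hom C (L s) (oo D j)" using g t by auto
 fix z assume z: "z : s"
 have "z : Z" using z P_sub[OF s(1)] by auto
 then have "tr i j $ at i z = at j z" using tr_at b(1,2) z j by blast
 then show "(tr i j $ ga s i) $ e s z = ga s j $ e s z"
  using g t e_simps(2-4)[OF s(1) z] z by simp
qed

text \<open>An image of \<open>L s\<close> that no later transition changes: composing its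
  \<open>M\<close>-part with any transition leaves it in \<open>M\<close>.\<close>

definition is_stable where
 "is_stable s i q m \<longleftrightarrow> is_base s i & q : E & dm C q = L s & m : hom C (cd C q) (oo D i) & m $ q = ga s i &
  (ALL j:J. (i, j) : lej --> tr i j $ m : M)"

text \<open>The \<open>E\<close>-images of \<open>L s\<close> in the objects of the diagram form an increasing family in a set of at most
 \<open>|B|\<close> quotients, so by directedness the family is eventually constant.\<close>

lemma stable_exists:
 assumes s: "s : P" shows "EX i q m. is_stable s i q m"
proof -
 note sub = P_sub[OF s]
 obtain i0 where i0: "is_base s i0" using base_exists[OF s] by blast
 have i0J: "i0 : J" using is_baseD[OF i0] by simp
 let ?J = "{i : J. (i0, i) : lej}"
 have base: "is_base s i" if "i : ?J" for i using is_base_later[OF sub i0] that by auto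
 have "EX q m. q : Qs s & m : M & m : hom C (cd C q) (oo D i) & m $ q = ga s i" if i: "i : ?J" for i
 proof -
  note g = ga[OF s base[OF i]]
  obtain e1 m1 where em: "e1 : E" "m1 : M" "dm C m1 = cd C e1" "ga s i = m1 $ e1" using factor[OF g(1)] .
  have d: "dm C e1 = L s" "cd C m1 = oo D i" using em g by auto
  obtain q k where q: "q : Qs s" "k : hom C (cd C q) (cd C e1)" "is_iso C k" "k $ q = e1"
  using Lc(4)[OF s] em(1) d(1) by blast
  have "q : E" using q(1) Lc(3)[OF s] by blast
  then have "(m1 $ k) $ q = ga s i" using em q by simp
  moreover have "m1 $ k : M" using M_cmp[OF iso_M[OF q(3)] em(2)] q(2) em(3) by simp
  ultimately show ?thesis using q(1,2) em d by (intro exI[of _ q] exI[of _ "m1 $ k"]) simp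
 qed
 then have "ALL i:?J. EX qm. fst qm : Qs s & snd qm : M & snd qm : hom C (cd C (fst qm)) (oo D i) & snd qm $ fst qm = ga s i"
  by fastforce
 from bchoice[OF this] obtain qm where qm: "ALL i:?J. fst (qm i) : Qs s & snd (qm i) : M & snd (qm i) : hom C (cd C (fst (qm i))) (oo D i) & snd (qm i) $ fst (qm i) = ga s i" ..
 define q where "q i = fst (qm i)" for i
 define m where "m i = snd (qm i)" for i
 have q: "q i : Qs s" "q i : E" "q i : ar C" "dm C (q i) = L s" and m: "m i : M" "m i : ar C" "dm C (m i) = cd C (q i)" "cd C (m i) = oo D i" "m i $ q i = ga s i"
  if "i : ?J" for i
  using qm that Lc(3)[OF s] unfolding q_def m_def by (auto simp: subset_iff)
 have step: "EX t. t : hom C (cd C (q i)) (cd C (q j)) & t $ q i = q j & m j $ t = tr i j $ m i"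
  if i: "i : ?J" and j: "j : ?J" and ij: "(i, j) : lej" for i j
 proof -
  have iJ: "i : J" "j : J" using i j by auto
  note t = tr_simps[OF iJ ij]
  have "m j $ q j = (tr i j $ m i) $ q i"
  using m[OF i] m[OF j] q[OF i] q[OF j] t tr_ga[OF s base[OF i] iJ(2) ij] by simp
  then have "EX! d. d : hom C (cd C (q i)) (dm C (m j)) & d $ q i = q j & m j $ d = tr i j $ m i"
  by (intro fill[OF q(2)[OF i] m(1)[OF j]]) (use m[OF i] m[OF j] q[OF i] q[OF j] t in auto)
  then show ?thesis using m[OF j] by auto
 qed
 \<comment> \<open>One index for every quotient that occurs, hence at most |B| indices, with an
   upper bound \<open>k\<close>.\<close>
 define pick where "pick r = (SOME i. i : ?J & q i = r)" for r
 have pick: "pick (q i) : ?J" "q (pick (q i)) = q i" if "i : ?J" for i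
  using someI[of "%i'. i' : ?J & q i' = q i" i] that unfolding pick_def by auto
 let ?U = "{i0} \<union> pick ` (q ` ?J)"
 have "q ` ?J <= Qs s" using q(1) by blast
 then have "|q ` ?J| <=o |B|" using Lc(2)[OF s] card_of_mono1 ordLeq_transitive by blast
 then have "|pick ` (q ` ?J)| <=o |B|" using card_of_image ordLeq_transitive by blast
 moreover have "|{i0}| <=o |B|" using B_inf by (intro card_of_finite_infinite) auto
 ultimately have "|?U| <=o |B|" by (intro card_of_Un_le_infinite[OF B_inf])
 moreover have "?U <= J" using i0J pick(1) by auto
 ultimately obtain k where k: "k : J" "ALL u:?U. (u, k) : lej" using ub_J by meson
 have kJ: "k : ?J" using k by auto
 have "tr k i $ m k : M" if i: "i : J" "(k, i) : lej" for i
 proof -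
  have iJ: "i : ?J" using i k le_trans by blast
  \<comment> \<open>The quotient occurring at \<open>i\<close> has already occurred at an index
    below \<open>k\<close>. The passages between the images there and back are mutually inverse,
    since \<open>E\<close>-arrows are epic; so the image at \<open>i\<close> is the one at
    \<open>k\<close>.\<close>
  let ?i = "pick (q i)"
  have pi: "?i : ?J" "q ?i = q i" using pick[OF iJ] by auto
  have ik: "(?i, k) : lej" using k(2) iJ by blast
  obtain t1 where t1: "t1 : hom C (cd C (q ?i)) (cd C (q k))" "t1 $ q ?i = q k" using step[OF pi(1) kJ ik] by blast
  obtain t2 where t2: "t2 : hom C (cd C (q k)) (cd C (q i))" "t2 $ q k = q i" "m i $ t2 = tr k i $ m k"
  using step[OF kJ iJ i(2)] by blast
  have "t2 $ t1 = idn C (cd C (q i))"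
  by (rule epi[OF q(2)[OF iJ]]) (use t1 t2 pi q[OF iJ] in auto)
  moreover have "t1 $ t2 = idn C (cd C (q k))"
  by (rule epi[OF q(2)[OF kJ]]) (use t1 t2 pi q[OF kJ] in auto)
  ultimately have "is_iso C t2" using t1 t2 pi by (intro is_isoI[OF t2(1), of t1]) auto
  then have "m i $ t2 : M" using M_cmp[OF iso_M m(1)[OF iJ]] t2(1) m(3)[OF iJ] by simp
  then show ?thesis using t2(3) by simp
 qed
 then have "is_stable s k (q k) (m k)"
  unfolding is_stable_def using base[OF kJ] q[OF kJ] m[OF kJ] by auto
 then show ?thesis by blast
qed

end

lemma gcolim_ex_induced:
 assumes "gcolim C S b R x e" "gcocone C S b R y d"
 shows "EX u:hom C x y. ALL z:S. u $\<^bsub>C\<^esub> e z = d z"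
 by (rule gcolim_induced[OF assms]) blast

context rank_argument
begin

definition stable where "stable s = (SOME t. is_stable s (fst t) (fst (snd t)) (snd (snd t)))"
definition lev where "lev s = fst (stable s)"
definition q where "q s = fst (snd (stable s))"
definition m where "m s = snd (snd (stable s))"

lemma stable_simps:
 assumes "s : P"
 shows "is_base s (lev s)" "lev s : J" "q s : E" "q s : ar C" "dm C (q s) = L s" "m s : ar C" "dm C (m s) = cd C (q s)"
  "cd C (m s) = oo D (lev s)" "m s $ q s = ga s (lev s)" "j : J ==> (lev s, j) : lej ==> tr (lev s) j $ m s : M"
proof -
 obtain i k n where "is_stable s i k n" using stable_exists[OF assms] by blast
 then have "is_stable s (fst (i, k, n)) (fst (snd (i, k, n))) (snd (snd (i, k, n)))" by simp
 then have st: "is_stable s (lev s) (q s) (m s)"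
  unfolding lev_def q_def m_def stable_def by (rule someI)
 then show "is_base s (lev s)" by (simp add: is_stable_def)
 then show "lev s : J" by (rule is_baseD)
 show "q s : E" "q s : ar C" "dm C (q s) = L s" "m s : ar C" "dm C (m s) = cd C (q s)"
  "cd C (m s) = oo D (lev s)" "m s $ q s = ga s (lev s)" "j : J ==> (lev s, j) : lej ==> tr (lev s) j $ m s : M"
  using st by (auto simp: is_stable_def)
qed

lemma later_stage:
 assumes "s : P" "j : J" "(lev s, j) : lej"
 shows "is_base s j" "tr (lev s) j $ m s $ q s = ga s j"
 using is_base_later[OF P_sub[OF assms(1)] stable_simps(1)[OF assms(1)] assms(2,3)]
  tr_ga[OF assms(1) stable_simps(1)[OF assms(1)] assms(2,3)] stable_simps(9)[OF assms(1)] by simp_all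

definition ell where "ell s s' = (SOME u. u : hom C (L s) (L s') & (ALL z:s. u $ e s z = e s' z))"

lemma ell:
 assumes "s : P" "s' : P" "s <= s'"
 shows "ell s s' : ar C" "dm C (ell s s') = L s" "cd C (ell s s') = L s'" "z : s ==> ell s s' $ e s z = e s' z"
proof -
 have "gcocone C s fst (rels s) (L s') (e s')"
  unfolding gcocone_def
 proof (intro conjI ballI)
  show "L s' : ob C" by (rule e_simps(1)[OF assms(2)])
  show "e s' z : hom C (fst z) (L s')" if "z : s" for z using e_simps(2-4)[OF assms(2), of z] assms(3) that by auto
  show "case r of (z, z', w) => e s' z' $ w = e s' z" if "r : rels s" for r
  using e_simps(5)[OF assms(2)] that rels_mono[OF assms(3)] by (cases r) auto
 qed
 from gcolim_induced[OF Lc(1)[OF assms(1)] this]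
 have "EX u. u : hom C (L s) (L s') & (ALL z:s. u $ e s z = e s' z)" by metis
 from someI_ex[OF this]
 show "ell s s' : ar C" "dm C (ell s s') = L s" "cd C (ell s s') = L s'" "z : s ==> ell s s' $ e s z = e s' z"
  unfolding ell_def by auto
qed

lemma ga_ell:
 assumes "s : P" "s' : P" "s <= s'" "is_base s i" "is_base s' i"
 shows "ga s' i $ ell s s' = ga s i"
proof (rule L_ext[OF assms(1)])
 note g = ga[OF assms(1,4)] ga[OF assms(2,5)] and l = ell[OF assms(1-3)]
 show "ga s' i $ ell s s' : hom C (L s) (oo D i)" "ga s i : hom C (L s) (oo D i)" using g l by auto
 fix z assume z: "z : s"
 then have "z : s'" using assms(3) by blast
 then show "(ga s' i $ ell s s') $ e s z = ga s i $ e s z"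
  using g l z e_simps(2-4)[OF assms(1) z] by simp
qed

definition tt where "tt s s' = (SOME t. t : hom C (cd C (q s)) (cd C (q s')) & t $ q s = q s' $ ell s s' & t : M)"

text \<open>Both images embed in a common later stage, where the factorization system fills the
  square; the filler is in \<open>M\<close> by left cancellation.\<close>

lemma tt:
 assumes "s : P" "s' : P" "s <= s'"
 shows "tt s s' : ar C" "dm C (tt s s') = cd C (q s)" "cd C (tt s s') = cd C (q s')"
  "tt s s' $ q s = q s' $ ell s s'" "tt s s' : M"
proof -
 note S = stable_simps[OF assms(1)] and S' = stable_simps[OF assms(2)] and l = ell[OF assms]
 obtain k where k: "k : J" "(lev s, k) : lej" "(lev s', k) : lej" using ub2[OF S(2) S'(2)] by blast
 note t = tr_simps[OF S(2) k(1,2)] and t' = tr_simps[OF S'(2) k(1,3)]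
 note b = later_stage[OF assms(1) k(1,2)] and b' = later_stage[OF assms(2) k(1,3)]
 let ?m = "tr (lev s) k $ m s" and ?m' = "tr (lev s') k $ m s'"
 have m': "?m' : M" using S'(10)[OF k(1,3)] .
 have "?m' $ q s' $ ell s s' = (?m' $ q s') $ ell s s'" using S'(3-8) t' l by simp
 also have "... = ga s' k $ ell s s'" using b'(2) S' t' by simp
 also have "... = ga s k" by (rule ga_ell[OF assms b(1) b'(1)])
 also have "... = ?m $ q s" using b(2) S t by simp
 finally have "EX! d. d : hom C (cd C (q s)) (dm C ?m') & d $ q s = q s' $ ell s s' & ?m' $ d = ?m"
  by (intro fill[OF S(3) m']) (use S S' t t' l in auto)
 then obtain d where d0: "d : hom C (cd C (q s)) (dm C ?m')" and d: "d $ q s = q s' $ ell s s'" "?m' $ d = ?m"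
  by (elim ex1E conjE)
 have dh: "d : hom C (cd C (q s)) (cd C (q s'))" using d0 S' t' by simp
 have "d : M"
 proof (rule M_left_cancel[OF _ m'])
  show "?m' $ d : M" unfolding d(2) by (rule S(10)[OF k(1,2)])
  show "d : ar C" "cd C d = dm C ?m'" using d0 by simp_all
 qed
 then have "EX t. t : hom C (cd C (q s)) (cd C (q s')) & t $ q s = q s' $ ell s s' & t : M" using d(1) dh by blast
 from someI_ex[OF this]
 show "tt s s' : ar C" "dm C (tt s s') = cd C (q s)" "cd C (tt s s') = cd C (q s')"
  "tt s s' $ q s = q s' $ ell s s'" "tt s s' : M"
  unfolding tt_def by auto
qed

lemma q_e_epi:
 assumes "s : P" "u : hom C (cd C (q s)) y" "v : hom C (cd C (q s)) y" "!!z. z : s ==> u $ q s $ e s z = v $ q s $ e s z"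
 shows "u = v"
proof (rule epi[OF stable_simps(3)[OF assms(1)] _ assms(2,3)])
 note S = stable_simps[OF assms(1)]
 show "u $ q s = v $ q s"
  by (rule L_ext[OF assms(1), of _ y]) (use assms S e_simps(2-4)[OF assms(1)] in auto)
qed

lemma tt_q_e:
 assumes "s : P" "s' : P" "s <= s'" "z : s"
 shows "tt s s' $ q s $ e s z = q s' $ e s' z"
proof -
 note S = stable_simps[OF assms(1)] and S' = stable_simps[OF assms(2)] and l = ell[OF assms(1-3)]
  and t = tt[OF assms(1-3)] and ez = e_simps(2-4)[OF assms(1,4)]
 have "tt s s' $ q s $ e s z = (q s' $ ell s s') $ e s z"
  by (rule extend[OF t(4)]) (use S t ez in auto)
 then show ?thesis using S' l ez assms(4) by simp
qed

text \<open>The stable images, ordered by inclusion of the sets that present them: the directed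
  diagram of \<open>M\<close>-arrows to which \<open>good_factor\<close> can be applied.\<close>

definition leP where "leP = {(s, s'). s : P & s' : P & s <= s'}"
definition DP where "DP = \<lparr>oo = (%s. cd C (q s)), oa = (%(s, s'). tt s s')\<rparr>"

lemma DP_functor: "cat_functor (poset_cat P leP) C DP"
 unfolding cat_functor_def
proof (intro conjI ballI impI)
 fix s assume "s : ob (poset_cat P leP)"
 then have s: "s : P" by simp
 note S = stable_simps[OF s]
 show "oo DP s : ob C" using S by (simp add: DP_def)
 have "tt s s = idn C (cd C (q s))"
  by (rule q_e_epi[OF s, of _ "cd C (q s)"]) (use tt[OF s s] S tt_q_e[OF s s] e_simps(2-4)[OF s] in auto)
 then show "oa DP (idn (poset_cat P leP) s) = idn C (oo DP s)" by (simp add: DP_def)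
next
 fix f assume "f : ar (poset_cat P leP)"
 then obtain s s' where f: "f = (s, s')" "s : P" "s' : P" "s <= s'" by (cases f) (auto simp: leP_def)
 then show "oa DP f : hom C (oo DP (dm (poset_cat P leP) f)) (oo DP (cd (poset_cat P leP) f))"
  using tt[OF f(2-4)] by (simp add: DP_def)
next
 fix f g assume fg: "f : ar (poset_cat P leP)" "g : ar (poset_cat P leP)" "dm (poset_cat P leP) g = cd (poset_cat P leP) f"
 from fg(1) obtain s s' where f: "f = (s, s')" "s : P" "s' : P" "s <= s'" by (cases f) (auto simp: leP_def)
 from fg(2,3) obtain s'' where g: "g = (s', s'')" "s'' : P" "s' <= s''" using f(1) by (cases g) (auto simp: leP_def)
 have ss: "s <= s''" using f g by blast
 note t = tt[OF f(2-4)] and t' = tt[OF f(3) g(2,3)] and t'' = tt[OF f(2) g(2) ss] and S = stable_simps[OF f(2)]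
 have "tt s s'' = tt s' s'' $ tt s s'"
 proof (rule q_e_epi[OF f(2), of _ "cd C (q s'')"])
  fix z assume z: "z : s"
  then have z': "z : s'" using f by blast
  show "tt s s'' $ q s $ e s z = (tt s' s'' $ tt s s') $ q s $ e s z"
  using t t' S e_simps(2-4)[OF f(2) z] tt_q_e[OF f(2) g(2) ss z] tt_q_e[OF f(2-4) z] tt_q_e[OF f(3) g(2,3) z'] by simp
 qed (use t t' t'' in auto)
 then show "oa DP (g $\<^bsub>poset_cat P leP\<^esub> f) = oa DP g $ oa DP f" by (simp add: DP_def f g)
qed

lemma Z_small: "small ka Z"
proof -
 have "small ka (SIGMA a:A. SIGMA j:J. hom C a (oo D j))"
  using ls A_ob D_simps unfolding locally_small_def by (intro small_Sigma ka A_small J_small) blast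
 then show ?thesis by (rule small_subset) (auto simp: Z_def)
qed

lemma P_small: "small ka P"
 by (rule small_subset[OF small_Pow[OF ka Z_small]]) (auto simp: P_def)

lemma finite_P: "finite s ==> s <= Z ==> s : P"
proof -
 assume s: "finite s" "s <= Z"
 have "natLeq <=o lam" using lam by (intro natLeq_ordLeq_cinfinite) (simp add: regular_cardinal_def)
 moreover have "|s| <o natLeq" using s(1) finite_iff_ordLess_natLeq by blast
 ultimately have "|s| <o lam" by (rule ordLess_ordLeq_trans[rotated])
 then show ?thesis using s by (simp add: P_def)
qed

lemma directed_P: "directed_poset lam P leP"
 unfolding directed_poset_def
proof (intro conjI allI impI)
 show "partial_order_on P leP"
  unfolding partial_order_on_def preorder_on_def leP_def
  by (auto simp: refl_on_def intro!: transI antisymI)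
 fix S assume S: "S <= P" "|S| <o lam"
 have c: "Card_order lam" "regularCard lam" "infinite (Field lam)"
  using lam by (auto simp: regular_cardinal_def cinfinite_def)
 have "BNF_Cardinal_Order_Relation.stable lam" using regularCard_stable[OF c(1) c(3) c(2)] .
 then have "|UN s:S. s| <o lam" using stable_UNION[of lam S "%s. s"] S by (auto simp: P_def)
 then have "\<Union>S : P" using S(1) by (auto simp: P_def)
 then show "EX u:P. ALL s:S. (s, u) : leP" using S(1) by (intro bexI[of _ "\<Union>S"]) (auto simp: leP_def)
qed

text \<open>\<open>x\<close> is a retract of the colimit \<open>y\<close> of the stable images:
  \<open>r\<close> is induced by their \<open>M\<close>-parts, and its section \<open>k\<close>
  sends a generalized element to its class in \<open>y\<close>. As \<open>y\<close> is a directed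
  colimit of \<open>M\<close>-arrows, \<open>k $ f\<close> factors through an image, and
  \<open>r\<close> returns the factorization to a stage of \<open>D\<close>.\<close>

theorem factor_through_stage:
 assumes f: "f : hom C a0 x"
 shows "EX j:J. EX g:hom C a0 (oo D j). c j $ g = f"
proof -
 obtain fi :: "_ => 'u" where fi: "inj_on fi P" using small_embed[OF ka P_small] .
 let ?I = "fi ` P" and ?le = "image_rel fi P leP" and ?D = "image_fun fi P DP"
 note im = image_fun_simps[OF fi, where D = DP]
 have dd: "directed_diagram ka lam C M ?I ?le ?D"
  unfolding directed_diagram_def
 proof (intro conjI ballI)
  show "small ka ?I" by (rule small_image[OF P_small])
  show "directed_poset lam ?I ?le" by (rule directed_poset_image[OF fi directed_P])
  show "cat_functor (poset_cat ?I ?le) C ?D" by (rule cat_functor_image[OF fi DP_functor])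
  fix k assume "k : ar (poset_cat ?I ?le)"
  then obtain s s' where k: "k = (fi s, fi s')" "s : P" "s' : P" "(s, s') : leP"
  by (cases k) (auto simp: image_rel_iff[OF fi])
  then show "oa ?D k : M" using im(2)[OF k(2,3)] tt(5)[OF k(2,3)] by (simp add: DP_def leP_def)
 qed
 obtain y cy where y: "good ?I ?le ?D y cy" using good_exists[OF dd] by blast
 define xs where "xs s = cy (fi s)" for s
 have "gcolim C ?I (oo ?D) (poset_edges ?I ?le ?D) y cy"
  using good_colim[OF dd y] unfolding is_colim_poset_iff_gcolim[OF cat_functor_image[OF fi DP_functor]] .
 then have "gcolim C ?I (oo DP \<circ> inv_into P fi) ((%(z, z', w). (fi z, fi z', w)) ` poset_edges P leP DP) y cy"
  unfolding poset_edges_image[OF fi] by (simp add: image_fun_def)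
 from gcolim_reindex[OF fi gdiagram_poset[OF DP_functor] this]
 have colim_y: "gcolim C P (oo DP) (poset_edges P leP DP) y xs" by (simp add: xs_def[abs_def] comp_def)
 have xs: "xs s : ar C" "dm C (xs s) = cd C (q s)" "cd C (xs s) = y" if "s : P" for s
  using gcolim_arr(2-4)[OF colim_y that] by (simp_all add: DP_def)
 have y_ob: "y : ob C" by (rule gcolim_arr(1)[OF colim_y])
 have xs_tt: "xs s' $ tt s s' = xs s" if "s : P" "s' : P" "s <= s'" for s s'
  by (rule gcolim_arr(5)[OF colim_y]) (use that in \<open>auto simp: poset_edges_def leP_def DP_def\<close>)
 have x_ob: "x : ob C" by (rule gcolim_arr(1)[OF colim_D])
 have c_m_q_e: "c (lev s) $ m s $ q s $ e s z = c (stage z) $ snd (snd z)" if s: "s : P" and z: "z : s" for s z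
 proof -
  note S = stable_simps[OF s] and ez = e_simps(2-4)[OF s z] and cs = c_simps[OF stable_simps(2)[OF s]]
  have zZ: "z : Z" using P_sub[OF s] z by auto
  have "c (lev s) $ m s $ q s $ e s z = c (lev s) $ ga s (lev s) $ e s z"
  using extend[OF S(9), of "e s z"] S ez by simp
  also have "... = c (lev s) $ at (lev s) z" by (simp add: ga(4)[OF s S(1) z])
  also have "... = c (stage z) $ snd (snd z)" by (rule c_at[OF zZ S(2) is_baseD(2)[OF S(1) z]])
  finally show ?thesis .
 qed
 have "gcocone C P (oo DP) (poset_edges P leP DP) x (%s. c (lev s) $ m s)"
  unfolding gcocone_def
 proof (intro conjI ballI)
  show "c (lev s) $ m s : hom C (oo DP s) x" if "s : P" for s
  using stable_simps[OF that] c_simps[OF stable_simps(2)[OF that]] by (simp add: DP_def)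
  fix r assume "r : poset_edges P leP DP"
  then obtain s s' where r: "r = (s, s', tt s s')" and s: "s : P" "s' : P" "s <= s'"
  by (auto simp: poset_edges_def leP_def DP_def)
  note S = stable_simps[OF s(1)] and S' = stable_simps[OF s(2)] and t = tt[OF s]
  and cs = c_simps[OF stable_simps(2)[OF s(1)]] and cs' = c_simps[OF stable_simps(2)[OF s(2)]]
  have "(c (lev s') $ m s') $ tt s s' = c (lev s) $ m s"
  proof (rule q_e_epi[OF s(1), of _ x])
  fix z assume z: "z : s"
  then have z': "z : s'" using s by blast
  note ez = e_simps(2-4)[OF s(1) z]
  have "((c (lev s') $ m s') $ tt s s') $ q s $ e s z = c (lev s') $ m s' $ tt s s' $ q s $ e s z"
  using S S' t cs cs' ez by simp
  also have "... = c (lev s') $ m s' $ q s' $ e s' z" by (simp add: tt_q_e[OF s z])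
  also have "... = c (lev s) $ m s $ q s $ e s z" by (simp only: c_m_q_e[OF s(2) z'] c_m_q_e[OF s(1) z])
  finally show "((c (lev s') $ m s') $ tt s s') $ q s $ e s z = (c (lev s) $ m s) $ q s $ e s z"
  using S cs ez by simp
  qed (use S S' t cs cs' in auto)
  then show "case r of (s, s', w) => (c (lev s') $ m s') $ w = c (lev s) $ m s" by (simp add: r)
 qed (rule x_ob)
 from gcolim_ex_induced[OF colim_y this]
 obtain r where r: "r : hom C y x" and rx': "ALL s:P. r $ xs s = c (lev s) $ m s"
  by (rule bexE)
 note rx = bspec[OF rx']
 have sing: "{z} : P" if "z : Z" for z using that by (intro finite_P) auto
 define p where "p z = xs {z} $ q {z} $ e {z} z" for z
 have p_eq: "xs s $ q s $ e s z = p z" if s: "s : P" and z: "z : s" for s z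
 proof -
  have zZ: "z : Z" using P_sub[OF s] z by (rule subsetD)
  have zP: "{z} : P" "{z} <= s" using sing[OF zZ] z by simp_all
  note S = stable_simps[OF zP(1)] and S' = stable_simps[OF s] and t = tt[OF zP(1) s zP(2)] and ez = e_simps(2-4)[OF zP(1), of z]
  have "p z = xs s $ tt {z} s $ q {z} $ e {z} z"
  unfolding p_def xs_tt[OF zP(1) s zP(2), symmetric]
  by (rule assoc) (use S t ez xs[OF s] in auto)
  then show ?thesis using tt_q_e[OF zP(1) s zP(2), of z] by simp
 qed
 have p: "p z : ar C" "dm C (p z) = fst z" "cd C (p z) = y" if z: "z : Z" for z
  using stable_simps[OF sing[OF z]] xs[OF sing[OF z]] e_simps(2-4)[OF sing[OF z], of z] by (auto simp: p_def)
 have p_rel: "p z' $ w = p z" if z: "z : Z" "z' : Z" and w: "w : hom C (fst z) (fst z')"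
  and i: "i : J" "(stage z, i) : lej" "(stage z', i) : lej" "at i z' $ w = at i z" for z z' w i
 proof -
  \<comment> \<open>A relation between two elements is already an edge of the graph on that
    pair.\<close>
  let ?s = "{z, z'}"
  have s: "?s : P" using z by (intro finite_P) auto
  have "(z, z', w) : rels ?s" using w i by (auto simp: rels_def)
  then have ew: "e ?s z' $ w = e ?s z" by (rule e_simps(5)[OF s])
  note S = stable_simps[OF s] and ez = e_simps(2-4)[OF s, of z'] and xss = xs[OF s]
  have "p z' $ w = xs ?s $ q ?s $ e ?s z' $ w"
  unfolding p_eq[OF s, of z', symmetric, simplified] using S ez xss w by simp
  then show ?thesis using ew p_eq[OF s, of z] by simp
 qed
 have r_p: "r $ p z = c (stage z) $ snd (snd z)" if z: "z : Z" for z
 proof -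
  note S = stable_simps[OF sing[OF z]] and ez = e_simps(2-4)[OF sing[OF z], of z] and xss = xs[OF sing[OF z]]
  and cs = c_simps[OF stable_simps(2)[OF sing[OF z]]]
  have "r $ p z = (r $ xs {z}) $ q {z} $ e {z} z" unfolding p_def using r S ez xss by simp
  also have "... = c (lev {z}) $ m {z} $ q {z} $ e {z} z" unfolding rx[OF sing[OF z]] using S ez cs by simp
  finally show ?thesis using c_m_q_e[OF sing[OF z], of z] by simp
 qed
 have at_self: "at i (a, i, g) = g" if "i : J" "g : hom C a (oo D i)" for a i g
  using that by (simp add: at_def tr_id)
 \<comment> \<open>The values of \<open>p\<close> on elements at stage \<open>j\<close> determine an
   arrow out of \<open>D j\<close>, since \<open>D j\<close> is a colimit of objects of
   \<open>A\<close>; \<open>good_factor\<close> extends the defining equation from the legs of that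
   colimit to all \<open>g\<close>.\<close>
 have "EX d. d : hom C (oo D j) y & (ALL a:A. ALL g:hom C a (oo D j). d $ g = p (a, j, g)) &
  (ALL u v z. u : hom C (oo D j) z & v : hom C (oo D j) z & (ALL a:A. ALL g:hom C a (oo D j). u $ g = v $ g) --> u = v)"
  if j: "j : J" for j
 proof -
  obtain I' le' D' f where D': "directed_diagram ka lam C M I' le' D'" "good I' le' D' (oo D j) f" "ALL k:I'. oo D' k : A"
  using good_dense[OF D_simps[OF j]] by blast
  have fD: "cat_functor (poset_cat I' le') C D'" using D'(1) by (simp add: directed_diagram_def)
  have colim: "gcolim C I' (oo D') (poset_edges I' le' D') (oo D j) f"
  using good_colim[OF D'(1,2)] unfolding is_colim_poset_iff_gcolim[OF fD] .
  have f: "f k : ar C" "dm C (f k) = oo D' k" "cd C (f k) = oo D j" if "k : I'" for k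
  using gcolim_arr(2-4)[OF colim that] by auto
  have fZ: "(oo D' k, j, f k) : Z" if "k : I'" for k using that f D'(3) j by (auto simp: Z_def)
  have rel: "p (a', j, g') $ w = p (a, j, g)"
  if z: "(a, j, g) : Z" "(a', j, g') : Z" "w : hom C a a'" "g' $ w = g" for a a' g g' w
  proof (rule p_rel[OF z(1,2), of w j])
  have gh: "g : hom C a (oo D j)" "g' : hom C a' (oo D j)" using z(1,2) by (simp_all add: Z_def)
  show "at j (a', j, g') $ w = at j (a, j, g)" unfolding at_self[OF j gh(1)] at_self[OF j gh(2)] by (rule z(4))
  qed (use z(3) j refl_J in simp_all)
  have "gcocone C I' (oo D') (poset_edges I' le' D') y (%k. p (oo D' k, j, f k))"
  unfolding gcocone_def
  proof (intro conjI ballI)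
  show "p (oo D' k, j, f k) : hom C (oo D' k) y" if "k : I'" for k using p[OF fZ[OF that]] by simp
  fix s assume s: "s : poset_edges I' le' D'"
  then obtain k k' w where kw: "s = (k, k', w)" "k : I'" "k' : I'" by (auto simp: poset_edges_def)
  have "w : hom C (oo D' k) (oo D' k')" using gdiagram_poset[OF fD] s kw(1) by (auto simp: gdiagram_def)
  then show "case s of (k, k', w) => p (oo D' k', j, f k') $ w = p (oo D' k, j, f k)"
  using rel[OF fZ[OF kw(2)] fZ[OF kw(3)]] gcolim_arr(5)[OF colim] s kw(1) by simp
  qed (rule y_ob)
  from gcolim_ex_induced[OF colim this]
  obtain d where d1: "d : hom C (oo D j) y" and d': "ALL k:I'. d $ f k = p (oo D' k, j, f k)"
  by (rule bexE)
  note d = d1 bspec[OF d']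
  have "d $ g = p (a, j, g)" if a: "a : A" "g : hom C a (oo D j)" for a g
  proof -
  obtain k w where k: "k : I'" "w : hom C a (oo D' k)" "f k $ w = g"
  using good_factor[OF D'(1,2) _ a(2)] a(1) by blast
  have "(a, j, g) : Z" using a j by (auto simp: Z_def)
  then have "p (oo D' k, j, f k) $ w = p (a, j, g)" using rel fZ[OF k(1)] k by blast
  moreover have "d $ g = (d $ f k) $ w" unfolding k(3)[symmetric] using d(1) f[OF k(1)] k(2) by simp
  ultimately show ?thesis using d(2)[OF k(1)] by simp
  qed
  moreover have "u = v" if uv: "u : hom C (oo D j) z & v : hom C (oo D j) z & (ALL a:A. ALL g:hom C a (oo D j). u $ g = v $ g)" for u v z
  proof (rule gcolim_ext[OF colim gdiagram_poset[OF fD]])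
  show "u $ f k = v $ f k" if "k : I'" for k
  proof -
  have "f k : hom C (oo D' k) (oo D j)" using f[OF that] by simp
  then show ?thesis using uv D'(3) that by blast
  qed
  qed (use uv in auto)
  ultimately show ?thesis using d(1) by blast
 qed
 then have "ALL j:J. EX d. d : hom C (oo D j) y & (ALL a:A. ALL g:hom C a (oo D j). d $ g = p (a, j, g)) &
  (ALL u v z. u : hom C (oo D j) z & v : hom C (oo D j) z & (ALL a:A. ALL g:hom C a (oo D j). u $ g = v $ g) --> u = v)"
  by (rule ballI)
 from bchoice[OF this] obtain d where dall: "ALL j:J. d j : hom C (oo D j) y & (ALL a:A. ALL g:hom C a (oo D j). d j $ g = p (a, j, g)) &
  (ALL u v z. u : hom C (oo D j) z & v : hom C (oo D j) z & (ALL a:A. ALL g:hom C a (oo D j). u $ g = v $ g) --> u = v)"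
  by (rule exE)
 have d: "d j : hom C (oo D j) y" "a : A ==> g : hom C a (oo D j) ==> d j $ g = p (a, j, g)" if "j : J" for j a g
  using bspec[OF dall that] by blast+
 have A_ext: "u = v" if "j : J" "u : hom C (oo D j) z" "v : hom C (oo D j) z"
  "!!a g. a : A ==> g : hom C a (oo D j) ==> u $ g = v $ g" for j u v z
  using bspec[OF dall that(1)] that(2-4) by blast
 have "gcocone C J (oo D) (poset_edges J lej D) y d"
  unfolding gcocone_def
 proof (intro conjI ballI)
  show "d j : hom C (oo D j) y" if "j : J" for j by (rule d(1)[OF that])
  fix s assume "s : poset_edges J lej D"
  then obtain i j where s: "s = (i, j, tr i j)" "i : J" "j : J" "(i, j) : lej" by (auto simp: poset_edges_def)
  note t = tr_simps[OF s(2-4)] and di = d(1)[OF s(2)] and dj = d(1)[OF s(3)]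
  have "d j $ tr i j = d i"
  proof (rule A_ext[OF s(2), of _ y])
  fix a g assume a: "a : A" "g : hom C a (oo D i)"
  have z: "(a, i, g) : Z" "(a, j, tr i j $ g) : Z" using a s t by (auto simp: Z_def)
  have a_ob: "a : ob C" using a A_ob by auto
  have "p (a, j, tr i j $ g) $ idn C a = p (a, i, g)"
  proof (rule p_rel[OF z(1,2), of "idn C a" j])
  show "at j (a, j, tr i j $ g) $ idn C a = at j (a, i, g)"
  using a s t a_ob by (simp add: at_def tr_id)
  qed (use a_ob s refl_J in simp_all)
  then have "p (a, j, tr i j $ g) = p (a, i, g)" using p[OF z(2)] by simp
  moreover have "tr i j $ g : hom C a (oo D j)" using a t by simp
  ultimately show "(d j $ tr i j) $ g = d i $ g"
  using d(2)[OF s(2) a] d(2)[OF s(3) a(1)] t dj a by simp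
  qed (use t di dj in auto)
  then show "case s of (i, j, w) => d j $ w = d i" by (simp add: s)
 qed (rule y_ob)
 from gcolim_ex_induced[OF colim_D this]
 obtain k where k1: "k : hom C x y" and k': "ALL j:J. k $ c j = d j"
  by (rule bexE)
 note k = k1 bspec[OF k']
 have rk: "r $ k = idn C x"
 proof (rule gcolim_ext[OF colim_D gdiagram_poset[OF D]])
  fix j assume j: "j : J"
  note cj = c_simps[OF j]
  show "(r $ k) $ c j = idn C x $ c j"
  proof (rule A_ext[OF j, of _ x])
  fix a g assume a: "a : A" "g : hom C a (oo D j)"
  have z: "(a, j, g) : Z" using a j by (auto simp: Z_def)
  have "((r $ k) $ c j) $ g = r $ (k $ c j) $ g" using r k(1) cj a by simp
  also have "... = r $ p (a, j, g)" using k(2)[OF j] d(2)[OF j a] by simp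
  also have "... = c j $ g" using r_p[OF z] by simp
  finally show "((r $ k) $ c j) $ g = (idn C x $ c j) $ g" using cj by simp
  qed (use r k(1) cj x_ob in auto)
 qed (use r k x_ob in auto)
 have "k $ f : hom C a0 y" using k(1) f by simp
 from good_factor[OF dd y _ this] obtain i h where ih: "i : ?I" "h : hom C a0 (oo ?D i)" "cy i $ h = k $ f" by blast
 then obtain s where s: "i = fi s" "s : P" by blast
 note S = stable_simps[OF s(2)] and xss = xs[OF s(2)] and cs = c_simps[OF stable_simps(2)[OF s(2)]]
 have h: "h : hom C a0 (cd C (q s))" using ih(2) im(1)[OF s(2)] s(1) by (simp add: DP_def)
 have "f = (r $ k) $ f" using rk f by simp
 also have "... = r $ xs s $ h" using r k(1) f ih(3) s(1) by (simp add: xs_def)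
 also have "... = (r $ xs s) $ h" using r xss h by simp
 also have "... = c (lev s) $ m s $ h" using rx[OF s(2)] S cs h by simp
 finally have "c (lev s) $ m s $ h = f" by simp
 moreover have "m s $ h : hom C a0 (oo D (lev s))" using S h by simp
 ultimately show ?thesis using S(2) by blast
qed

end

lemma gcolim_cong:
 assumes "!!z. z : S ==> b z = b' z"
 shows "gcolim C S b R x e \<longleftrightarrow> gcolim C S b' R x e"
 unfolding gcolim_def gcocone_def using assms by simp

section \<open>A uniform bound for the rank\<close>

context generated_category
begin

text \<open>Diagrams of fewer than \<open>lam\<close> objects can be indexed by subsets of
  \<open>Field lam\<close>; this turns the requirement into one about a small set of
  diagrams.\<close>

definition bounds_shapes :: "'u set => bool" where
 "bounds_shapes B \<longleftrightarrow> infinite B & |Field lam| <=o |B| &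
  (ALL S b R. S <= Field lam & b ` S <= A & gdiagram C S b R -->
  |R| <=o |B| & (EX l e Q. gcolim C S b R l e & |Q| <=o |B| & quotient_reps C E l Q))"

text \<open>The bound is the disjoint union of \<open>Field lam\<close>, of all possible edges and
  of all chosen quotients, moved into \<open>'u\<close>. It is small because the diagrams indexed by
  subsets of \<open>Field lam\<close> form a small set.\<close>

lemma bounding_set_exists: "EX B. small ka B & bounds_shapes B"
proof -
 let ?F = "Field lam" and ?Arr = "UN a:A. UN a':A. hom C a a'"
 let ?X = "?F \<times> ?F \<times> ?Arr"
 let ?Sh = "{(S, b, R). S <= ?F & b : PiE S (%_. A) & R <= ?X & gdiagram C S b R}"
 have lc: "Card_order lam" "infinite ?F" using lam by (auto simp: regular_cardinal_def cinfinite_def)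
 have F: "small ka ?F" by (rule small_Field[OF lc(1) lam_small])
 have "small ka (hom C a a')" if "a : A" "a' : A" for a a'
  using ls A_ob that unfolding locally_small_def by blast
 then have Arr: "small ka ?Arr" by (intro small_UN ka A_small)
 then have X: "small ka ?X" by (intro small_Sigma ka F)
 have Sh: "small ka ?Sh"
 proof (rule small_subset)
  show "small ka (SIGMA S:Pow ?F. PiE S (%_. A) \<times> Pow ?X)"
  proof (intro small_Sigma small_Pow ka F Arr)
  fix S assume "S : Pow ?F"
  then have "small ka S" using small_subset[OF F] by blast
  then show "small ka (PiE S (%_. A))" by (intro small_PiE ka A_small)
  qed
 qed blast
 have "ALL sg:?Sh. EX Q. small ka Q & (EX l e. gcolim C (fst sg) (fst (snd sg)) (snd (snd sg)) l e & quotient_reps C E l Q)"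
 proof
  fix sg assume "sg : ?Sh"
  then obtain S b R where sg: "sg = (S, b, R)" and S: "S <= ?F" "R <= ?X" and d: "gdiagram C S b R" by blast
  obtain l e where le: "gcolim C S b R l e"
  using gcolim_exists[OF ka cocomplete small_subset[OF F S(1)] small_subset[OF X S(2)] d] .
  have "EX Q. small ka Q & quotient_reps C E l Q"
  unfolding quotient_reps_def by (rule bspec[OF cwp[unfolded cowellpowered_def] gcolim_arr(1)[OF le]])
  then obtain Q where "small ka Q" "quotient_reps C E l Q" by (elim exE conjE)
  then show "EX Q. small ka Q & (EX l e. gcolim C (fst sg) (fst (snd sg)) (snd (snd sg)) l e & quotient_reps C E l Q)"
  using le by (auto simp: sg)
 qed
 from bchoice[OF this] obtain Qf where Qf: "ALL sg:?Sh. small ka (Qf sg) &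
  (EX l e. gcolim C (fst sg) (fst (snd sg)) (snd (snd sg)) l e & quotient_reps C E l (Qf sg))" ..
 define U where "U = (UN sg:?Sh. Qf sg)"
 have U: "small ka U" unfolding U_def using Qf by (intro small_UN ka Sh) blast
 let ?W = "?F <+> ?X <+> U"
 have W: "small ka ?W" by (intro small_Plus ka F X U)
 obtain fi :: "_ => 'u" where fi: "inj_on fi ?W" using small_embed[OF ka W] .
 let ?B = "fi ` ?W"
 have WB: "|Y| <=o |?B|" if "inj_on h Y" "h ` Y <= ?W" for h :: "'w => _" and Y
 proof -
  have "inj_on (fi \<circ> h) Y" using that fi by (intro comp_inj_on) (auto intro: inj_on_subset)
  moreover have "(fi \<circ> h) ` Y <= ?B" using that(2) by auto
  ultimately show ?thesis using card_of_ordLeq by blast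
 qed
 have FB: "|?F| <=o |?B|"
 proof (rule WB)
  show "inj_on Inl ?F" by (rule inj_Inl)
  show "Inl ` ?F <= ?W" by blast
 qed
 have inf: "infinite ?B" using lc(2) FB card_of_ordLeq_finite by blast
 have key: "|R| <=o |?B| & (EX l e Q. gcolim C S b R l e & |Q| <=o |?B| & quotient_reps C E l Q)"
  if S: "S <= ?F" "b ` S <= A" "gdiagram C S b R" for S b R
 proof -
  have RX: "R <= ?X" using S unfolding gdiagram_def by fastforce
  have "gdiagram C S (restrict b S) R" using S(3) unfolding gdiagram_def by fastforce
  moreover have "restrict b S : PiE S (%_. A)" using S(2) by auto
  ultimately have sh: "(S, restrict b S, R) : ?Sh" using S(1) RX by blast
  from bspec[OF Qf sh] obtain l e where le: "gcolim C S (restrict b S) R l e"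
  "quotient_reps C E l (Qf (S, restrict b S, R))" unfolding fst_conv snd_conv by (elim exE conjE)
  have QU: "Qf (S, restrict b S, R) <= U" unfolding U_def using sh by (rule UN_upper)
  have q1: "|Qf (S, restrict b S, R)| <=o |?B|"
  proof (rule WB)
  show "inj_on (%q. Inr (Inr q)) (Qf (S, restrict b S, R))" by (simp add: inj_on_def)
  show "(%q. Inr (Inr q)) ` Qf (S, restrict b S, R) <= ?W" using QU by blast
  qed
  have q2: "gcolim C S b R l e" by (rule gcolim_cong[THEN iffD1, OF _ le(1)]) simp
  have q3: "|R| <=o |?B|"
  proof (rule WB)
  show "inj_on (%r. Inr (Inl r)) R" by (simp add: inj_on_def)
  show "(%r. Inr (Inl r)) ` R <= ?W" using RX by blast
  qed
  show ?thesis
  by (rule conjI[OF q3], rule exI[of _ l], rule exI[of _ e], rule exI[of _ "Qf (S, restrict b S, R)"], intro conjI q1 q2 le(2))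
 qed
 have "bounds_shapes ?B"
  unfolding bounds_shapes_def
 proof (rule conjI[OF inf conjI[OF FB]], intro allI impI, elim conjE)
  fix S b R assume "S <= ?F" "b ` S <= A" "gdiagram C S b R"
  then show "|R| <=o |?B| & (EX l e Q. gcolim C S b R l e & |Q| <=o |?B| & quotient_reps C E l Q)" by (rule key)
 qed
 with small_image[OF W] have "small ka ?B & bounds_shapes ?B" by (rule conjI)
 then show ?thesis by (rule exI)
qed

lemma few_shapes:
 fixes S :: "'s set"
 assumes B: "bounds_shapes B" and S: "|S| <o lam" "b ` S <= A" "gdiagram C S b R"
 shows "|S| <=o |B| & |R| <=o |B| & (EX l e Q. gcolim C S b R l e & |Q| <=o |B| & quotient_reps C E l Q)"
proof -
 have "Card_order lam" using lam by (auto simp: regular_cardinal_def)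
 then have SF: "|S| <=o |Field lam|"
  using S(1) card_of_Field_ordIso ordLess_imp_ordLeq ordIso_symmetric ordLeq_ordIso_trans by blast
 then obtain fi where fi: "inj_on fi S" "fi ` S <= Field lam" using card_of_ordLeq by metis
 let ?b = "b \<circ> inv_into S fi" and ?R = "(%(z, z', w). (fi z, fi z', w)) ` R"
 have inv: "inv_into S fi (fi z) = z" if "z : S" for z using fi(1) that by simp
 have d: "gdiagram C (fi ` S) ?b ?R"
  using S(3) unfolding gdiagram_def by (fastforce simp: inv)
 have "?b ` fi ` S <= A" using S(2) by (auto simp: inv)
 then have *: "|?R| <=o |B|" "EX l e Q. gcolim C (fi ` S) ?b ?R l e & |Q| <=o |B| & quotient_reps C E l Q"
  using B d fi(2) unfolding bounds_shapes_def by blast+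
 have RS: "z : S & z' : S" if "(z, z', w) : R" for z z' w using S(3) that by (auto simp: gdiagram_def)
 have "inj_on (%(z, z', w). (fi z, fi z', w)) R"
 proof (rule inj_onI)
  fix r r' assume r: "r : R" "r' : R" and eq: "(case r of (z, z', w) => (fi z, fi z', w)) = (case r' of (z, z', w) => (fi z, fi z', w))"
  obtain z z' w y y' v where rr: "r = (z, z', w)" "r' = (y, y', v)" by (cases r, cases r')
  then have "z : S" "z' : S" "y : S" "y' : S" using RS r by blast+
  then show "r = r'" using eq inj_onD[OF fi(1)] by (simp add: rr)
 qed
 then have "|R| <=o |?R|" using card_of_ordLeq by blast
 then have "|R| <=o |B|" using *(1) ordLeq_transitive by blast
 moreover have "|S| <=o |B|" using SF B ordLeq_transitive unfolding bounds_shapes_def by blast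
 moreover have "EX l e Q. gcolim C S b R l e & |Q| <=o |B| & quotient_reps C E l Q"
  using *(2) gcolim_reindex[OF fi(1) S(3)] by blast
 ultimately show ?thesis by blast
qed

theorem rank:
 fixes J :: "'j set"
 assumes B: "bounds_shapes B" and J: "small ka J" "trans lej" "!!i. i : J ==> (i, i) : lej"
  and ub: "!!S. S <= J ==> |S| <=o |B| ==> EX u:J. ALL s:S. (s, u) : lej"
  and D: "cat_functor (poset_cat J lej) C D" "is_colim C (poset_cat J lej) D x c" and f: "f : hom C a0 x"
 shows "EX j:J. EX g:hom C a0 (oo D j). c j $ g = f"
proof -
 interpret rank_argument C E M ka lam A a0 good B J lej D x c
 proof
  show "infinite B" using B by (simp add: bounds_shapes_def)
  show "|S| <=o |B| & |R| <=o |B| & (EX l e Q. gcolim C S b R l e & |Q| <=o |B| & quotient_reps C E l Q)"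
  if "|S| <o lam" "b ` S <= A" "gdiagram C S b R" for S :: "('o \<times> 'j \<times> 'a) set" and b R
  by (rule few_shapes[OF B that])
  show "gcolim C J (oo D) (poset_edges J lej D) x c"
  using D is_colim_poset_iff_gcolim[OF D(1)] by simp
 qed (use J ub D in auto)
 show ?thesis by (rule factor_through_stage[OF f])
qed

end

text \<open>A point outside all images would be separated by two functions into a two-point set that
  agree on every leg.\<close>

lemma set_colim_jointly_surjective:
 fixes ka :: "'u rel"
 assumes ka: "inaccessible ka" and colim: "is_set_colim ka J S h X c" and x: "x : X"
 shows "EX i:ob J. EX s:S i. c i s = x"
proof (rule ccontr)
 assume no: "\<not> ?thesis"
 have "infinite (Field ka)" using card_order_inaccessible(2)[OF ka] by (simp add: cinfinite_def)
 then have "infinite (Field ka - {p})" for p by simp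
 from infinite_imp_nonempty[OF this] obtain p q :: 'u where pq: "p \<noteq> q" by blast
 let ?Y = "{p, q}" and ?d = "%i s. p"
 have cX: "ALL i:ob J. c i : S i \<rightarrow> X" using colim by (simp add: is_set_colim_def)
 have univ: "EX! u. u : X \<rightarrow>\<^sub>E ?Y & (ALL i:ob J. ALL s:S i. u (c i s) = ?d i s)"
  using colim small_finite[OF ka, of ?Y] unfolding is_set_colim_def by simp
 let ?u = "restrict (%y. p) X" and ?v = "restrict (%y. if y = x then q else p) X"
 have "?u : X \<rightarrow>\<^sub>E ?Y & (ALL i:ob J. ALL s:S i. ?u (c i s) = ?d i s)" using cX by auto
 moreover have "?v : X \<rightarrow>\<^sub>E ?Y & (ALL i:ob J. ALL s:S i. ?v (c i s) = ?d i s)" using cX no by auto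
 ultimately have "?u = ?v" using ex1_unique[OF univ] by blast
 then have "?u x = ?v x" by (rule fun_cong)
 then show False using x pq by simp
qed

section \<open>The base category\<close>

locale generated_base = symmetric_monoidal_closed V
 for V :: "('o, 'a, 'z) smc_scheme" (structure) +
 fixes ka :: "'u rel" and lam :: "'l rel" and EV MV :: "'a set"
 assumes ka: "inaccessible ka" and lam: "regular_cardinal lam" and lam_small: "lam <o ka"
  and locally_small: "locally_small ka V" and generated: "locally_generated_closed ka lam V EV MV"
begin

abbreviation "Es \<equiv> self_arrows V EV"
abbreviation "Ms \<equiv> self_arrows V MV"
abbreviation "W \<equiv> und V Vs"

lemma locally_generated_self: "locally_generated ka lam V Vs Es Ms"
 and E_sub: "EV <= ar V" and M_sub: "MV <= ar V" and unit_generated: "generated_object ka lam V MV (unt V)"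
 using generated by (simp_all add: locally_generated_closed_def)

lemma has_colimits: "has_weighted_colimits ka V Vs"
 and v_fs: "v_factorization_system V Vs Es Ms"
 and cowellpowered: "cowellpowered ka W Es"
 using locally_generated_self by (simp_all add: locally_generated_def convenient_def)

lemma fs: "factorization_system W Es Ms"
 using v_fs by (simp add: v_factorization_system_def)

sublocale fact: factorization W Es Ms
 by unfold_locales (rule fs)

lemma E_triple:
 assumes "t : Es"
 obtains f where "f : ar V" "t = (dm V f, cd V f, arrow_name f)"
 using assms E_sub unfolding self_arrows_eq by blast

lemma M_triple:
 assumes "t : Ms"
 obtains f where "f : MV" "f : ar V" "t = (dm V f, cd V f, arrow_name f)"
 using assms M_sub unfolding self_arrows_eq by blast

text \<open>The correspondence between arrows from \<open>p\<close> to [a, c] and arrows from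
  \<open>a\<close> to [p, c] given by the symmetry.\<close>

definition flip :: "'o => 'o => 'o => 'a => 'a" where
 "flip a p c u = curry_ar V a p c (ev V a c $ (u ** idn V a) $ swp V a p)"

lemma flip_simps:
 assumes "a : ob V" "c : ob V" "u : ar V" "dm V u = p" "cd V u = ihom V a c"
 shows "flip a p c u : ar V" "dm V (flip a p c u) = a" "cd V (flip a p c u) = ihom V p c"
  "ev V p c $ (flip a p c u ** idn V p) = ev V a c $ (u ** idn V a) $ swp V a p"
proof -
 have p: "p : ob V" using assms by auto
 let ?h = "ev V a c $ (u ** idn V a) $ swp V a p"
 have h: "?h : ar V" "dm V ?h = a @@ p" "cd V ?h = c" using assms p by simp_all
 show "flip a p c u : ar V" "dm V (flip a p c u) = a" "cd V (flip a p c u) = ihom V p c"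
  "ev V p c $ (flip a p c u ** idn V p) = ev V a c $ (u ** idn V a) $ swp V a p"
  using curry_hom_ev[OF assms(1) p assms(2) h] unfolding flip_def by simp_all
qed

lemma flip_ev:
 assumes "a : ob V" "c : ob V" "u : ar V" "dm V u = p" "cd V u = ihom V a c" "q : ar V" "cd V q = p"
 shows "ev V p c $ (flip a p c u ** q) = ev V a c $ ((u $ q) ** idn V a) $ swp V a (dm V q)"
proof -
 note f = flip_simps[OF assms(1-5)]
 have p: "p : ob V" using assms by auto
 have "ev V p c $ (flip a p c u ** q) = (ev V p c $ (flip a p c u ** idn V p)) $ (idn V a ** q)"
  using f(1-3) assms p by simp
 also have "... = ev V a c $ (u ** idn V a) $ swp V a p $ (idn V a ** q)" unfolding f(4) using assms p by simp
 also have "swp V a p $ (idn V a ** q) = (q ** idn V a) $ swp V a (dm V q)" using assms by (simp add: swp_nat)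
 finally show ?thesis using assms p by simp
qed

text \<open>Transposition turns lifting \<open>p \<rightarrow> [a, c]\<close> along \<open>e : p \<rightarrow> q\<close> against \<open>[a, m]\<close> into lifting \<open>a \<rightarrow> [p, c]\<close>, for which
 the pullback condition of an enriched factorization system applies.\<close>

lemma M_ihom:
 assumes m: "m : Ms" and a: "a : ob V"
 shows "und_ar V (vrep V Vs a) m : Ms"
proof (rule fact.M_orthogonal)
 obtain m0 where m0: "m0 : ar V" "m = (dm V m0, cd V m0, arrow_name m0)" using M_triple[OF m] by metis
 let ?c = "dm V m0" and ?d = "cd V m0"
 have cd: "?c : ob V" "?d : ob V" using m0 by auto
 have am: "vpost V Vs a m : hom V (ihom V a ?c) (ihom V a ?d)"
  using m0(1) a by (simp add: m0(2))
 have n: "und_ar V (vrep V Vs a) m = name_ar (vpost V Vs a m)"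
  using m0(1) a am by (simp add: m0(2) und_ar_def self.vrep_arrow name_ar_def)
 show "und_ar V (vrep V Vs a) m : ar W" unfolding n using name_ar_hom[OF am] by simp
 fix e u v
 assume e: "e : Es" and u: "u : hom W (dm W e) (dm W (und_ar V (vrep V Vs a) m))"
  and v: "v : hom W (cd W e) (cd W (und_ar V (vrep V Vs a) m))"
  and sq: "und_ar V (vrep V Vs a) m $\<^bsub>W\<^esub> u = v $\<^bsub>W\<^esub> e"
 obtain e0 where e0: "e0 : ar V" "e = (dm V e0, cd V e0, arrow_name e0)" using E_triple[OF e] .
 let ?p = "dm V e0" and ?q = "cd V e0"
 have pq: "?p : ob V" "?q : ob V" using e0 by auto
 define u0 where "u0 = unname_ar u"
 define v0 where "v0 = unname_ar v"
 have dn: "dm W (name_ar (vpost V Vs a m)) = ihom V a ?c" "cd W (name_ar (vpost V Vs a m)) = ihom V a ?d"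
  using name_ar_hom[OF am] by simp_all
 have uh: "u : hom W ?p (ihom V a ?c)" using u unfolding n dn by (simp add: e0(2))
 have vh: "v : hom W ?q (ihom V a ?d)" using v unfolding n dn by (simp add: e0(2))
 have u0: "u0 : ar V" "dm V u0 = ?p" "cd V u0 = ihom V a ?c" using unname_ar_hom[OF uh] by (simp_all add: u0_def)
 have v0: "v0 : ar V" "dm V v0 = ?q" "cd V v0 = ihom V a ?d" using unname_ar_hom[OF vh] by (simp_all add: v0_def)
 have eh: "e : hom W ?p ?q" "unname_ar e = e0"
  using e0(1) name_ar_hom[of e0 ?p ?q] unname_name_ar[OF e0(1)] by (simp_all add: e0(2) name_ar_def)
 have amar: "vpost V Vs a m : ar V" using am by simp
 have sq0: "vpost V Vs a m $ u0 = v0 $ e0"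
  using arg_cong[OF sq, of unname_ar] unname_ar_cmp[OF uh name_ar_hom[OF am]] unname_ar_cmp[OF eh(1) vh] eh(2)
  unfolding n by (simp add: u0_def v0_def unname_name_ar[OF amar])
 have pb: "is_pullback V (vpost V Vs ?p m) (vpre V Vs e ?d) (vpre V Vs e ?c) (vpost V Vs ?q m)"
  using v_fs e m unfolding v_factorization_system_def e0(2) m0(2) by fastforce
 note fu = flip_simps[OF a cd(1) u0] and fv = flip_simps[OF a cd(2) v0]
 have pm: "vpost V Vs ?p m : hom V (ihom V ?p ?c) (ihom V ?p ?d)" "vpost V Vs ?q m : hom V (ihom V ?q ?c) (ihom V ?q ?d)"
  and pe: "vpre V Vs e ?d : hom V (ihom V ?q ?d) (ihom V ?p ?d)" "vpre V Vs e ?c : hom V (ihom V ?q ?c) (ihom V ?p ?c)"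
  using m0(1) e0(1) by (simp_all add: m0(2) e0(2))
 have "vpost V Vs ?p m $ flip a ?p ?c u0 = vpre V Vs e ?d $ flip a ?q ?d v0"
 proof (rule ev_ext[of ?p ?d _ _ a])
  have "ev V ?p ?d $ ((vpost V Vs ?p m $ flip a ?p ?c u0) ** idn V ?p) = m0 $ ev V a ?c $ (u0 ** idn V a) $ swp V a ?p"
  unfolding m0(2) using ev_self_vpost[of m0 ?c ?d ?p "flip a ?p ?c u0" "idn V ?p"] m0(1) pq fu by simp
  also have "... = (m0 $ ev V a ?c $ (u0 ** idn V a)) $ swp V a ?p" using m0(1) u0 a pq by simp
  also have "m0 $ ev V a ?c $ (u0 ** idn V a) = ev V a ?d $ ((v0 $ e0) ** idn V a)"
  unfolding sq0[symmetric] unfolding m0(2) using ev_self_vpost[of m0 ?c ?d a u0 "idn V a"] m0(1) u0 a by simp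
  also have "(...) $ swp V a ?p = ev V ?q ?d $ (flip a ?q ?d v0 ** e0)"
  using flip_ev[OF a cd(2) v0 e0(1) refl] v0 e0(1) a pq cd by simp
  also have "... = ev V ?p ?d $ ((vpre V Vs e ?d $ flip a ?q ?d v0) ** idn V ?p)"
  unfolding e0(2) using ev_self_vpre[of e0 ?p ?q ?d "flip a ?q ?d v0" "idn V ?p"] e0(1) pq fv cd by simp
  finally show "ev V ?p ?d $ ((vpost V Vs ?p m $ flip a ?p ?c u0) ** idn V ?p)
  = ev V ?p ?d $ ((vpre V Vs e ?d $ flip a ?q ?d v0) ** idn V ?p)" .
 qed (use pm pe fu fv pq cd a in simp_all)
 moreover have "flip a ?p ?c u0 : hom V a (dm V (vpost V Vs ?p m))" "flip a ?q ?d v0 : hom V a (dm V (vpre V Vs e ?d))"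
  using fu fv pm pe by simp_all
 ultimately have "EX! y. y : hom V a (dm V (vpre V Vs e ?c)) & vpre V Vs e ?c $ y = flip a ?p ?c u0 & vpost V Vs ?q m $ y = flip a ?q ?d v0"
  using pb unfolding is_pullback_def by blast
 then obtain y where yh: "y : hom V a (dm V (vpre V Vs e ?c))" and y: "vpre V Vs e ?c $ y = flip a ?p ?c u0"
  "vpost V Vs ?q m $ y = flip a ?q ?d v0" by (elim ex1E conjE)
 have yy: "y : ar V" "dm V y = a" "cd V y = ihom V ?q ?c" using yh pe by simp_all
 note fy = flip_simps[OF pq(2) cd(1) yy]
 have d1: "flip ?q a ?c y $ e0 = u0"
 proof (rule ev_ext[of a ?c _ _ ?p])
  have "ev V a ?c $ ((flip ?q a ?c y $ e0) ** idn V a) = (ev V a ?c $ (flip ?q a ?c y ** idn V a)) $ (e0 ** idn V a)"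
  using fy(1-3) e0(1) a cd pq by simp
  also have "... = ev V ?q ?c $ (y ** idn V ?q) $ swp V ?q a $ (e0 ** idn V a)"
  unfolding fy(4) using yy e0(1) a cd pq by simp
  also have "swp V ?q a $ (e0 ** idn V a) = (idn V a ** e0) $ swp V ?p a" using e0(1) a by (simp add: swp_nat)
  also have "ev V ?q ?c $ (y ** idn V ?q) $ (idn V a ** e0) $ swp V ?p a = (ev V ?q ?c $ (y ** e0)) $ swp V ?p a"
  using yy e0(1) a cd pq by simp
  also have "ev V ?q ?c $ (y ** e0) = ev V ?p ?c $ (flip a ?p ?c u0 ** idn V ?p)"
  unfolding y(1)[symmetric] unfolding e0(2) using ev_self_vpre[of e0 ?p ?q ?c y "idn V ?p"] e0(1) pq yy cd by simp
  also have "(...) $ swp V ?p a = ev V a ?c $ (u0 ** idn V a) $ swp V a ?p $ swp V ?p a"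
  unfolding fu(4) using u0 a cd pq by simp
  finally show "ev V a ?c $ ((flip ?q a ?c y $ e0) ** idn V a) = ev V a ?c $ (u0 ** idn V a)"
  using u0 a cd pq by (simp add: swp_swp)
 qed (use fy e0(1) u0 a cd in simp_all)
 have d2: "vpost V Vs a m $ flip ?q a ?c y = v0"
 proof (rule ev_ext[of a ?d _ _ ?q])
  have "ev V a ?d $ ((vpost V Vs a m $ flip ?q a ?c y) ** idn V a) = m0 $ ev V ?q ?c $ (y ** idn V ?q) $ swp V ?q a"
  unfolding m0(2) using ev_self_vpost[of m0 ?c ?d a "flip ?q a ?c y" "idn V a"] m0(1) a fy by simp
  also have "... = (m0 $ ev V ?q ?c $ (y ** idn V ?q)) $ swp V ?q a" using m0(1) yy a pq by simp
  also have "m0 $ ev V ?q ?c $ (y ** idn V ?q) = ev V ?q ?d $ (flip a ?q ?d v0 ** idn V ?q)"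
  unfolding y(2)[symmetric] unfolding m0(2) using ev_self_vpost[of m0 ?c ?d ?q y "idn V ?q"] m0(1) yy pq by simp
  also have "(...) $ swp V ?q a = ev V a ?d $ (v0 ** idn V a) $ swp V a ?q $ swp V ?q a"
  unfolding fv(4) using v0 a cd pq by simp
  finally show "ev V a ?d $ ((vpost V Vs a m $ flip ?q a ?c y) ** idn V a) = ev V a ?d $ (v0 ** idn V a)"
  using v0 a cd pq by (simp add: swp_swp)
 qed (use fy am v0 a cd in simp_all)
 have fyh: "flip ?q a ?c y : hom V ?q (ihom V a ?c)" using fy by simp
 have e0h: "e0 : hom V ?p ?q" using e0 by simp
 have "name_ar (flip ?q a ?c y) $\<^bsub>W\<^esub> e = u"
  using name_ar_cmp[OF e0h fyh] d1 name_unname_ar[of u] uh by (simp add: u0_def e0(2) name_ar_def)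
 moreover have "name_ar (vpost V Vs a m) $\<^bsub>W\<^esub> name_ar (flip ?q a ?c y) = v"
  using name_ar_cmp[OF fyh am] d2 name_unname_ar[of v] vh by (simp add: v0_def)
 moreover have "name_ar (flip ?q a ?c y) : hom W (cd W e) (ihom V a ?c)" using name_ar_hom[OF fyh] by (simp add: e0(2))
 ultimately show "EX d. d : hom W (cd W e) (dm W (und_ar V (vrep V Vs a) m)) & d $\<^bsub>W\<^esub> e = u & und_ar V (vrep V Vs a) m $\<^bsub>W\<^esub> d = v"
  unfolding n dn by blast
qed

end

section \<open>The base as an instance of the rank argument\<close>

context generated_base
begin

definition generators :: "'o set" where
 "generators = (SOME A. small ka A & (ALL a:A. v_generated_object ka lam V Vs Ms a) &
  (ALL x:vob Vs. EX I le D c. directed_diagram ka lam W Ms I le D &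
  (ALL i:I. oo D i : A) & is_conical_colim V Vs (poset_cat I le) D x c))"

lemma generators:
 "small ka generators" "a : generators ==> v_generated_object ka lam V Vs Ms a"
 "x : ob V ==> EX I le D c. directed_diagram ka lam W Ms I le D &
  (ALL i:I. oo D i : generators) & is_conical_colim V Vs (poset_cat I le) D x c"
proof -
 have "EX A. small ka A & (ALL a:A. v_generated_object ka lam V Vs Ms a) &
  (ALL x:vob Vs. EX I le D c. directed_diagram ka lam W Ms I le D &
  (ALL i:I. oo D i : A) & is_conical_colim V Vs (poset_cat I le) D x c)"
  using locally_generated_self unfolding locally_generated_def by (elim conjE)
 from someI_ex[OF this, folded generators_def]
 show "small ka generators" "a : generators ==> v_generated_object ka lam V Vs Ms a"
 "x : ob V ==> EX I le D c. directed_diagram ka lam W Ms I le D &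
  (ALL i:I. oo D i : generators) & is_conical_colim V Vs (poset_cat I le) D x c"
  by simp_all
qed

text \<open>The hypothesis on the unit concerns diagrams of arrows of V, so the diagram of names is
  translated back first; then a stage comes from
  \<open>set_colim_jointly_surjective\<close>.\<close>

lemma unit_factor:
 assumes dd: "directed_diagram ka lam W Ms I le D" and colim: "is_conical_colim V Vs (poset_cat I le) D x c"
  and f: "f : hom V (unt V) x"
 shows "EX i:I. EX g:hom V (unt V) (oo D i). unname_ar (c i) $ g = f"
proof -
 let ?D = "\<lparr>oo = oo D, oa = (%k. unname_ar (oa D k))\<rparr>"
 have D: "cat_functor (poset_cat I le) W D" using dd by (simp add: directed_diagram_def)
 note dp = cat_functor_posetD[OF D]
 have D': "cat_functor (poset_cat I le) V ?D"
  unfolding cat_functor_def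
 proof (intro conjI ballI impI)
  fix i assume "i : ob (poset_cat I le)"
  then have i: "i : I" by simp
  have ob: "oo D i : ob V" using dp(1)[OF i] by simp
  show "oo ?D i : ob V" using ob by simp
  show "oa ?D (idn (poset_cat I le) i) = idn V (oo ?D i)"
  using dp(3)[OF i] ob unname_name_ar[of "idn V (oo D i)"] by (simp add: name_ar_idn)
 next
  fix k assume "k : ar (poset_cat I le)"
  then obtain i j where k: "k = (i, j)" "i : I" "j : I" "(i, j) : le" by (cases k) auto
  show "oa ?D k : hom V (oo ?D (dm (poset_cat I le) k)) (oo ?D (cd (poset_cat I le) k))"
  using unname_ar_hom[OF dp(2)[OF k(2-4)]] by (simp add: k(1))
 next
  fix k l assume kl: "k : ar (poset_cat I le)" "l : ar (poset_cat I le)" "dm (poset_cat I le) l = cd (poset_cat I le) k"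
  from kl(1) obtain i j where k: "k = (i, j)" "i : I" "j : I" "(i, j) : le" by (cases k) auto
  from kl(2,3) obtain h where l: "l = (j, h)" "h : I" "(j, h) : le" using k by (cases l) auto
  have "oa D (l $\<^bsub>poset_cat I le\<^esub> k) = oa D l $\<^bsub>W\<^esub> oa D k"
  using D kl unfolding cat_functor_def by blast
  then show "oa ?D (l $\<^bsub>poset_cat I le\<^esub> k) = oa ?D l $ oa ?D k"
  using unname_ar_cmp[OF dp(2)[OF k(2-4)] dp(2)[OF k(3) l(2,3)]] by (simp add: k(1) l(1))
 qed
 have "unname_ar t : MV" if t: "t : Ms" for t
 proof -
  obtain m0 where m0: "m0 : MV" "m0 : ar V" "t = (dm V m0, cd V m0, arrow_name m0)" using M_triple[OF t] .
  then have "t = name_ar m0" by (simp add: name_ar_def)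
  then show ?thesis using m0 by (simp add: unname_name_ar)
 qed
 then have dd': "directed_diagram ka lam V MV I le ?D" using dd D' by (simp add: directed_diagram_def)
 have gc: "gcolim W I (oo D) (poset_edges I le D) x c"
  using self.conical_colim_is_colim[OF colim] unfolding is_colim_poset_iff_gcolim[OF D] .
 have edges: "poset_edges I le ?D = unname_edges (poset_edges I le D)"
  unfolding poset_edges_def unname_edges_def by force
 have "is_colim V (poset_cat I le) ?D x (%i. unname_ar (c i))"
  unfolding is_colim_poset_iff_gcolim[OF D'] edges
  using gcolim_unname[OF gdiagram_poset[OF D] gc] by simp
 then have "is_set_colim ka (poset_cat I le) (%i. hom V (unt V) (oo ?D i)) (%f g. oa ?D f $ g)
  (hom V (unt V) x) (%i g. unname_ar (c i) $ g)"
  using unit_generated dd' unfolding generated_object_def by blast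
 from set_colim_jointly_surjective[OF ka this f] show ?thesis by (simp del: hom_iff)
qed

lemma und_ar_vrep:
 assumes "enriched V K" "a : vob K" "t : ar (und V K)"
 shows "und_ar V (vrep V K a) t = name_ar (vpost V K a t)"
proof -
 interpret K: enriched V K by fact
 obtain y z g where t: "t = (y, z, g)" by (cases t)
 show ?thesis using assms(2,3) unfolding t by (simp add: und_ar_def K.vrep_arrow name_ar_def)
qed

text \<open>For a generator \<open>a\<close> the functor [a, -] preserves the colimit and, by
  \<open>M_ihom\<close>, keeps the diagram inside \<open>Ms\<close>. Arrows from \<open>a\<close> to
  \<open>x\<close> are elements of [a, x], so they factor through a stage because arrows from the
  unit do.\<close>

lemma generator_factor:
 assumes dd: "directed_diagram ka lam W Ms I le D" and colim: "is_conical_colim V Vs (poset_cat I le) D x c"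
  and a: "a : insert (unt V) generators" and f: "f : hom W a x"
 shows "EX i:I. EX g:hom W a (oo D i). c i $\<^bsub>W\<^esub> g = f"
proof (cases "a = unt V")
 case True
 have f0: "unname_ar f : hom V (unt V) x" using unname_ar_hom[OF f] True by simp
 obtain i g where i: "i : I" and g: "g : hom V (unt V) (oo D i)" and eq: "unname_ar (c i) $ g = unname_ar f"
  using unit_factor[OF dd colim f0] by (elim bexE)
 have ci: "c i : hom W (oo D i) x" using colim i by (simp add: is_conical_colim_def is_cocone_def del: hom_iff)
 have "c i $\<^bsub>W\<^esub> name_ar g = name_ar (unname_ar (c i) $ g)"
  using name_ar_cmp[OF g unname_ar_hom[OF ci]] name_unname_ar[of "c i"] ci by simp
 also have "... = f" unfolding eq using f by (simp add: name_unname_ar)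
 finally show ?thesis using i name_ar_hom[OF g] unfolding True by (intro bexI[of _ i] bexI[of _ "name_ar g"])
next
 case False
 then have aG: "a : generators" using a by simp
 have aob: "a : ob V" using generators(2)[OF aG] by (simp add: v_generated_object_def)
 let ?D = "\<lparr>oo = (%i. fo (vrep V Vs a) (oo D i)), oa = (%f. und_ar V (vrep V Vs a) (oa D f))\<rparr>"
 have pres: "is_conical_colim V Vs (poset_cat I le) ?D (fo (vrep V Vs a) x) (%i. und_ar V (vrep V Vs a) (c i))"
  using generators(2)[OF aG] dd colim unfolding v_generated_object_def preserves_directed_colimits_def preserves_conical_colim_def by blast
 have dd2: "directed_diagram ka lam W Ms I le ?D"
  using dd pres M_ihom[OF _ aob] by (simp add: directed_diagram_def is_conical_colim_def)
 obtain h where h: "f = (a, x, h)" "h : hom V (unt V) (ihom V a x)" using f by (cases f) auto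
 then have "h : hom V (unt V) (fo (vrep V Vs a) x)" by simp
 from unit_factor[OF dd2 pres this] obtain i g where i: "i : I" and g: "g : hom V (unt V) (ihom V a (oo D i))"
  and eq: "unname_ar (und_ar V (vrep V Vs a) (c i)) $ g = h" by (auto simp del: hom_iff)
 have ci: "c i : hom W (oo D i) x" using colim i by (simp add: is_conical_colim_def is_cocone_def del: hom_iff)
 obtain k where k: "c i = (oo D i, x, k)" using ci by (cases "c i") auto
 have "vpost V Vs a (c i) : ar V" using ci aob by (simp add: k)
 then have eq': "vpost V Vs a (c i) $ g = h"
  using eq und_ar_vrep[OF enriched_self, of a "c i"] ci aob by (simp add: unname_name_ar)
 have "(a, oo D i, g) : hom W a (oo D i)" using g ci aob by (auto simp: k)
 moreover have "c i $\<^bsub>W\<^esub> (a, oo D i, g) = f" using eq' ci g aob by (simp add: k h(1))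
 ultimately show ?thesis using i by blast
qed

lemma locally_small_und:
 assumes "enriched V K" shows "Defs.locally_small ka (und V K)"
 unfolding locally_small_def
proof (intro ballI)
 interpret K: enriched V K by fact
 fix a b assume ab: "a : ob (und V K)" "b : ob (und V K)"
 have "small ka (hom V (unt V) (vhom K a b))"
  using locally_small ab unfolding locally_small_def by (simp add: K.vhom_ob unt_ob)
 then have "small ka ((%h. (a, b, h)) ` hom V (unt V) (vhom K a b))" by (rule small_image)
 then show "small ka (hom (und V K) a b)" by (rule small_subset) auto
qed

sublocale gen: generated_category W Es Ms ka lam generators "unt V"
 "%I le D x c. is_conical_colim V Vs (poset_cat I le) D x c"
proof
 show "graph_cocomplete ka W" by (rule self.graph_cocomplete_und[OF ka has_colimits has_colimits])
 show "Defs.locally_small ka W" by (rule locally_small_und[OF enriched_self])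
 show "generators <= ob W" using generators(2) by (auto simp: v_generated_object_def)
 show "EX x c. is_conical_colim V Vs (poset_cat I le) D x c" if "directed_diagram ka lam W Ms I le D" for I le D
 proof -
  have I: "small ka I" "trans le" "!!i. i : I ==> (i, i) : le" "cat_functor (poset_cat I le) W D"
  using that by (auto simp: directed_diagram_def directed_poset_def partial_order_on_def preorder_on_def refl_on_def)
  obtain x c where "is_conical_colim V Vs (poset_cat I le) D x c"
  using self.conical_colim_exists[OF ka has_colimits has_colimits I] .
  then show ?thesis by (intro exI)
 qed
 show "EX I le D c. directed_diagram ka lam W Ms I le D & is_conical_colim V Vs (poset_cat I le) D y c & (ALL i:I. oo D i : generators)"
  if "y : ob W" for y
  using generators(3)[of y] that by (simp add: conj_commute)
qed (use ka lam lam_small cowellpowered generators(1) self.conical_colim_is_colim generator_factor in blast)+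

lemma complete_base: "complete_base V ka generators"
proof
 show "graph_cocomplete ka V" by (rule graph_cocomplete_base[OF ka has_colimits])
 show "densely_generated ka V generators"
  unfolding densely_generated_def
 proof (intro conjI ballI)
  show "generators <= ob V" using gen.A_ob by simp
  fix y assume "y : ob V"
  then obtain I le D c where D: "directed_diagram ka lam W Ms I le D" "ALL i:I. oo D i : generators"
  and colim: "is_conical_colim V Vs (poset_cat I le) D y c" using generators(3) by blast
  have F: "cat_functor (poset_cat I le) W D" using D(1) by (simp add: directed_diagram_def)
  have gc: "gcolim W I (oo D) (poset_edges I le D) y c"
  using self.conical_colim_is_colim[OF colim] unfolding is_colim_poset_iff_gcolim[OF F] .
  show "EX (S :: 'u set) b R e. gdiagram V S b R & gcolim V S b R y e & b ` S <= generators"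
  using gdiagram_unname[OF gdiagram_poset[OF F]] gcolim_unname[OF gdiagram_poset[OF F] gc] D(2)
  by blast
 qed
qed (use ka locally_small generators(1) in blast)+

end

section \<open>Generated objects form a small class\<close>

text \<open>A retract of \<open>x\<close> is determined up to isomorphism by the idempotent it
  induces on \<open>x\<close>, so one representative per idempotent suffices.\<close>

lemma (in category) retract_representatives:
 fixes ka :: "'u rel"
 assumes ka: "inaccessible ka" and ls: "locally_small ka C" and X: "small ka X" "X <= ob C"
  and ret: "!!a. Q a ==> a : ob C & (EX x:X. EX m:hom C x a. EX g:hom C a x. m $ g = idn C a)"
 shows "EX R. small ka R & (ALL b:R. Q b) & (ALL a. Q a --> (EX b:R. isomorphic C a b))"
proof -
 let ?I = "SIGMA x:X. hom C x x"
 define is_ret where "is_ret a r \<longleftrightarrow> Q a & (EX m:hom C (fst r) a. EX g:hom C a (fst r). m $ g = idn C a & g $ m = snd r)" for a r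
 define rep where "rep r = (SOME a. is_ret a r)" for r
 have rep: "is_ret (rep r) r" if "is_ret a r" for a r unfolding rep_def using that by (rule someI)
 let ?R = "rep ` {r : ?I. EX a. is_ret a r}"
 have "small ka ?I" using ls X(2) unfolding locally_small_def by (intro small_Sigma ka X(1)) blast
 then have "small ka {r : ?I. EX a. is_ret a r}" by (rule small_subset) blast
 then have "small ka ?R" by (rule small_image)
 moreover have "Q b" if b: "b : ?R" for b
 proof -
  obtain r a where "b = rep r" "is_ret a r" using b by blast
  then show ?thesis using rep[of a r] by (simp add: is_ret_def)
 qed
 moreover have "EX b:?R. isomorphic C a b" if a: "Q a" for a
 proof -
  obtain x m g where x: "x : X" and m: "m : hom C x a" and g: "g : hom C a x" and mg: "m $ g = idn C a"
  using ret[OF a] by blast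
  let ?r = "(x, g $ m)"
  have r: "is_ret a ?r" unfolding is_ret_def using a m g mg by (intro conjI bexI[of _ m] bexI[of _ g]) simp_all
  have rI: "?r : ?I" using x m g by simp
  obtain m' g' where m': "m' : hom C x (rep ?r)" and g': "g' : hom C (rep ?r) x" and
  mg': "m' $ g' = idn C (rep ?r)" "g' $ m' = g $ m" using rep[OF r] by (auto simp: is_ret_def simp del: hom_iff)
  have rob: "rep ?r : ob C" using ret[of "rep ?r"] rep[OF r] by (simp add: is_ret_def)
  have h: "m' $ g : hom C a (rep ?r)" "m $ g' : hom C (rep ?r) a" using m g m' g' by simp_all
  have "(m $ g') $ m' $ g = m $ (g' $ m') $ g" using m g m' g' by simp
  also have "... = (m $ g) $ m $ g" unfolding mg'(2) using m g by simp
  also have "... = idn C a" unfolding mg using m by auto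
  finally have 1: "(m $ g') $ m' $ g = idn C a" .
  have "(m' $ g) $ m $ g' = m' $ (g $ m) $ g'" using m g m' g' by simp
  also have "... = (m' $ g') $ m' $ g'" unfolding mg'(2)[symmetric] using m' g' by simp
  also have "... = idn C (rep ?r)" unfolding mg'(1) using rob by simp
  finally have "is_iso C (m' $ g)" using is_isoI[OF h 1] by simp
  then have "isomorphic C a (rep ?r)" using h(1) unfolding isomorphic_def by blast
  then show ?thesis using rI r by blast
 qed
 ultimately show ?thesis by (intro exI[of _ ?R]) blast
qed

text \<open>Diagrams over subsets of \<open>B\<close> with values in \<open>A\<close> form a small
  set; one colimit is chosen for each of them.\<close>

lemma (in category) small_colimits:
 fixes ka :: "'u rel" and B :: "'b set"
 assumes ka: "inaccessible ka" and cocomplete: "graph_cocomplete ka C" and ls: "locally_small ka C"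
  and A: "small ka A" "A <= ob C" and B: "small ka B"
 shows "EX Ls. small ka Ls & Ls <= ob C & (ALL (S :: 's set) b R. |S| <=o |B| & b ` S <= A & gdiagram C S b R -->
  (EX l:Ls. EX e. gcolim C S b R l e))"
proof -
 let ?Arr = "UN a:A. UN a':A. hom C a a'"
 let ?X = "B \<times> B \<times> ?Arr"
 let ?Sh = "{(S, b, R). S <= B & b : PiE S (%_. A) & R <= ?X & gdiagram C S b R}"
 have "small ka (hom C a a')" if "a : A" "a' : A" for a a'
  using ls A(2) that unfolding locally_small_def by blast
 then have Arr: "small ka ?Arr" by (intro small_UN ka A(1))
 have X: "small ka ?X" by (intro small_Sigma ka B Arr)
 have Sh: "small ka ?Sh"
 proof (rule small_subset)
  show "small ka (SIGMA S:Pow B. PiE S (%_. A) \<times> Pow ?X)"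
  proof (intro small_Sigma small_Pow ka B Arr)
  fix S assume "S : Pow B"
  then have "small ka S" using small_subset[OF B] by blast
  then show "small ka (PiE S (%_. A))" by (intro small_PiE ka A(1))
  qed
 qed blast
 define f where "f sg = (SOME l. EX e. gcolim C (fst sg) (fst (snd sg)) (snd (snd sg)) l e)" for sg :: "'b set \<times> ('b => 'o) \<times> ('b \<times> 'b \<times> 'a) set"
 have f: "EX e. gcolim C S b R (f (S, b, R)) e" if sg: "(S, b, R) : ?Sh" for S b R
 proof -
  have S: "S <= B" "R <= ?X" "gdiagram C S b R" using sg by blast+
  obtain l e where "gcolim C S b R l e"
  using gcolim_exists[OF ka cocomplete small_subset[OF B S(1)] small_subset[OF X S(2)] S(3)] .
  then have "EX l e. gcolim C S b R l e" by (intro exI)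
  from someI_ex[OF this] show ?thesis unfolding f_def fst_conv snd_conv .
 qed
 show ?thesis
 proof (intro exI[of _ "f ` ?Sh"] conjI allI impI)
  show "small ka (f ` ?Sh)" by (rule small_image[OF Sh])
  show "f ` ?Sh <= ob C"
  proof (rule image_subsetI)
  fix sg assume sg: "sg : ?Sh"
  obtain S b R where e: "sg = (S, b, R)" by (cases sg)
  from f[OF sg[unfolded e]] obtain h where "gcolim C S b R (f sg) h" unfolding e by (rule exE)
  then show "f sg : ob C" by (rule gcolim_arr(1))
  qed
  fix S :: "'s set" and b R assume SbR: "|S| <=o |B| & b ` S <= A & gdiagram C S b R"
  then have SB: "|S| <=o |B|" and bA: "b ` S <= A" and d: "gdiagram C S b R" by simp_all
  obtain h where h: "inj_on h S" "h ` S <= B" using SB card_of_ordLeq by metis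
  let ?b = "b \<circ> inv_into S h" and ?R = "(%(z, z', w). (h z, h z', w)) ` R"
  have inv: "inv_into S h (h z) = z" if "z : S" for z using h(1) that by simp
  have RS: "z : S & z' : S & w : hom C (b z) (b z')" if "(z, z', w) : R" for z z' w
  using d that unfolding gdiagram_def by blast
  have "?R <= ?X" using RS h(2) bA by (fastforce simp del: hom_iff)
  moreover have "restrict ?b (h ` S) : PiE (h ` S) (%_. A)" using bA by (auto simp: inv)
  moreover have "gdiagram C (h ` S) (restrict ?b (h ` S)) ?R"
  using d RS unfolding gdiagram_def by (auto simp: inv simp del: hom_iff)
  ultimately have sh: "(h ` S, restrict ?b (h ` S), ?R) : ?Sh" using h(2) by blast
  from f[OF this] obtain k where "gcolim C (h ` S) (restrict ?b (h ` S)) ?R (f (h ` S, restrict ?b (h ` S), ?R)) k" ..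
  then have "gcolim C (h ` S) ?b ?R (f (h ` S, restrict ?b (h ` S), ?R)) k"
  by (rule gcolim_cong[THEN iffD1, rotated]) simp
  from gcolim_reindex[OF h(1) d this]
  have "EX e. gcolim C S b R (f (h ` S, restrict ?b (h ` S), ?R)) e" by (intro exI[of _ "k \<circ> h"])
  then show "EX l:f ` ?Sh. EX e. gcolim C S b R l e" by (rule bexI[OF _ imageI[OF sh]])
 qed
qed

section \<open>Representatives of the generated objects of K\<close>

locale generated_vcategory = generated_base V ka lam EV MV + enriched V K
 for V :: "('o, 'a, 'z) smc_scheme" (structure) and ka :: "'u rel" and lam :: "'l rel" and EV MV :: "'a set"
  and K :: "('k, 'o, 'a) vcat" +
 fixes E M :: "('k \<times> 'k \<times> 'a) set"
 assumes K_generated: "locally_generated ka lam V K E M"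
begin

abbreviation "C \<equiv> und V K"
abbreviation kcmp (infixr "$$" 65) where "g $$ f \<equiv> g $\<^bsub>C\<^esub> f"
abbreviation "is_generated \<equiv> v_generated_object ka lam V K M"

lemma K_colimits: "has_weighted_colimits ka V K" and K_cowellpowered: "Defs.cowellpowered ka C E"
 using K_generated by (simp_all add: locally_generated_def convenient_def)

sublocale K: factorization C E M
 by unfold_locales (use K_generated in \<open>simp add: locally_generated_def v_factorization_system_def\<close>)

lemma K_cocomplete: "graph_cocomplete ka C"
 by (rule graph_cocomplete_und[OF ka has_colimits K_colimits])

lemma K_locally_small: "Defs.locally_small ka C"
 by (rule locally_small_und) unfold_locales

lemmas K_E_epi = K.E_epi[OF ka K_cocomplete K_locally_small K_cowellpowered]

definition gens :: "'k set" where
 "gens = (SOME A. small ka A & (ALL a:A. is_generated a) &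
  (ALL x:vob K. EX I le D c. directed_diagram ka lam C M I le D &
  (ALL i:I. oo D i : A) & is_conical_colim V K (poset_cat I le) D x c))"

lemma gens:
 "small ka gens" "a : gens ==> is_generated a" "gens <= vob K"
 "x : vob K ==> EX I le D c. directed_diagram ka lam C M I le D &
  (ALL i:I. oo D i : gens) & is_conical_colim V K (poset_cat I le) D x c"
proof -
 have "EX A. small ka A & (ALL a:A. is_generated a) &
  (ALL x:vob K. EX I le D c. directed_diagram ka lam C M I le D &
  (ALL i:I. oo D i : A) & is_conical_colim V K (poset_cat I le) D x c)"
  using K_generated unfolding locally_generated_def by (elim conjE)
 note g = someI_ex[OF this, folded gens_def]
 show "small ka gens" using g by simp
 have gen: "is_generated b" if "b : gens" for b using g that by simp
 then show "a : gens ==> is_generated a" .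
 show "x : vob K ==> EX I le D c. directed_diagram ka lam C M I le D &
  (ALL i:I. oo D i : gens) & is_conical_colim V K (poset_cat I le) D x c" using g by simp
 show "gens <= vob K" using gen by (auto simp: v_generated_object_def)
qed

text \<open>\<open>G\<close> is the colimit of the directed \<open>M\<close>-diagram of images of colimits of subdiagrams of size at most \<open>|B|\<close>. Since
 \<open>V(I, K(G, -))\<close> commutes with it, \<open>G\<close> is a retract of one of these images.\<close>

lemma generated_retract:
 fixes B :: "'u set"
 assumes B: "gen.bounds_shapes B"
  and Ls: "!!(S :: 'u set) b R. |S| <=o |B| ==> b ` S <= gens ==> gdiagram C S b R ==> EX l:Ls. EX e. gcolim C S b R l e"
  and Qf: "!!l. l : Ls ==> quotient_reps C E l (Qf l)"
  and G: "is_generated G"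
 shows "EX x:(UN l:Ls. cd C ` Qf l). EX m:hom C x G. EX g:hom C G x. m $$ g = idn C G"
proof -
 have G_ob: "G : vob K" using G by (simp add: v_generated_object_def)
 have B_inf: "infinite B" and lamB: "|Field lam| <=o |B|" using B by (simp_all add: gen.bounds_shapes_def)
 obtain I le D c where dd: "directed_diagram ka lam C M I le D" and DA: "ALL i:I. oo D i : gens"
  and colim: "is_conical_colim V K (poset_cat I le) D G c" using gens(4)[OF G_ob] by (elim exE conjE)
 have DF: "cat_functor (poset_cat I le) C D" and I: "small ka I" using dd by (simp_all add: directed_diagram_def)
 note dp = cat_functor_posetD[OF DF]
 have gcG: "gcolim C I (oo D) (poset_edges I le D) G c"
  using conical_colim_is_colim[OF colim] unfolding is_colim_poset_iff_gcolim[OF DF] .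
 have ci: "c i : ar C" "dm C (c i) = oo D i" "cd C (c i) = G" if "i : I" for i
  using gcolim_arr(2-4)[OF gcG that] by simp_all
 let ?pe = "%S. poset_edges S le D"
 \<comment> \<open>Size at most |B|, not size below \<open>lam\<close>: unions of |B| members then
   stay in \<open>J\<close>, and the rank theorem applies to diagrams over it.\<close>
 define J where "J = {S. S <= I & |S| <=o |B|}"
 have JI: "S <= I" if "S : J" for S using that by (simp add: J_def)
 have pe_sub: "?pe S <= ?pe S'" if "S <= S'" for S S' using that unfolding poset_edges_def by blast
 have gd: "gdiagram C S (oo D) (?pe S)" if "S : J" for S
  unfolding gdiagram_def
 proof (intro conjI ballI)
  show "oo D z : ob C" if "z : S" for z using dp(1) JI[OF \<open>S : J\<close>] that by blast
  fix r assume "r : ?pe S"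
  then obtain i j where r: "r = (i, j, oa D (i, j))" "i : S" "j : S" "(i, j) : le" unfolding poset_edges_def by blast
  then show "case r of (z, z', w) => z : S & z' : S & w : hom C (oo D z) (oo D z')"
  using dp(2)[of i j] JI[OF that] by (auto simp del: hom_iff)
 qed
 have cocone: "gcocone C S (oo D) (?pe S) y f" if S: "S <= S'" and f: "gcocone C S' (oo D) (?pe S') y f" for S S' y f
  using f S pe_sub[OF S] unfolding gcocone_def by (intro conjI) blast+
 \<comment> \<open>\<open>l\<close> is the colimit of the subdiagram on \<open>S\<close>, and
   \<open>q\<close>, \<open>m\<close> factor its comparison with \<open>G\<close>. Taking
   \<open>q\<close> among the chosen representatives keeps all images inside one fixed small
   set.\<close>
 define st where "st S l e q m \<longleftrightarrow> l : Ls & gcolim C S (oo D) (?pe S) l e & q : Qf l & m : M & m : hom C (cd C q) G &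
  (ALL i:S. m $$ q $$ e i = c i)" for S l e q m
 have "EX t. st S (fst t) (fst (snd t)) (fst (snd (snd t))) (snd (snd (snd t)))" if S: "S : J" for S
 proof -
  have SB: "|S| <=o |B|" "oo D ` S <= gens" using S DA by (auto simp: J_def)
  obtain l e where l: "l : Ls" and le: "gcolim C S (oo D) (?pe S) l e" using Ls[OF SB gd[OF S]] by (elim bexE exE)
  obtain k where k: "k : hom C l G" and ke: "ALL i:S. k $$ e i = c i"
  using gcolim_ex_induced[OF le cocone[OF JI[OF S] gcolim_cocone[OF gcG]]] by (elim bexE)
  have kar: "k : ar C" using k by simp
  obtain e1 m1 where em: "e1 : E" "m1 : M" "dm C m1 = cd C e1" "k = m1 $$ e1" using K.factor[OF kar] .
  have ar: "e1 : ar C" "m1 : ar C" using em by auto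
  have dmc: "dm C e1 = l" "cd C m1 = G" using k ar em(3) by (auto simp: em(4))
  obtain q i0 where q: "q : Qf l" and i0: "i0 : hom C (cd C q) (cd C e1)" "is_iso C i0" "i0 $$ q = e1"
  using Qf[OF l] em(1) dmc(1) unfolding quotient_reps_def by blast
  have qE: "q : E" "dm C q = l" using Qf[OF l] q unfolding quotient_reps_def by auto
  have qar: "q : ar C" using qE by auto
  have "(m1 $$ i0) $$ q $$ e i = c i" if i: "i : S" for i
  proof -
  note ei = gcolim_arr(2-4)[OF le i]
  have "(m1 $$ i0) $$ q $$ e i = m1 $$ (i0 $$ q) $$ e i" using ar i0(1) em(3) qar qE(2) ei by simp
  also have "... = k $$ e i" unfolding i0(3) em(4) using ar em(3) dmc ei by simp
  finally show ?thesis using ke i by simp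
  qed
  moreover have "m1 $$ i0 : M" using K.M_cmp[OF K.iso_M[OF i0(2)] em(2)] i0(1) em(3) by simp
  moreover have "m1 $$ i0 : hom C (cd C q) G" using ar i0(1) em(3) dmc by simp
  ultimately have "st S l e q (m1 $$ i0)" unfolding st_def using l le q by blast
  then show ?thesis by (intro exI[of _ "(l, e, q, m1 $$ i0)"]) simp
 qed
 then have "ALL S:J. EX t. st S (fst t) (fst (snd t)) (fst (snd (snd t))) (snd (snd (snd t)))" by (rule ballI)
 from bchoice[OF this] obtain tp where tp: "ALL S:J. st S (fst (tp S)) (fst (snd (tp S))) (fst (snd (snd (tp S)))) (snd (snd (snd (tp S))))" ..
 define l where "l S = fst (tp S)" for S
 define e where "e S = fst (snd (tp S))" for S
 define q where "q S = fst (snd (snd (tp S)))" for S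
 define m where "m S = snd (snd (snd (tp S)))" for S
 have st: "st S (l S) (e S) (q S) (m S)" if "S : J" for S using bspec[OF tp that] by (simp only: l_def e_def q_def m_def)
 have lS: "l S : Ls" "gcolim C S (oo D) (?pe S) (l S) (e S)" "q S : Qf (l S)" "m S : M" "m S : ar C" "dm C (m S) = cd C (q S)" "cd C (m S) = G"
  and mqe: "i : S ==> m S $$ q S $$ e S i = c i" if "S : J" for S i
  using st[OF that] unfolding st_def by simp_all
 have qS: "q S : E" "q S : ar C" "dm C (q S) = l S" if "S : J" for S
  using Qf[OF lS(1)[OF that]] lS(3)[OF that] unfolding quotient_reps_def by auto
 note eS = gcolim_arr(2-4)[OF lS(2)]
 have q_e_epi: "u = v" if S: "S : J" and uv: "u : hom C (cd C (q S)) y" "v : hom C (cd C (q S)) y"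
  and eq: "!!i. i : S ==> u $$ q S $$ e S i = v $$ q S $$ e S i" for S u v y
 proof (rule K_E_epi[OF qS(1)[OF S] uv])
  show "u $$ q S = v $$ q S"
  proof (rule und.gcolim_ext[OF lS(2)[OF S] gd[OF S]])
  show "(u $$ q S) $$ e S i = (v $$ q S) $$ e S i" if "i : S" for i
  using eq[OF that] uv qS[OF S] eS[OF S that] by simp
  qed (use uv qS[OF S] in simp_all)
 qed
 have "EX t. t : hom C (cd C (q S)) (cd C (q S')) & t : M & (ALL i:S. t $$ q S $$ e S i = q S' $$ e S' i) & m S' $$ t = m S"
  if S: "S : J" "S' : J" "S <= S'" for S S'
 proof -
  note s = lS[OF S(1)] qS[OF S(1)] and s' = lS[OF S(2)] qS[OF S(2)]
  obtain w where w: "w : hom C (l S) (l S')" and we: "ALL i:S. w $$ e S i = e S' i"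
  using gcolim_ex_induced[OF s(2) cocone[OF S(3) gcolim_cocone[OF s'(2)]]] by (elim bexE)
  have "m S' $$ q S' $$ w = m S $$ q S"
  proof (rule und.gcolim_ext[OF s(2) gd[OF S(1)]])
  show "(m S' $$ q S' $$ w) $$ e S i = (m S $$ q S) $$ e S i" if i: "i : S" for i
  proof -
  have i': "i : S'" using i S(3) by blast
  have "(m S' $$ q S' $$ w) $$ e S i = m S' $$ q S' $$ w $$ e S i"
  using s'(5-7,9,10) w eS[OF S(1) i] by simp
  also have "... = c i" using bspec[OF we i] mqe[OF S(2) i'] by simp
  finally show ?thesis using mqe[OF S(1) i] s(5-7,9,10) eS[OF S(1) i] by simp
  qed
  qed (use s(5-7,9,10) s'(5-7,9,10) w in simp_all)
  then have "EX! d. d : hom C (cd C (q S)) (dm C (m S')) & d $$ q S = q S' $$ w & m S' $$ d = m S"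
  by (intro K.fill[OF s(8) s'(4)]) (use s(5-7,9,10) s'(5-7,9,10) w in simp_all)
  then obtain d where d: "d : hom C (cd C (q S)) (dm C (m S'))" "d $$ q S = q S' $$ w" "m S' $$ d = m S" by (elim ex1E conjE)
  have "d : M" by (rule K.M_left_cancel[OF _ s'(4)]) (use d s(4) in simp_all)
  moreover have "d $$ q S $$ e S i = q S' $$ e S' i" if i: "i : S" for i
  proof -
  have "d $$ q S $$ e S i = (q S' $$ w) $$ e S i"
  by (rule und.extend[OF d(2)]) (use d(1) s(9,10) eS[OF S(1) i] in simp_all)
  then show ?thesis using w s'(9,10) eS[OF S(1) i] bspec[OF we i] by simp
  qed
  ultimately show ?thesis using d(1,3) s'(6) by (intro exI[of _ d]) simp
 qed
 then have "EX t. ALL S S'. S : J & S' : J & S <= S' --> t S S' : hom C (cd C (q S)) (cd C (q S')) & t S S' : M &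
  (ALL i:S. t S S' $$ q S $$ e S i = q S' $$ e S' i) & m S' $$ t S S' = m S" by (intro choice allI) blast
 then obtain t where t_all: "ALL S S'. S : J & S' : J & S <= S' --> t S S' : hom C (cd C (q S)) (cd C (q S')) & t S S' : M &
  (ALL i:S. t S S' $$ q S $$ e S i = q S' $$ e S' i) & m S' $$ t S S' = m S" by (elim exE)
 have t: "t S S' : ar C" "dm C (t S S') = cd C (q S)" "cd C (t S S') = cd C (q S')" "t S S' : M"
  and tqe: "i : S ==> t S S' $$ q S $$ e S i = q S' $$ e S' i" and mt: "m S' $$ t S S' = m S"
  if "S : J" "S' : J" "S <= S'" for S S' i
  using t_all[rule_format, of S S'] that by simp_all
 define leJ where "leJ = {(S, S'). S : J & S' : J & S <= S'}"
 define X where "X = \<lparr>oo = (%S. cd C (q S)), oa = (%(S, S'). t S S')\<rparr>"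
 have XF: "cat_functor (poset_cat J leJ) C X"
  unfolding cat_functor_def
 proof (intro conjI ballI impI)
  fix S assume "S : ob (poset_cat J leJ)"
  then have S: "S : J" by simp
  show "oo X S : ob C" unfolding X_def ofun.simps by (rule und.cd_ob[OF qS(2)[OF S]])
  have xob: "cd C (q S) : ob C" by (rule und.cd_ob[OF qS(2)[OF S]])
  have "t S S = idn C (cd C (q S))"
  by (rule q_e_epi[OF S]) (use xob t[OF S S] tqe[OF S S] qS[OF S] eS[OF S] in \<open>simp_all del: und_simps\<close>)
  then show "oa X (idn (poset_cat J leJ) S) = idn C (oo X S)" by (simp add: X_def)
 next
  fix f assume "f : ar (poset_cat J leJ)"
  then obtain S S' where f: "f = (S, S')" "S : J" "S' : J" "S <= S'" by (cases f) (auto simp: leJ_def)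
  then show "oa X f : hom C (oo X (dm (poset_cat J leJ) f)) (oo X (cd (poset_cat J leJ) f))"
  using t[OF f(2-4)] by (simp add: X_def)
 next
  fix f g assume fg: "f : ar (poset_cat J leJ)" "g : ar (poset_cat J leJ)" "dm (poset_cat J leJ) g = cd (poset_cat J leJ) f"
  from fg(1) obtain S S' where f: "f = (S, S')" "S : J" "S' : J" "S <= S'" by (cases f) (auto simp: leJ_def)
  from fg(2,3) obtain S'' where g: "g = (S', S'')" "S'' : J" "S' <= S''" using f(1) by (cases g) (auto simp: leJ_def)
  have SS: "S <= S''" using f g by blast
  note t1 = t[OF f(2-4)] and t2 = t[OF f(3) g(2,3)] and t3 = t[OF f(2) g(2) SS]
  have "t S S'' = t S' S'' $$ t S S'"
  proof (rule q_e_epi[OF f(2)])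
  fix i assume i: "i : S"
  then have i': "i : S'" using f by blast
  show "t S S'' $$ q S $$ e S i = (t S' S'' $$ t S S') $$ q S $$ e S i"
  using t1 t2 qS[OF f(2)] eS[OF f(2) i] tqe[OF f(2) g(2) SS i] tqe[OF f(2-4) i] tqe[OF f(3) g(2,3) i'] by simp
  qed (use t1 t2 t3 in simp_all)
  then show "oa X (g $\<^bsub>poset_cat J leJ\<^esub> f) = oa X g $$ oa X f" by (simp add: X_def f g)
 qed
 have UJ: "\<Union>F : J" if F: "F <= J" "|F| <=o |B|" for F
 proof -
  have "|UN S:F. S| <=o |B|"
  by (rule card_of_UNION_ordLeq_infinite[OF B_inf F(2)]) (use F(1) in \<open>auto simp: J_def\<close>)
  then show ?thesis using F(1) by (auto simp: J_def)
 qed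
 have directed: "directed_poset lam J leJ"
  unfolding directed_poset_def
 proof (intro conjI allI impI)
  show "partial_order_on J leJ"
  unfolding partial_order_on_def preorder_on_def leJ_def by (auto simp: refl_on_def intro!: transI antisymI)
  fix F assume F: "F <= J" "|F| <o lam"
  have "Card_order lam" using lam by (simp add: regular_cardinal_def)
  then have "|F| <=o |Field lam|"
  using F(2) card_of_Field_ordIso ordLess_imp_ordLeq ordIso_symmetric ordLeq_ordIso_trans by blast
  then have "\<Union>F : J" using UJ[OF F(1)] lamB ordLeq_transitive by blast
  then show "EX u:J. ALL s:F. (s, u) : leJ" using F(1) by (intro bexI[of _ "\<Union>F"]) (auto simp: leJ_def)
 qed
 have J: "small ka J" by (rule small_subset[OF small_Pow[OF ka I]]) (auto simp: J_def)
 obtain fi :: "'u set => 'u" where fi: "inj_on fi J" using small_embed[OF ka J] .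
 let ?I = "fi ` J" and ?le = "image_rel fi J leJ" and ?D = "image_fun fi J X"
 note im = image_fun_simps[OF fi, where D = X]
 have dd': "directed_diagram ka lam C M ?I ?le ?D"
  unfolding directed_diagram_def
 proof (intro conjI ballI)
  show "small ka ?I" by (rule small_image[OF J])
  show "directed_poset lam ?I ?le" by (rule directed_poset_image[OF fi directed])
  show "cat_functor (poset_cat ?I ?le) C ?D" by (rule cat_functor_image[OF fi XF])
  fix k assume "k : ar (poset_cat ?I ?le)"
  then obtain S S' where k: "k = (fi S, fi S')" "S : J" "S' : J" "(S, S') : leJ"
  by (cases k) (auto simp: image_rel_iff[OF fi])
  then show "oa ?D k : M" using im(2)[OF k(2,3)] t(4)[OF k(2,3)] by (simp add: X_def leJ_def)
 qed
 have po: "trans ?le" "!!i. i : ?I ==> (i, i) : ?le" and DF': "cat_functor (poset_cat ?I ?le) C ?D"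
  using dd' by (auto simp: directed_diagram_def directed_poset_def partial_order_on_def preorder_on_def refl_on_def)
 obtain y xs' where y: "is_conical_colim V K (poset_cat ?I ?le) ?D y xs'"
  using conical_colim_exists[OF ka has_colimits K_colimits small_image[OF J] po DF'] .
 define xs where "xs S = xs' (fi S)" for S
 have "gcolim C ?I (oo ?D) (poset_edges ?I ?le ?D) y xs'"
  using conical_colim_is_colim[OF y] unfolding is_colim_poset_iff_gcolim[OF DF'] .
 then have "gcolim C ?I (oo X \<circ> inv_into J fi) ((%(z, z', w). (fi z, fi z', w)) ` poset_edges J leJ X) y xs'"
  unfolding poset_edges_image[OF fi] by (simp add: image_fun_def)
 from gcolim_reindex[OF fi gdiagram_poset[OF XF] this]
 have colim_y: "gcolim C J (oo X) (poset_edges J leJ X) y xs" by (simp add: xs_def[abs_def] comp_def)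
 have xs: "xs S : ar C" "dm C (xs S) = cd C (q S)" "cd C (xs S) = y" if "S : J" for S
  using gcolim_arr(2-4)[OF colim_y that] by (simp_all add: X_def)
 have y_ob: "y : ob C" by (rule gcolim_arr(1)[OF colim_y])
 have xs_t: "xs S' $$ t S S' = xs S" if "S : J" "S' : J" "S <= S'" for S S'
  by (rule gcolim_arr(5)[OF colim_y]) (use that in \<open>auto simp: poset_edges_def leJ_def X_def\<close>)
 have "gcocone C J (oo X) (poset_edges J leJ X) G m"
  unfolding gcocone_def
 proof (intro conjI ballI)
  show "G : ob C" using G_ob by simp
  show "m S : hom C (oo X S) G" if "S : J" for S using lS(5-7)[OF that] by (simp add: X_def)
  fix r assume "r : poset_edges J leJ X"
  then obtain S S' where r: "r = (S, S', t S S')" "S : J" "S' : J" "S <= S'" by (auto simp: poset_edges_def leJ_def X_def)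
  then show "case r of (S, S', w) => m S' $$ w = m S" using mt[OF r(2-4)] by simp
 qed
 from gcolim_ex_induced[OF colim_y this]
 obtain r where r: "r : hom C y G" and rx: "ALL S:J. r $$ xs S = m S" by (rule bexE)
 have finJ: "S : J" if "finite S" "S <= I" for S using card_of_finite_infinite[OF that(1) B_inf] that(2) by (simp add: J_def)
 \<comment> \<open>Each leg is sent through the image of its one-element subdiagram; as in the rank
   argument, these arrows induce a section of \<open>r\<close>.\<close>
 define p where "p i = xs {i} $$ q {i} $$ e {i} i" for i
 have sing: "{i} : J" if "i : I" for i using that by (intro finJ) simp_all
 have p: "p i : ar C" "dm C (p i) = oo D i" "cd C (p i) = y" if i: "i : I" for i
  using xs[OF sing[OF i]] qS[OF sing[OF i]] eS[OF sing[OF i], of i] by (simp_all add: p_def)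
 have p_eq: "xs S $$ q S $$ e S i = p i" if S: "S : J" and i: "i : S" for S i
 proof -
  have iI: "i : I" using JI[OF S] i by (rule subsetD)
  have sub: "{i} <= S" using i by simp
  note s = sing[OF iI] and t1 = t[OF sing[OF iI] S sub] and e1 = eS[OF sing[OF iI], of i]
  have "p i = (xs S $$ t {i} S) $$ q {i} $$ e {i} i" unfolding p_def xs_t[OF s S sub] ..
  also have "... = xs S $$ t {i} S $$ q {i} $$ e {i} i" using xs[OF S] t1 qS[OF s] e1 by simp
  finally show ?thesis using tqe[OF s S sub, of i] by simp
 qed
 have "gcocone C I (oo D) (poset_edges I le D) y p"
  unfolding gcocone_def
 proof (intro conjI ballI)
  show "p i : hom C (oo D i) y" if "i : I" for i using p[OF that] by simp
  fix s assume "s : poset_edges I le D"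
  then obtain i j where s: "s = (i, j, oa D (i, j))" "i : I" "j : I" "(i, j) : le" by (auto simp: poset_edges_def)
  let ?S = "{i, j}"
  have S: "?S : J" using s by (intro finJ) simp_all
  have w: "oa D (i, j) : ar C" "dm C (oa D (i, j)) = oo D i" "cd C (oa D (i, j)) = oo D j" using dp(2)[OF s(2-4)] by simp_all
  have "(i, j, oa D (i, j)) : ?pe ?S" using s(4) by (auto simp: poset_edges_def)
  then have ew: "e ?S j $$ oa D (i, j) = e ?S i" by (rule gcolim_arr(5)[OF lS(2)[OF S]])
  have "p j $$ oa D (i, j) = (xs ?S $$ q ?S $$ e ?S j) $$ oa D (i, j)" using p_eq[OF S, of j] by simp
  also have "... = xs ?S $$ q ?S $$ e ?S j $$ oa D (i, j)" using xs[OF S] qS[OF S] eS[OF S, of j] w by simp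
  also have "... = p i" unfolding ew using p_eq[OF S, of i] by simp
  finally show "case s of (i, j, w) => p j $$ w = p i" by (simp add: s(1))
 qed (rule y_ob)
 from gcolim_ex_induced[OF gcG this]
 obtain s where s: "s : hom C G y" and sc: "ALL i:I. s $$ c i = p i" by (rule bexE)
 have rs: "r $$ s = idn C G"
 proof (rule und.gcolim_ext[OF gcG gdiagram_poset[OF DF]])
  fix i assume i: "i : I"
  note si = sing[OF i]
  have "(r $$ s) $$ c i = r $$ s $$ c i" using r s ci[OF i] by simp
  also have "... = (r $$ xs {i}) $$ q {i} $$ e {i} i"
  unfolding bspec[OF sc i] p_def using r xs[OF si] qS[OF si] eS[OF si, of i] by simp
  also have "... = c i" unfolding bspec[OF rx si] using mqe[OF si, of i] by simp
  finally show "(r $$ s) $$ c i = idn C G $$ c i" using und.idl[of "c i" G] ci[OF i] by (simp del: und_simps)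
 qed (use r s G_ob in simp_all)
 let ?F = "vrep V K G"
 let ?D2 = "\<lparr>oo = (%i. fo ?F (oo ?D i)), oa = (%f. und_ar V ?F (oa ?D f))\<rparr>"
 have pres: "is_conical_colim V (self V) (poset_cat ?I ?le) ?D2 (fo ?F y) (%i. und_ar V ?F (xs' i))"
  using G dd' y unfolding v_generated_object_def preserves_directed_colimits_def preserves_conical_colim_def by blast
 have D2F: "cat_functor (poset_cat ?I ?le) W ?D2" using pres by (simp add: is_conical_colim_def)
 obtain s1 where s1: "s = (G, y, s1)" "s1 : hom V (unt V) (vhom K G y)" using s by (cases s) auto
 have s1ar: "s1 : ar V" using s1(2) by simp
 have f: "name_ar s1 : hom W (unt V) (fo ?F y)" using name_ar_hom[OF s1(2)] by simp
 have "EX j:?I. EX g:hom W (unt V) (oo ?D2 j). und_ar V ?F (xs' j) $\<^bsub>W\<^esub> g = name_ar s1"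
 \<comment> \<open>K(G, -) preserves this colimit but need not send \<open>M\<close> into
   \<open>Ms\<close>, so \<open>unit_factor\<close> is not applicable. The rank theorem asks only
   for upper bounds of sets of size |B|, which unions provide.\<close>
 proof (rule gen.rank[OF B small_image[OF J] po _ D2F self.conical_colim_is_colim[OF pres] f])
  fix F assume F: "F <= ?I" "|F| <=o |B|"
  let ?H = "{S : J. fi S : F}"
  have "inj_on fi ?H" using fi by (rule inj_on_subset) blast
  moreover have "fi ` ?H <= F" by blast
  ultimately have "|?H| <=o |F|" using card_of_ordLeq by blast
  then have "|?H| <=o |B|" using F(2) ordLeq_transitive by blast
  then have HJ: "\<Union>?H : J" by (intro UJ) blast
  have "(k, fi (\<Union>?H)) : ?le" if kF: "k : F" for k
  proof -
  obtain S where S: "k = fi S" "S : J" using kF F(1) by blast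
  have "(S, \<Union>?H) : leJ" unfolding leJ_def using S HJ kF by blast
  then show ?thesis unfolding S(1) using image_rel_iff[OF fi S(2) HJ] by blast
  qed
  then show "EX u:?I. ALL s:F. (s, u) : ?le" using HJ by blast
 qed
 then obtain S g where S: "S : J" and g: "g : hom W (unt V) (vhom K G (oo ?D (fi S)))" and eq: "und_ar V ?F (xs S) $\<^bsub>W\<^esub> g = name_ar s1"
  by (auto simp: xs_def simp del: hom_iff)
 have oD: "oo ?D (fi S) = cd C (q S)" using im(1)[OF S] by (simp add: X_def)
 have g0: "unname_ar g : hom V (unt V) (vhom K G (cd C (q S)))" using unname_ar_hom[OF g] by (simp only: oD)
 obtain x1 where x1: "xs S = (cd C (q S), y, x1)" using xs[OF S] by (cases "xs S") auto
 have xob: "cd C (q S) : vob K" using und.cd_ob[OF qS(2)[OF S]] by simp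
 have vp: "vpost V K G (xs S) : hom V (vhom K G (cd C (q S))) (vhom K G y)"
  using xs(1)[OF S] G_ob unfolding x1 by simp
 have en: "enriched V K" by unfold_locales
 have ux: "und_ar V ?F (xs S) = name_ar (vpost V K G (xs S))" by (rule und_ar_vrep[OF en G_ob xs(1)[OF S]])
 have gh: "g : hom W (unt V) (vhom K G (cd C (q S)))" using g by (simp only: oD)
 have "unname_ar (name_ar (vpost V K G (xs S)) $\<^bsub>W\<^esub> g) = unname_ar (name_ar (vpost V K G (xs S))) $ unname_ar g"
  by (rule unname_ar_cmp[OF gh name_ar_hom[OF vp]])
 then have sv: "vpost V K G (xs S) $ unname_ar g = s1"
  using eq vp s1ar unfolding ux by (simp add: unname_name_ar)
 let ?g = "(G, cd C (q S), unname_ar g)"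
 have gC: "?g : hom C G (cd C (q S))" using g0 G_ob xob by simp
 have "xs S $$ ?g = s" using sv xs(1)[OF S] gC unfolding x1 s1(1) by simp
 then have "m S $$ ?g = idn C G"
  using rs r xs[OF S] gC bspec[OF rx S] und.assoc[of ?g "xs S" r] by simp
 moreover have "m S : hom C (cd C (q S)) G" using lS(5-7)[OF S] by simp
 moreover have "cd C (q S) : (UN l:Ls. cd C ` Qf l)" using lS(1,3)[OF S] by blast
 ultimately show ?thesis using gC by blast
qed

theorem generated_representatives:
 "EX R. small ka R & (ALL b:R. is_generated b) & (ALL a. is_generated a --> (EX b:R. isomorphic C a b))"
proof -
 obtain B where B: "small ka B" "gen.bounds_shapes B" using gen.bounding_set_exists by blast
 have g: "gens <= ob C" using gens(3) by simp
 from und.small_colimits[OF ka K_cocomplete K_locally_small gens(1) g B(1)]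
 obtain Ls where Ls: "small ka Ls" "Ls <= ob C" and Lc: "ALL (S :: 'u set) b R. |S| <=o |B| & b ` S <= gens & gdiagram C S b R -->
  (EX l:Ls. EX e. gcolim C S b R l e)" by (elim exE conjE)
 have "EX Q. small ka Q & quotient_reps C E l Q" if "l : Ls" for l
  unfolding quotient_reps_def by (rule bspec[OF K_cowellpowered[unfolded cowellpowered_def] subsetD[OF Ls(2) that]])
 then have "ALL l:Ls. EX Q. small ka Q & quotient_reps C E l Q" by (rule ballI)
 from bchoice[OF this] obtain Qf where Qf: "ALL l:Ls. small ka (Qf l) & quotient_reps C E l (Qf l)" ..
 have Xob: "(UN l:Ls. cd C ` Qf l) <= ob C"
 proof (intro UN_least image_subsetI)
  fix l q assume "l : Ls" "q : Qf l"
  then have "q : E" using Qf unfolding quotient_reps_def by blast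
  then show "cd C q : ob C" by (intro und.cd_ob K.E_ar)
 qed
 show ?thesis
 proof (rule und.retract_representatives[OF ka K_locally_small _ Xob])
  show "small ka (UN l:Ls. cd C ` Qf l)" using Qf by (intro small_UN small_image ka Ls(1)) blast
  fix a assume a: "is_generated a"
  have "EX x:(UN l:Ls. cd C ` Qf l). EX m:hom C x a. EX g:hom C a x. m $$ g = idn C a"
  proof (rule generated_retract[OF B(2) _ _ a])
  show "EX l:Ls. EX e. gcolim C S b R l e" if "|S| <=o |B|" "b ` S <= gens" "gdiagram C S b R" for S :: "'u set" and b R
  using Lc that by blast
  show "quotient_reps C E l (Qf l)" if "l : Ls" for l using Qf that by blast
  qed
  then show "a : ob C & (EX x:(UN l:Ls. cd C ` Qf l). EX m:hom C x a. EX g:hom C a x. m $$ g = idn C a)"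
  using a by (simp add: v_generated_object_def)
 qed
qed

end

lemma jointly_epicD:
 assumes F: "jointly_epic C x F" and uv: "u : hom C x y" "v : hom C x y" and eq: "!!f. f : F ==> u $\<^bsub>C\<^esub> f = v $\<^bsub>C\<^esub> f"
 shows "u = v"
proof -
 have "ALL u:ar C. ALL v:ar C. dm C u = x & dm C v = x & cd C u = cd C v & (ALL f:F. u $\<^bsub>C\<^esub> f = v $\<^bsub>C\<^esub> f) --> u = v"
  using F unfolding jointly_epic_def by (elim conjE)
 from bspec[OF bspec[OF this, of u], of v] uv eq show ?thesis by simp
qed

lemma fo_vrep: "fo (vrep V K k) = vhom K k"
 by (simp add: vrep_def)

section \<open>The theory of a monad\<close>

text \<open>\<open>A\<close> is kept abstract: a small set of generated objects that presents every
  object. \<open>T_M\<close> and \<open>T_pres\<close> together let \<open>T\<close> be applied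
  repeatedly to such presentations.\<close>

locale generated_monad = generated_vcategory V ka lam EV MV K E M + enriched_monad V K T
 for V :: "('o, 'a, 'z) smc_scheme" (structure) and ka :: "'u rel" and lam :: "'l rel" and EV MV :: "'a set"
  and K :: "('k, 'o, 'a) vcat" and E M :: "('k \<times> 'k \<times> 'a) set" and T :: "('k, 'a) vmnd" +
 fixes A :: "'k set"
 assumes T_M: "m : M ==> und_ar V (mfun T) m : M"
  and T_pres: "preserves_directed_colimits ka lam V K M K (mfun T)"
  and A_small: "small ka A" and A_gen: "a : A ==> v_generated_object ka lam V K M a"
  and A_dense: "y : vob K ==> EX I le D c. directed_diagram ka lam (und V K) M I le D &
  (ALL i:I. oo D i : A) & is_conical_colim V K (poset_cat I le) D y c"
begin

lemma A_ob [simp]: "a : A ==> a : vob K"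
 using A_gen by (simp add: v_generated_object_def)

sublocale cb: complete_base V ka generators
 by (rule complete_base)

lemma equalizers: "EM_equalizers"
 unfolding EM_equalizers_def
proof (intro allI impI)
 fix x y assume xy: "is_EM x" "is_EM y"
 obtain x0 h y0 k where e: "x = (x0, h)" "y = (y0, k)" by (cases x, cases y)
 note dx = EM_algebraD[OF xy(1)[unfolded e]] and dy = EM_algebraD[OF xy(2)[unfolded e]]
 show "EX e. is_equalizer V (Kpo (mob T (fst x)) (alg_ar T y) $ Tm (fst x) (fst y)) (Kpe (alg_ar T x) (fst y)) e"
  by (rule cb.equalizer_exists) (use dx(1-4) dy(1-4) in \<open>simp_all add: e\<close>)
qed

lemma enriched_K: "enriched V K" by unfold_locales

sublocale coll: enriched V collage by (rule enriched_collage[OF equalizers])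
sublocale op: enriched V "vop V collage" by (rule coll.enriched_vop)

definition Th :: "('k, 'o, 'a) vcat" where
 "Th = \<lparr>vob = A, vhom = (%a b. vhom (vop V collage) (Inl a) (Inl b)), vid = (%a. vid (vop V collage) (Inl a)),
  vcmp = (%a b c. vcmp (vop V collage) (Inl a) (Inl b) (Inl c))\<rparr>"

lemma collage_alg_simps [simp]: "collage_alg (Inl a) = (mob T a, mmult T a)" "collage_alg (Inr X) = X"
 by (simp_all add: collage_alg_def)

lemma Th_simps [simp]:
 "vob Th = A" "a : A ==> b : A ==> vhom Th a b = Kh b (mob T a)" "a : A ==> vid Th a = munit T a"
 by (simp_all add: Th_def InlI collage_vid[OF equalizers])

lemma Th_vcmp:
 assumes "a : A" "b : A" "c : A"
 shows "vcmp Th a b c = vcmp K c (mob T b) (mob T a) $ (ext b (mob T a, mmult T a) ** idn V (Kh c (mob T b)))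
  $ swp V (Kh c (mob T b)) (Kh b (mob T a))"
 using assms collage_vcmp[OF equalizers, of b c "Inl a"] free_algebra[of a]
 by (simp add: Th_def InlI)

lemma vcategory_Th: "vcategory V Th"
proof -
 have [simp]: "Inl a : vob (vop V collage)" if "a : A" for a using that by (simp add: InlI)
 show ?thesis
  unfolding Th_def
  by (rule vcategory.intro)
  (simp_all only: vcat.simps op.vhom_ob op.vid_hom op.vcmp_hom op.vcmp_vid_left op.vcmp_vid_right op.vcmp_assoc \<open>!!a. a : A ==> Inl a : vob (vop V collage)\<close>)
qed

lemma enriched_Th: "enriched V Th" by (rule enrichedI[OF vcategory_Th])

text \<open>The representable of the opposite collage at \<open>Inr X\<close>, restricted to the
  free part, so that functoriality is inherited. The value \<open>undefined\<close> elsewhere is the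
  normal form demanded by \<open>vf_restrict\<close>.\<close>

definition hat :: "'k \<times> 'a => ('k, 'o, 'a) vfun" where
 "hat X = \<lparr>fo = restrict (%a. Kh a (fst X)) A,
  fm = (%a b. if a : A & b : A then fm (vrep V (vop V collage) (Inr X)) (Inl a) (Inl b) else undefined)\<rparr>"

lemma hat_fo [simp]: "a : A ==> fo (hat X) a = Kh a (fst X)" by (simp add: hat_def)

lemma vfunctor_hat:
 assumes X: "is_EM X"
 shows "vfunctor V Th (self V) (hat X)"
proof -
 have o: "Inr X : vob (vop V collage)" using X by (simp add: InrI)
 interpret R: vfunctor V "vop V collage" "self V" "vrep V (vop V collage) (Inr X)" by (rule op.vfunctor_vrep[OF o])
 have L: "Inl a : vob (vop V collage)" if "a : A" for a using that by (simp add: InlI)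
 have fo: "fo (hat X) a = fo (vrep V (vop V collage) (Inr X)) (Inl a)" if "a : A" for a
  using that X by (simp add: InlI InrI)
 have fm: "fm (hat X) a b = fm (vrep V (vop V collage) (Inr X)) (Inl a) (Inl b)" if "a : A" "b : A" for a b
  using that by (simp add: hat_def)
 show ?thesis
 proof
  fix a assume "a : vob Th"
  then have a: "a : A" by simp
  show "fo (hat X) a : vob (self V)" unfolding fo[OF a] by (rule R.fo_vob[OF L[OF a]])
  show "fm (hat X) a a $ vid Th a = vid (self V) (fo (hat X) a)"
  unfolding fo[OF a] fm[OF a a] Th_def vcat.simps by (rule R.fm_vid[OF L[OF a]])
  fix b assume "b : vob Th"
  then have b: "b : A" by simp
  show "fm (hat X) a b : hom V (vhom Th a b) (vhom (self V) (fo (hat X) a) (fo (hat X) b))"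
  unfolding fo[OF a] fo[OF b] fm[OF a b] Th_def vcat.simps by (rule R.fm_hom[OF L[OF a] L[OF b]])
  fix c assume "c : vob Th"
  then have c: "c : A" by simp
  show "fm (hat X) a c $ vcmp Th a b c = vcmp (self V) (fo (hat X) a) (fo (hat X) b) (fo (hat X) c) $ (fm (hat X) b c ** fm (hat X) a b)"
  unfolding fo[OF a] fo[OF b] fo[OF c] fm[OF a b] fm[OF a c] fm[OF b c] Th_def vcat.simps by (rule R.fm_vcmp[OF L[OF a] L[OF b] L[OF c]])
 qed
qed

text \<open>Composition in the collage, read in K: an operation from \<open>b\<close> to T a and an
  arrow from \<open>a\<close> to the algebra yield the extension of the latter composed with the
  former.\<close>

lemma hat_ev:
 assumes X: "is_EM X" and ab: "a : A" "b : A"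
 shows "ev V (Kh a (fst X)) (Kh b (fst X)) $ (fm (hat X) a b ** idn V (Kh a (fst X)))
  = vcmp K b (mob T a) (fst X) $ (ext a X ** idn V (Kh b (mob T a))) $ swp V (Kh b (mob T a)) (Kh a (fst X))"
proof -
 have o: "Inr X : vob (vop V collage)" "Inl a : vob (vop V collage)" "Inl b : vob (vop V collage)"
  using X ab by (simp_all add: InlI InrI)
 have x0: "fst X : vob K" using X by (simp add: is_EM_algebra_def)
 have j: "Inr X : vob K <+> {x. is_EM x}" using X by (simp add: InrI)
 have va: "vhom collage (Inl a) (Inr X) = Kh a (fst X)" "vhom collage (Inl b) (Inr X) = Kh b (fst X)"
  "vhom collage (Inl b) (Inl a) = Kh b (mob T a)" using ab j by (simp_all add: InlI)
 have "ev V (Kh a (fst X)) (Kh b (fst X)) $ (fm (hat X) a b ** idn V (Kh a (fst X)))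
  = vcmp (vop V collage) (Inr X) (Inl a) (Inl b) $ (idn V (Kh b (mob T a)) ** idn V (Kh a (fst X)))"
  using op.ev_vrep1[OF o, of "idn V (Kh a (fst X))"] ab x0 va by (simp add: hat_def)
 also have "... = vcmp collage (Inl b) (Inl a) (Inr X) $ swp V (Kh b (mob T a)) (Kh a (fst X))"
  using coll.vcmp_simps[of "Inl b" "Inl a" "Inr X"] o x0 ab va by simp
 also have "... = vcmp K b (mob T a) (fst X) $ (ext a X ** idn V (Kh b (mob T a))) $ swp V (Kh b (mob T a)) (Kh a (fst X))"
  using collage_vcmp[OF equalizers _ _ j, of a b] ab x0 X by simp
 finally show ?thesis .
qed

text \<open>An arrow f from \<open>b\<close> to \<open>a\<close> becomes the operation eta . f; this
  is the free functor into the Kleisli category, seen on opposites.\<close>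

definition xi :: "('k, 'k, 'a) vfun" where
 "xi = \<lparr>fo = (%a. a), fm = (%a b. Kpo b (munit_ar T a))\<rparr>"

abbreviation "Aop \<equiv> vop V (vfull K A)"

lemma vfull_simps [simp]: "vob (vfull K A) = A" "vhom (vfull K A) = vhom K" "vid (vfull K A) = vid K" "vcmp (vfull K A) = vcmp K"
 by (simp_all add: vfull_def)

text \<open>The extension of eta . g is mu . T eta . T g = T g.\<close>

lemma ext_unit:
 assumes "a : vob K" "b : vob K"
 shows "ext b (mob T a, mmult T a) $ Kpo b (munit_ar T a) = Tm b a"
proof -
 have "Tm b (mob T a) $ Kpo b (munit_ar T a)
  = Kpo (mob T b) (mob T a, mob T (mob T a), Tm a (mob T a) $ munit T a) $ Tm b a"
  by (rule T.fm_vpost) (use assms in simp_all)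
 moreover have "Kpo (mob T b) (mmult_ar T a) $ Kpo (mob T b) (mob T a, mob T (mob T a), Tm a (mob T a) $ munit T a) = idn V (Kh (mob T b) (mob T a))"
  using vpost_cmp[of "mob T b" "mob T a" "mob T (mob T a)" "Tm a (mob T a) $ munit T a" "mob T a" "mmult T a"] mult_unit_right[of a] assms by simp
 ultimately show ?thesis
  using assms extend[of "Kpo (mob T b) (mmult_ar T a)" "Kpo (mob T b) (mob T a, mob T (mob T a), Tm a (mob T a) $ munit T a)" _ "Tm b a"]
  by (simp add: ext_def)
qed

lemma vcategory_Aop: "vcategory V Aop"
proof -
 have "vcategory V (vfull K A)"
  by (rule vcategory.intro) (simp_all add: vfull_def vhom_ob vid_hom vcmp_hom vcmp_vid_left vcmp_vid_right vcmp_assoc del: hom_iff)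
 then interpret f: enriched V "vfull K A" by (rule enrichedI)
 show ?thesis by (rule f.vcategory_vop)
qed

lemma vfunctor_xi: "vfunctor V Aop Th xi"
proof
 fix a assume "a : vob Aop"
 then have a: "a : A" by simp
 show "fo xi a : vob Th" using a by (simp add: xi_def)
 have "Kpo a (munit_ar T a) $ vid K a = munit T a"
  by (rule vpost_eqI) (use a in \<open>simp_all add: vid_right run_unt\<close>)
 then show "fm xi a a $ vid Aop a = vid Th (fo xi a)" using a by (simp add: xi_def)
 fix b assume "b : vob Aop"
 then have b: "b : A" by simp
 show "fm xi a b : hom V (vhom Aop a b) (vhom Th (fo xi a) (fo xi b))" using a b by (simp add: xi_def)
 fix c assume "c : vob Aop"
 then have c: "c : A" by simp
 let ?p = "Kpo c (munit_ar T b)" and ?q = "Kpo b (munit_ar T a)"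
 have "vcmp Th a b c $ (?p ** ?q) = vcmp K c (mob T b) (mob T a) $ (ext b (mob T a, mmult T a) ** idn V (Kh c (mob T b))) $ (?q ** ?p) $ swp V (Kh c b) (Kh b a)"
  unfolding Th_vcmp[OF a b c] using a b c free_algebra[of a] by (simp add: swp_nat)
 also have "... = (vcmp K c (mob T b) (mob T a) $ (Tm b a ** ?p)) $ swp V (Kh c b) (Kh b a)"
  using a b c free_algebra[of a] by (simp add: ext_unit)
 also have "vcmp K c (mob T b) (mob T a) $ (Tm b a ** ?p) = vcmp K c b (mob T a) $ ((Kpe (munit_ar T b) (mob T a) $ Tm b a) ** idn V (Kh c b))"
  using vpre_vpost_vcmp[of b "mob T b" "munit T b" c "mob T a" "Tm b a" "idn V (Kh c b)"] a b c by simp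
 also have "... = Kpo c (munit_ar T a) $ vcmp K c b a"
  using unit_natural[of b a] vpost_vcmp1[of a "mob T a" "munit T a" c b] a b c by simp
 finally show "fm xi a c $ vcmp Aop a b c = vcmp Th (fo xi a) (fo xi b) (fo xi c) $ (fm xi b c ** fm xi a b)"
  using a b c by (simp add: xi_def)
qed

definition nr :: "'k => ('k, 'o, 'a) vfun" where "nr k = vf_restrict Aop (vrep_contra V K k)"

lemma nr_simps [simp]: "a : A ==> fo (nr k) a = Kh a k" "a : A ==> b : A ==> fm (nr k) a b = fm (vrep V (vop V K) k) a b"
 by (simp_all add: nr_def vf_restrict_def vrep_contra_def fo_vrep)

lemma nr_ev:
 assumes "a : A" "b : A" "k : vob K"
 shows "ev V (Kh a k) (Kh b k) $ (fm (nr k) a b ** idn V (Kh a k)) = vcmp K b a k $ swp V (Kh b a) (Kh a k)"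
proof -
 interpret Kop: enriched V "vop V K" by (rule enriched_vop)
 show ?thesis using Kop.ev_vrep1[of k a b "idn V (Kh a k)"] assms by simp
qed

lemma vfunctor_nr:
 assumes k: "k : vob K" shows "vfunctor V Aop (self V) (nr k)"
proof -
 interpret Kop: enriched V "vop V K" by (rule enriched_vop)
 interpret R: vfunctor V "vop V K" "self V" "vrep V (vop V K) k" by (rule Kop.vfunctor_vrep) (simp add: k)
 show ?thesis
  by unfold_locales (use R.fo_vob R.fm_hom R.fm_vid R.fm_vcmp in \<open>simp_all del: hom_iff\<close>)
qed

text \<open>Operations that come from arrows between arities act by composition, since
  \<open>ext\<close> followed by restriction along the unit is the identity. So \<open>hat X\<close>
  meets the strict condition on objects of \<open>Alg\<close>.\<close>

lemma hat_xi:
 assumes X: "is_EM X"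
 shows "vf_restrict Aop (vf_cmp V xi (hat X)) = nr (fst X)"
proof -
 have x0: "fst X : vob K" using X by (simp add: is_EM_algebra_def)
 interpret h: vfunctor V Th "self V" "hat X" by (rule vfunctor_hat[OF X])
 interpret n: vfunctor V Aop "self V" "nr (fst X)" by (rule vfunctor_nr[OF x0])
 have "fm (hat X) a b $ Kpo b (munit_ar T a) = fm (nr (fst X)) a b" if a: "a : A" and b: "b : A" for a b
 proof (rule ev_ext[of "Kh a (fst X)" "Kh b (fst X)"])
  have hh: "fm (hat X) a b : ar V" "dm V (fm (hat X) a b) = Kh b (mob T a)" "cd V (fm (hat X) a b) = ihom V (Kh a (fst X)) (Kh b (fst X))"
  using h.fm_hom[of a b] a b by simp_all
  let ?u = "Kpo b (munit_ar T a)"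
  have "ev V (Kh a (fst X)) (Kh b (fst X)) $ ((fm (hat X) a b $ ?u) ** idn V (Kh a (fst X)))
  = (ev V (Kh a (fst X)) (Kh b (fst X)) $ (fm (hat X) a b ** idn V (Kh a (fst X)))) $ (?u ** idn V (Kh a (fst X)))"
  using hh a b x0 by simp
  also have "... = (vcmp K b (mob T a) (fst X) $ (ext a X ** ?u)) $ swp V (Kh b a) (Kh a (fst X))"
  unfolding hat_ev[OF X a b] using a b x0 X by (simp add: swp_nat)
  also have "vcmp K b (mob T a) (fst X) $ (ext a X ** ?u) = vcmp K b a (fst X) $ ((Kpe (munit_ar T a) (fst X) $ ext a X) ** idn V (Kh b a))"
  using vpre_vpost_vcmp[of a "mob T a" "munit T a" b "fst X" "ext a X" "idn V (Kh b a)"] a b x0 X by simp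
  also have "... = vcmp K b a (fst X)" using ext_retract[of a X] a b x0 X by simp
  finally show "ev V (Kh a (fst X)) (Kh b (fst X)) $ ((fm (hat X) a b $ ?u) ** idn V (Kh a (fst X)))
  = ev V (Kh a (fst X)) (Kh b (fst X)) $ (fm (nr (fst X)) a b ** idn V (Kh a (fst X)))"
  unfolding nr_ev[OF a b x0] .
  show "fm (hat X) a b $ ?u : hom V (Kh b a) (ihom V (Kh a (fst X)) (Kh b (fst X)))" using hh a b by simp
  show "fm (nr (fst X)) a b : hom V (Kh b a) (ihom V (Kh a (fst X)) (Kh b (fst X)))" using n.fm_hom[of a b] a b by simp
 qed (use a b x0 in simp_all)
 then show ?thesis
  by (auto simp: nr_def vf_restrict_def vf_cmp_def xi_def vrep_contra_def fo_vrep fun_eq_iff restrict_def)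
qed

lemma equational_theory: "equational_theory V K Th xi"
 unfolding equational_theory_def
proof (intro conjI ballI)
 show "vob Th <= vob K" by auto
 show "vfunctor V (vop V (vfull K (vob Th))) Th xi" using vfunctor_xi by simp
qed (simp_all add: vcategory_Th xi_def)

subsection \<open>Density of the arities\<close>

text \<open>Arities are generated, so K(b, -) preserves the colimit and sends its cocone to a
  colimit cocone in V. This takes the place of testing on elements.\<close>

lemma colim_jointly_epic:
 assumes dd: "directed_diagram ka lam C M I le D" and colim: "is_conical_colim V K (poset_cat I le) D y c" and b: "b : A"
 shows "jointly_epic V (Kh b y) ((%i. Kpo b (c i)) ` I)"
proof -
 let ?F = "vrep V K b"
 let ?D = "\<lparr>oo = (%i. fo ?F (oo D i)), oa = (%f. und_ar V ?F (oa D f))\<rparr>"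
 have pres: "is_conical_colim V (self V) (poset_cat I le) ?D (fo ?F y) (%i. und_ar V ?F (c i))"
  using A_gen[OF b] dd colim unfolding v_generated_object_def preserves_directed_colimits_def preserves_conical_colim_def by blast
 have DF: "cat_functor (poset_cat I le) W ?D" using pres by (simp add: is_conical_colim_def)
 have gc: "gcolim W I (oo ?D) (poset_edges I le ?D) (fo ?F y) (%i. und_ar V ?F (c i))"
  using self.conical_colim_is_colim[OF pres] unfolding is_colim_poset_iff_gcolim[OF DF] .
 note gd = gdiagram_poset[OF DF]
 have "jointly_epic V (fo ?F y) ((%i. unname_ar (und_ar V ?F (c i))) ` I)"
  by (rule jointly_epic_gcolim[OF gdiagram_unname[OF gd] gcolim_unname[OF gd gc]])
 moreover have "unname_ar (und_ar V ?F (c i)) = Kpo b (c i)" if i: "i : I" for i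
 proof -
  have ci: "c i : hom C (oo D i) y" using colim i by (simp add: is_conical_colim_def is_cocone_def del: hom_iff)
  obtain k where k: "c i = (oo D i, y, k)" using ci by (cases "c i") auto
  have "Kpo b (c i) : ar V" using ci b unfolding k by simp
  then show ?thesis using und_ar_vrep[OF enriched_K, of b "c i"] ci b by (simp add: unname_name_ar)
 qed
 ultimately show ?thesis by (simp cong: image_cong)
qed

lemma T_colim:
 assumes dd: "directed_diagram ka lam C M I le D" and colim: "is_conical_colim V K (poset_cat I le) D y c"
 shows "directed_diagram ka lam C M I le \<lparr>oo = (%i. mob T (oo D i)), oa = (%f. und_ar V (mfun T) (oa D f))\<rparr>" (is "directed_diagram _ _ _ _ _ _ ?D")
  and "is_conical_colim V K (poset_cat I le) \<lparr>oo = (%i. mob T (oo D i)), oa = (%f. und_ar V (mfun T) (oa D f))\<rparr> (mob T y) (%i. und_ar V (mfun T) (c i))"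
proof -
 show p: "is_conical_colim V K (poset_cat I le) ?D (mob T y) (%i. und_ar V (mfun T) (c i))"
  using T_pres dd colim unfolding preserves_directed_colimits_def preserves_conical_colim_def by blast
 show "directed_diagram ka lam C M I le ?D"
  using dd p T_M by (simp add: directed_diagram_def is_conical_colim_def)
qed

lemma vpre_jointly_monic:
 assumes colim: "is_conical_colim V K (poset_cat I le) D y c" and x: "x : vob K"
  and uv: "u : hom V z (Kh y x)" "v : hom V z (Kh y x)"
  and eq: "!!i k. i : I ==> c i = (oo D i, y, k) ==> (oo D i, y, k) : ar C ==> Kpe (oo D i, y, k) x $ u = Kpe (oo D i, y, k) x $ v"
 shows "u = v"
proof (rule conical_colim_ext[OF colim x uv])
 fix i assume i: "i : I"
 have ci: "c i : hom C (oo D i) y" using colim i by (simp add: is_conical_colim_def is_cocone_def del: hom_iff)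
 obtain k where k: "c i = (oo D i, y, k)" using ci by (cases "c i") auto
 show "Kpe (c i) x $ u = Kpe (c i) x $ v" unfolding k by (rule eq[OF i k]) (use ci k in simp)
qed

lemma density_unique:
 assumes "y : vob K" "x : vob K" "u : hom V (unt V) (Kh y x)" "v : hom V (unt V) (Kh y x)"
  and eq: "!!b. b : A ==> Kpo b (y, x, u) = Kpo b (y, x, v)"
 shows "u = v"
proof -
 obtain I le D c where D: "directed_diagram ka lam C M I le D" "ALL i:I. oo D i : A" and colim: "is_conical_colim V K (poset_cat I le) D y c"
  using A_dense[OF assms(1)] by (elim exE conjE)
 show ?thesis
 proof (rule vpre_jointly_monic[OF colim assms(2-4)])
  fix i k assume i: "i : I" and k: "(oo D i, y, k) : ar C"
  show "Kpe (oo D i, y, k) x $ u = Kpe (oo D i, y, k) x $ v"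
  using vpre_elt[of "oo D i" y k x u] vpre_elt[of "oo D i" y k x v] eq[of "oo D i"] D(2) i k assms by simp
 qed
qed

text \<open>Applying \<open>al\<close> to the legs of a presentation of \<open>y\<close> gives a
  cocone to \<open>x\<close>, as in the Yoneda lemma. The induced arrow agrees with
  \<open>al b\<close> on the legs, which are jointly epic after K(b, -).\<close>

lemma density:
 assumes y: "y : vob K" and x: "x : vob K"
  and al: "!!b. b : A ==> al b : hom V (Kh b y) (Kh b x)"
  and nat: "!!b b'. b : A ==> b' : A ==> al b' $ vcmp K b' b y = vcmp K b' b x $ (al b ** idn V (Kh b' b))"
 shows "EX u. u : hom V (unt V) (Kh y x) & (ALL b:A. al b = Kpo b (y, x, u))"
proof -
 obtain I le D c where D: "directed_diagram ka lam C M I le D" "ALL i:I. oo D i : A" and colim: "is_conical_colim V K (poset_cat I le) D y c"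
  using A_dense[OF y] by (elim exE conjE)
 have DA: "oo D i : A" if "i : I" for i using D(2) that by blast
 define k where "k i = snd (snd (c i))" for i
 have ci: "c i = (oo D i, y, k i)" "k i : ar V" "dm V (k i) = unt V" "cd V (k i) = Kh (oo D i) y" if "i : I" for i
  using conical_colimD(4-7)[OF colim that] by (simp_all add: k_def)
 have aa: "al b : ar V" "dm V (al b) = Kh b y" "cd V (al b) = Kh b x" if "b : A" for b using al[OF that] by simp_all
 have step: "al b $ Kpo b (b', y, f) = Kpo b (b', x, al b' $ f)" if b: "b : A" "b' : A" and f: "f : hom V (unt V) (Kh b' y)" for b b' f
 proof -
  have "(al b $ Kpo b (b', y, f)) $ lun V (Kh b b') = al b $ vcmp K b b' y $ (f ** idn V (Kh b b'))"
  using vpost_lun1[of b b' y f] b f y aa[OF b(1)] by simp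
  also have "... = (vcmp K b b' x $ (al b' ** idn V (Kh b b'))) $ (f ** idn V (Kh b b'))"
  by (rule extend[OF nat[OF b(2,1)]]) (use b f y x aa in simp_all)
  also have "... = Kpo b (b', x, al b' $ f) $ lun V (Kh b b')"
  using vpost_lun1[of b b' x "al b' $ f"] b f x y aa[OF b(2)] by simp
  finally show ?thesis
  by (rule iso_epi[OF lun_iso[of "Kh b b'"], rotated]) (use b f x y aa in simp_all)
 qed
 have "EX! u. u : hom V (unt V) (Kh y x) & (ALL i:I. Kpe (c i) x $ u = al (oo D i) $ k i)"
 proof (rule conical_colim_universal[OF colim x unt_ob])
  show "al (oo D i) $ k i : hom V (unt V) (Kh (oo D i) x)" if "i : I" for i using ci[OF that] aa[OF DA[OF that]] by simp
  fix i j assume ij: "i : I" "j : I" "(i, j) : le"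
  obtain w where w: "oa D (i, j) = (oo D i, oo D j, w)" "w : hom V (unt V) (Kh (oo D i) (oo D j))"
  using cat_functor_posetD(2)[OF conical_colimD(1)[OF colim] ij] by (cases "oa D (i, j)") auto
  have wj: "Kpo (oo D i) (oo D j, y, k j) $ w = k i"
  using conical_colimD(8)[OF colim ij] unfolding w(1) ci(1)[OF ij(1)] ci(1)[OF ij(2)]
  using w(2) ci[OF ij(2)] DA ij y by simp
  have "Kpe (oa D (i, j)) x $ al (oo D j) $ k j = Kpo (oo D i) (oo D j, x, al (oo D j) $ k j) $ w"
  unfolding w(1) using vpre_elt[of "oo D i" "oo D j" w x "al (oo D j) $ k j"] w(2) ci[OF ij(2)] aa[OF DA[OF ij(2)]] DA ij x by simp
  also have "... = (al (oo D i) $ Kpo (oo D i) (oo D j, y, k j)) $ w"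
  using step[OF DA[OF ij(1)] DA[OF ij(2)], of "k j"] ci[OF ij(2)] by simp
  also have "... = al (oo D i) $ k i"
  using wj w(2) ci[OF ij(2)] aa[OF DA[OF ij(1)]] DA ij y by simp
  finally show "Kpe (oa D (i, j)) x $ al (oo D j) $ k j = al (oo D i) $ k i" .
 qed
 then obtain u where u: "u : hom V (unt V) (Kh y x)" and uc: "ALL i:I. Kpe (c i) x $ u = al (oo D i) $ k i" by (elim ex1E conjE)
 have "al b = Kpo b (y, x, u)" if b: "b : A" for b
 proof -
  have "al b $ Kpo b (c i) = Kpo b (y, x, u) $ Kpo b (c i)" if i: "i : I" for i
  proof -
  have "Kpo (oo D i) (y, x, u) $ k i = al (oo D i) $ k i"
  using bspec[OF uc i] vpre_elt[of "oo D i" y "k i" x u] ci[OF i] DA[OF i] u x y by simp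
  then have "Kpo b (y, x, u) $ Kpo b (c i) = Kpo b (oo D i, x, al (oo D i) $ k i)"
  using vpost_cmp[of b "oo D i" y "k i" x u] ci[OF i] DA[OF i] u x y b by simp
  also have "... = al b $ Kpo b (c i)" using step[OF b DA[OF i], of "k i"] ci[OF i] by simp
  finally show ?thesis by simp
  qed
  note eq = this
  have vu: "Kpo b (y, x, u) : hom V (Kh b y) (Kh b x)" using u x y b by simp
  show ?thesis
  proof (rule jointly_epicD[OF colim_jointly_epic[OF D(1) colim b] al[OF b] vu])
  fix f assume "f : (%i. Kpo b (c i)) ` I"
  then obtain i where "f = Kpo b (c i)" "i : I" by (rule imageE)
  then show "al b $ f = Kpo b (y, x, u) $ f" using eq by simp
  qed
 qed
 then show ?thesis using u by blast
qed

end

subsection \<open>Algebras of the theory\<close>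

context generated_monad
begin

section \<open>Operations of a fixed algebra as arrows from T a to X0\<close>

context
 fixes F :: "('k, 'o, 'a) vfun" and X0 :: 'k
 assumes F: "vfunctor V Th Vs F" and X0 [simp]: "X0 : vob K" and F_nr: "vf_restrict Aop (vf_cmp V xi F) = nr X0"
begin

lemma F_fo [simp]: "a : A ==> fo F a = Kh a X0"
 using fun_cong[OF arg_cong[OF F_nr, of fo], of a] by (simp add: vf_restrict_def vf_cmp_def xi_def)

lemma F_fm [simp]:
 assumes "a : A" "b : A"
 shows "fm F a b : ar V" "dm V (fm F a b) = Kh b (mob T a)" "cd V (fm F a b) = ihom V (Kh a X0) (Kh b X0)"
 using vfunctor.fm_hom[OF F, of a b] assms by simp_all

lemma F_xi:
 assumes "a : A" "b : A"
 shows "fm F a b $ Kpo b (munit_ar T a) = fm (nr X0) a b"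
 using fun_cong[OF fun_cong[OF arg_cong[OF F_nr, of fm], of a], of b] assms by (simp add: vf_restrict_def vf_cmp_def xi_def)

text \<open>\<open>x\<close> is a choice of arguments, at which every operation in K(b, T a) is
  evaluated. By density these evaluations for all \<open>b\<close> are composition with a single
  arrow from T a to X0, called \<open>op_ar a x\<close> below.\<close>

definition act :: "'k => 'a => 'k => 'a" where
 "act a x b = ev V (Kh a X0) (Kh b X0) $ (fm F a b ** x) $ cinv V (run V (Kh b (mob T a)))"

lemma act:
 assumes "a : A" "b : A" "x : hom V (unt V) (Kh a X0)"
 shows "act a x b : ar V" "dm V (act a x b) = Kh b (mob T a)" "cd V (act a x b) = Kh b X0"
  "act a x b $ run V (Kh b (mob T a)) = ev V (Kh a X0) (Kh b X0) $ (fm F a b ** x)"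
 using assms by (simp_all add: act_def)

lemma act_eqI:
 assumes "a : A" "b : A" "x : hom V (unt V) (Kh a X0)" "u : hom V (Kh b (mob T a)) (Kh b X0)"
  "ev V (Kh a X0) (Kh b X0) $ (fm F a b ** x) = u $ run V (Kh b (mob T a))"
 shows "act a x b = u"
 by (rule iso_epi[OF run_iso[of "Kh b (mob T a)"]]) (use assms act[OF assms(1-3)] in simp_all)

lemma Th_vcmp_simps:
 assumes "a : A" "b : A" "c : A"
 shows "vcmp Th a b c : ar V" "dm V (vcmp Th a b c) = Kh c (mob T b) @@ Kh b (mob T a)" "cd V (vcmp Th a b c) = Kh c (mob T a)"
 using vcategory.vcmp_hom[OF vcategory_Th, of a b c] assms by simp_all

text \<open>Functoriality of \<open>F\<close> evaluated at \<open>x\<close>: applying two operations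
  in turn is applying their composite.\<close>

lemma act_cmp:
 assumes a: "a : A" and b: "b : A" and b': "b' : A" and x: "x : hom V (unt V) (Kh a X0)"
 shows "ev V (Kh b X0) (Kh b' X0) $ (fm F b b' ** act a x b) = act a x b' $ vcmp Th a b b'"
proof (rule iso_epi[OF run_iso[of "Kh b' (mob T b) @@ Kh b (mob T a)"]])
 let ?P = "Kh b' (mob T b)" and ?Q = "Kh b (mob T a)"
 note t = Th_vcmp_simps[OF a b b'] and ab = act[OF a b x] and ab' = act[OF a b' x]
 have "(act a x b' $ vcmp Th a b b') $ run V (?P @@ ?Q) = (act a x b' $ run V (Kh b' (mob T a))) $ (vcmp Th a b b' ** idn V (unt V))"
  using t ab'(1-3) a b b' by (simp add: run_nat)
 also have "... = ev V (Kh a X0) (Kh b' X0) $ ((fm F a b' $ vcmp Th a b b') ** x)"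
  unfolding ab'(4) using t a b b' x by simp
 also have "fm F a b' $ vcmp Th a b b' = vcmp Vs (Kh a X0) (Kh b X0) (Kh b' X0) $ (fm F b b' ** fm F a b)"
  using vfunctor.fm_vcmp[OF F, of a b b'] a b b' by simp
 also have "ev V (Kh a X0) (Kh b' X0) $ ((vcmp Vs (Kh a X0) (Kh b X0) (Kh b' X0) $ (fm F b b' ** fm F a b)) ** x)
  = ev V (Kh b X0) (Kh b' X0) $ (fm F b b' ** (ev V (Kh a X0) (Kh b X0) $ (fm F a b ** x))) $ ass V ?P ?Q (unt V)"
  using ev_self_vcmp[of "Kh a X0" "Kh b X0" "Kh b' X0" "fm F b b'" "fm F a b" x] a b b' x by simp
 also have "... = (ev V (Kh b X0) (Kh b' X0) $ (fm F b b' ** act a x b)) $ (idn V ?P ** run V ?Q) $ ass V ?P ?Q (unt V)"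
  unfolding ab(4)[symmetric] using ab(1-3) a b b' by simp
 also have "(idn V ?P ** run V ?Q) $ ass V ?P ?Q (unt V) = run V (?P @@ ?Q)" using a b b' by (simp add: run_ass)
 finally show "(ev V (Kh b X0) (Kh b' X0) $ (fm F b b' ** act a x b)) $ run V (?P @@ ?Q) = (act a x b' $ vcmp Th a b b') $ run V (?P @@ ?Q)" by simp
qed (use act[OF a b x] act[OF a b' x] Th_vcmp_simps[OF a b b'] a b b' in simp_all)

text \<open>Composing with an arrow between arities is composing with the operation that
  \<open>xi\<close> assigns to it, so naturality is a case of \<open>act_cmp\<close>;
  \<open>F_nr\<close> identifies that action with composition in K.\<close>

lemma act_natural:
 assumes a: "a : A" and b: "b : A" and b': "b' : A" and x: "x : hom V (unt V) (Kh a X0)"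
 shows "act a x b' $ vcmp K b' b (mob T a) = vcmp K b' b X0 $ (act a x b ** idn V (Kh b' b))"
proof (rule iso_epi[OF swp_iso[of "Kh b' b" "Kh b (mob T a)"]])
 let ?P = "Kh b' b" and ?Q = "Kh b (mob T a)" and ?e = "Kpo b' (munit_ar T b)"
 note t = Th_vcmp_simps[OF a b b'] and ab = act[OF a b x] and ab' = act[OF a b' x]
 have e: "?e : ar V" "dm V ?e = ?P" "cd V ?e = Kh b' (mob T b)" using b b' by simp_all
 have nh: "fm (nr X0) b b' : ar V" "dm V (fm (nr X0) b b') = ?P" "cd V (fm (nr X0) b b') = ihom V (Kh b X0) (Kh b' X0)"
  unfolding F_xi[OF b b', symmetric] using e b b' by simp_all
 have "(ev V (Kh b X0) (Kh b' X0) $ (fm F b b' ** act a x b)) $ (?e ** idn V ?Q)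
  = ev V (Kh b X0) (Kh b' X0) $ ((fm F b b' $ ?e) ** act a x b)"
  using e ab a b b' by simp
 also have "... = (ev V (Kh b X0) (Kh b' X0) $ (fm (nr X0) b b' ** idn V (Kh b X0))) $ (idn V ?P ** act a x b)"
  unfolding F_xi[OF b b'] using nh ab a b b' by (simp del: nr_simps)
 also have "... = (vcmp K b' b X0 $ (act a x b ** idn V ?P)) $ swp V ?P ?Q"
  unfolding nr_ev[OF b b' X0] using ab a b b' by (simp add: swp_nat)
 finally have 1: "(ev V (Kh b X0) (Kh b' X0) $ (fm F b b' ** act a x b)) $ (?e ** idn V ?Q) = (vcmp K b' b X0 $ (act a x b ** idn V ?P)) $ swp V ?P ?Q" .
 have "(act a x b' $ vcmp Th a b b') $ (?e ** idn V ?Q)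
  = act a x b' $ (vcmp K b' (mob T b) (mob T a) $ (ext b (mob T a, mmult T a) ** ?e)) $ swp V ?P ?Q"
  unfolding Th_vcmp[OF a b b'] using e ab' a b b' free_algebra[of a] by (simp add: swp_nat)
 also have "vcmp K b' (mob T b) (mob T a) $ (ext b (mob T a, mmult T a) ** ?e) = vcmp K b' b (mob T a) $ ((Kpe (munit_ar T b) (mob T a) $ ext b (mob T a, mmult T a)) ** idn V ?P)"
  using vpre_vpost_vcmp[of b "mob T b" "munit T b" b' "mob T a" "ext b (mob T a, mmult T a)" "idn V ?P"] a b b' free_algebra[of a] by simp
 also have "... = vcmp K b' b (mob T a)" using ext_retract[of b "(mob T a, mmult T a)"] a b b' free_algebra[of a] by simp
 finally show "(act a x b' $ vcmp K b' b (mob T a)) $ swp V ?P ?Q = (vcmp K b' b X0 $ (act a x b ** idn V ?P)) $ swp V ?P ?Q"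
  using 1 act_cmp[OF a b b' x] ab' a b b' by simp
qed (use act[OF a b x] act[OF a b' x] a b b' in simp_all)

definition op_ar :: "'k => 'a => 'a" where
 "op_ar a x = (SOME u. u : hom V (unt V) (Kh (mob T a) X0) & (ALL b:A. act a x b = Kpo b (mob T a, X0, u)))"

lemma op_ar:
 assumes a: "a : A" and x: "x : hom V (unt V) (Kh a X0)"
 shows "op_ar a x : ar V" "dm V (op_ar a x) = unt V" "cd V (op_ar a x) = Kh (mob T a) X0"
  "b : A ==> act a x b = Kpo b (mob T a, X0, op_ar a x)"
proof -
 have "EX u. u : hom V (unt V) (Kh (mob T a) X0) & (ALL b:A. act a x b = Kpo b (mob T a, X0, u))"
  by (rule density) (use a act[OF a _ x] act_natural[OF a _ _ x] in simp_all)
 from someI_ex[OF this, folded op_ar_def]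
 show "op_ar a x : ar V" "dm V (op_ar a x) = unt V" "cd V (op_ar a x) = Kh (mob T a) X0"
  "b : A ==> act a x b = Kpo b (mob T a, X0, op_ar a x)" by simp_all
qed

lemma op_ar_eqI:
 assumes a: "a : A" and x: "x : hom V (unt V) (Kh a X0)" and u: "u : hom V (unt V) (Kh (mob T a) X0)"
  and eq: "!!b. b : A ==> ev V (Kh a X0) (Kh b X0) $ (fm F a b ** x)
  = vcmp K b (mob T a) X0 $ (u ** idn V (Kh b (mob T a))) $ swp V (Kh b (mob T a)) (unt V)"
 shows "op_ar a x = u"
proof (rule density_unique[of "mob T a" X0])
 show "Kpo b (mob T a, X0, op_ar a x) = Kpo b (mob T a, X0, u)" if b: "b : A" for b
  unfolding op_ar(4)[OF a x b, symmetric]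
 proof (rule act_eqI[OF a b x])
  have "Kpo b (mob T a, X0, u) $ run V (Kh b (mob T a)) = (Kpo b (mob T a, X0, u) $ lun V (Kh b (mob T a))) $ swp V (Kh b (mob T a)) (unt V)"
  using a b u by (simp add: lun_swp)
  also have "... = vcmp K b (mob T a) X0 $ (u ** idn V (Kh b (mob T a))) $ swp V (Kh b (mob T a)) (unt V)"
  using vpost_lun1[of b "mob T a" X0 u] a b u by simp
  finally show "ev V (Kh a X0) (Kh b X0) $ (fm F a b ** x) = Kpo b (mob T a, X0, u) $ run V (Kh b (mob T a))"
  unfolding eq[OF b] by (rule sym)
 qed (use a b u in simp)
qed (use a u op_ar[OF a x] in simp_all)

text \<open>Recognizes \<open>op_ar\<close> from a formula for the whole action of \<open>F\<close>.
  It serves to compare \<open>F\<close> with the algebra reconstructed from it, and to recover an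
  algebra from its own action.\<close>

lemma op_ar_ext:
 assumes a: "a : A" and x: "x : hom V (unt V) (Kh a X0)" and e: "e : hom V (Kh a X0) (Kh (mob T a) X0)"
  and eq: "!!b. b : A ==> ev V (Kh a X0) (Kh b X0) $ (fm F a b ** idn V (Kh a X0))
  = vcmp K b (mob T a) X0 $ (e ** idn V (Kh b (mob T a))) $ swp V (Kh b (mob T a)) (Kh a X0)"
 shows "op_ar a x = e $ x"
proof (rule op_ar_eqI[OF a x])
 show "e $ x : hom V (unt V) (Kh (mob T a) X0)" using e x by simp
 fix b assume b: "b : A"
 have "ev V (Kh a X0) (Kh b X0) $ (fm F a b ** x)
  = (ev V (Kh a X0) (Kh b X0) $ (fm F a b ** idn V (Kh a X0))) $ (idn V (Kh b (mob T a)) ** x)"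
  using a b x by simp
 then show "ev V (Kh a X0) (Kh b X0) $ (fm F a b ** x)
  = vcmp K b (mob T a) X0 $ ((e $ x) ** idn V (Kh b (mob T a))) $ swp V (Kh b (mob T a)) (unt V)"
  unfolding eq[OF b] using a b x e by (simp add: swp_nat)
qed

text \<open>The unit of the monad is the identity operation of the theory, and \<open>F\<close>
  preserves identities.\<close>

lemma op_ar_unit:
 assumes a: "a : A" and x: "x : hom V (unt V) (Kh a X0)"
 shows "Kpo a (mob T a, X0, op_ar a x) $ munit T a = x"
proof (rule iso_epi[OF run_iso[OF unt_ob]])
 note ab = act[OF a a x]
 have "(act a x a $ munit T a) $ run V (unt V) = (act a x a $ run V (Kh a (mob T a))) $ (munit T a ** idn V (unt V))"
  using ab(1-3) a by (simp add: run_nat)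
 also have "... = ev V (Kh a X0) (Kh a X0) $ ((fm F a a $ munit T a) ** x)" unfolding ab(4) using a x by simp
 also have "fm F a a $ munit T a = vid Vs (Kh a X0)" using vfunctor.fm_vid[OF F, of a] a by simp
 also have "ev V (Kh a X0) (Kh a X0) $ (vid Vs (Kh a X0) ** x) = x $ run V (unt V)" using a x by (simp add: run_unt)
 finally show "(Kpo a (mob T a, X0, op_ar a x) $ munit T a) $ run V (unt V) = x $ run V (unt V)"
  unfolding op_ar(4)[OF a x a] .
qed (use a x op_ar[OF a x] in simp_all)

text \<open>x . g is the result of the operation eta . g at \<open>x\<close>, so
  \<open>act_cmp\<close> applies; \<open>ext_unit\<close> then turns the Kleisli extension of eta .
  g into T g.\<close>

lemma act_post:
 assumes a: "a : A" and a': "a' : A" and b: "b : A" and x: "x : hom V (unt V) (Kh a X0)"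
 shows "ev V (Kh a' X0) (Kh b X0) $ (fm F a' b ** Kpo a' (a, X0, x))
  = vcmp K b (mob T a') X0 $ ((Kpo (mob T a') (mob T a, X0, op_ar a x) $ Tm a' a) ** idn V (Kh b (mob T a')))
  $ swp V (Kh b (mob T a')) (Kh a' a)"
proof -
 let ?P = "Kh b (mob T a')" and ?e = "Kpo a' (munit_ar T a)" and ?H = "op_ar a x"
 note o = op_ar[OF a x] and t = Th_vcmp_simps[OF a a' b] and ab = act[OF a a' x]
 have e: "?e : ar V" "dm V ?e = Kh a' a" "cd V ?e = Kh a' (mob T a)" using a a' by simp_all
 have "act a x a' $ ?e = Kpo a' (a, X0, x)"
  unfolding o(4)[OF a'] using vpost_cmp[of a' a "mob T a" "munit T a" X0 ?H] op_ar_unit[OF a x] o(1-3) a a' by simp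
 then have "ev V (Kh a' X0) (Kh b X0) $ (fm F a' b ** Kpo a' (a, X0, x))
  = (ev V (Kh a' X0) (Kh b X0) $ (fm F a' b ** act a x a')) $ (idn V ?P ** ?e)"
  using e ab a a' b by simp
 also have "... = Kpo b (mob T a, X0, ?H) $ vcmp Th a a' b $ (idn V ?P ** ?e)"
  unfolding act_cmp[OF a a' b x] o(4)[OF b] using e t o(1-3) a a' b by simp
 also have "vcmp Th a a' b $ (idn V ?P ** ?e) = vcmp K b (mob T a') (mob T a) $ ((ext a' (mob T a, mmult T a) $ ?e) ** idn V ?P) $ swp V ?P (Kh a' a)"
  unfolding Th_vcmp[OF a a' b] using e a a' b free_algebra[of a] by (simp add: swp_nat)
 also have "Kpo b (mob T a, X0, ?H) $ vcmp K b (mob T a') (mob T a) $ ((ext a' (mob T a, mmult T a) $ ?e) ** idn V ?P) $ swp V ?P (Kh a' a)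
  = (Kpo b (mob T a, X0, ?H) $ vcmp K b (mob T a') (mob T a) $ (Tm a' a ** idn V ?P)) $ swp V ?P (Kh a' a)"
  using e a a' b o(1-3) by (simp add: ext_unit)
 also have "Kpo b (mob T a, X0, ?H) $ vcmp K b (mob T a') (mob T a) $ (Tm a' a ** idn V ?P)
  = vcmp K b (mob T a') X0 $ ((Kpo (mob T a') (mob T a, X0, ?H) $ Tm a' a) ** idn V ?P)"
  using vpost_vcmp[of "mob T a" X0 ?H b "mob T a'" "Tm a' a" "idn V ?P"] o(1-3) a a' b by simp
 finally show ?thesis using o(1-3) a a' b by simp
qed

text \<open>Compatibility with change of arity, which makes the arrows \<open>op_ar\<close> at the
  legs of a presentation of X0 a cocone.\<close>

lemma op_ar_pre:
 assumes a: "a : A" and a': "a' : A" and x: "x : hom V (unt V) (Kh a X0)" and w: "w : hom V (unt V) (Kh a' a)"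
 shows "op_ar a' (Kpo a' (a, X0, x) $ w) = Kpo (mob T a') (mob T a, X0, op_ar a x) $ Tm a' a $ w"
proof (rule op_ar_eqI[OF a'])
 note o = op_ar[OF a x]
 show "Kpo a' (a, X0, x) $ w : hom V (unt V) (Kh a' X0)" using a a' x w by simp
 show "Kpo (mob T a') (mob T a, X0, op_ar a x) $ Tm a' a $ w : hom V (unt V) (Kh (mob T a') X0)"
  using o a a' w by simp
 fix b assume b: "b : A"
 let ?P = "Kh b (mob T a')"
 have "ev V (Kh a' X0) (Kh b X0) $ (fm F a' b ** (Kpo a' (a, X0, x) $ w))
  = (ev V (Kh a' X0) (Kh b X0) $ (fm F a' b ** Kpo a' (a, X0, x))) $ (idn V ?P ** w)"
  using a a' b x w by simp
 then show "ev V (Kh a' X0) (Kh b X0) $ (fm F a' b ** (Kpo a' (a, X0, x) $ w))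
  = vcmp K b (mob T a') X0 $ ((Kpo (mob T a') (mob T a, X0, op_ar a x) $ Tm a' a $ w) ** idn V ?P) $ swp V ?P (unt V)"
  unfolding act_post[OF a a' b x] using o(1-3) a a' b w by (simp add: swp_nat)
qed

text \<open>Prepares associativity: the new argument is itself the result of the operation
  \<open>f\<close>, and the Kleisli extension of \<open>f\<close> brings in the multiplication of
  the monad.\<close>

lemma op_ar_act:
 assumes a: "a : A" and b: "b : A" and x: "x : hom V (unt V) (Kh a X0)" and f: "f : hom V (unt V) (Kh b (mob T a))"
 shows "op_ar b (Kpo b (mob T a, X0, op_ar a x) $ f) = Kpo (mob T b) (mob T a, X0, op_ar a x) $ ext b (mob T a, mmult T a) $ f"
proof (rule op_ar_eqI[OF b])
 note o = op_ar[OF a x] and fa = free_algebra[OF A_ob[OF a]]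
 show "Kpo b (mob T a, X0, op_ar a x) $ f : hom V (unt V) (Kh b X0)" using o a b f by simp
 show "Kpo (mob T b) (mob T a, X0, op_ar a x) $ ext b (mob T a, mmult T a) $ f : hom V (unt V) (Kh (mob T b) X0)"
  using o fa a b f by simp
 fix b' assume b': "b' : A"
 let ?P = "Kh b' (mob T b)"
 note t = Th_vcmp_simps[OF a b b'] and ab = act[OF a b x]
 have "ev V (Kh b X0) (Kh b' X0) $ (fm F b b' ** (act a x b $ f)) = (ev V (Kh b X0) (Kh b' X0) $ (fm F b b' ** act a x b)) $ (idn V ?P ** f)"
  using ab a b b' f by simp
 also have "... = Kpo b' (mob T a, X0, op_ar a x) $ vcmp Th a b b' $ (idn V ?P ** f)"
  unfolding act_cmp[OF a b b' x] o(4)[OF b'] using t o(1-3) a b b' f by simp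
 also have "vcmp Th a b b' $ (idn V ?P ** f) = (vcmp K b' (mob T b) (mob T a) $ ((ext b (mob T a, mmult T a) $ f) ** idn V ?P)) $ swp V ?P (unt V)"
  unfolding Th_vcmp[OF a b b'] using a b b' f fa by (simp add: swp_nat)
 also have "Kpo b' (mob T a, X0, op_ar a x) $ (vcmp K b' (mob T b) (mob T a) $ ((ext b (mob T a, mmult T a) $ f) ** idn V ?P)) $ swp V ?P (unt V)
  = (Kpo b' (mob T a, X0, op_ar a x) $ vcmp K b' (mob T b) (mob T a) $ ((ext b (mob T a, mmult T a) $ f) ** idn V ?P)) $ swp V ?P (unt V)"
  using o(1-3) a b b' f fa by simp
 also have "Kpo b' (mob T a, X0, op_ar a x) $ vcmp K b' (mob T b) (mob T a) $ ((ext b (mob T a, mmult T a) $ f) ** idn V ?P)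
  = vcmp K b' (mob T b) X0 $ ((Kpo (mob T b) (mob T a, X0, op_ar a x) $ ext b (mob T a, mmult T a) $ f) ** idn V ?P)"
  using vpost_vcmp[of "mob T a" X0 "op_ar a x" b' "mob T b" "ext b (mob T a, mmult T a) $ f" "idn V ?P"] o(1-3) a b b' f fa by simp
 finally show "ev V (Kh b X0) (Kh b' X0) $ (fm F b b' ** (Kpo b (mob T a, X0, op_ar a x) $ f))
  = vcmp K b' (mob T b) X0 $ ((Kpo (mob T b) (mob T a, X0, op_ar a x) $ ext b (mob T a, mmult T a) $ f) ** idn V ?P) $ swp V ?P (unt V)"
  unfolding o(4)[OF b] using o(1-3) a b b' f fa by simp
qed

text \<open>T may be applied twice to the presentation of X0, so equations between arrows out of T
  X0 or T T X0 can be tested on its legs, where they reduce to the laws of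
  \<open>op_ar\<close>.\<close>

lemma reconstruct: "EX h. is_EM (X0, h) & (ALL a:A. ALL b:A. fm F a b = fm (hat (X0, h)) a b)"
proof -
 obtain I le D c where D: "directed_diagram ka lam C M I le D" "ALL i:I. oo D i : A" and colim: "is_conical_colim V K (poset_cat I le) D X0 c"
  using A_dense[OF X0] by (elim exE conjE)
 have DA: "oo D i : A" if "i : I" for i using D(2) that by blast
 define k where "k i = snd (snd (c i))" for i
 have ci: "c i = (oo D i, X0, k i)" "k i : ar V" "dm V (k i) = unt V" "cd V (k i) = Kh (oo D i) X0" if "i : I" for i
  using conical_colimD(4-7)[OF colim that] by (simp_all add: k_def)
 have kh: "k i : hom V (unt V) (Kh (oo D i) X0)" if "i : I" for i using ci[OF that] by simp
 let ?H = "%i. op_ar (oo D i) (k i)"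
 note H = op_ar[OF DA kh]
 let ?TD = "\<lparr>oo = (%i. mob T (oo D i)), oa = (%f. und_ar V (mfun T) (oa D f))\<rparr>" and ?Tc = "%i. und_ar V (mfun T) (c i)"
 note Tdd = T_colim(1)[OF D(1) colim] and Tcolim = T_colim(2)[OF D(1) colim]
 have Tc: "?Tc i = (mob T (oo D i), mob T X0, Tm (oo D i) X0 $ k i)" if "i : I" for i
  using ci[OF that] DA[OF that] by simp
 have "EX! u. u : hom V (unt V) (Kh (mob T X0) X0) & (ALL i:I. Kpe (?Tc i) X0 $ u = ?H i)"
 proof (rule conical_colim_universal[OF Tcolim X0 unt_ob])
  show "?H i : hom V (unt V) (Kh (oo ?TD i) X0)" if "i : I" for i using H[OF that that] by simp
  fix i j assume ij: "i : I" "j : I" "(i, j) : le"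
  obtain w where w: "oa D (i, j) = (oo D i, oo D j, w)" "w : hom V (unt V) (Kh (oo D i) (oo D j))"
  using cat_functor_posetD(2)[OF conical_colimD(1)[OF colim] ij] by (cases "oa D (i, j)") auto
  have wj: "Kpo (oo D i) (oo D j, X0, k j) $ w = k i"
  using conical_colimD(8)[OF colim ij] unfolding w(1) ci(1)[OF ij(1)] ci(1)[OF ij(2)]
  using w(2) ci[OF ij(2)] DA ij by simp
  have "?H i = Kpo (mob T (oo D i)) (mob T (oo D j), X0, ?H j) $ Tm (oo D i) (oo D j) $ w"
  using op_ar_pre[OF DA[OF ij(2)] DA[OF ij(1)] kh[OF ij(2)] w(2)] unfolding wj .
  also have "... = Kpe (oa ?TD (i, j)) X0 $ ?H j"
  using vpre_elt[of "mob T (oo D i)" "mob T (oo D j)" "Tm (oo D i) (oo D j) $ w" X0 "?H j"] w DA ij H[OF ij(2) ij(2)] by simp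
  finally show "Kpe (oa ?TD (i, j)) X0 $ ?H j = ?H i" by simp
 qed
 then obtain h where hh: "h : hom V (unt V) (Kh (mob T X0) X0)" and hT: "ALL i:I. Kpe (?Tc i) X0 $ h = ?H i" by (elim ex1E conjE)
 have h: "h : ar V" "dm V h = unt V" "cd V h = Kh (mob T X0) X0" using hh by simp_all
 let ?h = "(mob T X0, X0, h)"
 have hH: "Kpo (mob T (oo D i)) ?h $ Tm (oo D i) X0 $ k i = ?H i" if i: "i : I" for i
  using bspec[OF hT i] vpre_elt[of "mob T (oo D i)" "mob T X0" "Tm (oo D i) X0 $ k i" X0 h] ci[OF i] DA[OF i] h unfolding Tc[OF i] by simp
 define e where "e a = Kpo (mob T a) ?h $ Tm a X0" for a
 have e: "e a : ar V" "dm V (e a) = Kh a X0" "cd V (e a) = Kh (mob T a) X0" if "a : A" for a using that h by (simp_all add: e_def)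
 \<comment> \<open>Elements do not suffice to identify the action of \<open>F\<close> with h . T(-).
   Both are compared on the jointly epic images of the legs in K(a, X0), tensored with the object of
   operations.\<close>
 have main: "ev V (Kh a X0) (Kh b X0) $ (fm F a b ** idn V (Kh a X0))
  = vcmp K b (mob T a) X0 $ (e a ** idn V (Kh b (mob T a))) $ swp V (Kh b (mob T a)) (Kh a X0)"
  if a: "a : A" and b: "b : A" for a b
 proof -
  let ?P = "Kh b (mob T a)" and ?Q = "Kh a X0"
  let ?u = "ev V ?Q (Kh b X0) $ (fm F a b ** idn V ?Q) $ swp V ?Q ?P" and ?v = "vcmp K b (mob T a) X0 $ (e a ** idn V ?P)"
  have uv: "?u = ?v"
  proof (rule jointly_epic_tensor[OF colim_jointly_epic[OF D(1) colim a], of ?P _ "Kh b X0"])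
  fix f assume "f : (%i. Kpo a (c i)) ` I"
  then obtain i where f: "f = Kpo a (oo D i, X0, k i)" and i: "i : I" using ci(1) by auto
  note ki = ci(2-4)[OF i] and Di = DA[OF i] and Hi = H(1-3)[OF i i]
  have fh: "f : ar V" "dm V f = Kh a (oo D i)" "cd V f = ?Q" unfolding f using ki Di a by simp_all
  have "?u $ (f ** idn V ?P) = (ev V ?Q (Kh b X0) $ (fm F a b ** f)) $ swp V (Kh a (oo D i)) ?P"
  using fh a b Di by (simp add: swp_nat)
  also have "... = vcmp K b (mob T a) X0 $ ((Kpo (mob T a) (mob T (oo D i), X0, ?H i) $ Tm a (oo D i)) ** idn V ?P)"
  unfolding f act_post[OF Di a b kh[OF i]] using Hi a b Di by simp
  finally have 1: "?u $ (f ** idn V ?P) = vcmp K b (mob T a) X0 $ ((Kpo (mob T a) (mob T (oo D i), X0, ?H i) $ Tm a (oo D i)) ** idn V ?P)" .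
  have "Tm a X0 $ f = Kpo (mob T a) (mob T (oo D i), mob T X0, Tm (oo D i) X0 $ k i) $ Tm a (oo D i)"
  unfolding f by (rule T.fm_vpost) (use ki Di a in simp_all)
  then have "e a $ f = (Kpo (mob T a) ?h $ Kpo (mob T a) (mob T (oo D i), mob T X0, Tm (oo D i) X0 $ k i)) $ Tm a (oo D i)"
  using fh a h Di ki by (simp add: e_def)
  also have "Kpo (mob T a) ?h $ Kpo (mob T a) (mob T (oo D i), mob T X0, Tm (oo D i) X0 $ k i) = Kpo (mob T a) (mob T (oo D i), X0, ?H i)"
  using vpost_cmp[of "mob T a" "mob T (oo D i)" "mob T X0" "Tm (oo D i) X0 $ k i" X0 h] hH[OF i] h ki Di a by simp
  finally show "?u $ (f ** idn V ?P) = ?v $ (f ** idn V ?P)" unfolding 1 using fh e[OF a] a b by simp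
  qed (use a b e[OF a] in simp_all)
  have "ev V ?Q (Kh b X0) $ (fm F a b ** idn V ?Q) = ?u $ swp V ?P ?Q" using a b by simp
  also have "... = ?v $ swp V ?P ?Q" unfolding uv ..
  finally show ?thesis using a b e[OF a] by simp
 qed
 have hx: "op_ar a x = e a $ x" if "a : A" "x : hom V (unt V) (Kh a X0)" for a x
  by (rule op_ar_ext[OF that]) (use e main that in simp_all)
 have unit: "Kpo X0 ?h $ munit T X0 = vid K X0"
 proof (rule vpre_jointly_monic[OF colim X0])
  fix i k' assume i: "i : I" and k': "c i = (oo D i, X0, k')"
  have kk: "k' = k i" using ci(1)[OF i] k' by simp
  note ki = ci(2-4)[OF i] and Di = DA[OF i] and Hi = H(1-3)[OF i i]
  have "Kpe (oo D i, X0, k i) X0 $ Kpo X0 ?h $ munit T X0 = (Kpo (oo D i) ?h $ Kpo (oo D i) (munit_ar T X0)) $ k i"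
  using vpre_elt[of "oo D i" X0 "k i" X0 "Kpo X0 ?h $ munit T X0"] vpost_cmp[of "oo D i" X0 "mob T X0" "munit T X0" X0 h] h ki Di by simp
  also have "... = Kpo (oo D i) ?h $ Kpe (munit_ar T (oo D i)) (mob T X0) $ Tm (oo D i) X0 $ k i"
  using unit_natural[of "oo D i" X0] h ki Di by simp
  also have "... = (Kpo (oo D i) ?h $ Kpo (oo D i) (mob T (oo D i), mob T X0, Tm (oo D i) X0 $ k i)) $ munit T (oo D i)"
  using vpre_elt[of "oo D i" "mob T (oo D i)" "munit T (oo D i)" "mob T X0" "Tm (oo D i) X0 $ k i"] h ki Di by simp
  also have "... = Kpo (oo D i) (mob T (oo D i), X0, ?H i) $ munit T (oo D i)"
  using vpost_cmp[of "oo D i" "mob T (oo D i)" "mob T X0" "Tm (oo D i) X0 $ k i" X0 h] hH[OF i] h ki Di by simp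
  also have "... = k i" by (rule op_ar_unit[OF Di kh[OF i]])
  also have "... = Kpe (oo D i, X0, k i) X0 $ vid K X0"
  using vpre_elt[of "oo D i" X0 "k i" X0 "vid K X0"] ki Di by simp
  finally show "Kpe (oo D i, X0, k') X0 $ Kpo X0 ?h $ munit T X0 = Kpe (oo D i, X0, k') X0 $ vid K X0" unfolding kk .
 qed (use h in simp_all)
 \<comment> \<open>Associativity at a single leg. Here the domain T T (D i) needs a presentation of
   its own, obtained by applying T to one of T (D i).\<close>
 have Hassoc: "Kpo (mob T (mob T (oo D i))) ?h $ Tm (mob T (oo D i)) X0 $ ?H i
  = Kpo (mob T (mob T (oo D i))) (mob T (oo D i), X0, ?H i) $ mmult T (oo D i)" if i: "i : I" for i
 proof -
  note ki = ci(2-4)[OF i] and Di = DA[OF i] and Hi = H(1-3)[OF i i] and fa = free_algebra[OF A_ob[OF DA[OF i]]]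
  let ?Y = "mob T (oo D i)"
  have Y: "?Y : vob K" using Di by simp
  obtain I' le' D' c' where D': "directed_diagram ka lam C M I' le' D'" "ALL i:I'. oo D' i : A" and colim': "is_conical_colim V K (poset_cat I' le') D' ?Y c'"
  using A_dense[OF Y] by (elim exE conjE)
  show ?thesis
  proof (rule vpre_jointly_monic[OF T_colim(2)[OF D'(1) colim'] X0])
  fix j k' assume j: "j : I'" and k': "und_ar V (mfun T) (c' j) = (oo \<lparr>oo = (%i. mob T (oo D' i)), oa = (%f. und_ar V (mfun T) (oa D' f))\<rparr> j, mob T ?Y, k')"
  let ?b = "oo D' j"
  have b: "?b : A" using D'(2) j by blast
  define f where "f = snd (snd (c' j))"
  have f: "c' j = (?b, ?Y, f)" "f : ar V" "dm V f = unt V" "cd V f = Kh ?b ?Y"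
  using conical_colimD(4-7)[OF colim' j] by (simp_all add: f_def)
  have kk: "k' = Tm ?b ?Y $ f" using k' unfolding f(1) by simp
  let ?Tf = "Tm ?b ?Y $ f"
  have Tf: "(mob T ?b, mob T ?Y, ?Tf) : ar C" using f b Di by simp
  have Hf: "Kpo ?b (?Y, X0, ?H i) $ f : hom V (unt V) (Kh ?b X0)" using f Hi b Di by simp
  have "Kpe (mob T ?b, mob T ?Y, ?Tf) X0 $ Kpo (mob T ?Y) ?h $ Tm ?Y X0 $ ?H i
  = (Kpo (mob T ?b) ?h $ Kpo (mob T ?b) (mob T ?Y, mob T X0, Tm ?Y X0 $ ?H i)) $ ?Tf"
  using vpre_elt[OF Tf, of X0 "Kpo (mob T ?Y) ?h $ Tm ?Y X0 $ ?H i"]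
  vpost_cmp[of "mob T ?b" "mob T ?Y" "mob T X0" "Tm ?Y X0 $ ?H i" X0 h] h Hi Di b by simp
  also have "... = Kpo (mob T ?b) ?h $ (Kpo (mob T ?b) (mob T ?Y, mob T X0, Tm ?Y X0 $ ?H i) $ Tm ?b ?Y) $ f"
  using h Hi Di b f by simp
  also have "Kpo (mob T ?b) (mob T ?Y, mob T X0, Tm ?Y X0 $ ?H i) $ Tm ?b ?Y = Tm ?b X0 $ Kpo ?b (?Y, X0, ?H i)"
  by (rule T.fm_vpost[symmetric]) (use Hi Di b in simp_all)
  also have "Kpo (mob T ?b) ?h $ (Tm ?b X0 $ Kpo ?b (?Y, X0, ?H i)) $ f = e ?b $ Kpo ?b (?Y, X0, ?H i) $ f"
  unfolding e_def using h Hi Di b f by simp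
  also have "... = op_ar ?b (Kpo ?b (?Y, X0, ?H i) $ f)" using hx[OF b Hf] by simp
  also have "... = Kpo (mob T ?b) (?Y, X0, ?H i) $ ext ?b (?Y, mmult T (oo D i)) $ f"
  by (rule op_ar_act[OF Di b kh[OF i]]) (use f in simp)
  also have "... = (Kpo (mob T ?b) (?Y, X0, ?H i) $ Kpo (mob T ?b) (mmult_ar T (oo D i))) $ ?Tf"
  unfolding ext_def using f Hi Di b by simp
  also have "... = Kpe (mob T ?b, mob T ?Y, ?Tf) X0 $ Kpo (mob T ?Y) (?Y, X0, ?H i) $ mmult T (oo D i)"
  using vpre_elt[OF Tf, of X0 "Kpo (mob T ?Y) (?Y, X0, ?H i) $ mmult T (oo D i)"]
  vpost_cmp[of "mob T ?b" "mob T ?Y" ?Y "mmult T (oo D i)" X0 "?H i"] Hi Di b by simp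
  finally show "Kpe (oo \<lparr>oo = (%i. mob T (oo D' i)), oa = (%f. und_ar V (mfun T) (oa D' f))\<rparr> j, mob T ?Y, k') X0 $ Kpo (mob T ?Y) ?h $ Tm ?Y X0 $ ?H i
  = Kpe (oo \<lparr>oo = (%i. mob T (oo D' i)), oa = (%f. und_ar V (mfun T) (oa D' f))\<rparr> j, mob T ?Y, k') X0 $ Kpo (mob T ?Y) (?Y, X0, ?H i) $ mmult T (oo D i)"
  unfolding kk by simp
  qed (use h Hi Di in simp_all)
 qed
 \<comment> \<open>On each leg k: h . T h . T T k = h . T (H i) = H i . mu = h . T k . mu = h . mu .
   T T k.\<close>
 have assoc: "Kpo (mob T (mob T X0)) ?h $ Tm (mob T X0) X0 $ h
  = Kpo (mob T (mob T X0)) ?h $ mmult T X0"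
 proof (rule vpre_jointly_monic[OF T_colim(2)[OF Tdd Tcolim] X0])
  let ?TTD = "\<lparr>oo = (%i. mob T (oo ?TD i)), oa = (%f. und_ar V (mfun T) (oa ?TD f))\<rparr>"
  fix i k' assume i: "i : I" and k': "und_ar V (mfun T) (?Tc i) = (oo ?TTD i, mob T (mob T X0), k')"
  let ?d = "oo D i"
  note ki = ci(2-4)[OF i] and Di = DA[OF i] and Hi = H(1-3)[OF i i]
  let ?t = "Tm ?d X0 $ k i"
  have t: "?t : ar V" "dm V ?t = unt V" "cd V ?t = Kh (mob T ?d) (mob T X0)" using ki Di by simp_all
  have kk: "k' = Tm (mob T ?d) (mob T X0) $ ?t" using k' unfolding Tc[OF i] by simp
  let ?tt = "Tm (mob T ?d) (mob T X0) $ ?t"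
  have tt: "(mob T (mob T ?d), mob T (mob T X0), ?tt) : ar C" using t Di by simp
  have "Kpe (mob T (mob T ?d), mob T (mob T X0), ?tt) X0 $ Kpo (mob T (mob T X0)) ?h $ Tm (mob T X0) X0 $ h
  = Kpo (mob T (mob T ?d)) ?h $ (Kpo (mob T (mob T ?d)) (mob T (mob T X0), mob T X0, Tm (mob T X0) X0 $ h) $ Tm (mob T ?d) (mob T X0)) $ ?t"
  using vpre_elt[OF tt, of X0 "Kpo (mob T (mob T X0)) ?h $ Tm (mob T X0) X0 $ h"]
  vpost_cmp[of "mob T (mob T ?d)" "mob T (mob T X0)" "mob T X0" "Tm (mob T X0) X0 $ h" X0 h] h t ki Di by simp
  also have "Kpo (mob T (mob T ?d)) (mob T (mob T X0), mob T X0, Tm (mob T X0) X0 $ h) $ Tm (mob T ?d) (mob T X0)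
  = Tm (mob T ?d) X0 $ Kpo (mob T ?d) ?h"
  by (rule T.fm_vpost[symmetric]) (use h Di in simp_all)
  also have "Kpo (mob T (mob T ?d)) ?h $ (Tm (mob T ?d) X0 $ Kpo (mob T ?d) ?h) $ ?t
  = Kpo (mob T (mob T ?d)) ?h $ Tm (mob T ?d) X0 $ ?H i"
  using hH[OF i] h Di ki by simp
  also have "... = Kpo (mob T (mob T ?d)) (mob T ?d, X0, ?H i) $ mmult T ?d" by (rule Hassoc[OF i])
  also have "... = (Kpo (mob T (mob T ?d)) ?h $ Kpo (mob T (mob T ?d)) (mob T ?d, mob T X0, ?t)) $ mmult T ?d"
  using vpost_cmp[of "mob T (mob T ?d)" "mob T ?d" "mob T X0" ?t X0 h] hH[OF i] h t ki Di by simp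
  also have "... = Kpo (mob T (mob T ?d)) ?h $ (Kpe (mmult_ar T ?d) (mob T X0) $ Tm ?d X0) $ k i"
  using vpre_elt[of "mob T (mob T ?d)" "mob T ?d" "mmult T ?d" "mob T X0" ?t] h t ki Di by simp
  also have "Kpe (mmult_ar T ?d) (mob T X0) $ Tm ?d X0 = Kpo (mob T (mob T ?d)) (mmult_ar T X0) $ Tm (mob T ?d) (mob T X0) $ Tm ?d X0"
  using mult_natural[of ?d X0] Di by simp
  also have "Kpo (mob T (mob T ?d)) ?h $ (Kpo (mob T (mob T ?d)) (mmult_ar T X0) $ Tm (mob T ?d) (mob T X0) $ Tm ?d X0) $ k i
  = (Kpo (mob T (mob T ?d)) ?h $ Kpo (mob T (mob T ?d)) (mmult_ar T X0)) $ ?tt"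
  using h ki Di by simp
  also have "... = Kpe (mob T (mob T ?d), mob T (mob T X0), ?tt) X0 $ Kpo (mob T (mob T X0)) ?h $ mmult T X0"
  using vpre_elt[OF tt, of X0 "Kpo (mob T (mob T X0)) ?h $ mmult T X0"]
  vpost_cmp[of "mob T (mob T ?d)" "mob T (mob T X0)" "mob T X0" "mmult T X0" X0 h] h t ki Di by simp
  finally show "Kpe (oo ?TTD i, mob T (mob T X0), k') X0 $ Kpo (mob T (mob T X0)) ?h $ Tm (mob T X0) X0 $ h
  = Kpe (oo ?TTD i, mob T (mob T X0), k') X0 $ Kpo (mob T (mob T X0)) ?h $ mmult T X0"
  unfolding kk by simp
 qed (use h in simp_all)
 have EM: "is_EM (X0, h)"
  unfolding is_EM_algebra_def using h unit assoc by simp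
 have "fm F a b = fm (hat (X0, h)) a b" if a: "a : A" and b: "b : A" for a b
 proof (rule ev_ext[of "Kh a X0" "Kh b X0"])
  show "ev V (Kh a X0) (Kh b X0) $ (fm F a b ** idn V (Kh a X0)) = ev V (Kh a X0) (Kh b X0) $ (fm (hat (X0, h)) a b ** idn V (Kh a X0))"
  using hat_ev[OF EM a b] main[OF a b] by (simp add: e_def ext_def)
  show "fm (hat (X0, h)) a b : hom V (Kh b (mob T a)) (ihom V (Kh a X0) (Kh b X0))"
  using vfunctor.fm_hom[OF vfunctor_hat[OF EM], of a b] a b by simp
 qed (use a b in simp_all)
 then show ?thesis using EM by blast
qed

end

text \<open>\<open>op_ar_ext\<close> recovers the extensions of arrows from arities. At the legs k
  of a presentation of X0 these are h . T k, and T preserves the presentation, so they determine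
  h.\<close>

lemma hat_inj:
 assumes X: "is_EM (X0, h)" and X': "is_EM (X0, h')" and eq: "hat (X0, h) = hat (X0, h')"
 shows "h = h'"
proof -
 note d = EM_algebraD(1-4)[OF X] and d' = EM_algebraD(1-4)[OF X']
 obtain I le D c where D: "directed_diagram ka lam C M I le D" "ALL i:I. oo D i : A" and colim: "is_conical_colim V K (poset_cat I le) D X0 c"
  using A_dense[OF d(1)] by (elim exE conjE)
 have F: "vfunctor V Th Vs (hat (X0, h))" "vf_restrict Aop (vf_cmp V xi (hat (X0, h))) = nr X0"
  using vfunctor_hat[OF X] hat_xi[OF X] by simp_all
 have "ext a (X0, h) $ x = ext a (X0, h') $ x" if a: "a : A" and x: "x : hom V (unt V) (Kh a X0)" for a x
 proof -
  have "op_ar (hat (X0, h)) X0 a x = ext a (X0, h) $ x"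
  by (rule op_ar_ext[OF F(1) d(1) F(2) a x]) (use hat_ev[OF X] a X in simp_all)
  moreover have "op_ar (hat (X0, h)) X0 a x = ext a (X0, h') $ x"
  by (rule op_ar_ext[OF F(1) d(1) F(2) a x]) (use hat_ev[OF X'] a X' eq in simp_all)
  ultimately show ?thesis by simp
 qed
 note ex = this
 show ?thesis
 proof (rule vpre_jointly_monic[OF T_colim(2)[OF D(1) colim] d(1)])
  fix i k' assume i: "i : I" and k': "und_ar V (mfun T) (c i) = (oo \<lparr>oo = (%i. mob T (oo D i)), oa = (%f. und_ar V (mfun T) (oa D f))\<rparr> i, mob T X0, k')"
  let ?a = "oo D i"
  have a: "?a : A" using D(2) i by blast
  define x where "x = snd (snd (c i))"
  have x: "c i = (?a, X0, x)" "x : ar V" "dm V x = unt V" "cd V x = Kh ?a X0"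
  using conical_colimD(4-7)[OF colim i] by (simp_all add: x_def)
  have kk: "k' = Tm ?a X0 $ x" using k' unfolding x(1) by simp
  have Tx: "(mob T ?a, mob T X0, Tm ?a X0 $ x) : ar C" using x a d by simp
  have "Kpe (mob T ?a, mob T X0, Tm ?a X0 $ x) X0 $ h = ext ?a (X0, h) $ x"
  using vpre_elt[OF Tx, of X0 h] d a x by (simp add: ext_def)
  also have "... = ext ?a (X0, h') $ x" by (rule ex[OF a]) (use x in simp)
  also have "... = Kpe (mob T ?a, mob T X0, Tm ?a X0 $ x) X0 $ h'"
  using vpre_elt[OF Tx, of X0 h'] d d' a x by (simp add: ext_def)
  finally show "Kpe (oo \<lparr>oo = (%i. mob T (oo D i)), oa = (%f. und_ar V (mfun T) (oa D f))\<rparr> i, mob T X0, k') X0 $ h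
  = Kpe (oo \<lparr>oo = (%i. mob T (oo D i)), oa = (%f. und_ar V (mfun T) (oa D f))\<rparr> i, mob T X0, k') X0 $ h'"
  unfolding kk by simp
 qed (use d d' in simp_all)
qed

end

subsection \<open>Homomorphisms\<close>

context enriched
begin

lemma braid_middle:
 assumes "z : ob V" "q : ob V" "p : ob V"
 shows "swp V q (z @@ p) $ ass V q z p $ (swp V z q ** idn V p)
  = cinv V (ass V z p q) $ (idn V z ** swp V q p) $ ass V z q p"
proof -
 have "(ass V z p q $ swp V q (z @@ p) $ ass V q z p) $ (swp V z q ** idn V p)
  = ((idn V z ** swp V q p) $ ass V z q p $ (swp V q z ** idn V p)) $ (swp V z q ** idn V p)"
  using hexagon[of q z p] assms by simp
 also have "... = (idn V z ** swp V q p) $ ass V z q p" using assms by simp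
 finally have "ass V z p q $ swp V q (z @@ p) $ ass V q z p $ (swp V z q ** idn V p) = (idn V z ** swp V q p) $ ass V z q p"
  using assms by simp
 then have "cinv V (ass V z p q) $ ass V z p q $ swp V q (z @@ p) $ ass V q z p $ (swp V z q ** idn V p)
  = cinv V (ass V z p q) $ (idn V z ** swp V q p) $ ass V z q p" by (simp only:)
 then show ?thesis using assms by simp
qed

text \<open>Transposition turns the naturality square of a wedge into an equation in K. Both sides
  acquire the same invertible reshuffling \<open>?sg\<close>, which cancels. The object
  \<open>m\<close> will be \<open>a\<close> for the nerve and T a for algebras of the
  theory.\<close>

lemma wedge_square_iff:
 assumes ob: "a : vob K" "b : vob K" "m : vob K" "x : vob K" "y : vob K"
  and eX: "eX : hom V (vhom K a x) (vhom K m x)" and eY: "eY : hom V (vhom K a y) (vhom K m y)"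
  and FX: "FX : hom V (vhom K b m) (ihom V (vhom K a x) (vhom K b x))" and FY: "FY : hom V (vhom K b m) (ihom V (vhom K a y) (vhom K b y))"
  and evX: "ev V (vhom K a x) (vhom K b x) $ (FX ** idn V (vhom K a x)) = vcmp K b m x $ (eX ** idn V (vhom K b m)) $ swp V (vhom K b m) (vhom K a x)"
  and evY: "ev V (vhom K a y) (vhom K b y) $ (FY ** idn V (vhom K a y)) = vcmp K b m y $ (eY ** idn V (vhom K b m)) $ swp V (vhom K b m) (vhom K a y)"
  and t: "t : hom V z (vhom K x y)"
 shows "vcmp Vs (vhom K a x) (vhom K a y) (vhom K b y) $ (FY ** (fm (vrep V K a) x y $ t)) $ swp V z (vhom K b m)
  = vcmp Vs (vhom K a x) (vhom K b x) (vhom K b y) $ ((fm (vrep V K b) x y $ t) ** FX)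
  \<longleftrightarrow> vcmp K b m y $ ((eY $ vcmp K a x y $ (t ** idn V (vhom K a x))) ** idn V (vhom K b m))
  = vcmp K b m y $ ((vcmp K m x y $ (t ** eX)) ** idn V (vhom K b m))" (is "?L = ?R \<longleftrightarrow> ?LL = ?RR")
proof -
 let ?Q = "vhom K b m" and ?P = "vhom K a x"
 let ?sg = "cinv V (ass V z ?P ?Q) $ (idn V z ** swp V ?Q ?P) $ ass V z ?Q ?P"
 let ?s = "vcmp K a x y $ (t ** idn V ?P)"
 note [simp] = ob
 have z [simp]: "z : ob V" using t by auto
 have [simp]: "t : ar V" "dm V t = z" "cd V t = vhom K x y" "eX : ar V" "dm V eX = ?P" "cd V eX = vhom K m x"
  "eY : ar V" "dm V eY = vhom K a y" "cd V eY = vhom K m y"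
  "FX : ar V" "dm V FX = ?Q" "cd V FX = ihom V (vhom K a x) (vhom K b x)" "FY : ar V" "dm V FY = ?Q" "cd V FY = ihom V (vhom K a y) (vhom K b y)"
  using t eX eY FX FY by simp_all
 have sg: "is_iso V ?sg" by simp
 have sgh: "dm V ?sg = (z @@ ?Q) @@ ?P" "cd V ?sg = (z @@ ?P) @@ ?Q" by simp_all
 have Lh: "?L : hom V (z @@ ?Q) (ihom V ?P (vhom K b y))" and Rh: "?R : hom V (z @@ ?Q) (ihom V ?P (vhom K b y))" by simp_all
 have "ev V ?P (vhom K b y) $ (?L ** idn V ?P)
  = (ev V ?P (vhom K b y) $ ((vcmp Vs ?P (vhom K a y) (vhom K b y) $ (FY ** (fm (vrep V K a) x y $ t))) ** idn V ?P)) $ (swp V z ?Q ** idn V ?P)"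
  by simp
 also have "ev V ?P (vhom K b y) $ ((vcmp Vs ?P (vhom K a y) (vhom K b y) $ (FY ** (fm (vrep V K a) x y $ t))) ** idn V ?P)
  = ev V (vhom K a y) (vhom K b y) $ (FY ** (ev V ?P (vhom K a y) $ ((fm (vrep V K a) x y $ t) ** idn V ?P))) $ ass V ?Q z ?P"
  using ev_self_vcmp[of ?P "vhom K a y" "vhom K b y" FY "fm (vrep V K a) x y $ t" "idn V ?P"] by simp
 also have "ev V ?P (vhom K a y) $ ((fm (vrep V K a) x y $ t) ** idn V ?P) = ?s" by (rule ev_vrep) simp_all
 also have "ev V (vhom K a y) (vhom K b y) $ (FY ** ?s) $ ass V ?Q z ?P = (ev V (vhom K a y) (vhom K b y) $ (FY ** idn V (vhom K a y))) $ (idn V ?Q ** ?s) $ ass V ?Q z ?P"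
  by simp
 also have "... = vcmp K b m y $ (eY ** idn V ?Q) $ (swp V ?Q (vhom K a y) $ (idn V ?Q ** ?s)) $ ass V ?Q z ?P"
  unfolding evY by simp
 also have "swp V ?Q (vhom K a y) $ (idn V ?Q ** ?s) = (?s ** idn V ?Q) $ swp V ?Q (z @@ ?P)" by (simp add: swp_nat)
 also have "(vcmp K b m y $ (eY ** idn V ?Q) $ ((?s ** idn V ?Q) $ swp V ?Q (z @@ ?P)) $ ass V ?Q z ?P) $ (swp V z ?Q ** idn V ?P)
  = ?LL $ (swp V ?Q (z @@ ?P) $ ass V ?Q z ?P $ (swp V z ?Q ** idn V ?P))" by simp
 finally have 1: "ev V ?P (vhom K b y) $ (?L ** idn V ?P) = ?LL $ ?sg" unfolding braid_middle[OF z vhom_ob[OF ob(2,3)] vhom_ob[OF ob(1,4)]] .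
 have "ev V ?P (vhom K b y) $ (?R ** idn V ?P)
  = ev V (vhom K b x) (vhom K b y) $ ((fm (vrep V K b) x y $ t) ** (ev V ?P (vhom K b x) $ (FX ** idn V ?P))) $ ass V z ?Q ?P"
  using ev_self_vcmp[of ?P "vhom K b x" "vhom K b y" "fm (vrep V K b) x y $ t" FX "idn V ?P"] by simp
 also have "... = (ev V (vhom K b x) (vhom K b y) $ ((fm (vrep V K b) x y $ t) ** (vcmp K b m x $ (eX ** idn V ?Q) $ swp V ?Q ?P))) $ ass V z ?Q ?P"
  unfolding evX by simp
 also have "ev V (vhom K b x) (vhom K b y) $ ((fm (vrep V K b) x y $ t) ** (vcmp K b m x $ (eX ** idn V ?Q) $ swp V ?Q ?P))
  = vcmp K b x y $ (t ** (vcmp K b m x $ (eX ** idn V ?Q) $ swp V ?Q ?P))" by (rule ev_vrep) simp_all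
 also have "... = (vcmp K b x y $ (t ** (vcmp K b m x $ (eX ** idn V ?Q)))) $ (idn V z ** swp V ?Q ?P)" by simp
 also have "vcmp K b x y $ (t ** (vcmp K b m x $ (eX ** idn V ?Q))) = ?RR $ cinv V (ass V z ?P ?Q)"
  using vassoc[of b m x y "idn V ?Q" eX t] by simp
 finally have 2: "ev V ?P (vhom K b y) $ (?R ** idn V ?P) = ?RR $ ?sg" by simp
 have h0: "?LL : ar V" "?RR : ar V" "dm V ?LL = cd V ?sg" "dm V ?RR = cd V ?sg" unfolding sgh by simp_all
 have Pb: "?P : ob V" "vhom K b y : ob V" by simp_all
 show ?thesis
 proof
  assume "?L = ?R"
  then have "?LL $ ?sg = ?RR $ ?sg" unfolding 1[symmetric] 2[symmetric] by (rule arg_cong)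
  then show "?LL = ?RR" by (rule iso_epi[OF sg _ h0])
 next
  assume "?LL = ?RR"
  then have "ev V ?P (vhom K b y) $ (?L ** idn V ?P) = ev V ?P (vhom K b y) $ (?R ** idn V ?P)" unfolding 1 2 by (rule arg_cong)
  then show "?L = ?R" by (rule ev_ext[OF _ Lh Rh Pb])
 qed
qed

end

section \<open>Objects of natural transformations between functors into the base\<close>

context complete_base
begin

lemma wedge_hom:
 assumes "natural_wedge V D Vs F G x p" "d : vob D"
 shows "p d : hom V x (ihom V (fo F d) (fo G d))"
 using assms unfolding natural_wedge_def self_simps by blast

lemma wedge_sq:
 assumes "natural_wedge V D Vs F G x p" "d : vob D" "d' : vob D"
 shows "vcmp Vs (fo F d) (fo G d) (fo G d') $ (fm G d d' ** p d) $ swp V x (vhom D d d')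
  = vcmp Vs (fo F d) (fo F d') (fo G d') $ (p d' ** fm F d d')"
 using assms unfolding natural_wedge_def by blast

lemma wedgeI:
 assumes "x : ob V" "!!d. d : vob D ==> p d : hom V x (ihom V (fo F d) (fo G d))"
  "!!d d'. d : vob D ==> d' : vob D ==> vcmp Vs (fo F d) (fo G d) (fo G d') $ (fm G d d' ** p d) $ swp V x (vhom D d d')
  = vcmp Vs (fo F d) (fo F d') (fo G d') $ (p d' ** fm F d d')"
 shows "natural_wedge V D Vs F G x p"
 unfolding natural_wedge_def self_simps by (intro conjI ballI assms)

lemma wedge_ob: "natural_wedge V D Vs F G x p ==> x : ob V"
 by (simp add: natural_wedge_def)

lemma wedge_cong:
 assumes "natural_wedge V D Vs F G x p" "!!d. d : vob D ==> p d = q d"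
 shows "natural_wedge V D Vs F G x q"
proof (rule wedgeI)
 show "x : ob V" by (rule wedge_ob[OF assms(1)])
 show "q d : hom V x (ihom V (fo F d) (fo G d))" if "d : vob D" for d
  using wedge_hom[OF assms(1) that] unfolding assms(2)[OF that] .
 show "vcmp Vs (fo F d) (fo G d) (fo G d') $ (fm G d d' ** q d) $ swp V x (vhom D d d')
  = vcmp Vs (fo F d) (fo F d') (fo G d') $ (q d' ** fm F d d')" if "d : vob D" "d' : vob D" for d d'
  using wedge_sq[OF assms(1) that] unfolding assms(2)[OF that(1)] assms(2)[OF that(2)] .
qed

lemma wedge_pre:
 assumes DF: "vcategory V D" "vfunctor V D Vs F" "vfunctor V D Vs G"
  and w: "natural_wedge V D Vs F G x p" and u: "u : hom V y x"
 shows "natural_wedge V D Vs F G y (%d. p d $ u)"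
proof (rule wedgeI)
 show "y : ob V" using u by auto
 show "p d $ u : hom V y (ihom V (fo F d) (fo G d))" if "d : vob D" for d using wedge_hom[OF w that] u by simp
 fix d d' assume d: "d : vob D" "d' : vob D"
 show "vcmp Vs (fo F d) (fo G d) (fo G d') $ (fm G d d' ** (p d $ u)) $ swp V y (vhom D d d')
  = vcmp Vs (fo F d) (fo F d') (fo G d') $ ((p d' $ u) ** fm F d d')"
  unfolding natural_wedge_precompose(1)[OF DF d wedge_hom[OF w d(1)] u wedge_hom[OF w d(2)]]
  natural_wedge_precompose(2)[OF DF d wedge_hom[OF w d(1)] u wedge_hom[OF w d(2)]] wedge_sq[OF w d] ..
qed

lemma wedge_vid:
 assumes D: "vcategory V D" and F: "vfunctor V D Vs F"
 shows "natural_wedge V D Vs F F (unt V) (%d. vid Vs (fo F d))"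
proof (rule wedgeI)
 interpret F: enriched_functor V D "self V" F by (intro enriched_functorI enrichedI D F enriched_self)
 have ob [simp]: "fo F d : ob V" if "d : vob D" for d using F.fo_vob[OF that] by simp
 show "vid Vs (fo F d) : hom V (unt V) (ihom V (fo F d) (fo F d))" if "d : vob D" for d using that by simp
 fix d d' assume d: "d : vob D" "d' : vob D"
 have f: "fm F d d' : ar V" "dm V (fm F d d') = vhom D d d'" "cd V (fm F d d') = ihom V (fo F d) (fo F d')" using F.fm_simps[OF d] by simp_all
 have vh: "vhom D d d' : ob V" using dm_ob[OF f(1)] f(2) by simp
 have "vcmp Vs (fo F d) (fo F d) (fo F d') $ (fm F d d' ** vid Vs (fo F d)) = fm F d d' $ run V (vhom D d d')"
  using self.vid_right[of "fo F d" "fo F d'" "fm F d d'"] f d by simp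
 then have "vcmp Vs (fo F d) (fo F d) (fo F d') $ (fm F d d' ** vid Vs (fo F d)) $ swp V (unt V) (vhom D d d') = (fm F d d' $ run V (vhom D d d')) $ swp V (unt V) (vhom D d d')"
  by (rule extend) (use f d vh in simp_all)
 also have "... = fm F d d' $ lun V (vhom D d d')" using f vh by (simp add: run_swp)
 also have "... = vcmp Vs (fo F d) (fo F d') (fo F d') $ (vid Vs (fo F d') ** fm F d d')"
  using self.vid_left[of "fo F d" "fo F d'" "fm F d d'"] f d by simp
 finally show "vcmp Vs (fo F d) (fo F d) (fo F d') $ (fm F d d' ** vid Vs (fo F d)) $ swp V (unt V) (vhom D d d')
  = vcmp Vs (fo F d) (fo F d') (fo F d') $ (vid Vs (fo F d') ** fm F d d')" .
qed simp

text \<open>Vertical composition of transformations: the naturality squares of \<open>p\<close> and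
  \<open>q\<close> are pasted by associativity, and \<open>swp_tensor_left\<close> splits the swap
  past the product of the vertices.\<close>

lemma wedge_vcmp:
 assumes D: "vcategory V D" and FGH: "vfunctor V D Vs F" "vfunctor V D Vs G" "vfunctor V D Vs H"
  and p: "natural_wedge V D Vs F G x p" and q: "natural_wedge V D Vs G H y q"
 shows "natural_wedge V D Vs F H (y @@ x) (%d. vcmp Vs (fo F d) (fo G d) (fo H d) $ (q d ** p d))"
proof (rule wedgeI)
 interpret F: enriched_functor V D "self V" F by (intro enriched_functorI enrichedI D FGH enriched_self)
 interpret G: enriched_functor V D "self V" G by (intro enriched_functorI enrichedI D FGH enriched_self)
 interpret H: enriched_functor V D "self V" H by (intro enriched_functorI enrichedI D FGH enriched_self)
 have xy [simp]: "x : ob V" "y : ob V" using wedge_ob p q by blast+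
 show "y @@ x : ob V" by simp
 have ob: "fo F d : ob V" "fo G d : ob V" "fo H d : ob V" if "d : vob D" for d
  using F.fo_vob[OF that] G.fo_vob[OF that] H.fo_vob[OF that] by simp_all
 have pq: "p d : ar V" "dm V (p d) = x" "cd V (p d) = ihom V (fo F d) (fo G d)" "q d : ar V" "dm V (q d) = y" "cd V (q d) = ihom V (fo G d) (fo H d)"
  if "d : vob D" for d using wedge_hom[OF p that] wedge_hom[OF q that] by simp_all
 show "vcmp Vs (fo F d) (fo G d) (fo H d) $ (q d ** p d) : hom V (y @@ x) (ihom V (fo F d) (fo H d))" if "d : vob D" for d
  using pq[OF that] ob[OF that] by simp
 fix d d' assume d: "d : vob D" "d' : vob D"
 let ?Q = "vhom D d d'"
 have fF: "fm F d d' : ar V" "dm V (fm F d d') = ?Q" "cd V (fm F d d') = ihom V (fo F d) (fo F d')" using F.fm_simps[OF d] by simp_all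
 have fG: "fm G d d' : ar V" "dm V (fm G d d') = ?Q" "cd V (fm G d d') = ihom V (fo G d) (fo G d')" using G.fm_simps[OF d] by simp_all
 have fH: "fm H d d' : ar V" "dm V (fm H d d') = ?Q" "cd V (fm H d d') = ihom V (fo H d) (fo H d')" using H.fm_simps[OF d] by simp_all
 have Q [simp]: "?Q : ob V" using dm_ob[OF fF(1)] fF(2) by simp
 note [simp] = ob[OF d(1)] ob[OF d(2)] pq[OF d(1)] pq[OF d(2)] fF fG fH
 let ?c = "%a b c. vcmp Vs a b c"
 have "?c (fo F d) (fo F d') (fo H d') $ ((?c (fo F d') (fo G d') (fo H d') $ (q d' ** p d')) ** fm F d d')
  = ?c (fo F d) (fo G d') (fo H d') $ (q d' ** (?c (fo F d) (fo F d') (fo G d') $ (p d' ** fm F d d'))) $ ass V y x ?Q"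
  using self.vassoc[of "fo F d" "fo F d'" "fo G d'" "fo H d'" "fm F d d'" "p d'" "q d'"] by simp
 also have "... = (?c (fo F d) (fo G d') (fo H d') $ (q d' ** (?c (fo F d) (fo G d) (fo G d') $ (fm G d d' ** p d)))) $ (idn V y ** swp V x ?Q) $ ass V y x ?Q"
  unfolding wedge_sq[OF p d, symmetric] by simp
 also have "?c (fo F d) (fo G d') (fo H d') $ (q d' ** (?c (fo F d) (fo G d) (fo G d') $ (fm G d d' ** p d)))
  = ?c (fo F d) (fo G d) (fo H d') $ ((?c (fo G d) (fo G d') (fo H d') $ (q d' ** fm G d d')) ** p d) $ cinv V (ass V y ?Q x)"
  using self.vassoc[of "fo F d" "fo G d" "fo G d'" "fo H d'" "p d" "fm G d d'" "q d'"]
  extend[of "?c (fo F d) (fo G d) (fo H d')" "(?c (fo G d) (fo G d') (fo H d') $ (q d' ** fm G d d')) ** p d" _ "cinv V (ass V y ?Q x)"] by simp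
 also have "(?c (fo G d) (fo G d') (fo H d') $ (q d' ** fm G d d')) ** p d = ((?c (fo G d) (fo H d) (fo H d') $ (fm H d d' ** q d)) ** p d) $ (swp V y ?Q ** idn V x)"
  unfolding wedge_sq[OF q d, symmetric] by simp
 also have "(?c (fo F d) (fo G d) (fo H d') $ (((?c (fo G d) (fo H d) (fo H d') $ (fm H d d' ** q d)) ** p d) $ (swp V y ?Q ** idn V x)) $ cinv V (ass V y ?Q x)) $ (idn V y ** swp V x ?Q) $ ass V y x ?Q
  = (?c (fo F d) (fo G d) (fo H d') $ ((?c (fo G d) (fo H d) (fo H d') $ (fm H d d' ** q d)) ** p d)) $ (swp V y ?Q ** idn V x) $ cinv V (ass V y ?Q x) $ (idn V y ** swp V x ?Q) $ ass V y x ?Q"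
  by simp
 also have "?c (fo F d) (fo G d) (fo H d') $ ((?c (fo G d) (fo H d) (fo H d') $ (fm H d d' ** q d)) ** p d)
  = ?c (fo F d) (fo H d) (fo H d') $ (fm H d d' ** (?c (fo F d) (fo G d) (fo H d) $ (q d ** p d))) $ ass V ?Q y x"
  using self.vassoc[of "fo F d" "fo G d" "fo H d" "fo H d'" "p d" "q d" "fm H d d'"] by simp
 finally show "?c (fo F d) (fo H d) (fo H d') $ (fm H d d' ** (?c (fo F d) (fo G d) (fo H d) $ (q d ** p d))) $ swp V (y @@ x) ?Q
  = ?c (fo F d) (fo F d') (fo H d') $ ((?c (fo F d') (fo G d') (fo H d') $ (q d' ** p d')) ** fm F d d')"
  unfolding swp_tensor_left[OF xy Q] by simp
qed

context
 fixes D :: "('d, 'o, 'a) vcat"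
 assumes D: "vcategory V D" "small ka (vob D)"
begin

abbreviation "fn F \<equiv> vfunctor V D Vs F"
abbreviation "nat_ob F G \<equiv> fst (natobj V D Vs F G)"
abbreviation "nat_pr F G \<equiv> natobj_proj V D Vs F G"

text \<open>Turns the choice in \<open>natobj\<close> into a universal property; the end exists
  because \<open>D\<close> is small.\<close>

lemma natobj_universal:
 assumes "fn F" "fn G"
 shows "natural_wedge V D Vs F G (nat_ob F G) (nat_pr F G)"
  "natural_wedge V D Vs F G x q ==> EX! u. u : hom V x (nat_ob F G) & (ALL d:vob D. nat_pr F G d $ u = q d)"
proof -
 obtain e p where "is_natobj V D Vs F G e p" using natobj_exists[OF D assms] by (elim exE)
 then have "case (e, p) of (e, p) => is_natobj V D Vs F G e p" by simp
 from someI[of "%(e, p). is_natobj V D Vs F G e p", OF this]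
 have n: "is_natobj V D Vs F G (nat_ob F G) (nat_pr F G)" unfolding natobj_def by (simp add: split_beta)
 then show "natural_wedge V D Vs F G (nat_ob F G) (nat_pr F G)" by (simp add: is_natobj_def)
 show "EX! u. u : hom V x (nat_ob F G) & (ALL d:vob D. nat_pr F G d $ u = q d)" if w: "natural_wedge V D Vs F G x q"
  using n w unfolding is_natobj_def by blast
qed

lemma nat_pr_simps:
 assumes "fn F" "fn G"
 shows "nat_ob F G : ob V" "d : vob D ==> nat_pr F G d : ar V" "d : vob D ==> dm V (nat_pr F G d) = nat_ob F G"
  "d : vob D ==> cd V (nat_pr F G d) = ihom V (fo F d) (fo G d)"
 using wedge_ob[OF natobj_universal(1)[OF assms]] wedge_hom[OF natobj_universal(1)[OF assms]] by simp_all

lemma natobj_ext: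
 assumes FG: "fn F" "fn G" and uv: "u : hom V x (nat_ob F G)" "v : hom V x (nat_ob F G)"
  and eq: "!!d. d : vob D ==> nat_pr F G d $ u = nat_pr F G d $ v"
 shows "u = v"
proof -
 have "natural_wedge V D Vs F G x (%d. nat_pr F G d $ u)" by (rule wedge_pre[OF D(1) FG natobj_universal(1)[OF FG] uv(1)])
 from natobj_universal(2)[OF FG this] show ?thesis by (rule ex1_unique) (use uv eq in auto)
qed

lemma vfun_vid:
 assumes F: "fn F"
 shows "vid (vfun_cat V D Vs) F : hom V (unt V) (nat_ob F F)"
  "d : vob D ==> nat_pr F F d $ vid (vfun_cat V D Vs) F = vid Vs (fo F d)"
 using theI'[OF natobj_universal(2)[OF F F wedge_vid[OF D(1) F]]] by (simp_all add: vfun_cat_def del: hom_iff)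

lemma vfun_vcmp:
 assumes FGH: "fn F" "fn G" "fn H"
 shows "vcmp (vfun_cat V D Vs) F G H : hom V (nat_ob G H @@ nat_ob F G) (nat_ob F H)"
  "d : vob D ==> nat_pr F H d $ vcmp (vfun_cat V D Vs) F G H
  = vcmp Vs (fo F d) (fo G d) (fo H d) $ (nat_pr G H d ** nat_pr F G d)"
 using theI'[OF natobj_universal(2)[OF FGH(1,3) wedge_vcmp[OF D(1) FGH natobj_universal(1)[OF FGH(1,2)] natobj_universal(1)[OF FGH(2,3)]]]]
 by (simp_all add: vfun_cat_def del: hom_iff)

end

end

section \<open>The hom-objects of the category of algebras\<close>

context generated_monad
begin

lemma Th_small: "small ka (vob Th)" and Aop_small: "small ka (vob Aop)"
 using A_small by simp_all

lemmas Th_wedge = cb.natobj_universal[OF vcategory_Th Th_small]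
lemmas Aop_wedge = cb.natobj_universal[OF vcategory_Aop Aop_small]

abbreviation "Th_ob F G \<equiv> fst (natobj V Th Vs F G)"
abbreviation "Th_pr F G \<equiv> natobj_proj V Th Vs F G"
abbreviation "Aop_ob F G \<equiv> fst (natobj V Aop Vs F G)"
abbreviation "Aop_pr F G \<equiv> natobj_proj V Aop Vs F G"
abbreviation "N \<equiv> nerve V K A"
abbreviation "PC \<equiv> vf_precompose V Aop Th Vs xi"

text \<open>The case of \<open>wedge_square_iff\<close> with \<open>m = a\<close> and identities in
  place of the extensions, where both sides are the same composite.\<close>

lemma nr_wedge:
 assumes x: "x : vob K" and y: "y : vob K"
 shows "natural_wedge V Aop Vs (nr x) (nr y) (Kh x y) (%a. fm (vrep V K a) x y)"
proof (rule cb.wedgeI)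
 show "Kh x y : ob V" using x y by simp
 show "fm (vrep V K a) x y : hom V (Kh x y) (ihom V (fo (nr x) a) (fo (nr y) a))" if "a : vob Aop" for a
  using that x y by simp
 fix a b assume "a : vob Aop" "b : vob Aop"
 then have a: "a : A" and b: "b : A" by simp_all
 have nh: "fm (nr k) a b : hom V (Kh b a) (ihom V (Kh a k) (Kh b k))" if "k : vob K" for k
  using vfunctor.fm_hom[OF vfunctor_nr[OF that], of a b] a b by simp
 have nev: "ev V (Kh a k) (Kh b k) $ (fm (nr k) a b ** idn V (Kh a k)) = vcmp K b a k $ (idn V (Kh a k) ** idn V (Kh b a)) $ swp V (Kh b a) (Kh a k)"
  if "k : vob K" for k unfolding nr_ev[OF a b that] using a b that by simp
 have i: "idn V (Kh x y) : hom V (Kh x y) (Kh x y)" "idn V (Kh a x) : hom V (Kh a x) (Kh a x)" "idn V (Kh a y) : hom V (Kh a y) (Kh a y)"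
  using x y a by simp_all
 have "vcmp Vs (Kh a x) (Kh a y) (Kh b y) $ (fm (nr y) a b ** (fm (vrep V K a) x y $ idn V (Kh x y))) $ swp V (Kh x y) (Kh b a)
  = vcmp Vs (Kh a x) (Kh b x) (Kh b y) $ ((fm (vrep V K b) x y $ idn V (Kh x y)) ** fm (nr x) a b)"
  by (rule wedge_square_iff[OF A_ob[OF a] A_ob[OF b] A_ob[OF a] x y i(2,3) nh[OF x] nh[OF y] nev[OF x] nev[OF y] i(1), THEN iffD2])
  (use a b x y in simp)
 then show "vcmp Vs (fo (nr x) a) (fo (nr y) a) (fo (nr y) b) $ (fm (nr y) a b ** fm (vrep V K a) x y) $ swp V (Kh x y) (vhom Aop a b)
  = vcmp Vs (fo (nr x) a) (fo (nr x) b) (fo (nr y) b) $ (fm (vrep V K b) x y ** fm (nr x) a b)"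
  using a b x y by (simp del: nr_simps(2))
qed

lemma nerve_fm:
 assumes "x : vob K" "y : vob K"
 shows "fm N x y : hom V (Kh x y) (Aop_ob (nr x) (nr y))" "a : A ==> Aop_pr (nr x) (nr y) a $ fm N x y = fm (vrep V K a) x y"
 using theI'[OF Aop_wedge(2)[OF vfunctor_nr[OF assms(1)] vfunctor_nr[OF assms(2)] nr_wedge[OF assms]]]
 by (simp_all add: nerve_def Let_def nr_def[symmetric] vfun_cat_def del: hom_iff)

definition is_alg :: "'k \<times> ('k, 'o, 'a) vfun => bool" where
 "is_alg p \<longleftrightarrow> fst p : vob K & vfunctor V Th Vs (snd p) & vf_restrict Th (snd p) = snd p &
  vf_restrict Aop (vf_cmp V xi (snd p)) = nr (fst p)"

lemma is_algD:
 assumes "is_alg p"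
 shows "fst p : vob K" "vfunctor V Th Vs (snd p)" "vf_restrict Th (snd p) = snd p" "vf_restrict Aop (vf_cmp V xi (snd p)) = nr (fst p)"
 using assms by (simp_all add: is_alg_def)

text \<open>The components stay the same because \<open>xi\<close> is the identity on objects;
  naturality over the arities is naturality at the operations that \<open>xi\<close>
  provides.\<close>

lemma precompose_wedge:
 assumes p: "is_alg p" and q: "is_alg q"
 shows "natural_wedge V Aop Vs (nr (fst p)) (nr (fst q)) (Th_ob (snd p) (snd q)) (Th_pr (snd p) (snd q))"
proof (rule cb.wedgeI)
 note P = is_algD[OF p] and Q = is_algD[OF q]
 let ?F = "snd p" and ?G = "snd q"
 let ?x = "fst p" and ?y = "fst q" and ?w = "Th_pr ?F ?G" and ?z = "Th_ob ?F ?G"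
 note w = Th_wedge(1)[OF P(2) Q(2)]
 show z: "?z : ob V" by (rule cb.wedge_ob[OF w])
 have fo: "fo ?F a = Kh a ?x" "fo ?G a = Kh a ?y" if "a : A" for a
  using F_fo[OF P(2,1,4) that] F_fo[OF Q(2,1,4) that] by simp_all
 have wh: "?w a : ar V" "dm V (?w a) = ?z" "cd V (?w a) = ihom V (Kh a ?x) (Kh a ?y)" if "a : A" for a
  using cb.wedge_hom[OF w, of a] fo[OF that] that by simp_all
 show "?w a : hom V ?z (ihom V (fo (nr ?x) a) (fo (nr ?y) a))" if "a : vob Aop" for a using that wh[of a] by simp
 fix a b assume "a : vob Aop" "b : vob Aop"
 then have a: "a : A" and b: "b : A" by simp_all
 let ?e = "Kpo b (munit_ar T a)"
 have e: "?e : ar V" "dm V ?e = Kh b a" "cd V ?e = Kh b (mob T a)" using a b by simp_all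
 note ff = F_fm[OF P(2,1,4) a b] and gg = F_fm[OF Q(2,1,4) a b]
 have sq: "vcmp Vs (Kh a ?x) (Kh a ?y) (Kh b ?y) $ (fm ?G a b ** ?w a) $ swp V ?z (Kh b (mob T a))
  = vcmp Vs (Kh a ?x) (Kh b ?x) (Kh b ?y) $ (?w b ** fm ?F a b)"
  using cb.wedge_sq[OF w, of a b] a b fo by simp
 have "vcmp Vs (Kh a ?x) (Kh a ?y) (Kh b ?y) $ ((fm ?G a b $ ?e) ** ?w a) $ swp V ?z (Kh b a)
  = vcmp Vs (Kh a ?x) (Kh a ?y) (Kh b ?y) $ (fm ?G a b ** ?w a) $ (?e ** idn V ?z) $ swp V ?z (Kh b a)"
  using e gg wh[OF a] a b z P(1) Q(1) by simp
 also have "(?e ** idn V ?z) $ swp V ?z (Kh b a) = swp V ?z (Kh b (mob T a)) $ (idn V ?z ** ?e)"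
  using e z a b by (simp add: swp_nat)
 also have "vcmp Vs (Kh a ?x) (Kh a ?y) (Kh b ?y) $ (fm ?G a b ** ?w a) $ swp V ?z (Kh b (mob T a)) $ (idn V ?z ** ?e)
  = (vcmp Vs (Kh a ?x) (Kh a ?y) (Kh b ?y) $ (fm ?G a b ** ?w a) $ swp V ?z (Kh b (mob T a))) $ (idn V ?z ** ?e)"
  using e gg wh[OF a] a b z P(1) Q(1) by simp
 also have "... = vcmp Vs (Kh a ?x) (Kh b ?x) (Kh b ?y) $ (?w b ** (fm ?F a b $ ?e))"
  unfolding sq using e ff wh[OF b] a b z P(1) Q(1) by simp
 finally show "vcmp Vs (fo (nr ?x) a) (fo (nr ?y) a) (fo (nr ?y) b) $ (fm (nr ?y) a b ** ?w a) $ swp V ?z (vhom Aop a b)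
  = vcmp Vs (fo (nr ?x) a) (fo (nr ?x) b) (fo (nr ?y) b) $ (?w b ** fm (nr ?x) a b)"
  using a b unfolding F_xi[OF P(2,1,4) a b] F_xi[OF Q(2,1,4) a b] by (simp del: nr_simps(2))
qed

lemma precompose_fm:
 assumes p: "is_alg p" and q: "is_alg q"
 shows "fm PC (snd p) (snd q) : hom V (Th_ob (snd p) (snd q)) (Aop_ob (nr (fst p)) (nr (fst q)))"
  "a : A ==> Aop_pr (nr (fst p)) (nr (fst q)) a $ fm PC (snd p) (snd q) = Th_pr (snd p) (snd q) a"
 using theI'[OF Aop_wedge(2)[OF vfunctor_nr[OF is_algD(1)[OF p]] vfunctor_nr[OF is_algD(1)[OF q]] precompose_wedge[OF p q]]]
 by (simp_all add: vf_precompose_def Let_def vfun_cat_def is_algD(4)[OF p] is_algD(4)[OF q] xi_def[THEN arg_cong, of fo] del: hom_iff)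

text \<open>Arrows into an object of transformations are equal if their components are, and the
  components of the nerve and of restriction along \<open>xi\<close> are known.\<close>

lemma nerve_precompose_iff:
 assumes p: "is_alg p" and q: "is_alg q" and h: "h : hom V z (Kh (fst p) (fst q))" and k: "k : hom V z (Th_ob (snd p) (snd q))"
 shows "fm N (fst p) (fst q) $ h = fm PC (snd p) (snd q) $ k \<longleftrightarrow> (ALL a:A. fm (vrep V K a) (fst p) (fst q) $ h = Th_pr (snd p) (snd q) a $ k)"
proof -
 let ?x = "fst p" and ?y = "fst q"
 note x = is_algD(1)[OF p] and y = is_algD(1)[OF q]
 note n = nerve_fm[OF x y] and c = precompose_fm[OF p q]
 note pr = cb.nat_pr_simps(2-4)[OF vcategory_Aop Aop_small vfunctor_nr[OF x] vfunctor_nr[OF y]]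
 have l: "Aop_pr (nr ?x) (nr ?y) a $ fm N ?x ?y $ h = fm (vrep V K a) ?x ?y $ h" if a: "a : A" for a
  by (rule extend[OF n(2)[OF a]]) (use n(1) h pr[of a] a in simp_all)
 have r: "Aop_pr (nr ?x) (nr ?y) a $ fm PC (snd p) (snd q) $ k = Th_pr (snd p) (snd q) a $ k" if a: "a : A" for a
  by (rule extend[OF c(2)[OF a]]) (use c(1) k pr[of a] a in simp_all)
 show ?thesis
 proof
  assume "fm N ?x ?y $ h = fm PC (snd p) (snd q) $ k"
  then show "ALL a:A. fm (vrep V K a) ?x ?y $ h = Th_pr (snd p) (snd q) a $ k" using l r by metis
 next
  assume eq: "ALL a:A. fm (vrep V K a) ?x ?y $ h = Th_pr (snd p) (snd q) a $ k"
  show "fm N ?x ?y $ h = fm PC (snd p) (snd q) $ k"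
  by (rule cb.natobj_ext[OF vcategory_Aop Aop_small vfunctor_nr[OF x] vfunctor_nr[OF y]]) (use n(1) c(1) h k l r eq in simp_all)
 qed
qed

definition PP where "PP p q = fst (chosen_pullback V (fm N (fst p) (fst q)) (fm PC (snd p) (snd q)))"
definition QQ where "QQ p q = snd (chosen_pullback V (fm N (fst p) (fst q)) (fm PC (snd p) (snd q)))"

lemma PP_QQ:
 assumes p: "is_alg p" and q: "is_alg q"
 shows "PP p q : ar V" "QQ p q : ar V" "dm V (QQ p q) = dm V (PP p q)" "cd V (PP p q) = Kh (fst p) (fst q)" "cd V (QQ p q) = Th_ob (snd p) (snd q)"
  "a : A ==> fm (vrep V K a) (fst p) (fst q) $ PP p q = Th_pr (snd p) (snd q) a $ QQ p q"
  "h : hom V z (Kh (fst p) (fst q)) ==> k : hom V z (Th_ob (snd p) (snd q)) ==>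
  (!!a. a : A ==> fm (vrep V K a) (fst p) (fst q) $ h = Th_pr (snd p) (snd q) a $ k) ==>
  EX! u. u : hom V z (dm V (PP p q)) & PP p q $ u = h & QQ p q $ u = k"
proof -
 note n = nerve_fm(1)[OF is_algD(1)[OF p] is_algD(1)[OF q]] and c = precompose_fm(1)[OF p q]
 obtain f g where "is_pullback V (fm N (fst p) (fst q)) (fm PC (snd p) (snd q)) f g"
  using cb.pullback_exists[of "fm N (fst p) (fst q)" "fm PC (snd p) (snd q)"] n c by auto
 then have "case (f, g) of (f, g) => is_pullback V (fm N (fst p) (fst q)) (fm PC (snd p) (snd q)) f g" by simp
 from someI[of "%(f, g). is_pullback V (fm N (fst p) (fst q)) (fm PC (snd p) (snd q)) f g", OF this]
 have pb: "is_pullback V (fm N (fst p) (fst q)) (fm PC (snd p) (snd q)) (PP p q) (QQ p q)"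
  unfolding PP_def QQ_def chosen_pullback_def by (simp add: split_beta)
 show pq: "PP p q : ar V" "QQ p q : ar V" "dm V (QQ p q) = dm V (PP p q)" "cd V (PP p q) = Kh (fst p) (fst q)" "cd V (QQ p q) = Th_ob (snd p) (snd q)"
  using pb n c by (simp_all add: is_pullback_def)
 have "PP p q : hom V (dm V (PP p q)) (Kh (fst p) (fst q))" "QQ p q : hom V (dm V (PP p q)) (Th_ob (snd p) (snd q))" using pq by simp_all
 from nerve_precompose_iff[OF p q this] pb
 show "a : A ==> fm (vrep V K a) (fst p) (fst q) $ PP p q = Th_pr (snd p) (snd q) a $ QQ p q" by (simp add: is_pullback_def)
 assume h: "h : hom V z (Kh (fst p) (fst q))" and k: "k : hom V z (Th_ob (snd p) (snd q))"
  and eq: "!!a. a : A ==> fm (vrep V K a) (fst p) (fst q) $ h = Th_pr (snd p) (snd q) a $ k"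
 have "fm N (fst p) (fst q) $ h = fm PC (snd p) (snd q) $ k" using nerve_precompose_iff[OF p q h k] eq by blast
 moreover have "dm V (fm N (fst p) (fst q)) = Kh (fst p) (fst q)" "dm V (fm PC (snd p) (snd q)) = Th_ob (snd p) (snd q)" using n c by simp_all
 ultimately show "EX! u. u : hom V z (dm V (PP p q)) & PP p q $ u = h & QQ p q $ u = k"
  using pb h k unfolding is_pullback_def by metis
qed

text \<open>The second projection is determined by the first: its components are K(a, -) applied to
  it, again because \<open>xi\<close> is the identity on objects.\<close>

lemma PP_mono:
 assumes p: "is_alg p" and q: "is_alg q"
 shows "is_mono V (PP p q)"
 unfolding is_mono_def
proof (rule conjI[OF PP_QQ(1)[OF p q]], intro ballI impI, elim conjE)
 note P = PP_QQ[OF p q] and F = is_algD(2)[OF p] is_algD(2)[OF q] and x = is_algD(1)[OF p] is_algD(1)[OF q]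
 note pr = cb.nat_pr_simps(2-4)[OF vcategory_Th Th_small F]
 fix g h assume g: "g : ar V" "cd V g = dm V (PP p q)" and h: "h : ar V" "cd V h = dm V (PP p q)" and d: "dm V g = dm V h" and eq: "PP p q $ g = PP p q $ h"
 have qa: "Th_pr (snd p) (snd q) a $ QQ p q $ u = fm (vrep V K a) (fst p) (fst q) $ PP p q $ u" if a: "a : A" and u: "u : ar V" "cd V u = dm V (PP p q)" for a u
 proof -
  have "(fm (vrep V K a) (fst p) (fst q) $ PP p q) $ u = (Th_pr (snd p) (snd q) a $ QQ p q) $ u" unfolding P(6)[OF a] ..
  then show ?thesis using P(1-5) u pr[of a] x a by simp
 qed
 have "QQ p q $ g = QQ p q $ h"
  by (rule cb.natobj_ext[OF vcategory_Th Th_small F, of _ "dm V h"]) (use P(1-5) g h d qa eq in simp_all)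
 note Q = this
 have U: "EX! u. u : hom V (dm V h) (dm V (PP p q)) & PP p q $ u = PP p q $ h & QQ p q $ u = QQ p q $ h"
  by (rule P(7)) (use P(1-5) h qa in simp_all)
 show "g = h"
 proof (rule ex1_unique[OF U])
  show "g : hom V (dm V h) (dm V (PP p q)) & PP p q $ g = PP p q $ h & QQ p q $ g = QQ p q $ h" using Q eq g d by simp
  show "h : hom V (dm V h) (dm V (PP p q)) & PP p q $ h = PP p q $ h & QQ p q $ h = QQ p q $ h" using h by simp
 qed
qed

text \<open>Being a homomorphism is a property of the underlying arrow: the only candidate for the
  transformation has components K(a, t), so lifting \<open>t\<close> means that these are natural
  over the theory.\<close>

lemma alg_hom_iff:
 assumes p: "is_alg p" and q: "is_alg q" and t: "t : hom V z (Kh (fst p) (fst q))"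
 shows "(EX u:hom V z (dm V (PP p q)). PP p q $ u = t) \<longleftrightarrow>
  natural_wedge V Th Vs (snd p) (snd q) z (%a. fm (vrep V K a) (fst p) (fst q) $ t)"
proof
 note P = PP_QQ[OF p q] and F = is_algD(2)[OF p] is_algD(2)[OF q] and x = is_algD(1)[OF p] is_algD(1)[OF q]
 note pr = cb.nat_pr_simps(2-4)[OF vcategory_Th Th_small F]
 {
  assume "EX u:hom V z (dm V (PP p q)). PP p q $ u = t"
  then obtain u where u: "u : hom V z (dm V (PP p q))" "PP p q $ u = t" by (rule bexE)
  have k: "QQ p q $ u : hom V z (Th_ob (snd p) (snd q))" using u P(1-5) by simp
  show "natural_wedge V Th Vs (snd p) (snd q) z (%a. fm (vrep V K a) (fst p) (fst q) $ t)"
  proof (rule cb.wedge_cong[OF cb.wedge_pre[OF vcategory_Th F Th_wedge(1)[OF F] k]])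
  fix a assume "a : vob Th"
  then have a: "a : A" by simp
  have "(fm (vrep V K a) (fst p) (fst q) $ PP p q) $ u = (Th_pr (snd p) (snd q) a $ QQ p q) $ u" unfolding P(6)[OF a] ..
  then show "Th_pr (snd p) (snd q) a $ QQ p q $ u = fm (vrep V K a) (fst p) (fst q) $ t"
  unfolding u(2)[symmetric] using P(1-5) u(1) pr[of a] x a by simp
  qed
 next
  assume w: "natural_wedge V Th Vs (snd p) (snd q) z (%a. fm (vrep V K a) (fst p) (fst q) $ t)"
  obtain s where s: "s : hom V z (Th_ob (snd p) (snd q))" "ALL d:vob Th. Th_pr (snd p) (snd q) d $ s = fm (vrep V K d) (fst p) (fst q) $ t"
  using Th_wedge(2)[OF F w] by (elim ex1E conjE)
  have "EX! u. u : hom V z (dm V (PP p q)) & PP p q $ u = t & QQ p q $ u = s" by (rule P(7)[OF t s(1)]) (use s(2) in simp)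
  then show "EX u:hom V z (dm V (PP p q)). PP p q $ u = t" by blast
 }
qed

text \<open>Naturality over the theory is the homomorphism equation restricted to arities. From the
  equation to naturality one only composes in K; the converse removes the arities by two
  presentations, first of the algebra (with T applied), then of T a.\<close>

lemma wedge_hat_iff:
 assumes X: "is_EM X" and Y: "is_EM Y" and t: "t : hom V z (Kh (fst X) (fst Y))"
 shows "natural_wedge V Th Vs (hat X) (hat Y) z (%a. fm (vrep V K a) (fst X) (fst Y) $ t) \<longleftrightarrow>
  Kpo (mob T (fst X)) (alg_ar T Y) $ Tm (fst X) (fst Y) $ t = Kpe (alg_ar T X) (fst Y) $ t" (is "?wedge \<longleftrightarrow> ?EM")
proof -
 obtain x h y g where xy: "X = (x, h)" "Y = (y, g)" by (cases X, cases Y)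
 note dx = EM_algebraD(1-4)[OF X[unfolded xy(1)]] and dy = EM_algebraD(1-4)[OF Y[unfolded xy(2)]]
 have fxy: "fst X = x" "fst Y = y" "snd X = h" "snd Y = g" by (simp_all add: xy)
 note [simp] = fxy dx dy
 have [simp]: "t : ar V" "dm V t = z" "cd V t = Kh x y" using t by simp_all
 have z: "z : ob V" using dm_ob[of t] by simp
 note [simp] = z
 have exs: "ext a X : hom V (Kh a x) (Kh (mob T a) x)" "ext a Y : hom V (Kh a y) (Kh (mob T a) y)" if "a : A" for a
  using ext_simps[of a X] ext_simps[of a Y] X Y that by simp_all
 \<comment> \<open>The transposed square for the arities \<open>a\<close> and \<open>b\<close>:
   extend after composing with \<open>t\<close>, or compose with \<open>t\<close> after
   extending.\<close>
 define sq where "sq a b \<longleftrightarrow> vcmp K b (mob T a) y $ ((ext a Y $ vcmp K a x y $ (t ** idn V (Kh a x))) ** idn V (Kh b (mob T a)))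
  = vcmp K b (mob T a) y $ ((vcmp K (mob T a) x y $ (t ** ext a X)) ** idn V (Kh b (mob T a)))" for a b
 have hh: "fm (hat X) a b : hom V (Kh b (mob T a)) (ihom V (Kh a x) (Kh b x))" "fm (hat Y) a b : hom V (Kh b (mob T a)) (ihom V (Kh a y) (Kh b y))"
  if "a : A" "b : A" for a b
  using vfunctor.fm_hom[OF vfunctor_hat[OF X], of a b] vfunctor.fm_hom[OF vfunctor_hat[OF Y], of a b] that by simp_all
 have sq_iff: "vcmp Vs (Kh a x) (Kh a y) (Kh b y) $ (fm (hat Y) a b ** (fm (vrep V K a) x y $ t)) $ swp V z (Kh b (mob T a))
  = vcmp Vs (Kh a x) (Kh b x) (Kh b y) $ ((fm (vrep V K b) x y $ t) ** fm (hat X) a b) \<longleftrightarrow> sq a b" if ab: "a : A" "b : A" for a b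
  unfolding sq_def
  by (rule wedge_square_iff) (use ab dx dy exs[OF ab(1)] hh[OF ab] hat_ev[OF X ab] hat_ev[OF Y ab] t in \<open>simp_all del: hom_iff\<close>)
 have "?wedge \<longleftrightarrow> (ALL a:A. ALL b:A. sq a b)"
 proof
  assume w: ?wedge
  show "ALL a:A. ALL b:A. sq a b"
  proof (intro ballI)
  fix a b assume ab: "a : A" "b : A"
  show "sq a b" using cb.wedge_sq[OF w, of a b] sq_iff[OF ab] ab by simp
  qed
 next
  assume s: "ALL a:A. ALL b:A. sq a b"
  show ?wedge
  proof (rule cb.wedgeI[OF z])
  show "fm (vrep V K a) (fst X) (fst Y) $ t : hom V z (ihom V (fo (hat X) a) (fo (hat Y) a))" if "a : vob Th" for a using that by simp
  fix a b assume "a : vob Th" "b : vob Th"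
  then have ab: "a : A" "b : A" by simp_all
  show "vcmp Vs (fo (hat X) a) (fo (hat Y) a) (fo (hat Y) b) $ (fm (hat Y) a b ** (fm (vrep V K a) (fst X) (fst Y) $ t)) $ swp V z (vhom Th a b)
  = vcmp Vs (fo (hat X) a) (fo (hat X) b) (fo (hat Y) b) $ ((fm (vrep V K b) (fst X) (fst Y) $ t) ** fm (hat X) a b)"
  using sq_iff[OF ab] s ab by simp
  qed
 qed
 also have "... \<longleftrightarrow> ?EM"
 proof
  assume EM: ?EM
  have "ext a Y $ vcmp K a x y $ (t ** idn V (Kh a x)) = vcmp K (mob T a) x y $ (t ** ext a X)" if a: "a : A" for a
  proof -
  have "ext a Y $ vcmp K a x y $ (t ** idn V (Kh a x)) = Kpo (mob T a) (mob T y, y, g) $ Tm a y $ vcmp K a x y $ (t ** idn V (Kh a x))"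
  using a by (simp add: ext_def)
  also have "Tm a y $ vcmp K a x y $ (t ** idn V (Kh a x)) = vcmp K (mob T a) (mob T x) (mob T y) $ ((Tm x y $ t) ** Tm a x)"
  using T.fm_vcmp_elt[of a x y t "idn V (Kh a x)"] a by simp
  also have "Kpo (mob T a) (mob T y, y, g) $ vcmp K (mob T a) (mob T x) (mob T y) $ ((Tm x y $ t) ** Tm a x)
  = vcmp K (mob T a) (mob T x) y $ ((Kpo (mob T x) (mob T y, y, g) $ Tm x y $ t) ** Tm a x)"
  by (rule vpost_vcmp) (use a in simp_all)
  also have "Kpo (mob T x) (mob T y, y, g) $ Tm x y $ t = Kpe (mob T x, x, h) y $ t" using EM by simp
  also have "vcmp K (mob T a) (mob T x) y $ ((Kpe (mob T x, x, h) y $ t) ** Tm a x) = vcmp K (mob T a) x y $ (t ** (Kpo (mob T a) (mob T x, x, h) $ Tm a x))"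
  by (rule vpre_vpost_vcmp) (use a in simp_all)
  finally show ?thesis by (simp add: ext_def)
  qed
  then show "ALL a:A. ALL b:A. sq a b" by (simp add: sq_def)
 next
  assume s: "ALL a:A. ALL b:A. sq a b"
  obtain I le D c where D: "directed_diagram ka lam C M I le D" "ALL i:I. oo D i : A" and colim: "is_conical_colim V K (poset_cat I le) D x c"
  using A_dense[OF dx(1)] by (elim exE conjE)
  have "Kpo (mob T x) (mob T y, y, g) $ Tm x y $ t = Kpe (mob T x, x, h) y $ t"
  proof (rule vpre_jointly_monic[OF T_colim(2)[OF D(1) colim] dy(1)])
  fix i k' assume i: "i : I" and k': "und_ar V (mfun T) (c i) = (oo \<lparr>oo = (%i. mob T (oo D i)), oa = (%f. und_ar V (mfun T) (oa D f))\<rparr> i, mob T x, k')"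
  let ?a = "oo D i"
  have a: "?a : A" using D(2) i by blast
  define k where "k = snd (snd (c i))"
  have k: "c i = (?a, x, k)" "k : ar V" "dm V k = unt V" "cd V k = Kh ?a x"
  using conical_colimD(4-7)[OF colim i] by (simp_all add: k_def)
  have kk: "k' = Tm ?a x $ k" using k' unfolding k(1) by simp
  let ?u = "ext ?a Y $ Kpe (?a, x, k) y $ t" and ?v = "Kpe (mob T ?a, x, ext ?a X $ k) y $ t"
  have ea: "ext ?a X : ar V" "dm V (ext ?a X) = Kh ?a x" "cd V (ext ?a X) = Kh (mob T ?a) x"
  "ext ?a Y : ar V" "dm V (ext ?a Y) = Kh ?a y" "cd V (ext ?a Y) = Kh (mob T ?a) y" using exs[OF a] by simp_all
  have uv: "?u : ar V" "dm V ?u = z" "cd V ?u = Kh (mob T ?a) y" "?v : ar V" "dm V ?v = z" "cd V ?v = Kh (mob T ?a) y"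
  using ea k a by simp_all
  have Ta: "mob T ?a : vob K" using a by simp
  obtain I' le' D' c' where D': "directed_diagram ka lam C M I' le' D'" "ALL i:I'. oo D' i : A" and colim': "is_conical_colim V K (poset_cat I' le') D' (mob T ?a) c'"
  using A_dense[OF Ta] by (elim exE conjE)
  have "?u = ?v"
  proof (rule vpre_jointly_monic[OF colim' dy(1)])
  fix j f assume j: "j : I'" and f: "(oo D' j, mob T ?a, f) : ar C"
  let ?b = "oo D' j"
  have b: "?b : A" using D'(2) j by blast
  have fh: "f : ar V" "dm V f = unt V" "cd V f = Kh ?b (mob T ?a)" using f by simp_all
  have ru: "?u $ run V z = ext ?a Y $ vcmp K ?a x y $ (t ** k)" using vpre_run[of y ?a x k t] ea k a by simp
  have rv: "?v $ run V z = vcmp K (mob T ?a) x y $ (t ** (ext ?a X $ k))" using vpre_run[of y "mob T ?a" x "ext ?a X $ k" t] ea k a by simp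
  have S: "vcmp K ?b (mob T ?a) y $ ((ext ?a Y $ vcmp K ?a x y $ (t ** idn V (Kh ?a x))) ** idn V (Kh ?b (mob T ?a)))
  = vcmp K ?b (mob T ?a) y $ ((vcmp K (mob T ?a) x y $ (t ** ext ?a X)) ** idn V (Kh ?b (mob T ?a)))"
  using s a b by (simp add: sq_def)
  have "vcmp K ?b (mob T ?a) y $ ((ext ?a Y $ vcmp K ?a x y $ (t ** k)) ** f)
  = (vcmp K ?b (mob T ?a) y $ ((ext ?a Y $ vcmp K ?a x y $ (t ** idn V (Kh ?a x))) ** idn V (Kh ?b (mob T ?a)))) $ ((idn V z ** k) ** f)"
  using ea k a b fh by simp
  also have "... = vcmp K ?b (mob T ?a) y $ ((vcmp K (mob T ?a) x y $ (t ** (ext ?a X $ k))) ** f)"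
  unfolding S using ea k a b fh by simp
  finally have 1: "vcmp K ?b (mob T ?a) y $ ((?u $ run V z) ** f) = vcmp K ?b (mob T ?a) y $ ((?v $ run V z) ** f)"
  unfolding ru rv .
  \<comment> \<open>The domain of \<open>t\<close> is \<open>z\<close> rather than the unit, so
    composing with the elements \<open>k\<close> and \<open>f\<close> leaves two right unitors,
    which cancel.\<close>
  have r: "Kpe (?b, mob T ?a, f) y $ (w $ run V z) $ run V (z @@ unt V) = vcmp K ?b (mob T ?a) y $ ((w $ run V z) ** f)"
  if w: "w : ar V" "dm V w = z" "cd V w = Kh (mob T ?a) y" for w
  using vpre_run[OF dy(1) f, of "w $ run V z"] w by simp
  have 2: "(Kpe (?b, mob T ?a, f) y $ ?u) $ (run V z $ run V (z @@ unt V)) = (Kpe (?b, mob T ?a, f) y $ ?v) $ (run V z $ run V (z @@ unt V))"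
  using r[OF uv(1-3)] r[OF uv(4-6)] 1 uv f a b by (simp del: und_simps(5))
  show "Kpe (?b, mob T ?a, f) y $ ?u = Kpe (?b, mob T ?a, f) y $ ?v"
  by (rule iso_epi[OF _ 2]) (use uv fh a b in simp_all)
  qed (use uv in simp_all)
  moreover have "Kpe (mob T ?a, mob T x, Tm ?a x $ k) y $ Kpo (mob T x) (mob T y, y, g) $ Tm x y $ t = ?u"
  proof -
  have Tk: "(mob T ?a, mob T x, Tm ?a x $ k) : ar C" using k a by simp
  have "Kpe (mob T ?a, mob T x, Tm ?a x $ k) y $ Kpo (mob T x) (mob T y, y, g) = Kpo (mob T ?a) (mob T y, y, g) $ Kpe (mob T ?a, mob T x, Tm ?a x $ k) (mob T y)"
  using vpost_vpre[OF Tk, of "mob T y" y g] by simp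
  from extend[OF this, of "Tm x y $ t"]
  have "Kpe (mob T ?a, mob T x, Tm ?a x $ k) y $ Kpo (mob T x) (mob T y, y, g) $ Tm x y $ t
  = Kpo (mob T ?a) (mob T y, y, g) $ (Kpe (mob T ?a, mob T x, Tm ?a x $ k) (mob T y) $ Tm x y) $ t"
  using Tk a by simp
  also have "Kpe (mob T ?a, mob T x, Tm ?a x $ k) (mob T y) $ Tm x y = Tm ?a y $ Kpe (?a, x, k) y"
  by (rule T.fm_vpre[symmetric]) (use k a in simp_all)
  finally show ?thesis using k a by (simp add: ext_def)
  qed
  moreover have "Kpe (mob T ?a, mob T x, Tm ?a x $ k) y $ Kpe (mob T x, x, h) y $ t = ?v"
  proof -
  have "Kpe (mob T ?a, x, ext ?a X $ k) y = Kpe (mob T ?a, mob T x, Tm ?a x $ k) y $ Kpe (mob T x, x, h) y"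
  using vpre_cmp[of y "mob T ?a" "mob T x" "Tm ?a x $ k" x h] k a by (simp add: ext_def)
  then show ?thesis using k a by simp
  qed
  ultimately show "Kpe (oo \<lparr>oo = (%i. mob T (oo D i)), oa = (%f. und_ar V (mfun T) (oa D f))\<rparr> i, mob T x, k') y $ Kpo (mob T x) (mob T y, y, g) $ Tm x y $ t
  = Kpe (oo \<lparr>oo = (%i. mob T (oo D i)), oa = (%f. und_ar V (mfun T) (oa D f))\<rparr> i, mob T x, k') y $ Kpe (mob T x, x, h) y $ t"
  unfolding kk by simp
  qed simp_all
  then show ?EM by simp
 qed
 finally show ?thesis .
qed

section \<open>Comparison of the two categories of algebras\<close>

abbreviation "AL \<equiv> Alg V K Th xi"
abbreviation "AU \<equiv> Alg_forget V K Th xi"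

lemma Alg_simps:
 "p : vob AL \<longleftrightarrow> is_alg p" "vhom AL p q = dm V (PP p q)" "fo AU p = fst p" "fm AU p q = PP p q"
 "vid AL p = (THE u. u : hom V (unt V) (dm V (PP p p)) & PP p p $ u = vid K (fst p) & QQ p p $ u = vid (vfun_cat V Th Vs) (snd p))"
 "vcmp AL p q r = (THE u. u : hom V (dm V (PP q r) @@ dm V (PP p q)) (dm V (PP p r)) &
  PP p r $ u = vcmp K (fst p) (fst q) (fst r) $ (PP q r ** PP p q) &
  QQ p r $ u = vcmp (vfun_cat V Th Vs) (snd p) (snd q) (snd r) $ (QQ q r ** QQ p q))"
 by (cases p; auto simp: Alg_def Alg_forget_def vpullback_def vpullback_fst_def Let_def PP_def QQ_def is_alg_def nerve_def vf_precompose_def vfun_cat_def nr_def)+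

lemma Alg_structure:
 shows "vcategory V AL" "vfunctor V AL K AU"
proof -
 have fo: "fo AU p : vob K" if "p : vob AL" for p using that is_algD(1) by (simp add: Alg_simps)
 have hom: "fm AU p q : hom V (vhom AL p q) (Kh (fo AU p) (fo AU q))" if "p : vob AL" "q : vob AL" for p q
  using that PP_QQ(1,4)[of p q] by (simp add: Alg_simps)
 have mono: "is_mono V (fm AU p q)" if "p : vob AL" "q : vob AL" for p q
  using that PP_mono[of p q] by (simp add: Alg_simps)
 have id: "vid AL p : hom V (unt V) (vhom AL p p) & fm AU p p $ vid AL p = vid K (fo AU p)" if "p : vob AL" for p
 proof -
  have p: "is_alg p" using that by (simp add: Alg_simps)
  note x = is_algD(1)[OF p] and v = cb.vfun_vid[OF vcategory_Th Th_small is_algD(2)[OF p]]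
  have "EX! u. u : hom V (unt V) (dm V (PP p p)) & PP p p $ u = vid K (fst p) & QQ p p $ u = vid (vfun_cat V Th Vs) (snd p)"
  proof (rule PP_QQ(7)[OF p p])
  show "vid K (fst p) : hom V (unt V) (Kh (fst p) (fst p))" using x by simp
  show "vid (vfun_cat V Th Vs) (snd p) : hom V (unt V) (Th_ob (snd p) (snd p))" by (rule v(1))
  fix a assume a: "a : A"
  show "fm (vrep V K a) (fst p) (fst p) $ vid K (fst p) = Th_pr (snd p) (snd p) a $ vid (vfun_cat V Th Vs) (snd p)"
  using v(2)[of a] vfunctor.fm_vid[OF vfunctor_vrep[OF A_ob[OF a]] x] F_fo[OF is_algD(2,1,4)[OF p] a] a by simp
  qed
  from theI'[OF this, folded Alg_simps(5)] show ?thesis by (simp only: Alg_simps(2,3,4))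
 qed
 have cmp: "vcmp AL p q r : hom V (vhom AL q r @@ vhom AL p q) (vhom AL p r) &
  fm AU p r $ vcmp AL p q r = vcmp K (fo AU p) (fo AU q) (fo AU r) $ (fm AU q r ** fm AU p q)"
  if "p : vob AL" "q : vob AL" "r : vob AL" for p q r
 proof -
  have p: "is_alg p" and q: "is_alg q" and r: "is_alg r" using that by (simp_all add: Alg_simps)
  note x = is_algD(1)[OF p] is_algD(1)[OF q] is_algD(1)[OF r]
  note F = is_algD(2)[OF p] is_algD(2)[OF q] is_algD(2)[OF r]
  note v = cb.vfun_vcmp[OF vcategory_Th Th_small F]
  note P = PP_QQ(1-6)[OF p q] PP_QQ(1-6)[OF q r]
  have "EX! u. u : hom V (dm V (PP q r) @@ dm V (PP p q)) (dm V (PP p r)) &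
  PP p r $ u = vcmp K (fst p) (fst q) (fst r) $ (PP q r ** PP p q) &
  QQ p r $ u = vcmp (vfun_cat V Th Vs) (snd p) (snd q) (snd r) $ (QQ q r ** QQ p q)"
  proof (rule PP_QQ(7)[OF p r])
  show "vcmp K (fst p) (fst q) (fst r) $ (PP q r ** PP p q) : hom V (dm V (PP q r) @@ dm V (PP p q)) (Kh (fst p) (fst r))"
  using x P(1-5) P(7-11) by simp
  show "vcmp (vfun_cat V Th Vs) (snd p) (snd q) (snd r) $ (QQ q r ** QQ p q) : hom V (dm V (PP q r) @@ dm V (PP p q)) (Th_ob (snd p) (snd r))"
  using v(1) P(1-5) P(7-11) by simp
  fix a assume a: "a : A"
  note fo = F_fo[OF is_algD(2,1,4)[OF p] a] F_fo[OF is_algD(2,1,4)[OF q] a] F_fo[OF is_algD(2,1,4)[OF r] a]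
  interpret R: enriched_functor V K "self V" "vrep V K a" by (rule enriched_functor_vrep[OF A_ob[OF a]])
  note pr = cb.nat_pr_simps(2-4)[OF vcategory_Th Th_small F(1,2), of a] cb.nat_pr_simps(2-4)[OF vcategory_Th Th_small F(2,3), of a]
  cb.nat_pr_simps(2-4)[OF vcategory_Th Th_small F(1,3), of a]
  have "fm (vrep V K a) (fst p) (fst r) $ vcmp K (fst p) (fst q) (fst r) $ (PP q r ** PP p q)
  = vcmp Vs (Kh a (fst p)) (Kh a (fst q)) (Kh a (fst r)) $ ((Th_pr (snd q) (snd r) a $ QQ q r) ** (Th_pr (snd p) (snd q) a $ QQ p q))"
  using R.fm_vcmp_elt[of "fst p" "fst q" "fst r" "PP q r" "PP p q"] x P a by (simp add: fo_vrep)
  also have "... = (vcmp Vs (Kh a (fst p)) (Kh a (fst q)) (Kh a (fst r)) $ (Th_pr (snd q) (snd r) a ** Th_pr (snd p) (snd q) a)) $ (QQ q r ** QQ p q)"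
  using pr P(1-5) P(7-11) fo a x by simp
  also have "... = (Th_pr (snd p) (snd r) a $ vcmp (vfun_cat V Th Vs) (snd p) (snd q) (snd r)) $ (QQ q r ** QQ p q)"
  using v(2)[of a] fo a by simp
  finally show "fm (vrep V K a) (fst p) (fst r) $ vcmp K (fst p) (fst q) (fst r) $ (PP q r ** PP p q)
  = Th_pr (snd p) (snd r) a $ vcmp (vfun_cat V Th Vs) (snd p) (snd q) (snd r) $ (QQ q r ** QQ p q)"
  using pr v(1) P(1-5) P(7-11) a by simp
  qed
  from theI'[OF this, folded Alg_simps(6)] show ?thesis by (simp only: Alg_simps(2,3,4))
 qed
 show "vcategory V AL" by (rule faithful_vcategory(1)[OF fo hom mono id cmp])
 show "vfunctor V AL K AU" by (rule faithful_vcategory(2)[OF fo hom mono id cmp])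
qed

lemma is_alg_hat:
 assumes X: "is_EM X"
 shows "is_alg (fst X, hat X)"
 unfolding is_alg_def fst_conv snd_conv
proof (intro conjI)
 show "fst X : vob K" using X by (simp add: is_EM_algebra_def)
 show "vf_restrict Th (hat X) = hat X" by (simp add: vf_restrict_def hat_def fun_eq_iff)
qed (rule vfunctor_hat[OF X] hat_xi[OF X])+

theorem EM_Alg_equivalent: "concretely_equivalent V K (EM V K T) (EM_forget V K T) AL AU"
proof -
 note fam = EM_family[OF equalizers]
 define fi where "fi X = (fst X, hat X)" for X
 \<comment> \<open>A structure map exists by \<open>reconstruct\<close> and is unique by
   \<open>hat_inj\<close>, which makes \<open>ps\<close> inverse to \<open>fi\<close>.\<close>
 define ps where "ps p = (fst p, SOME h. is_EM (fst p, h) & hat (fst p, h) = snd p)" for p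
 have vE: "X : vob (EM V K T) \<longleftrightarrow> is_EM X" for X by (simp add: EM_def)
 have hE: "vhom (EM V K T) X Y = dm V (EM_hom V K T X Y)" for X Y by (simp add: EM_def)
 have fE: "fo (EM_forget V K T) X = fst X" "fm (EM_forget V K T) X Y = EM_hom V K T X Y" for X Y by (simp_all add: EM_forget_def)
 have fE': "EM_forget V K T = \<lparr>fo = (%x. fst ((%x. x) x)), fm = EM_hom V K T\<rparr>" by (simp add: EM_forget_def fun_eq_iff)
 have ps: "is_EM (ps p) & fi (ps p) = p" if p: "is_alg p" for p
 proof -
  note P = is_algD[OF p]
  obtain h where h: "is_EM (fst p, h)" "ALL a:A. ALL b:A. fm (snd p) a b = fm (hat (fst p, h)) a b"
  using reconstruct[OF P(2,1,4)] by blast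
  \<comment> \<open>Both functors are in normal form outside the theory, so agreement on the arities
    is equality.\<close>
  have "vf_restrict Th (hat (fst p, h)) = vf_restrict Th (snd p)"
  using h(2) F_fo[OF P(2,1,4)] by (auto simp: vf_restrict_def fun_eq_iff restrict_def)
  then have "hat (fst p, h) = snd p" using P(3) is_algD(3)[OF is_alg_hat[OF h(1)]] by simp
  then have "EX h. is_EM (fst p, h) & hat (fst p, h) = snd p" using h(1) by blast
  from someI_ex[OF this] show ?thesis by (simp add: fi_def ps_def)
 qed
 have psfi: "ps (fi X) = X" if X: "is_EM X" for X
 proof -
  note s = ps[OF is_alg_hat[OF X]]
  have "fst (ps (fi X)) = fst X" by (simp add: fi_def ps_def)
  moreover have "snd (ps (fi X)) = snd X"
  proof (rule hat_inj)
  show "is_EM (fst X, snd (ps (fi X)))" using s calculation by (metis fi_def prod.collapse)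
  show "is_EM (fst X, snd X)" using X by simp
  have "hat (ps (fi X)) = hat X" using s unfolding fi_def by simp
  then show "hat (fst X, snd (ps (fi X))) = hat (fst X, snd X)" using calculation by (metis prod.collapse)
  qed
  ultimately show ?thesis by (rule prod_eqI)
 qed
 have afi: "is_alg (fi X)" if "is_EM X" for X using is_alg_hat[OF that] by (simp add: fi_def)
 show ?thesis
 proof (rule concretely_equivalentI[where fi = fi and ps = ps])
  show "vcategory V (EM V K T)" unfolding EM_eq_algebra_vcat by (rule vcategory_algebra_vcat(1)[OF fam])
  show "vfunctor V (EM V K T) K (EM_forget V K T)" unfolding EM_eq_algebra_vcat fE' by (rule vcategory_algebra_vcat(2)[OF fam])
  show "vcategory V AL" "vfunctor V AL K AU" by (rule Alg_structure)+
  show "is_mono V (fm (EM_forget V K T) X Y)" if "X : vob (EM V K T)" "Y : vob (EM V K T)" for X Y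
  using is_algebra_familyD(5)[OF fam, of X Y] that by (simp add: fE vE)
  show "is_mono V (fm AU p q)" if "p : vob AL" "q : vob AL" for p q
  using that PP_mono[of p q] by (simp add: Alg_simps)
  show "fi X : vob AL & fo AU (fi X) = fo (EM_forget V K T) X & ps (fi X) = X" if "X : vob (EM V K T)" for X
  using afi[of X] psfi[of X] that by (simp add: Alg_simps vE fE) (simp add: fi_def)
  show "ps p : vob (EM V K T) & fi (ps p) = p" if "p : vob AL" for p
  using ps[of p] that by (simp add: Alg_simps vE)
  fix X Y assume "X : vob (EM V K T)" "Y : vob (EM V K T)"
  then have X: "is_EM X" and Y: "is_EM Y" by (simp_all add: vE)
  have XY: "X : {x. is_EM x}" "Y : {x. is_EM x}" using X Y by simp_all
  note f = is_algebra_familyD[OF fam XY]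
  let ?e = "EM_hom V K T X Y" and ?P = "PP (fi X) (fi Y)"
  have st: "fst (fi X) = fst X" "fst (fi Y) = fst Y" "snd (fi X) = hat X" "snd (fi Y) = hat Y" by (simp_all add: fi_def)
  note hi = alg_hom_iff[OF afi[OF X] afi[OF Y], unfolded st]
  have eh: "?e : hom V (dm V ?e) (Kh (fst X) (fst Y))" using f by simp
  show "EX i. i : hom V (vhom (EM V K T) X Y) (vhom AL (fi X) (fi Y)) & fm AU (fi X) (fi Y) $ i = fm (EM_forget V K T) X Y"
  using hi[OF eh] wedge_hat_iff[OF X Y eh] f(4) unfolding Alg_simps hE fE by blast
  note P = PP_QQ(1,4)[OF afi[OF X] afi[OF Y], unfolded st]
  have Ph: "?P : hom V (dm V ?P) (Kh (fst X) (fst Y))" using P by simp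
  \<comment> \<open>\<open>PP\<close> factors through itself by an identity, hence is natural over
    the theory and satisfies the homomorphism equation.\<close>
  have "EX u:hom V (dm V ?P) (dm V ?P). ?P $ u = ?P" by (rule bexI[of _ "idn V (dm V ?P)"]) (use P in simp_all)
  then have "Kpo (mob T (fst X)) (alg_ar T Y) $ Tm (fst X) (fst Y) $ ?P = Kpe (alg_ar T X) (fst Y) $ ?P"
  using hi[OF Ph] wedge_hat_iff[OF X Y Ph] by blast
  from is_algebra_family_factor[OF fam XY Ph this]
  have "EX! u. u : hom V (dm V ?P) (dm V ?e) & ?e $ u = ?P" .
  then show "EX j. j : hom V (vhom AL (fi X) (fi Y)) (vhom (EM V K T) X Y) & fm (EM_forget V K T) X Y $ j = fm AU (fi X) (fi Y)"
  unfolding Alg_simps hE fE by (rule ex1_implies_ex)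
 qed
qed

end

theorem theorem4p15:
 fixes \<kappa> :: "'u rel" and lam :: "'l rel" and mu :: "'m rel"
  and V :: "('o, 'a) smc" and E\<^sub>V M\<^sub>V :: "'a set"
  and K :: "('k, 'o, 'a) vcat" and E M :: "('k \<times> 'k \<times> 'a) set"
  and T :: "('k, 'a) vmnd"
 assumes "inaccessible \<kappa>"
  and "regular_cardinal lam" and "regular_cardinal mu" and "lam \<le>o mu" and "mu <o \<kappa>"
  and "symmetric_monoidal_closed V" and "locally_small \<kappa> V"
  and "locally_generated_closed \<kappa> lam V E\<^sub>V M\<^sub>V"
  and "vcategory V K"
  and "locally_generated \<kappa> lam V K E M"
  and "locally_presentable \<kappa> mu V K"
  and "vmonad V K T"
  and "preserves_filtered_colimits \<kappa> mu V K K (mfun T)"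
  and "\<forall>m \<in> M. und_ar V (mfun T) m \<in> M"
  and "preserves_directed_colimits \<kappa> lam V K M K (mfun T)"
 shows "\<exists>\<Theta> x. ary_equational_theory \<kappa> lam V K M \<Theta> x \<and>
  concretely_equivalent V K (EM V K T) (EM_forget V K T) (Alg V K \<Theta> x) (Alg_forget V K \<Theta> x)"
proof -
 interpret S: symmetric_monoidal_closed V by fact
 interpret vmonad V K T by fact
 interpret enriched V K by (rule S.enrichedI) fact
 have lam: "lam <o \<kappa>" using assms(4,5) by (rule ordLeq_ordLess_trans)
 interpret G: generated_vcategory V \<kappa> lam E\<^sub>V M\<^sub>V K E M
  by unfold_locales (use assms lam in simp_all)
 obtain R where R: "small \<kappa> R" "ALL b:R. v_generated_object \<kappa> lam V K M b"
  "ALL a. v_generated_object \<kappa> lam V K M a --> (EX b:R. isomorphic (und V K) a b)"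
  using G.generated_representatives by (elim exE conjE)
 \<comment> \<open>The generators provide the presentations; the representatives \<open>R\<close>
   provide an arity isomorphic to each generated object, as a \<open>lam\<close>-ary theory
   requires.\<close>
 let ?A = "G.gens \<union> R"
 interpret generated_monad V \<kappa> lam E\<^sub>V M\<^sub>V K E M T ?A
 proof
  show "small \<kappa> ?A" by (rule small_Un[OF assms(1) G.gens(1) R(1)])
  show "v_generated_object \<kappa> lam V K M a" if "a : ?A" for a using that G.gens(2) R(2) by blast
  show "EX I le D c. directed_diagram \<kappa> lam (und V K) M I le D & (ALL i:I. oo D i : ?A) & is_conical_colim V K (poset_cat I le) D y c"
  if "y : vob K" for y using G.gens(4)[OF that] by (elim exE conjE) (intro exI conjI; blast)
 qed (use assms in simp_all)
 have "ary_equational_theory \<kappa> lam V K M Th xi"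
  unfolding ary_equational_theory_def using equational_theory A_small A_gen R(3) by auto
 then show ?thesis using EM_Alg_equivalent by blast
qed

end
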